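(* Let $(B,g_B)$ be a non-degenerate semi-Riemannian manifold, let $(F_j,g_{F_j})$, $1\le j\le m$, be semi-regular semi-Riemannian manifolds, and let $b_j\in C^\infty(B)$. Fix $l\in\{1,\dots,m\}$ and $P\in\Gamma(TF_l)$, and let $\overline R$ be the semi-symmetric metric curvature, with respect to $P$, of the multiply warped product $B\times_{b_1}F_1\times\cdots\times_{b_m}F_m$. For all $X,Y,Z,T\in\Gamma(TB)$ and all $U_k\in\Gamma(TF_k)$, $V_i\in\Gamma(TF_i)$, $W_j\in\Gamma(TF_j)$, $Q_s\in\Gamma(TF_s)$: (1) $\overline R(X,Y,Z,T)=R_B(X,Y,Z,T)+b_l^2g_B(X,Z)g_B(Y,T)g_{F_l}(P,P)-b_l^2g_B(X,T)g_B(Y,Z)g_{F_l}(P,P)$; (2) if $j=l$: $\overline R(X,Y,Z,W_j)=-\overline R(Z,W_j,X,Y)=-b_jX(b_j)g_B(Y,Z)g_{F_j}(W_j,P)+b_jY(b_j)g_B(X,Z)g_{F_j}(W_j,P)$; (3) if $j\ne l$: $\overline R(X,Y,Z,W_j)=\overline R(Z,W_j,X,Y)=0$; (4) $\overline R(X,Y,V_i,W_j)=\overline R(V_i,W_j,X,Y)=0$; (5) if $i=j=l$: $\overline R(X,V_i,W_j,Y)=b_jg_B^*(\nabla^\flat_XY,db_j)g_{F_j}(V_j,W_j)-b_jXY(b_j)g_{F_j}(V_j,W_j)-b_j^2g_B(X,Y)\big(\mathcal K_{F_j}(V_j,P,W_j)+b_j^2g_{F_j}(V_j,W_j)g_{F_j}(P,P)-b_j^2g_{F_j}(V_j,P)g_{F_j}(W_j,P)\big)$;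 (6) if $i=j\ne l$: $\overline R(X,V_i,W_j,Y)=b_jg_B^*(\nabla^\flat_XY,db_j)g_{F_j}(V_j,W_j)-b_jXY(b_j)g_{F_j}(V_j,W_j)-b_j^2b_l^2g_B(X,Y)g_{F_j}(V_j,W_j)g_{F_l}(P,P)$; (7) $\overline R(X,V_i,W_j,Y)=0$ in all other cases; (8) if $i=j=k=l$: $\overline R(X,V_i,W_j,U_k)=-\overline R(W_j,U_k,X,V_i)=b_j^3X(b_j)\big(g_{F_j}(V_j,U_j)g_{F_j}(W_j,P)-g_{F_j}(V_j,W_j)g_{F_j}(U_j,P)\big)$; (9) if $i=j\ne k=l$: $\overline R(X,V_i,W_j,U_k)=-\overline R(W_j,U_k,X,V_i)=-b_lb_j^2X(b_l)g_{F_l}(U_l,P)g_{F_j}(V_j,W_j)$; (10) $\overline R(X,V_i,W_j,U_k)=0$ in all other cases, except the pattern $i=k\ne j=l$ (which is obtained from (9) by the antisymmetry $\overline R(X,Y,Z,T)=-\overline R(X,Y,T,Z)$); (11) if $i=j=k=s=l$: $\overline R(U_k,V_i,W_j,Q_s)=b_j^2R_{F_j}(U_j,V_j,W_j,Q_j)+\big(b_j^2g_B^*(db_j,db_j)+b_j^6g_{F_j}(P,P)\big)\big(g_{F_j}(U_j,W_j)g_{F_j}(V_j,Q_j)-g_{F_j}(V_j,W_j)g_{F_j}(U_j,Q_j)\big)+b_j^4g_{F_j}(V_j,Q_j)\mathcal K_{F_j}(U_j,P,W_j)-b_j^4g_{F_j}(U_j,Q_j)\mathcal K_{F_j}(V_j,P,W_j)-b_j^4g_{F_j}(V_j,W_j)\mathcal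 K_{F_j}(U_j,P,Q_j)+b_j^4g_{F_j}(U_j,W_j)\mathcal K_{F_j}(V_j,P,Q_j)+b_j^6g_{F_j}(U_j,P)\big(g_{F_j}(V_j,W_j)g_{F_j}(Q_j,P)-g_{F_j}(V_j,Q_j)g_{F_j}(W_j,P)\big)-b_j^6g_{F_j}(V_j,P)\big(g_{F_j}(U_j,W_j)g_{F_j}(Q_j,P)-g_{F_j}(U_j,Q_j)g_{F_j}(W_j,P)\big)$; (12) if $i=j=k=s\ne l$: $\overline R(U_k,V_i,W_j,Q_s)=b_j^2R_{F_j}(U_j,V_j,W_j,Q_j)+\big(b_j^2g_B^*(db_j,db_j)+b_l^2b_j^4g_{F_l}(P,P)\big)\big(g_{F_j}(U_j,W_j)g_{F_j}(V_j,Q_j)-g_{F_j}(V_j,W_j)g_{F_j}(U_j,Q_j)\big)$; (13) if $j=k\ne i=s=l$: $\overline R(U_k,V_i,W_j,Q_s)=b_ib_jg_B^*(db_i,db_j)g_{F_i}(V_i,Q_i)g_{F_j}(U_j,W_j)+b_i^2b_j^2g_{F_j}(U_j,W_j)\big(\mathcal K_{F_i}(V_i,P,Q_i)+b_i^2g_{F_i}(P,P)g_{F_i}(V_i,Q_i)-b_i^2g_{F_i}(V_i,P)g_{F_i}(Q_i,P)\big)$; (14) if $l=j=k\ne i=s$: $\overline R(U_k,V_i,W_j,Q_s)=b_ib_jg_B^*(db_i,db_j)g_{F_i}(V_i,Q_i)g_{F_j}(U_j,W_j)+b_i^2b_j^2g_{F_i}(V_i,Q_i)\big(\mathcal K_{F_j}(U_j,P,W_j)+b_j^2g_{F_j}(P,P)g_{F_j}(U_j,W_j)-b_j^2g_{F_j}(U_j,P)g_{F_j}(W_j,P)\big)$;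 (15) if $k=j$, $i=s$ and $j,i,l$ are pairwise different: $\overline R(U_k,V_i,W_j,Q_s)=b_ib_jg_B^*(db_i,db_j)g_{F_i}(V_i,Q_i)g_{F_j}(U_j,W_j)+b_i^2b_j^2b_l^2g_{F_i}(V_i,Q_i)g_{F_j}(U_j,W_j)g_{F_l}(P,P)$; (16) $\overline R(U_k,V_i,W_j,Q_s)=0$ in all other cases, except the pattern $k=s\ne i=j$ (which is obtained from (13)–(15) by the antisymmetry $\overline R(X,Y,Z,T)=-\overline R(X,Y,T,Z)$).
   Context: A singular semi-Riemannian manifold $(M,g)$ is a smooth manifold with a smooth symmetric bilinear form $g$ on $TM$, possibly degenerate and of variable signature; it is non-degenerate if $g$ is non-degenerate everywhere. Its Koszul form is $\mathcal K(X,Y,Z)=\frac12\{X(g(Y,Z))+Y(g(Z,X))-Z(g(X,Y))-g(X,[Y,Z])+g(Y,[Z,X])+g(Z,[X,Y])\}$, and $(\nabla^\flat_XY)(Z)=\mathcal K(X,Y,Z)$. Contraction: let $T_p^\bullet M=\{g_p(v,\cdot):v\in T_pM\}\subset T_p^*M$ with inner product $g_p^\bullet(g_p(v,\cdot),g_p(w,\cdot))=g_p(v,w)$. For 1-forms $\omega,\tau$ with values in $T^\bullet M$, $\omega(\bullet)\tau(\bullet)$ is the function $p\mapsto g^\bullet_p(\omega_p,\tau_p)$ on the dense open set where the rank of $g$ is locally constant; it is called smooth if it extends (uniquely) to a smooth function on $M$, and then the same symbol denotes the extension. $(M,g)$ is radical-stationary if $\mathcal K(X,Y,\cdot)$ takes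 values in $T^\bullet M$ for all vector fields $X,Y$, and semi-regular if moreover all $\mathcal K(X,Y,\bullet)\mathcal K(Z,T,\bullet)$ are smooth. On a semi-regular manifold $R(X,Y,Z,T)=X(\mathcal K(Y,Z,T))-Y(\mathcal K(X,Z,T))-\mathcal K([X,Y],Z,T)+\mathcal K(X,Z,\bullet)\mathcal K(Y,T,\bullet)-\mathcal K(Y,Z,\bullet)\mathcal K(X,T,\bullet)$. For a vector field $P$ on $M$, the semi-symmetric metric Koszul form is $\overline{\mathcal K}(X,Y,Z)=\mathcal K(X,Y,Z)+g(Y,P)g(X,Z)-g(X,Y)g(P,Z)$. The semi-symmetric metric curvature $\overline R$ is given by the formula for $R$ with $\mathcal K$ replaced everywhere by $\overline{\mathcal K}$ (well defined on semi-regular manifolds). The multiply warped product $B\times_{b_1}F_1\times\cdots\times_{b_m}F_m$ is $B\times F_1\times\cdots\times F_m$ with $g=\pi_B^*(g_B)+\sum_j(b_j\circ\pi_B)^2\pi_{F_j}^*(g_{F_j})$, where the $\pi$'s are the canonical projections; the $b_j$ may vanish. Under the hypotheses of the claim it is semi-regular. Vector fields in $\Gamma(TB)$, $\Gamma(TF_j)$ are identified with their lifts to the product, and functions and tensors on the factors with their pullbacks. Subscripts $B$, $F_j$ denote objects of that factor. When indices coincide, e.g. $i=j$, $V_i$ is also written $V_j$. $g_B^*$ is the inverse metric of $g_B$ on 1-forms of $B$; in $g_B^*(\nabla^\flat_XY,db_j)$, $\nabla^\flat_XY=\mathcal K_B(X,Y,\cdot)$. $XY(f)$ means $X(Y(f))$.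 *)

theory Defs
  imports "HOL-Analysis.Analysis" "HOL-Library.Function_Algebras"
begin

section \<open>Smooth manifolds\<close>

text \<open>
  Coordinates take values in the space of real families indexed by a finite set \<open>I\<close>, that is
  \<open>powertop_real I\<close>, instead of tuples of length \<open>n\<close>; this lets dimensions vary along a family of
  manifolds and makes charts of products immediate.  The points of \<open>powertop_real I\<close> are
  extensional on \<open>I\<close>.  \<open>S\<close> is always an open subset of it.
\<close>

definition partial_deriv :: "'c \<Rightarrow> (('c \<Rightarrow> real) \<Rightarrow> real) \<Rightarrow> ('c \<Rightarrow> real) \<Rightarrow> real"
  where "partial_deriv i f x = deriv (\<lambda>t. f (x(i := t))) (x i)"

primrec Ck_on :: "nat \<Rightarrow> 'c set \<Rightarrow> ('c \<Rightarrow> real) set \<Rightarrow> (('c \<Rightarrow> real) \<Rightarrow> real) \<Rightarrow> bool"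
  where
    "Ck_on 0 I S f \<longleftrightarrow> continuous_map (subtopology (powertop_real I) S) euclideanreal f"
  | "Ck_on (Suc k) I S f \<longleftrightarrow>
       continuous_map (subtopology (powertop_real I) S) euclideanreal f \<and>
       (\<forall>i\<in>I. (\<forall>x\<in>S. (\<lambda>t. f (x(i := t))) field_differentiable at (x i)) \<and>
              Ck_on k I S (partial_deriv i f))"

definition smooth_on :: "'c set \<Rightarrow> ('c \<Rightarrow> real) set \<Rightarrow> (('c \<Rightarrow> real) \<Rightarrow> real) \<Rightarrow> bool"
  where "smooth_on I S f \<longleftrightarrow> (\<forall>k. Ck_on k I S f)"

text \<open>A chart is a pair of its domain and its coordinate map, which is only relevant on the domain.\<close>

record ('a, 'c) manifold =
  Top :: "'a topology"
  Coord :: "'c set"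
  Atlas :: "('a set \<times> ('a \<Rightarrow> 'c \<Rightarrow> real)) set"

abbreviation Carrier :: "('a, 'c) manifold \<Rightarrow> 'a set"
  where "Carrier M \<equiv> topspace (Top M)"

definition smooth_manifold :: "('a, 'c) manifold \<Rightarrow> bool"
  where "smooth_manifold M \<longleftrightarrow>
     Hausdorff_space (Top M) \<and> second_countable (Top M) \<and> finite (Coord M) \<and>
     (\<Union>(U, \<phi>)\<in>Atlas M. U) = Carrier M \<and>
     (\<forall>(U, \<phi>)\<in>Atlas M.
        openin (Top M) U \<and> openin (powertop_real (Coord M)) (\<phi> ` U) \<and>
        homeomorphic_map (subtopology (Top M) U) (subtopology (powertop_real (Coord M)) (\<phi> ` U)) \<phi>) \<and>
     (\<forall>(U, \<phi>)\<in>Atlas M. \<forall>(V, \<psi>)\<in>Atlas M. \<forall>i\<in>Coord M.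
        smooth_on (Coord M) (\<phi> ` (U \<inter> V)) (\<lambda>x. \<psi> (inv_into U \<phi> x) i))"

definition C_inf :: "('a, 'c) manifold \<Rightarrow> ('a \<Rightarrow> real) set"
  where "C_inf M = {f. \<forall>(U, \<phi>)\<in>Atlas M. smooth_on (Coord M) (\<phi> ` U) (f \<circ> inv_into U \<phi>)}"

text \<open>
  Tangent vectors are derivations of the algebra of smooth functions; they are extended by zero to
  arbitrary functions, so that equality of tangent vectors is equality in HOL.  Members of \<open>C_inf M\<close>
  may take any values outside the carrier, but derivations do not depend on these values: if \<open>f\<close>
  vanishes on the carrier, then \<open>f = f * h\<close> for some \<open>h\<close> that also vanishes there, and the Leibniz rule
  gives \<open>v f = 0\<close>.
\<close>

type_synonym 'a tvec = "('a \<Rightarrow> real) \<Rightarrow> real"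
type_synonym 'a covec = "'a tvec \<Rightarrow> real"
type_synonym 'a vfield = "'a \<Rightarrow> 'a tvec"
type_synonym 'a bform = "'a \<Rightarrow> 'a tvec \<Rightarrow> 'a tvec \<Rightarrow> real"

definition tangent_space :: "('a, 'c) manifold \<Rightarrow> 'a \<Rightarrow> 'a tvec set"
  where "tangent_space M p = {v.
     (\<forall>f\<in>C_inf M. \<forall>h\<in>C_inf M. v (\<lambda>x. f x + h x) = v f + v h) \<and>
     (\<forall>c. \<forall>f\<in>C_inf M. v (\<lambda>x. c * f x) = c * v f) \<and>
     (\<forall>f\<in>C_inf M. \<forall>h\<in>C_inf M. v (\<lambda>x. f x * h x) = f p * v h + h p * v f) \<and>
     (\<forall>f. f \<notin> C_inf M \<longrightarrow> v f = 0)}"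

definition vector_fields :: "('a, 'c) manifold \<Rightarrow> 'a vfield set"
  where "vector_fields M = {X.
     (\<forall>p\<in>Carrier M. X p \<in> tangent_space M p) \<and>
     (\<forall>f\<in>C_inf M. (\<lambda>p. X p f) \<in> C_inf M)}"

definition lie_bracket :: "'a vfield \<Rightarrow> 'a vfield \<Rightarrow> 'a vfield"
  where "lie_bracket X Y = (\<lambda>p f. X p (\<lambda>q. Y q f) - Y p (\<lambda>q. X q f))"

text \<open>The differential of a smooth map \<open>\<phi>\<close> into \<open>N\<close>.\<close>

definition pushforward :: "('b, 'd) manifold \<Rightarrow> ('a \<Rightarrow> 'b) \<Rightarrow> 'a tvec \<Rightarrow> 'b tvec"
  where "pushforward N \<phi> v = (\<lambda>f. if f \<in> C_inf N then v (f \<circ> \<phi>) else 0)"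

text \<open>Covectors at \<open>p\<close> are functions on \<open>tangent_space M p\<close> that are extended by zero.\<close>

definition diff_at :: "('a, 'c) manifold \<Rightarrow> ('a \<Rightarrow> real) \<Rightarrow> 'a \<Rightarrow> 'a covec"
  where "diff_at M f p = (\<lambda>w. if w \<in> tangent_space M p then w f else 0)"

text \<open>
  The covector at \<open>p\<close> of a 1-form that is given by its action on vector fields.  As \<open>\<omega>\<close> is linear over
  smooth functions, the choice of the extension of \<open>w\<close> to a vector field does not matter.
\<close>

definition form_at :: "('a, 'c) manifold \<Rightarrow> ('a vfield \<Rightarrow> 'a \<Rightarrow> real) \<Rightarrow> 'a \<Rightarrow> 'a covec"
  where "form_at M \<omega> p = (\<lambda>w. if w \<in> tangent_space M p
     then \<omega> (SOME Z. Z \<in> vector_fields M \<and> Z p = w) p else 0)"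

section \<open>Singular semi-Riemannian manifolds\<close>

definition singular_semi_riemannian :: "('a, 'c) manifold \<Rightarrow> 'a bform \<Rightarrow> bool"
  where "singular_semi_riemannian M g \<longleftrightarrow>
     smooth_manifold M \<and>
     (\<forall>p\<in>Carrier M. \<forall>u\<in>tangent_space M p. \<forall>v\<in>tangent_space M p. \<forall>w\<in>tangent_space M p. \<forall>c.
        g p u v = g p v u \<and>
        g p (\<lambda>f. u f + v f) w = g p u w + g p v w \<and>
        g p (\<lambda>f. c * u f) w = c * g p u w) \<and>
     (\<forall>X\<in>vector_fields M. \<forall>Y\<in>vector_fields M. (\<lambda>p. g p (X p) (Y p)) \<in> C_inf M)"

definition non_degenerate :: "('a, 'c) manifold \<Rightarrow> 'a bform \<Rightarrow> bool"
  where "non_degenerate M g \<longleftrightarrow>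
     (\<forall>p\<in>Carrier M. \<forall>v\<in>tangent_space M p. (\<forall>w\<in>tangent_space M p. g p v w = 0) \<longrightarrow> v = (\<lambda>f. 0))"

definition flat_at :: "('a, 'c) manifold \<Rightarrow> 'a bform \<Rightarrow> 'a \<Rightarrow> 'a tvec \<Rightarrow> 'a covec"
  where "flat_at M g p v = (\<lambda>w. if w \<in> tangent_space M p then g p v w else 0)"

definition koszul :: "'a bform \<Rightarrow> 'a vfield \<Rightarrow> 'a vfield \<Rightarrow> 'a vfield \<Rightarrow> 'a \<Rightarrow> real"
  where "koszul g X Y Z = (\<lambda>p. 1/2 *
     (X p (\<lambda>q. g q (Y q) (Z q)) + Y p (\<lambda>q. g q (Z q) (X q)) - Z p (\<lambda>q. g q (X q) (Y q))
      - g p (X p) (lie_bracket Y Z p) + g p (Y p) (lie_bracket Z X p) + g p (Z p) (lie_bracket X Y p)))"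

definition T_bullet :: "('a, 'c) manifold \<Rightarrow> 'a bform \<Rightarrow> 'a \<Rightarrow> 'a covec set"
  where "T_bullet M g p = flat_at M g p ` tangent_space M p"

definition g_bullet :: "('a, 'c) manifold \<Rightarrow> 'a bform \<Rightarrow> 'a \<Rightarrow> 'a covec \<Rightarrow> 'a covec \<Rightarrow> real"
  where "g_bullet M g p \<alpha> \<beta> = (THE r. \<exists>v\<in>tangent_space M p. \<exists>w\<in>tangent_space M p.
     \<alpha> = flat_at M g p v \<and> \<beta> = flat_at M g p w \<and> r = g p v w)"

text \<open>The rank of \<open>g\<close> at \<open>p\<close> is the dimension of the image of \<open>v \<mapsto> g p v\<close>.\<close>

definition rank_at :: "('a, 'c) manifold \<Rightarrow> 'a bform \<Rightarrow> 'a \<Rightarrow> nat"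
  where "rank_at M g p = vector_space.dim (\<lambda>(c::real) (\<alpha>::'a covec) w. c * \<alpha> w) (T_bullet M g p)"

definition regular_points :: "('a, 'c) manifold \<Rightarrow> 'a bform \<Rightarrow> 'a set"
  where "regular_points M g =
     {p. \<exists>U. openin (Top M) U \<and> p \<in> U \<and> (\<forall>q\<in>U. rank_at M g q = rank_at M g p)}"

definition is_contraction ::
  "('a, 'c) manifold \<Rightarrow> 'a bform \<Rightarrow> ('a vfield \<Rightarrow> 'a \<Rightarrow> real) \<Rightarrow> ('a vfield \<Rightarrow> 'a \<Rightarrow> real) \<Rightarrow> ('a \<Rightarrow> real) \<Rightarrow> bool"
  where "is_contraction M g \<omega> \<tau> h \<longleftrightarrow>
     h \<in> C_inf M \<and> (\<forall>p\<in>regular_points M g. h p = g_bullet M g p (form_at M \<omega> p) (form_at M \<tau> p))"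

text \<open>Any two choices agree on the carrier, because the regular points are dense.\<close>

definition contraction ::
  "('a, 'c) manifold \<Rightarrow> 'a bform \<Rightarrow> ('a vfield \<Rightarrow> 'a \<Rightarrow> real) \<Rightarrow> ('a vfield \<Rightarrow> 'a \<Rightarrow> real) \<Rightarrow> 'a \<Rightarrow> real"
  where "contraction M g \<omega> \<tau> = (SOME h. is_contraction M g \<omega> \<tau> h)"

definition radical_stationary :: "('a, 'c) manifold \<Rightarrow> 'a bform \<Rightarrow> bool"
  where "radical_stationary M g \<longleftrightarrow>
     (\<forall>X\<in>vector_fields M. \<forall>Y\<in>vector_fields M. \<forall>p\<in>Carrier M.
        form_at M (koszul g X Y) p \<in> T_bullet M g p)"

definition semi_regular :: "('a, 'c) manifold \<Rightarrow> 'a bform \<Rightarrow> bool"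
  where "semi_regular M g \<longleftrightarrow>
     singular_semi_riemannian M g \<and> radical_stationary M g \<and>
     (\<forall>X\<in>vector_fields M. \<forall>Y\<in>vector_fields M. \<forall>Z\<in>vector_fields M. \<forall>T\<in>vector_fields M.
        \<exists>h. is_contraction M g (koszul g X Y) (koszul g Z T) h)"

text \<open>The formula of the Riemann curvature, for an arbitrary form \<open>K\<close> in place of the Koszul form.\<close>

definition curvature_of ::
  "('a, 'c) manifold \<Rightarrow> 'a bform \<Rightarrow> ('a vfield \<Rightarrow> 'a vfield \<Rightarrow> 'a vfield \<Rightarrow> 'a \<Rightarrow> real) \<Rightarrow>
   'a vfield \<Rightarrow> 'a vfield \<Rightarrow> 'a vfield \<Rightarrow> 'a vfield \<Rightarrow> 'a \<Rightarrow> real"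
  where "curvature_of M g K X Y Z T = (\<lambda>p.
     X p (K Y Z T) - Y p (K X Z T) - K (lie_bracket X Y) Z T p
     + contraction M g (K X Z) (K Y T) p - contraction M g (K Y Z) (K X T) p)"

definition curvature ::
  "('a, 'c) manifold \<Rightarrow> 'a bform \<Rightarrow> 'a vfield \<Rightarrow> 'a vfield \<Rightarrow> 'a vfield \<Rightarrow> 'a vfield \<Rightarrow> 'a \<Rightarrow> real"
  where "curvature M g = curvature_of M g (koszul g)"

definition ssm_koszul ::
  "'a bform \<Rightarrow> 'a vfield \<Rightarrow> 'a vfield \<Rightarrow> 'a vfield \<Rightarrow> 'a vfield \<Rightarrow> 'a \<Rightarrow> real"
  where "ssm_koszul g P X Y Z = (\<lambda>p.
     koszul g X Y Z p + g p (Y p) (P p) * g p (X p) (Z p) - g p (X p) (Y p) * g p (P p) (Z p))"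

definition ssm_curvature ::
  "('a, 'c) manifold \<Rightarrow> 'a bform \<Rightarrow> 'a vfield \<Rightarrow> 'a vfield \<Rightarrow> 'a vfield \<Rightarrow> 'a vfield \<Rightarrow> 'a vfield \<Rightarrow> 'a \<Rightarrow> real"
  where "ssm_curvature M g P = curvature_of M g (ssm_koszul g P)"

definition sharp_at :: "('a, 'c) manifold \<Rightarrow> 'a bform \<Rightarrow> 'a \<Rightarrow> 'a covec \<Rightarrow> 'a tvec"
  where "sharp_at M g p \<alpha> = (THE v. v \<in> tangent_space M p \<and> flat_at M g p v = \<alpha>)"

definition inverse_metric :: "('a, 'c) manifold \<Rightarrow> 'a bform \<Rightarrow> 'a \<Rightarrow> 'a covec \<Rightarrow> 'a covec \<Rightarrow> real"
  where "inverse_metric M g p \<alpha> \<beta> = g p (sharp_at M g p \<alpha>) (sharp_at M g p \<beta>)"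

section \<open>Multiply warped products\<close>

text \<open>
  A point of the product is a pair of a point of \<open>B\<close> and a family in \<open>\<Pi>\<^sub>E j\<in>J. Carrier (F j)\<close>.  The
  factors \<open>F j\<close> are carried by subsets of one type, but may differ in all other respects.
\<close>

definition prod_manifold ::
  "('b, 'c) manifold \<Rightarrow> (nat \<Rightarrow> ('f, 'd) manifold) \<Rightarrow> nat set \<Rightarrow> ('b \<times> (nat \<Rightarrow> 'f), 'c + nat \<times> 'd) manifold"
  where "prod_manifold B F J = (let C = Coord B <+> (SIGMA j:J. Coord (F j)) in
    \<lparr> Top = prod_topology (Top B) (product_topology (\<lambda>j. Top (F j)) J),
      Coord = C,
      Atlas = {(U \<times> (\<Pi>\<^sub>E j\<in>J. W j),
                \<lambda>(p, q). restrict (case_sum (\<phi> p) (\<lambda>(j, a). \<psi> j (q j) a)) C) | U \<phi> W \<psi>.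
               (U, \<phi>) \<in> Atlas B \<and> (\<forall>j\<in>J. (W j, \<psi> j) \<in> Atlas (F j))} \<rparr>)"

definition warped_metric ::
  "('b, 'c) manifold \<Rightarrow> 'b bform \<Rightarrow> (nat \<Rightarrow> ('f, 'd) manifold) \<Rightarrow> (nat \<Rightarrow> 'f bform) \<Rightarrow> (nat \<Rightarrow> 'b \<Rightarrow> real) \<Rightarrow>
   nat set \<Rightarrow> ('b \<times> (nat \<Rightarrow> 'f)) bform"
  where "warped_metric B gB F gF b J = (\<lambda>(p, q) v w.
     gB p (pushforward B fst v) (pushforward B fst w)
     + (\<Sum>j\<in>J. (b j p)\<^sup>2 * gF j (q j) (pushforward (F j) (\<lambda>x. snd x j) v)
                                   (pushforward (F j) (\<lambda>x. snd x j) w)))"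

text \<open>
  The lift of a vector field of a factor: its image under the inclusion of that factor as the slice
  through the given point.
\<close>

definition lift_base ::
  "('b, 'c) manifold \<Rightarrow> (nat \<Rightarrow> ('f, 'd) manifold) \<Rightarrow> nat set \<Rightarrow> 'b vfield \<Rightarrow> ('b \<times> (nat \<Rightarrow> 'f)) vfield"
  where "lift_base B F J X = (\<lambda>(p, q). pushforward (prod_manifold B F J) (\<lambda>x. (x, q)) (X p))"

definition lift_fibre ::
  "('b, 'c) manifold \<Rightarrow> (nat \<Rightarrow> ('f, 'd) manifold) \<Rightarrow> nat set \<Rightarrow> nat \<Rightarrow> 'f vfield \<Rightarrow> ('b \<times> (nat \<Rightarrow> 'f)) vfield"
  where "lift_fibre B F J j V = (\<lambda>(p, q). pushforward (prod_manifold B F J) (\<lambda>y. (p, q(j := y))) (V (q j)))"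

end

theory Submission
  imports Defs
begin

text \<open>
  Fields of the form \<open>H A + (\<Sum>j. L j (A\<^sub>j))\<close>, where the coefficients \<open>A\<close>, \<open>A\<^sub>j\<close> are fields on the
  factors, span all tangent spaces, and the Koszul form of two lifted fields is the flat of an explicit
  vector that is smooth wherever each \<open>b\<^sub>j\<close> vanishes identically or nowhere.  Such points, with regular
  components in the fibres, are dense, and there the contractions \<open>K(X,Y,\<bullet>)K(Z,T,\<bullet>)\<close> can be
  evaluated; the values are smooth functions on the whole product, where \<open>1 / b\<^sub>j\<close> has cancelled.
  This gives semi-regularity and the Riemann curvature.  The semi-symmetric curvature differs from it by
  an algebraic expression in \<open>g\<close>, \<open>K(X,P,Z)\<close> and \<open>g(X,P)\<close>, since the radical-stationary condition lets
  \<open>g(X,\<bullet>)K(Y,Z,\<bullet>)\<close> contract to \<open>K(Y,Z,X)\<close>.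
\<close>

section \<open>Calculus on open subsets of real families\<close>

text \<open>The obstacle is that a contraction is prescribed at every regular point of the product,
  and nothing describes these points in terms of the factors. Where some \<open>b j\<close> has a
  zero without vanishing nearby, the pointwise value of \<open>g_bullet\<close> can miss terms that
  survive in the limit, so no single formula holds at all points. The way out is continuity: at a
  regular point, \<open>g_bullet\<close> of two forms with values in \<open>T_bullet\<close> is
  continuous, hence agreement with a smooth function on a dense set is enough, whatever points that
  set consists of. The calculus is there because tangent vectors are bare derivations: Hadamard's
  lemma makes their space finite-dimensional, and bump functions make them local and extend them to
  fields. All claims come from one curvature formula for fields with components in all factors; a
  lift is such a field with zero components elsewhere, so an index pattern only decides which terms
  survive.\<close>

lemma subtopology_powertop_real:
  assumes "S \<subseteq> extensional I"
  shows "subtopology (powertop_real I) S = top_of_set S"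
proof -
  let ?X = "subtopology (powertop_real I) S"
  have ts: "topspace ?X = S" using assms by (auto simp: PiE_UNIV_domain PiE_def)
  have 1: "continuous_map (top_of_set S) ?X id"
    using assms by (auto simp: continuous_map_in_subtopology continuous_map_componentwise id_def
        intro!: continuous_on_product_coordinates[THEN continuous_on_subset])
  have 2: "continuous_map ?X euclidean id"
    unfolding euclidean_product_topology[symmetric] continuous_map_componentwise_UNIV
  proof
    fix i
    show "continuous_map ?X euclideanreal (\<lambda>x. id x i)"
    proof (cases "i \<in> I")
      case True
      then show ?thesis
        by (auto intro: continuous_map_from_subtopology continuous_map_product_projection)
    next
      \<comment> \<open>Coordinates outside \<open>I\<close> are constantly \<open>undefined\<close>
        on extensional points; this is why the subspace topology of the full function type adds
        nothing to the product topology over \<open>I\<close>.\<close>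
      case False
      have "continuous_map ?X euclideanreal (\<lambda>x. undefined)" by simp
      then show ?thesis
        by (rule continuous_map_eq) (use False assms ts in \<open>auto simp: extensional_def\<close>)
    qed
  qed
  have 3: "continuous_map ?X (top_of_set S) id"
    using 2 ts by (auto simp: continuous_map_in_subtopology)
  show ?thesis
    unfolding topology_eq
  proof (intro allI iffI)
    fix U
    { assume U: "openin ?X U"
      have "openin (top_of_set S) {x \<in> topspace (top_of_set S). id x \<in> U}"
        using 1 U unfolding continuous_map_def by blast
      moreover have "{x \<in> topspace (top_of_set S). id x \<in> U} = U"
        using openin_subset[OF U] ts by auto
      ultimately show "openin (top_of_set S) U" by simp }
    { assume U: "openin (top_of_set S) U"
      have "openin ?X {x \<in> topspace ?X. id x \<in> U}"
        using 3 U unfolding continuous_map_def by blast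
      moreover have "{x \<in> topspace ?X. id x \<in> U} = U"
        using openin_subset[OF U] ts by auto
      ultimately show "openin ?X U" by simp }
  qed
qed

lemma continuous_map_powertop_iff:
  assumes "S \<subseteq> extensional I"
  shows "continuous_map (subtopology (powertop_real I) S) euclideanreal f \<longleftrightarrow> continuous_on S f"
  using assms by (simp add: subtopology_powertop_real)

lemma openin_powertop_extensional: "openin (powertop_real I) S \<Longrightarrow> S \<subseteq> extensional I"
  using openin_subset by (fastforce simp: PiE_def)

text \<open>Finiteness of \<open>I\<close> gives one radius for all coordinates. The box is closed
  so that it can later serve as the compact support of a bump function.\<close>

lemma openin_powertop_box:
  assumes "openin (powertop_real I) S" "x \<in> S" "finite I"
  obtains \<epsilon> where "\<epsilon> > 0" "\<And>y. y \<in> extensional I \<Longrightarrow> (\<And>i. i \<in> I \<Longrightarrow> \<bar>y i - x i\<bar> \<le> \<epsilon>) \<Longrightarrow> y \<in> S"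
proof -
  obtain U where U: "\<forall>i\<in>I. open (U i)" "x \<in> Pi\<^sub>E I U" "Pi\<^sub>E I U \<subseteq> S"
    using assms(1,2) by (auto simp: openin_product_topology_alt)
  have "\<forall>i\<in>I. \<exists>e>0. cball (x i) e \<subseteq> U i"
    using U open_contains_cball by (metis PiE_mem)
  then obtain e where e: "\<And>i. i \<in> I \<Longrightarrow> e i > 0 \<and> cball (x i) (e i) \<subseteq> U i" by metis
  define \<epsilon> where "\<epsilon> = Min (insert 1 (e ` I))"
  have "\<epsilon> > 0" unfolding \<epsilon>_def using assms(3) e by (auto simp: Min_gr_iff)
  moreover have "y \<in> S" if y: "y \<in> extensional I" "\<And>i. i \<in> I \<Longrightarrow> \<bar>y i - x i\<bar> \<le> \<epsilon>" for y
  proof -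
    have "y i \<in> U i" if i: "i \<in> I" for i
    proof -
      have "\<epsilon> \<le> e i" unfolding \<epsilon>_def using assms(3) i by (auto intro: Min_le)
      then have "y i \<in> cball (x i) (e i)" using y(2)[OF i] by (auto simp: dist_real_def)
      then show ?thesis using e i by blast
    qed
    then show ?thesis using U(3) y(1) by (auto simp: PiE_def)
  qed
  ultimately show ?thesis by (rule that)
qed

lemma openin_powertop_ball:
  assumes "finite I"
  shows "openin (powertop_real I) {y \<in> extensional I. \<forall>i\<in>I. \<bar>y i - x i\<bar> < \<epsilon>}"
proof -
  have "{y \<in> extensional I. \<forall>i\<in>I. \<bar>y i - x i\<bar> < \<epsilon>} = (\<Pi>\<^sub>E i\<in>I. ball (x i) \<epsilon>)"
    by (auto simp: PiE_def Pi_def dist_real_def abs_minus_commute)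
  then show ?thesis using assms by (auto simp: openin_PiE)
qed

section \<open>Partial derivatives and the classes C^k\<close>

lemma eventually_line_in_open:
  assumes "openin (powertop_real I) S" "x \<in> S" "finite I" "i \<in> I"
  shows "\<forall>\<^sub>F t in nhds (x i). x(i := t) \<in> S"
proof -
  obtain \<epsilon> where \<epsilon>: "\<epsilon> > 0"
    "\<And>y. y \<in> extensional I \<Longrightarrow> (\<And>i. i \<in> I \<Longrightarrow> \<bar>y i - x i\<bar> \<le> \<epsilon>) \<Longrightarrow> y \<in> S"
    using openin_powertop_box[OF assms(1,2,3)] by blast
  have x: "x \<in> extensional I" using assms openin_powertop_extensional by blast
  show ?thesis unfolding eventually_nhds_metric
  proof (intro exI[of _ \<epsilon>] conjI allI impI)
    fix t assume "dist t (x i) < \<epsilon>"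
    then show "x(i := t) \<in> S"
      using x \<epsilon>(1) assms(4) by (intro \<epsilon>(2)) (auto simp: extensional_def dist_real_def)
  qed (use \<epsilon> in auto)
qed

text \<open>The relational counterpart of \<open>partial_deriv\<close>: the latter has a value even
  where no derivative exists, whereas this form asserts existence and lets the \<open>DERIV\<close>
  rules act on one coordinate.\<close>

definition has_pd :: "'c \<Rightarrow> (('c \<Rightarrow> real) \<Rightarrow> real) \<Rightarrow> ('c \<Rightarrow> real) \<Rightarrow> real \<Rightarrow> bool"
  where "has_pd i f x d \<longleftrightarrow> ((\<lambda>t. f (x(i := t))) has_real_derivative d) (at (x i))"

lemma has_pd_imp_partial_deriv: "has_pd i f x d \<Longrightarrow> partial_deriv i f x = d"
  unfolding partial_deriv_def has_pd_def by (rule DERIV_imp_deriv)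

lemma has_pd_cong:
  assumes "openin (powertop_real I) S" "finite I" "\<And>x. x \<in> S \<Longrightarrow> f x = h x" "x \<in> S" "i \<in> I"
  shows "has_pd i f x d \<longleftrightarrow> has_pd i h x d"
  unfolding has_pd_def
  by (rule DERIV_cong_ev[OF refl _ refl], rule eventually_mono[OF eventually_line_in_open])
     (use assms in auto)

lemma partial_deriv_cong:
  assumes "openin (powertop_real I) S" "finite I" "\<And>x. x \<in> S \<Longrightarrow> f x = h x" "x \<in> S" "i \<in> I"
  shows "partial_deriv i f x = partial_deriv i h x"
  unfolding partial_deriv_def deriv_def has_pd_def[symmetric]
  using has_pd_cong[where f=f and h=h, OF assms(1,2) _ assms(4,5)] assms(3) by simp

lemma Ck_on_0: "S \<subseteq> extensional I \<Longrightarrow> Ck_on 0 I S f \<longleftrightarrow> continuous_on S f"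
  by (simp add: continuous_map_powertop_iff)

lemma Ck_on_Suc:
  "S \<subseteq> extensional I \<Longrightarrow> Ck_on (Suc k) I S f \<longleftrightarrow> continuous_on S f \<and>
    (\<forall>i\<in>I. (\<forall>x\<in>S. has_pd i f x (partial_deriv i f x)) \<and> Ck_on k I S (partial_deriv i f))"
  by (simp add: continuous_map_powertop_iff partial_deriv_def has_pd_def DERIV_deriv_iff_field_differentiable)

declare Ck_on.simps [simp del]

lemma Ck_on_cont: "S \<subseteq> extensional I \<Longrightarrow> Ck_on k I S f \<Longrightarrow> continuous_on S f"
  by (cases k) (auto simp: Ck_on_0 Ck_on_Suc)

lemma Ck_on_cong:
  assumes "openin (powertop_real I) S" "finite I" "\<And>x. x \<in> S \<Longrightarrow> f x = h x" "Ck_on k I S f"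
  shows "Ck_on k I S h"
  using assms(3,4)
proof (induction k arbitrary: f h)
  case 0
  then show ?case using openin_powertop_extensional[OF assms(1)]
    by (auto simp: Ck_on_0 cong: continuous_on_cong)
next
  case (Suc k)
  note ext = openin_powertop_extensional[OF assms(1)]
  have eq: "partial_deriv i f x = partial_deriv i h x" if "x \<in> S" "i \<in> I" for x i
    using partial_deriv_cong[where f=f and h=h, OF assms(1,2) _ that] Suc.prems(1) by blast
  show ?case unfolding Ck_on_Suc[OF ext]
  proof (intro conjI ballI)
    show "continuous_on S h" using Suc.prems ext by (auto simp: Ck_on_Suc cong: continuous_on_cong)
    fix i assume i: "i \<in> I"
    show "Ck_on k I S (partial_deriv i h)"
      by (rule Suc.IH[of "partial_deriv i f"]) (use Suc.prems ext eq i in \<open>auto simp: Ck_on_Suc\<close>)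
    fix x assume x: "x \<in> S"
    have "has_pd i f x (partial_deriv i f x)" using Suc.prems ext i x by (auto simp: Ck_on_Suc)
    then show "has_pd i h x (partial_deriv i h x)"
      using has_pd_cong[where f=f and h=h, OF assms(1,2) _ x i] Suc.prems(1) eq[OF x i] by simp
  qed
qed

text \<open>The derivative \<open>f'\<close> has to be right on \<open>S\<close> only.
  \<open>partial_deriv i f\<close> is a function on the whole type and may differ from any
  convenient formula outside \<open>S\<close>, so the calculus rules below could not be stated with
  an equality of functions.\<close>

lemma Ck_on_SucI:
  assumes "openin (powertop_real I) S" "finite I" "continuous_on S f"
    "\<And>i x. i \<in> I \<Longrightarrow> x \<in> S \<Longrightarrow> has_pd i f x (f' i x)"
    "\<And>i. i \<in> I \<Longrightarrow> Ck_on k I S (f' i)"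
  shows "Ck_on (Suc k) I S f"
  unfolding Ck_on_Suc[OF openin_powertop_extensional[OF assms(1)]]
proof (intro conjI ballI)
  fix i assume i: "i \<in> I"
  have eq: "partial_deriv i f x = f' i x" if "x \<in> S" for x
    using has_pd_imp_partial_deriv assms(4)[OF i that] .
  show "Ck_on k I S (partial_deriv i f)"
    by (rule Ck_on_cong[OF assms(1,2) _ assms(5)[OF i]]) (simp add: eq)
  show "has_pd i f x (partial_deriv i f x)" if "x \<in> S" for x
    using assms(4)[OF i that] eq[OF that] by simp
qed (use assms in auto)

lemma Ck_on_SucD:
  assumes "openin (powertop_real I) S" "Ck_on (Suc k) I S f"
  shows "continuous_on S f" "\<And>i x. i \<in> I \<Longrightarrow> x \<in> S \<Longrightarrow> has_pd i f x (partial_deriv i f x)"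
    "\<And>i. i \<in> I \<Longrightarrow> Ck_on k I S (partial_deriv i f)"
  using assms(2) unfolding Ck_on_Suc[OF openin_powertop_extensional[OF assms(1)]] by auto

lemma Ck_on_Suc_imp:
  assumes "openin (powertop_real I) S" "Ck_on (Suc k) I S f"
  shows "Ck_on k I S f"
  using assms(2)
proof (induction k arbitrary: f)
  case 0
  then show ?case using Ck_on_SucD[OF assms(1)] openin_powertop_extensional[OF assms(1)]
    by (auto simp: Ck_on_0)
next
  case (Suc k)
  show ?case
    using Ck_on_SucD[OF assms(1) Suc.prems] Suc.IH openin_powertop_extensional[OF assms(1)]
    unfolding Ck_on_Suc[OF openin_powertop_extensional[OF assms(1)]] by auto
qed

lemma Ck_on_subset:
  assumes "S' \<subseteq> S" "S \<subseteq> extensional I" "Ck_on k I S f"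
  shows "Ck_on k I S' f"
  using assms(3)
proof (induction k arbitrary: f)
  case 0
  then show ?case using assms by (auto simp: Ck_on_0 intro: continuous_on_subset)
next
  case (Suc k)
  have "S' \<subseteq> extensional I" using assms by auto
  with Suc show ?case using assms(1,2) by (auto simp: Ck_on_Suc intro: continuous_on_subset)
qed

lemma continuous_on_powertop_local:
  assumes "S \<subseteq> extensional I"
    "\<And>x. x \<in> S \<Longrightarrow> \<exists>S'. openin (powertop_real I) S' \<and> x \<in> S' \<and> continuous_on (S \<inter> S') f"
  shows "continuous_on S f"
  unfolding continuous_on_def
proof
  fix x assume x: "x \<in> S"
  then obtain S' where S': "openin (powertop_real I) S'" "x \<in> S'" "continuous_on (S \<inter> S') f"
    using assms by blast
  have "openin (subtopology (powertop_real I) (extensional I)) S'"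
    unfolding openin_subtopology using S'(1) openin_powertop_extensional[OF S'(1)] by blast
  then have "openin (top_of_set (extensional I)) S'"
    by (simp only: subtopology_powertop_real[OF order_refl])
  then obtain T where T: "open T" "S' = extensional I \<inter> T" by (auto simp: openin_open)
  have "(f \<longlongrightarrow> f x) (at x within S \<inter> S')"
    using S'(3) unfolding continuous_on_def by (rule bspec) (use x S'(2) in blast)
  moreover have "at x within S \<inter> S' = at x within S"
  proof (rule at_within_nhd[of x T])
    show "S \<inter> S' \<inter> T - {x} = S \<inter> T - {x}" using T(2) assms(1) by blast
  qed (use T S'(2) in auto)
  ultimately show "(f \<longlongrightarrow> f x) (at x within S)" by simp
qed

text \<open>No gluing is involved: \<open>partial_deriv i f\<close> is determined by
  \<open>f\<close> alone, so the local hypothesis passes to it and the induction on \<open>k\<close>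
  closes.\<close>

lemma Ck_on_local:
  assumes "openin (powertop_real I) S"
    "\<And>x. x \<in> S \<Longrightarrow> \<exists>S'. openin (powertop_real I) S' \<and> x \<in> S' \<and> Ck_on k I S' f"
  shows "Ck_on k I S f"
  using assms(2)
proof (induction k arbitrary: f)
  case 0
  note ext = openin_powertop_extensional
  show ?case unfolding Ck_on_0[OF ext[OF assms(1)]]
  proof (rule continuous_on_powertop_local[OF ext[OF assms(1)]])
    fix x assume "x \<in> S"
    with 0 obtain S' where "openin (powertop_real I) S'" "x \<in> S'" "Ck_on 0 I S' f" by blast
    then show "\<exists>S'. openin (powertop_real I) S' \<and> x \<in> S' \<and> continuous_on (S \<inter> S') f"
      using Ck_on_cont[OF ext, of I S' 0 f] by (intro exI[of _ S']) (auto intro: continuous_on_subset)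
  qed
next
  case (Suc k)
  note ext = openin_powertop_extensional
  obtain N where N: "\<And>x. x \<in> S \<Longrightarrow> openin (powertop_real I) (N x)" "\<And>x. x \<in> S \<Longrightarrow> x \<in> N x"
      "\<And>x. x \<in> S \<Longrightarrow> Ck_on (Suc k) I (N x) f"
    using Suc.prems by metis
  note D = Ck_on_SucD[OF N(1) N(3)]
  have "continuous_on S f"
  proof (rule continuous_on_powertop_local[OF ext[OF assms(1)]])
    fix x assume x: "x \<in> S"
    then show "\<exists>S'. openin (powertop_real I) S' \<and> x \<in> S' \<and> continuous_on (S \<inter> S') f"
      using N(1,2)[OF x] continuous_on_subset[OF D(1)[OF x x], of "S \<inter> N x"]
      by (intro exI[of _ "N x"]) simp
  qed
  moreover have "has_pd i f x (partial_deriv i f x)" if "i \<in> I" "x \<in> S" for i x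
    using D(2)[OF that(2,2,1) N(2)[OF that(2)]] .
  moreover have "Ck_on k I S (partial_deriv i f)" if "i \<in> I" for i
  proof (rule Suc.IH)
    fix x assume x: "x \<in> S"
    show "\<exists>S'. openin (powertop_real I) S' \<and> x \<in> S' \<and> Ck_on k I S' (partial_deriv i f)"
      using N(1,2)[OF x] D(3)[OF x x that] by blast
  qed
  ultimately show ?case unfolding Ck_on_Suc[OF ext[OF assms(1)]] by simp
qed

section \<open>Closure of C^k under arithmetic\<close>

context
  fixes I :: "'c set" and S :: "('c \<Rightarrow> real) set"
  assumes finI: "finite I" and opS: "openin (powertop_real I) S"
begin

lemma Ck_on_const: "Ck_on k I S (\<lambda>x. c)"
proof (induction k arbitrary: c)
  case 0
  then show ?case using openin_powertop_extensional[OF opS] by (simp add: Ck_on_0)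
next
  case (Suc k)
  show ?case by (rule Ck_on_SucI[OF opS finI, of _ "\<lambda>_ _. 0"])
      (use Suc in \<open>auto simp: has_pd_def\<close>)
qed

lemma Ck_on_coord: "i \<in> I \<Longrightarrow> Ck_on k I S (\<lambda>x. x i)"
proof (cases k)
  case 0
  then show ?thesis using openin_powertop_extensional[OF opS]
    by (auto simp: Ck_on_0 intro: continuous_on_product_coordinates[THEN continuous_on_subset])
next
  case (Suc n)
  show ?thesis unfolding Suc
  proof (rule Ck_on_SucI[OF opS finI, of _ "\<lambda>j _. if i = j then 1 else 0"])
    show "continuous_on S (\<lambda>x. x i)"
      by (auto intro: continuous_on_product_coordinates[THEN continuous_on_subset])
  qed (auto simp: has_pd_def intro!: derivative_eq_intros Ck_on_const)
qed

lemma Ck_on_add: "Ck_on k I S f \<Longrightarrow> Ck_on k I S h \<Longrightarrow> Ck_on k I S (\<lambda>x. f x + h x)"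
proof (induction k arbitrary: f h)
  case 0
  then show ?case using openin_powertop_extensional[OF opS]
    by (auto simp: Ck_on_0 intro: continuous_intros)
next
  case (Suc k)
  note f = Ck_on_SucD[OF opS Suc.prems(1)] and h = Ck_on_SucD[OF opS Suc.prems(2)]
  show ?case
  proof (rule Ck_on_SucI[OF opS finI, of _ "\<lambda>i x. partial_deriv i f x + partial_deriv i h x"])
    fix i x assume "i \<in> I" "x \<in> S"
    from DERIV_add[OF f(2)[OF this, unfolded has_pd_def] h(2)[OF this, unfolded has_pd_def]]
    show "has_pd i (\<lambda>x. f x + h x) x (partial_deriv i f x + partial_deriv i h x)"
      by (simp add: has_pd_def)
  qed (intro continuous_intros f h Suc.IH; assumption)+
qed

lemma Ck_on_mult: "Ck_on k I S f \<Longrightarrow> Ck_on k I S h \<Longrightarrow> Ck_on k I S (\<lambda>x. f x * h x)"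
proof (induction k arbitrary: f h)
  case 0
  then show ?case using openin_powertop_extensional[OF opS]
    by (auto simp: Ck_on_0 intro: continuous_intros)
next
  case (Suc k)
  note f = Ck_on_SucD[OF opS Suc.prems(1)] and h = Ck_on_SucD[OF opS Suc.prems(2)]
  note fk = Ck_on_Suc_imp[OF opS Suc.prems(1)] and hk = Ck_on_Suc_imp[OF opS Suc.prems(2)]
  show ?case
  proof (rule Ck_on_SucI[OF opS finI, of _ "\<lambda>i x. partial_deriv i f x * h x + partial_deriv i h x * f x"])
    fix i x assume "i \<in> I" "x \<in> S"
    from DERIV_mult[OF f(2)[OF this, unfolded has_pd_def] h(2)[OF this, unfolded has_pd_def]]
    show "has_pd i (\<lambda>x. f x * h x) x (partial_deriv i f x * h x + partial_deriv i h x * f x)"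
      by (simp add: has_pd_def)
  qed (intro continuous_intros f h Ck_on_add Suc.IH fk hk; assumption)+
qed

lemma Ck_on_sum:
  "finite A \<Longrightarrow> (\<And>a. a \<in> A \<Longrightarrow> Ck_on k I S (f a)) \<Longrightarrow> Ck_on k I S (\<lambda>x. \<Sum>a\<in>A. f a x)"
  by (induction A rule: finite_induct) (auto intro: Ck_on_const Ck_on_add)

lemma Ck_on_inverse:
  "(\<And>x. x \<in> S \<Longrightarrow> f x \<noteq> 0) \<Longrightarrow> Ck_on k I S f \<Longrightarrow> Ck_on k I S (\<lambda>x. inverse (f x))"
proof (induction k)
  case 0
  then show ?case using openin_powertop_extensional[OF opS]
    by (auto simp: Ck_on_0 intro: continuous_intros)
next
  case (Suc k)
  note f = Ck_on_SucD[OF opS Suc.prems(2)] and fk = Ck_on_Suc_imp[OF opS Suc.prems(2)]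
  show ?case
  \<comment> \<open>The sign is written as the constant factor \<open>-1\<close> so that the closure
    under constants and products applies to the derivative.\<close>
  proof (rule Ck_on_SucI[OF opS finI, of _ "\<lambda>i x. (-1) * (partial_deriv i f x * (inverse (f x) * inverse (f x)))"])
    show "continuous_on S (\<lambda>x. inverse (f x))" using Suc.prems f by (auto intro: continuous_intros)
    fix i x assume "i \<in> I" "x \<in> S"
    then have "has_pd i (\<lambda>x. inverse (f x)) x (- (inverse (f (x(i := x i))) * partial_deriv i f x * inverse (f (x(i := x i)))))"
      unfolding has_pd_def by (intro DERIV_inverse' f(2)[unfolded has_pd_def]) (auto simp: Suc.prems)
    then show "has_pd i (\<lambda>x. inverse (f x)) x ((-1) * (partial_deriv i f x * (inverse (f x) * inverse (f x))))"
      by (simp add: mult_ac)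
  next
    show "Ck_on k I S (\<lambda>x. (-1) * (partial_deriv i f x * (inverse (f x) * inverse (f x))))" if "i \<in> I" for i
      by (intro Ck_on_mult Ck_on_const f(3) that Suc.IH Suc.prems fk)
  qed
qed

end

section \<open>The chain rule in finitely many coordinates\<close>

lemma tendsto_fun_componentwise:
  fixes f :: "'b \<Rightarrow> 'c \<Rightarrow> real"
  assumes "\<And>i. ((\<lambda>t. f t i) \<longlongrightarrow> l i) F"
  shows "(f \<longlongrightarrow> l) F"
proof -
  have "limitin (product_topology (\<lambda>i. euclidean) UNIV) f l F"
    unfolding limitin_componentwise using assms by auto
  then show ?thesis by (simp add: euclidean_product_topology)
qed

text \<open>The mean value theorem without an order between the end points. The case
  \<open>u = v\<close> is included because a coordinate of a curve may stand still at some
  times.\<close>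

lemma mvt_between:
  fixes F :: "real \<Rightarrow> real"
  assumes "\<And>s. \<bar>s - u\<bar> \<le> \<bar>v - u\<bar> \<Longrightarrow> (F has_real_derivative F' s) (at s)"
  shows "\<exists>\<xi>. \<bar>\<xi> - u\<bar> \<le> \<bar>v - u\<bar> \<and> F v - F u = F' \<xi> * (v - u)"
proof -
  consider "u = v" | "u < v" | "v < u" by linarith
  then show ?thesis
  proof cases
    case 1
    then show ?thesis by auto
  next
    case 2
    have "\<exists>z. u < z \<and> z < v \<and> F v - F u = (v - u) * F' z"
      by (rule MVT2) (use 2 assms in auto)
    then obtain z where "u < z" "z < v" "F v - F u = (v - u) * F' z" by blast
    then show ?thesis by (intro exI[of _ z]) (auto simp: algebra_simps)
  next
    case 3
    have "\<exists>z. v < z \<and> z < u \<and> F u - F v = (u - v) * F' z"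
      by (rule MVT2) (use 3 assms in auto)
    then obtain z where "v < z" "z < u" "F u - F v = (u - v) * F' z" by blast
    then show ?thesis by (intro exI[of _ z]) (auto simp: algebra_simps)
  qed
qed

lemma has_pd_upd:
  assumes "has_pd i f (x(i := s)) d"
  shows "((\<lambda>t. f (x(i := t))) has_real_derivative d) (at s)"
  using assms by (simp add: has_pd_def)

text \<open>The coordinates of \<open>\<gamma> t0\<close> are replaced by those of
  \<open>\<gamma> t\<close> one at a time. Each replacement is a difference in one variable,
  evaluated by the mean value theorem, and continuity of the partial derivative moves the
  intermediate point to \<open>\<gamma> t0\<close> in the limit.\<close>

lemma DERIV_chain_coords:
  fixes f :: "('c \<Rightarrow> real) \<Rightarrow> real" and \<gamma> :: "real \<Rightarrow> 'c \<Rightarrow> real"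
  assumes I: "finite I" and S: "openin (powertop_real I) S" and f: "Ck_on (Suc 0) I S f"
    and \<gamma>: "\<And>t. \<gamma> t \<in> extensional I" "\<gamma> t0 \<in> S"
    and d\<gamma>: "\<And>a. a \<in> I \<Longrightarrow> ((\<lambda>t. \<gamma> t a) has_real_derivative \<gamma>' a) (at t0)"
  shows "((\<lambda>t. f (\<gamma> t)) has_real_derivative (\<Sum>a\<in>I. partial_deriv a f (\<gamma> t0) * \<gamma>' a)) (at t0)"
proof -
  note ext = openin_powertop_extensional[OF S]
  note fD = Ck_on_SucD[OF S f]
  define x where "x = \<gamma> t0"
  \<comment> \<open>The intermediate points: coordinates in \<open>A\<close> have already moved
    along the curve, the others are still those of \<open>x\<close>.\<close>
  define mix where "mix A t = (\<lambda>a. if a \<in> A then \<gamma> t a else x a)" for A t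
  obtain \<epsilon> where \<epsilon>: "\<epsilon> > 0"
    "\<And>y. y \<in> extensional I \<Longrightarrow> (\<And>i. i \<in> I \<Longrightarrow> \<bar>y i - x i\<bar> \<le> \<epsilon>) \<Longrightarrow> y \<in> S"
    using openin_powertop_box[OF S \<gamma>(2) I] x_def by blast
  have xext: "x \<in> extensional I" and xS: "x \<in> S" using \<gamma> x_def by auto
  have lim\<gamma>: "((\<lambda>t. \<gamma> t a) \<longlongrightarrow> x a) (at t0)" if "a \<in> I" for a
    using DERIV_isCont[OF d\<gamma>[OF that]] by (simp add: isCont_def x_def)
  have close: "\<forall>\<^sub>F t in at t0. \<forall>a\<in>I. \<bar>\<gamma> t a - x a\<bar> \<le> \<epsilon>"
  proof (rule eventually_ball_finite[OF I], rule ballI)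
    fix a assume "a \<in> I"
    from tendstoD[OF lim\<gamma>[OF this] \<epsilon>(1)]
    show "\<forall>\<^sub>F t in at t0. \<bar>\<gamma> t a - x a\<bar> \<le> \<epsilon>"
      by eventually_elim (simp add: dist_real_def)
  qed
  have "((\<lambda>t. f (mix A t)) has_real_derivative (\<Sum>a\<in>A. partial_deriv a f x * \<gamma>' a)) (at t0)"
    if "finite A" "A \<subseteq> I" for A
    using that
  proof (induction A rule: finite_induct)
    case empty
    show ?case by (simp add: mix_def)
  next
    case (insert a A)
    then have a: "a \<in> I" "a \<notin> A" by auto
    \<comment> \<open>The increment caused by moving coordinate \<open>a\<close> after those in
      \<open>A\<close>; its derivative at \<open>t0\<close> is the new summand.\<close>
    define D where "D t = f ((mix A t)(a := \<gamma> t a)) - f ((mix A t)(a := x a))" for t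
    have mixeq: "mix (insert a A) t = (mix A t)(a := \<gamma> t a)" "mix A t = (mix A t)(a := x a)" for t
      using a by (auto simp: mix_def)
    have feq: "f (mix (insert a A) t) = f (mix A t) + D t" for t
      unfolding D_def mixeq(1) using mixeq(2)[of t] by simp
    have mixt0: "mix A t0 = x" by (auto simp: mix_def x_def)
    have inS: "(mix A t)(a := s) \<in> S"
      if "\<forall>b\<in>I. \<bar>\<gamma> t b - x b\<bar> \<le> \<epsilon>" "\<bar>s - x a\<bar> \<le> \<bar>\<gamma> t a - x a\<bar>" for t s
    proof (rule \<epsilon>(2))
      show "(mix A t)(a := s) \<in> extensional I"
        using \<gamma>(1)[of t] xext a(1) by (auto simp: mix_def extensional_def)
      show "\<bar>((mix A t)(a := s)) i - x i\<bar> \<le> \<epsilon>" if "i \<in> I" for i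
        using that \<open>\<forall>b\<in>I. _\<close> \<open>\<bar>s - x a\<bar> \<le> _\<close> \<epsilon>(1) a(1) by (fastforce simp: mix_def)
    qed
    have "\<exists>\<xi>. (\<forall>b\<in>I. \<bar>\<gamma> t b - x b\<bar> \<le> \<epsilon>) \<longrightarrow> \<bar>\<xi> - x a\<bar> \<le> \<bar>\<gamma> t a - x a\<bar> \<and>
        D t = partial_deriv a f ((mix A t)(a := \<xi>)) * (\<gamma> t a - x a)" for t
    proof (cases "\<forall>b\<in>I. \<bar>\<gamma> t b - x b\<bar> \<le> \<epsilon>")
      case True
      have "\<exists>\<xi>. \<bar>\<xi> - x a\<bar> \<le> \<bar>\<gamma> t a - x a\<bar> \<and>
          D t = partial_deriv a f ((mix A t)(a := \<xi>)) * (\<gamma> t a - x a)"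
        unfolding D_def
        by (rule mvt_between, rule has_pd_upd, rule fD(2)[OF a(1)], rule inS[OF True])
      then show ?thesis by blast
    qed blast
    then obtain \<xi> where \<xi>: "\<And>t. \<forall>b\<in>I. \<bar>\<gamma> t b - x b\<bar> \<le> \<epsilon> \<Longrightarrow> \<bar>\<xi> t - x a\<bar> \<le> \<bar>\<gamma> t a - x a\<bar> \<and>
        D t = partial_deriv a f ((mix A t)(a := \<xi> t)) * (\<gamma> t a - x a)" by metis
    define pt where "pt t = (mix A t)(a := \<xi> t)" for t
    have lim\<xi>: "(\<xi> \<longlongrightarrow> x a) (at t0)"
    proof -
      have "((\<lambda>t. \<xi> t - x a) \<longlongrightarrow> 0) (at t0)"
      proof (rule Lim_null_comparison)
        show "\<forall>\<^sub>F t in at t0. norm (\<xi> t - x a) \<le> \<bar>\<gamma> t a - x a\<bar>"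
          using close by eventually_elim (use \<xi> in auto)
        show "((\<lambda>t. \<bar>\<gamma> t a - x a\<bar>) \<longlongrightarrow> 0) (at t0)"
          using tendsto_rabs[OF tendsto_diff[OF lim\<gamma>[OF a(1)] tendsto_const[of "x a"]]] by simp
      qed
      then show ?thesis by (simp add: LIM_zero_iff)
    qed
    have limpt: "(pt \<longlongrightarrow> x) (at t0)"
    proof (rule tendsto_fun_componentwise)
      fix i
      show "((\<lambda>t. pt t i) \<longlongrightarrow> x i) (at t0)"
        using lim\<xi> lim\<gamma> insert.prems by (cases "i = a"; cases "i \<in> A") (auto simp: pt_def mix_def)
    qed
    have lim\<eta>: "((\<lambda>t. partial_deriv a f (pt t)) \<longlongrightarrow> partial_deriv a f x) (at t0)"
    proof (rule continuous_on_tendsto_compose[OF _ limpt xS])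
      show "continuous_on S (partial_deriv a f)" using Ck_on_cont[OF ext fD(3)[OF a(1)]] .
      show "\<forall>\<^sub>F t in at t0. pt t \<in> S"
        using close unfolding pt_def by eventually_elim (use inS \<xi> in blast)
    qed
    have lim\<zeta>: "((\<lambda>t. (\<gamma> t a - x a) / (t - t0)) \<longlongrightarrow> \<gamma>' a) (at t0)"
      using d\<gamma>[OF a(1)] by (simp add: has_field_derivative_iff x_def)
    have D0: "D t0 = 0" using a mixt0 by (simp add: D_def x_def)
    have "(D has_real_derivative partial_deriv a f x * \<gamma>' a) (at t0)"
      unfolding has_field_derivative_iff
    proof (rule Lim_transform_eventually[OF tendsto_mult[OF lim\<eta> lim\<zeta>]])
      show "\<forall>\<^sub>F t in at t0. partial_deriv a f (pt t) * ((\<gamma> t a - x a) / (t - t0)) = (D t - D t0) / (t - t0)"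
        using close by eventually_elim (use \<xi> D0 in \<open>auto simp: pt_def\<close>)
    qed
    from DERIV_add[OF insert.IH this]
    show ?case using insert by (simp add: feq add.commute)
  qed
  from this[OF I order_refl]
  have "((\<lambda>t. f (mix I t)) has_real_derivative (\<Sum>a\<in>I. partial_deriv a f x * \<gamma>' a)) (at t0)" .
  moreover have "mix I t = \<gamma> t" for t
    using \<gamma>(1)[of t] xext by (auto simp: mix_def extensional_def)
  ultimately show ?thesis by (simp add: x_def)
qed

text \<open>The partial derivatives of the composite are sums of products of composites with
  \<open>partial_deriv a f\<close> and derivatives of \<open>h\<close>. Both are one class lower, so
  the induction hypothesis, which quantifies over \<open>f\<close>, applies.\<close>

lemma Ck_on_compose:
  assumes I: "finite I" "openin (powertop_real I) S" and I': "finite I'" "openin (powertop_real I') S'"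
    and h: "\<And>x. x \<in> S \<Longrightarrow> h x \<in> S'" "\<And>a. a \<in> I' \<Longrightarrow> Ck_on k I S (\<lambda>x. h x a)"
    and f: "Ck_on k I' S' f"
  shows "Ck_on k I S (\<lambda>x. f (h x))"
  using h(2) f
proof (induction k arbitrary: f)
  case 0
  note ext = openin_powertop_extensional[OF I(2)] and ext' = openin_powertop_extensional[OF I'(2)]
  have "continuous_on S h"
  proof (rule continuous_on_coordinatewise_then_product)
    fix a
    show "continuous_on S (\<lambda>x. h x a)"
    proof (cases "a \<in> I'")
      case True
      then show ?thesis using 0(1) ext by (auto simp: Ck_on_0)
    next
      case False
      then have "h x a = undefined" if "x \<in> S" for x
        using h(1)[OF that] ext' by (auto simp: extensional_def)
      then show ?thesis by (simp cong: continuous_on_cong)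
    qed
  qed
  moreover have "continuous_on S' f" using 0(2) ext' by (simp add: Ck_on_0)
  moreover have "h ` S \<subseteq> S'" using h(1) by blast
  ultimately have "continuous_on S (\<lambda>x. f (h x))"
    by (metis continuous_on_compose2)
  then show ?case using ext by (simp add: Ck_on_0)
next
  case (Suc k)
  note ext = openin_powertop_extensional[OF I(2)] and ext' = openin_powertop_extensional[OF I'(2)]
  note fD = Ck_on_SucD[OF I'(2) Suc.prems(2)]
  have hk: "Ck_on k I S (\<lambda>x. h x a)" if "a \<in> I'" for a
    using Ck_on_Suc_imp[OF I(2) Suc.prems(1)[OF that]] .
  have f1: "Ck_on (Suc 0) I' S' f"
    unfolding Ck_on_Suc[OF ext'] Ck_on_0[OF ext'] using fD(1,2) Ck_on_cont[OF ext' fD(3)] by blast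
  show ?case
  proof (rule Ck_on_SucI[OF I(2,1), of _ "\<lambda>i x. \<Sum>a\<in>I'. partial_deriv a f (h x) * partial_deriv i (\<lambda>x. h x a) x"])
    show "continuous_on S (\<lambda>x. f (h x))"
      by (rule Ck_on_cont[OF ext Suc.IH[OF hk Ck_on_Suc_imp[OF I'(2) Suc.prems(2)]]])
    fix i assume i: "i \<in> I"
    show "Ck_on k I S (\<lambda>x. \<Sum>a\<in>I'. partial_deriv a f (h x) * partial_deriv i (\<lambda>x. h x a) x)"
    proof (intro Ck_on_sum Ck_on_mult I I')
      fix a assume a: "a \<in> I'"
      show "Ck_on k I S (\<lambda>x. partial_deriv a f (h x))" by (rule Suc.IH[OF hk fD(3)[OF a]])
      show "Ck_on k I S (partial_deriv i (\<lambda>x. h x a))" by (rule Ck_on_SucD(3)[OF I(2) Suc.prems(1)[OF a] i])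
    qed
    fix x assume x: "x \<in> S"
    \<comment> \<open>For \<open>t\<close> far from \<open>x i\<close> the point
      \<open>h (x(i := t))\<close> need not be extensional, as the chain rule demands of the curve
      at all times; the restriction changes nothing while the line stays in
      \<open>S\<close>.\<close>
    define \<gamma> where "\<gamma> t = restrict (h (x(i := t))) I'" for t
    have eq: "h (x(i := t)) = \<gamma> t" if "x(i := t) \<in> S" for t
      using h(1)[OF that] ext' unfolding \<gamma>_def by (auto simp: extensional_restrict)
    have \<gamma>0: "\<gamma> (x i) = h x" using eq[of "x i"] x by simp
    have "((\<lambda>t. f (\<gamma> t)) has_real_derivative
        (\<Sum>a\<in>I'. partial_deriv a f (\<gamma> (x i)) * partial_deriv i (\<lambda>x. h x a) x)) (at (x i))"
    proof (rule DERIV_chain_coords[OF I' f1])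
      show "\<gamma> t \<in> extensional I'" for t by (simp add: \<gamma>_def)
      show "\<gamma> (x i) \<in> S'" using \<gamma>0 h(1)[OF x] by simp
      fix a assume a: "a \<in> I'"
      have "has_pd i (\<lambda>x. h x a) x (partial_deriv i (\<lambda>x. h x a) x)"
        by (rule Ck_on_SucD(2)[OF I(2) Suc.prems(1)[OF a] i x])
      then show "((\<lambda>t. \<gamma> t a) has_real_derivative partial_deriv i (\<lambda>x. h x a) x) (at (x i))"
        using a by (simp add: has_pd_def \<gamma>_def)
    qed
    moreover have "\<forall>\<^sub>F t in nhds (x i). f (\<gamma> t) = f (h (x(i := t)))"
      using eventually_line_in_open[OF I(2) x I(1) i] by eventually_elim (simp add: eq)
    ultimately show "has_pd i (\<lambda>x. f (h x)) x
        (\<Sum>a\<in>I'. partial_deriv a f (h x) * partial_deriv i (\<lambda>x. h x a) x)"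
      unfolding has_pd_def \<gamma>0 by (subst (asm) DERIV_cong_ev[OF refl _ refl])
  qed
qed

section \<open>Hadamard's lemma on a coordinate box\<close>

definition seg :: "'c set \<Rightarrow> ('c \<Rightarrow> real) \<Rightarrow> real \<Rightarrow> ('c \<Rightarrow> real) \<Rightarrow> 'c \<Rightarrow> real"
  where "seg I x0 t x = restrict (\<lambda>i. x0 i + t * (x i - x0 i)) I"

context
  fixes I :: "'c set" and S :: "('c \<Rightarrow> real) set" and x0 :: "'c \<Rightarrow> real" and r :: real
  assumes I: "finite I" and r: "r > 0" and x0: "x0 \<in> extensional I"
    and S: "S = {y \<in> extensional I. \<forall>i\<in>I. \<bar>y i - x0 i\<bar> < r}"
begin

lemma opS: "openin (powertop_real I) S"
  unfolding S by (rule openin_powertop_ball[OF I])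

lemma seg_in: "x \<in> S \<Longrightarrow> t \<in> {0..1} \<Longrightarrow> seg I x0 t x \<in> S"
proof -
  assume x: "x \<in> S" and t: "t \<in> {0..1}"
  have "\<bar>t * (x i - x0 i)\<bar> < r" if "i \<in> I" for i
  proof -
    have "\<bar>t * (x i - x0 i)\<bar> \<le> 1 * \<bar>x i - x0 i\<bar>"
      unfolding abs_mult using t by (intro mult_right_mono) auto
    then show ?thesis using x that S by auto
  qed
  then show ?thesis using S by (auto simp: seg_def)
qed

lemma continuous_on_seg:
  assumes "continuous_on S f"
  shows "continuous_on (S \<times> {0..1}) (\<lambda>(x, t). f (seg I x0 t x))"
proof -
  have "continuous_on (S \<times> {0..1}) (\<lambda>z. seg I x0 (snd z) (fst z) i)" for i
  proof (cases "i \<in> I")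
    case True
    have "continuous_on UNIV (\<lambda>x. x i :: real)"
      by (rule continuous_on_product_coordinates)
    then have "continuous_on (S \<times> {0..1}) (\<lambda>z. fst z i)"
      by (rule continuous_on_compose2) (auto intro: continuous_intros)
    then show ?thesis using True by (auto simp: seg_def intro!: continuous_intros)
  qed (simp add: seg_def)
  then have "continuous_on (S \<times> {0..1}) (\<lambda>z. seg I x0 (snd z) (fst z))"
    by (rule continuous_on_coordinatewise_then_product)
  from continuous_on_compose2[OF assms this] show ?thesis
    using seg_in by (simp add: split_beta image_subset_iff)
qed

text \<open>The weights \<open>t ^ n\<close> make the statement closed under differentiation in \<open>x\<close>.\<close>

lemma Ck_on_integral_seg:
  assumes "Ck_on k I S f"
  shows "Ck_on k I S (\<lambda>x. integral {0..1} (\<lambda>t. t ^ n * f (seg I x0 t x)))"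
  using assms
proof (induction k arbitrary: f n)
  case 0
  note ext = openin_powertop_extensional[OF opS]
  have "continuous_on S f" using 0 ext by (simp add: Ck_on_0)
  from continuous_on_seg[OF this]
  have "continuous_on (S \<times> cbox 0 1) (\<lambda>(x, t). t ^ n * f (seg I x0 t x))"
    by (auto simp: split_beta intro!: continuous_intros)
  from integral_continuous_on_param[OF this] show ?case using ext by (simp add: Ck_on_0)
next
  case (Suc k)
  note ext = openin_powertop_extensional[OF opS]
  note fD = Ck_on_SucD[OF opS Suc.prems]
  show ?case
  proof (rule Ck_on_SucI[OF opS I, of _ "\<lambda>i x. integral {0..1} (\<lambda>t. t ^ Suc n * partial_deriv i f (seg I x0 t x))"])
    show "continuous_on S (\<lambda>x. integral {0..1} (\<lambda>t. t ^ n * f (seg I x0 t x)))"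
      by (rule Ck_on_cont[OF ext Suc.IH[OF Ck_on_Suc_imp[OF opS Suc.prems]]])
    fix i assume i: "i \<in> I"
    show "Ck_on k I S (\<lambda>x. integral {0..1} (\<lambda>t. t ^ Suc n * partial_deriv i f (seg I x0 t x)))"
      by (rule Suc.IH[OF fD(3)[OF i]])
    fix x assume x: "x \<in> S"
    \<comment> \<open>The values of the \<open>i\<close>-th coordinate that keep the point in the
      box, as an open interval: the parameter domain for differentiation under the integral.\<close>
    let ?U = "{x0 i - r<..<x0 i + r}"
    have xU: "x i \<in> ?U" using x i S by (auto simp: abs_diff_less_iff)
    have inS: "x(i := s) \<in> S" if "s \<in> ?U" for s
      using that x i S by (auto simp: extensional_def abs_diff_less_iff)
    \<comment> \<open>Moving \<open>x i\<close> by some amount moves the point of the segment by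
      \<open>t\<close> times that amount. This is the origin of the additional factor
      \<open>t\<close> in the weight.\<close>
    have segupd: "seg I x0 t (x(i := s)) = (seg I x0 t x)(i := x0 i + t * (s - x0 i))" for s t
      using i by (auto simp: seg_def)
    have lineU: "continuous_on ?U (\<lambda>s. x(i := s))"
    proof (rule continuous_on_coordinatewise_then_product)
      show "continuous_on ?U (\<lambda>s. (x(i := s)) j)" for j
        by (cases "j = i") (auto intro!: continuous_intros)
    qed
    have cf: "continuous_on (?U \<times> cbox 0 1) (\<lambda>(s, t). t ^ m * h (seg I x0 t (x(i := s))))"
      if h: "continuous_on S h" for h m
    proof -
      have "continuous_on (?U \<times> {0..1::real}) (\<lambda>z. (x(i := fst z), snd z))"
        by (intro continuous_on_Pair continuous_on_compose2[OF lineU] continuous_intros) auto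
      from continuous_on_compose2[OF continuous_on_seg[OF h] this]
      have "continuous_on (?U \<times> {0..1}) (\<lambda>z. h (seg I x0 (snd z) (x(i := fst z))))"
        using inS by (simp add: split_beta image_subset_iff)
      then show ?thesis by (auto simp: split_beta intro!: continuous_intros)
    qed
    have "((\<lambda>s. integral (cbox 0 1) (\<lambda>t. t ^ n * f (seg I x0 t (x(i := s))))) has_field_derivative
        integral (cbox 0 1) (\<lambda>t. t ^ Suc n * partial_deriv i f (seg I x0 t (x(i := x i))))) (at (x i) within ?U)"
    proof (rule leibniz_rule_field_derivative)
      fix s t :: real assume s: "s \<in> ?U" and t: "t \<in> cbox 0 1"
      have "has_pd i f (seg I x0 t (x(i := s))) (partial_deriv i f (seg I x0 t (x(i := s))))"
        by (intro fD(2) i seg_in inS s) (use t in auto)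
      then have *: "((\<lambda>u. f ((seg I x0 t x)(i := u))) has_real_derivative
          partial_deriv i f (seg I x0 t (x(i := s)))) (at (x0 i + t * (s - x0 i)))"
        unfolding segupd by (rule has_pd_upd)
      have "((\<lambda>s. x0 i + t * (s - x0 i)) has_real_derivative t) (at s)"
        by (auto intro!: derivative_eq_intros)
      from DERIV_chain2[OF * this]
      have "((\<lambda>s. f (seg I x0 t (x(i := s)))) has_real_derivative
          partial_deriv i f (seg I x0 t (x(i := s))) * t) (at s)"
        unfolding segupd .
      from DERIV_cmult[OF this, of "t ^ n"]
      have "((\<lambda>s. t ^ n * f (seg I x0 t (x(i := s)))) has_real_derivative
          t ^ Suc n * partial_deriv i f (seg I x0 t (x(i := s)))) (at s)"
        by (simp add: mult_ac)
      then show "((\<lambda>s. t ^ n * f (seg I x0 t (x(i := s)))) has_field_derivative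
          t ^ Suc n * partial_deriv i f (seg I x0 t (x(i := s)))) (at s within ?U)"
        by (rule has_field_derivative_at_within)
    next
      fix s :: real assume s: "s \<in> ?U"
      have "continuous_on (cbox 0 1) (\<lambda>t. (s, t))" by (intro continuous_intros)
      from continuous_on_compose2[OF cf[OF fD(1)] this]
      have "continuous_on (cbox 0 1) (\<lambda>t. t ^ n * f (seg I x0 t (x(i := s))))"
        using s by (auto simp: image_subset_iff)
      then show "(\<lambda>t. t ^ n * f (seg I x0 t (x(i := s)))) integrable_on cbox 0 1"
        by (rule integrable_continuous)
    next
      show "continuous_on (?U \<times> cbox 0 1) (\<lambda>(s, t). t ^ Suc n * partial_deriv i f (seg I x0 t (x(i := s))))"
        by (rule cf[OF Ck_on_cont[OF ext fD(3)[OF i]]])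
    qed (use xU in auto)
    then show "has_pd i (\<lambda>x. integral {0..1} (\<lambda>t. t ^ n * f (seg I x0 t x))) x
        (integral {0..1} (\<lambda>t. t ^ Suc n * partial_deriv i f (seg I x0 t x)))"
      unfolding has_pd_def using xU by (simp add: at_within_open[OF xU])
  qed
qed

text \<open>The fundamental theorem of calculus along the segment from \<open>x0\<close> to
  \<open>x\<close>, with \<open>G a\<close> the mean of the partial derivative over the segment. A
  derivation at \<open>x0\<close> applied to this expansion sees only the values
  \<open>G a x0\<close>, which ties derivations to partial derivatives.\<close>

lemma hadamard:
  assumes f: "smooth_on I S f"
  obtains G where "\<And>a. a \<in> I \<Longrightarrow> smooth_on I S (G a)"
    "\<And>a. a \<in> I \<Longrightarrow> G a x0 = partial_deriv a f x0"
    "\<And>x. x \<in> S \<Longrightarrow> f x = f x0 + (\<Sum>a\<in>I. (x a - x0 a) * G a x)"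
proof
  note ext = openin_powertop_extensional[OF opS]
  have fk: "Ck_on k I S f" for k using f by (simp add: smooth_on_def)
  note fD = Ck_on_SucD[OF opS fk]
  define G where "G a x = integral {0..1} (\<lambda>t. partial_deriv a f (seg I x0 t x))" for a x
  show "smooth_on I S (G a)" if "a \<in> I" for a
    unfolding smooth_on_def
  proof
    fix k
    have "Ck_on k I S (\<lambda>x. integral {0..1} (\<lambda>t. t ^ 0 * partial_deriv a f (seg I x0 t x)))"
      by (rule Ck_on_integral_seg[OF fD(3)[OF that]])
    moreover have "(\<lambda>x. integral {0..1} (\<lambda>t. t ^ 0 * partial_deriv a f (seg I x0 t x))) = G a"
      by (simp add: G_def fun_eq_iff)
    ultimately show "Ck_on k I S (G a)" by simp
  qed
  have seg0: "seg I x0 0 x = x0" and seg1: "x \<in> S \<Longrightarrow> seg I x0 1 x = x" for x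
    using x0 ext by (auto simp: seg_def fun_eq_iff extensional_def)
  have x0S: "x0 \<in> S" using S x0 r by auto
  have "seg I x0 t x0 = x0" for t
    using x0 by (auto simp: seg_def fun_eq_iff extensional_def)
  then show "G a x0 = partial_deriv a f x0" for a by (simp add: G_def)
  show "f x = f x0 + (\<Sum>a\<in>I. (x a - x0 a) * G a x)" if x: "x \<in> S" for x
  proof -
    have sc: "continuous_on {0..1} (\<lambda>t. h (seg I x0 t x))" if h: "continuous_on S h" for h
    proof -
      have "continuous_on {0..1::real} (\<lambda>t. (x, t))" by (intro continuous_intros)
      from continuous_on_compose2[OF continuous_on_seg[OF h] this]
      show ?thesis using x by (auto simp: image_subset_iff)
    qed
    have d: "((\<lambda>t. f (seg I x0 t x)) has_vector_derivative
        (\<Sum>a\<in>I. partial_deriv a f (seg I x0 t x) * (x a - x0 a))) (at t within {0..1})" if t: "t \<in> {0..1}" for t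
    proof -
      have "((\<lambda>t. f (seg I x0 t x)) has_real_derivative
        (\<Sum>a\<in>I. partial_deriv a f (seg I x0 t x) * (x a - x0 a))) (at t)"
      proof (rule DERIV_chain_coords[OF I opS fk])
        show "seg I x0 t x \<in> extensional I" for t by (simp add: seg_def)
        show "seg I x0 t x \<in> S" by (rule seg_in[OF x t])
        show "((\<lambda>t. seg I x0 t x a) has_real_derivative x a - x0 a) (at t)" if "a \<in> I" for a
          using that by (auto simp: seg_def intro!: derivative_eq_intros)
      qed
      then show ?thesis
        unfolding has_real_derivative_iff_has_vector_derivative by (rule has_vector_derivative_at_within)
    qed
    have "((\<lambda>t. \<Sum>a\<in>I. partial_deriv a f (seg I x0 t x) * (x a - x0 a)) has_integral
        f (seg I x0 1 x) - f (seg I x0 0 x)) {0..1}"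
      by (rule fundamental_theorem_of_calculus) (use d in auto)
    moreover have "((\<lambda>t. \<Sum>a\<in>I. partial_deriv a f (seg I x0 t x) * (x a - x0 a)) has_integral
        (\<Sum>a\<in>I. G a x * (x a - x0 a))) {0..1}"
    proof (rule has_integral_sum[OF I])
      fix a assume "a \<in> I"
      then have "(\<lambda>t. partial_deriv a f (seg I x0 t x)) integrable_on {0..1}"
        using sc[OF Ck_on_cont[OF ext fD(3)]] integrable_continuous_interval by blast
      then have "((\<lambda>t. partial_deriv a f (seg I x0 t x)) has_integral G a x) {0..1}"
        unfolding G_def by (rule integrable_integral)
      then show "((\<lambda>t. partial_deriv a f (seg I x0 t x) * (x a - x0 a)) has_integral
          G a x * (x a - x0 a)) {0..1}"
        by (rule has_integral_mult_left)
    qed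
    ultimately have "f (seg I x0 1 x) - f (seg I x0 0 x) = (\<Sum>a\<in>I. G a x * (x a - x0 a))"
      by (rule has_integral_unique)
    then show ?thesis using seg0 seg1[OF x] by (simp add: mult.commute)
  qed
qed

end

section \<open>A function on the line that is flat at zero\<close>

definition bump_fun :: "nat \<Rightarrow> real \<Rightarrow> real"
  where "bump_fun n t = (if t > 0 then (1 / t) ^ n * exp (- (1 / t)) else 0)"

text \<open>The powers of \<open>1 / t\<close> make the family closed under differentiation; the
  function of interest is \<open>n = 0\<close>. At \<open>t = 0\<close> the right difference
  quotient is \<open>u ^ Suc n / exp u\<close> with \<open>u = 1 / t\<close>, which tends to zero
  because the exponential dominates.\<close>

lemma DERIV_bump_fun:
  "(bump_fun n has_real_derivative (bump_fun (n + 2) t - real n * bump_fun (n + 1) t)) (at t)"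
proof -
  consider "t < 0" | "t = 0" | "t > 0" by linarith
  then show ?thesis
  proof cases
    case 1
    have "((\<lambda>t. 0) has_real_derivative 0) (at t)" by simp
    then have "(bump_fun n has_real_derivative 0) (at t)"
      by (rule has_field_derivative_transform_within_open[where S="{..<0}"])
         (use 1 in \<open>auto simp: bump_fun_def\<close>)
    then show ?thesis using 1 by (simp add: bump_fun_def)
  next
    case 2
    have e: "((\<lambda>u::real. u ^ Suc n / exp u) \<longlongrightarrow> 0) at_top" by (rule tendsto_power_div_exp_0)
    have l: "((\<lambda>h. bump_fun n h / h) \<longlongrightarrow> 0) (at_left 0)"
      by (rule tendsto_eventually, rule eventually_at_leftI[of "-1"]) (auto simp: bump_fun_def)
    have "((\<lambda>h. (inverse h) ^ Suc n / exp (inverse h)) \<longlongrightarrow> 0) (at_right (0::real))"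
      by (rule filterlim_compose[OF e filterlim_inverse_at_top_right])
    then have rt: "((\<lambda>h. bump_fun n h / h) \<longlongrightarrow> 0) (at_right 0)"
      by (rule Lim_transform_eventually, intro eventually_at_rightI[of _ 1])
         (auto simp: bump_fun_def exp_minus field_simps)
    from l rt have "((\<lambda>h. bump_fun n h / h) \<longlongrightarrow> 0) (at 0)" by (simp add: filterlim_split_at)
    then show ?thesis using 2 by (simp add: has_field_derivative_iff bump_fun_def)
  next
    case 3
    have d1: "((\<lambda>t. 1 / t) has_real_derivative - ((1 / t) * (1 / t))) (at t)"
      using 3 by (auto intro!: derivative_eq_intros simp: field_simps)
    have "((\<lambda>t. (1 / t) ^ n * exp (- (1 / t))) has_real_derivative
        (bump_fun (n + 2) t - real n * bump_fun (n + 1) t)) (at t)"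
      using 3
      by (auto intro!: derivative_eq_intros d1 simp: bump_fun_def)
         (cases n; simp add: field_simps)
    then show ?thesis
      by (rule has_field_derivative_transform_within_open[where S="{0<..}"])
         (use 3 in \<open>auto simp: bump_fun_def\<close>)
  qed
qed

lemma Ck_on_bump_fun:
  assumes I: "finite I" and S: "openin (powertop_real I) S" and h: "Ck_on k I S h"
  shows "Ck_on k I S (\<lambda>x. bump_fun n (h x))"
  using h
proof (induction k arbitrary: n)
  case 0
  have "continuous_on UNIV (bump_fun n)"
    using DERIV_bump_fun DERIV_isCont by (metis continuous_at_imp_continuous_on)
  then show ?case using 0 openin_powertop_extensional[OF S]
    by (auto simp: Ck_on_0 intro: continuous_on_compose2)
next
  case (Suc k)
  note ext = openin_powertop_extensional[OF S]
  note hD = Ck_on_SucD[OF S Suc.prems] and hk = Ck_on_Suc_imp[OF S Suc.prems]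
  show ?case
  proof (rule Ck_on_SucI[OF S I, of _ "\<lambda>i x. (bump_fun (n + 2) (h x) + (- real n) * bump_fun (n + 1) (h x)) * partial_deriv i h x"])
    show "continuous_on S (\<lambda>x. bump_fun n (h x))" by (rule Ck_on_cont[OF ext Suc.IH[OF hk]])
    fix i assume i: "i \<in> I"
    show "Ck_on k I S (\<lambda>x. (bump_fun (n + 2) (h x) + (- real n) * bump_fun (n + 1) (h x)) * partial_deriv i h x)"
      by (intro Ck_on_mult Ck_on_add Ck_on_const I S hD(3) i Suc.IH hk)
    fix x assume "x \<in> S"
    from hD(2)[OF i this, unfolded has_pd_def]
    have "((\<lambda>t. bump_fun n (h (x(i := t)))) has_real_derivative
        (bump_fun (n + 2) (h (x(i := x i))) - real n * bump_fun (n + 1) (h (x(i := x i)))) * partial_deriv i h x) (at (x i))"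
      by (rule DERIV_chain2[OF DERIV_bump_fun])
    then show "has_pd i (\<lambda>x. bump_fun n (h x)) x
        ((bump_fun (n + 2) (h x) + (- real n) * bump_fun (n + 1) (h x)) * partial_deriv i h x)"
      by (simp add: has_pd_def)
  qed
qed

section \<open>Smooth functions on open sets of coordinates\<close>

lemma smooth_on_cong:
  assumes "openin (powertop_real I) S" "finite I" "smooth_on I S f" "\<And>x. x \<in> S \<Longrightarrow> f x = h x"
  shows "smooth_on I S h"
  using Ck_on_cong[where f=f and h=h, OF assms(1,2)] assms(3,4) by (auto simp: smooth_on_def)

lemma smooth_on_subset:
  assumes "openin (powertop_real I) S" "smooth_on I S f" "S' \<subseteq> S"
  shows "smooth_on I S' f"
  using Ck_on_subset[OF assms(3) openin_powertop_extensional[OF assms(1)]] assms(2) by (auto simp: smooth_on_def)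

lemma smooth_on_local:
  assumes "openin (powertop_real I) S"
    "\<And>x. x \<in> S \<Longrightarrow> \<exists>S'. openin (powertop_real I) S' \<and> x \<in> S' \<and> smooth_on I S' f"
  shows "smooth_on I S f"
  unfolding smooth_on_def
proof
  fix k show "Ck_on k I S f"
    by (rule Ck_on_local[OF assms(1)]) (use assms(2) in \<open>auto simp: smooth_on_def\<close>)
qed

lemma smooth_on_compose:
  assumes "finite I" "openin (powertop_real I) S" "finite I'" "openin (powertop_real I') S'"
    "\<And>x. x \<in> S \<Longrightarrow> h x \<in> S'" "\<And>a. a \<in> I' \<Longrightarrow> smooth_on I S (\<lambda>x. h x a)" "smooth_on I' S' f"
  shows "smooth_on I S (\<lambda>x. f (h x))"
  unfolding smooth_on_def
proof
  fix k show "Ck_on k I S (\<lambda>x. f (h x))"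
    by (rule Ck_on_compose[OF assms(1-5)]) (use assms(6,7) in \<open>auto simp: smooth_on_def\<close>)
qed

lemma smooth_on_continuous:
  "openin (powertop_real I) S \<Longrightarrow> smooth_on I S f \<Longrightarrow> continuous_on S f"
  by (metis Ck_on_cont openin_powertop_extensional smooth_on_def)

lemma smooth_on_has_pd:
  assumes "openin (powertop_real I) S" "smooth_on I S f" "i \<in> I" "x \<in> S"
  shows "has_pd i f x (partial_deriv i f x)"
  using Ck_on_SucD(2)[OF assms(1), of 0 f i x] assms by (auto simp: smooth_on_def)

lemma smooth_on_partial_deriv:
  assumes "openin (powertop_real I) S" "smooth_on I S f" "i \<in> I"
  shows "smooth_on I S (partial_deriv i f)"
  using Ck_on_SucD(3)[OF assms(1)] assms by (auto simp: smooth_on_def)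

context
  fixes I :: "'c set" and S :: "('c \<Rightarrow> real) set"
  assumes I: "finite I" and S: "openin (powertop_real I) S"
begin

lemma smooth_on_const: "smooth_on I S (\<lambda>x. c)"
  by (simp add: smooth_on_def Ck_on_const[OF I S])

lemma smooth_on_coord: "i \<in> I \<Longrightarrow> smooth_on I S (\<lambda>x. x i)"
  by (simp add: smooth_on_def Ck_on_coord[OF I S])

lemma smooth_on_add: "smooth_on I S f \<Longrightarrow> smooth_on I S h \<Longrightarrow> smooth_on I S (\<lambda>x. f x + h x)"
  by (simp add: smooth_on_def Ck_on_add[OF I S])

lemma smooth_on_mult: "smooth_on I S f \<Longrightarrow> smooth_on I S h \<Longrightarrow> smooth_on I S (\<lambda>x. f x * h x)"
  by (simp add: smooth_on_def Ck_on_mult[OF I S])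

lemma smooth_on_sum:
  "finite A \<Longrightarrow> (\<And>a. a \<in> A \<Longrightarrow> smooth_on I S (f a)) \<Longrightarrow> smooth_on I S (\<lambda>x. \<Sum>a\<in>A. f a x)"
  by (simp add: smooth_on_def Ck_on_sum[OF I S])

lemma smooth_on_inverse:
  "(\<And>x. x \<in> S \<Longrightarrow> f x \<noteq> 0) \<Longrightarrow> smooth_on I S f \<Longrightarrow> smooth_on I S (\<lambda>x. inverse (f x))"
  by (simp add: smooth_on_def Ck_on_inverse[OF I S])

lemma smooth_on_bump_fun: "smooth_on I S f \<Longrightarrow> smooth_on I S (\<lambda>x. bump_fun n (f x))"
  by (simp add: smooth_on_def Ck_on_bump_fun[OF I S])

end

section \<open>Smooth functions and tangent vectors\<close>

locale mfd =
  fixes M :: "('a, 'c) manifold"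
  assumes haus: "Hausdorff_space (Top M)" and finC: "finite (Coord M)"
    and cover: "(\<Union>(U, \<phi>)\<in>Atlas M. U) = Carrier M"
    and chart: "\<And>U \<phi>. (U, \<phi>) \<in> Atlas M \<Longrightarrow> openin (Top M) U"
      "\<And>U \<phi>. (U, \<phi>) \<in> Atlas M \<Longrightarrow> openin (powertop_real (Coord M)) (\<phi> ` U)"
      "\<And>U \<phi>. (U, \<phi>) \<in> Atlas M \<Longrightarrow>
        homeomorphic_map (subtopology (Top M) U) (subtopology (powertop_real (Coord M)) (\<phi> ` U)) \<phi>"
    and trans: "\<And>U \<phi> V \<psi> i. (U, \<phi>) \<in> Atlas M \<Longrightarrow> (V, \<psi>) \<in> Atlas M \<Longrightarrow> i \<in> Coord M \<Longrightarrow>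
        smooth_on (Coord M) (\<phi> ` (U \<inter> V)) (\<lambda>x. \<psi> (inv_into U \<phi> x) i)"

lemma smooth_manifold_imp_mfd: "smooth_manifold M \<Longrightarrow> mfd M"
proof -
  assume "smooth_manifold M"
  note A = this[unfolded smooth_manifold_def]
  note A1 = A[THEN conjunct2, THEN conjunct2, THEN conjunct2, THEN conjunct2, THEN conjunct1, THEN bspec]
  note A2 = A[THEN conjunct2, THEN conjunct2, THEN conjunct2, THEN conjunct2, THEN conjunct2, THEN bspec]
  show "mfd M"
  proof
    fix U \<phi> assume U: "(U, \<phi>) \<in> Atlas M"
    show "openin (Top M) U" "openin (powertop_real (Coord M)) (\<phi> ` U)"
      "homeomorphic_map (subtopology (Top M) U) (subtopology (powertop_real (Coord M)) (\<phi> ` U)) \<phi>"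
      using A1[OF U] by simp_all
    fix V \<psi> i assume "(V, \<psi>) \<in> Atlas M" "i \<in> Coord M"
    then show "smooth_on (Coord M) (\<phi> ` (U \<inter> V)) (\<lambda>x. \<psi> (inv_into U \<phi> x) i)"
      using A2[OF U] by fastforce
  qed (use A in simp_all)
qed

context mfd
begin

abbreviation "C \<equiv> Coord M"

lemma chart_exists:
  assumes "r \<in> Carrier M" obtains U \<phi> where "(U, \<phi>) \<in> Atlas M" "r \<in> U"
  using assms cover by blast

section \<open>Charts as homeomorphisms onto open sets of coordinates\<close>

context
  fixes U \<phi> assumes c: "(U, \<phi>) \<in> Atlas M"
begin

lemma U_sub: "U \<subseteq> Carrier M"
  using chart(1)[OF c] openin_subset by blast

lemma chart_inj: "inj_on \<phi> U"
proof -
  have "inj_on \<phi> (topspace (subtopology (Top M) U))"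
    by (rule homeomorphic_imp_injective_map[OF chart(3)[OF c]])
  then show ?thesis using U_sub by (simp add: inf.absorb2)
qed

lemma inv_chart[simp]: "y \<in> U \<Longrightarrow> inv_into U \<phi> (\<phi> y) = y"
  by (rule inv_into_f_f[OF chart_inj])

lemma chart_ext: "\<phi> ` U \<subseteq> extensional C"
  by (rule openin_powertop_extensional[OF chart(2)[OF c]])

lemma chart_open_image:
  assumes "openin (Top M) W" "W \<subseteq> U"
  shows "openin (powertop_real C) (\<phi> ` W)"
proof -
  have "openin (subtopology (Top M) U) W" using assms by (simp add: openin_open_subtopology chart(1)[OF c])
  then have "openin (subtopology (powertop_real C) (\<phi> ` U)) (\<phi> ` W)"
    using homeomorphic_imp_open_map[OF chart(3)[OF c]] by (simp add: open_map_def)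
  then show ?thesis using openin_trans_full chart(2)[OF c] by blast
qed

lemma chart_continuous: "continuous_map (subtopology (Top M) U) (powertop_real C) \<phi>"
  using homeomorphic_imp_continuous_map[OF chart(3)[OF c]] by (simp add: continuous_map_in_subtopology)

lemma chart_open_preimage:
  assumes "openin (powertop_real C) S"
  shows "openin (Top M) {y \<in> U. \<phi> y \<in> S}"
proof -
  have "openin (subtopology (Top M) U) {y \<in> topspace (subtopology (Top M) U). \<phi> y \<in> S}"
    using chart_continuous assms by (simp add: continuous_map_def)
  moreover have "{y \<in> topspace (subtopology (Top M) U). \<phi> y \<in> S} = {y \<in> U. \<phi> y \<in> S}"
    using U_sub by auto
  ultimately show ?thesis using openin_trans_full[OF _ chart(1)[OF c]] by simp
qed

lemma inv_continuous: "continuous_map (subtopology (powertop_real C) (\<phi> ` U)) (Top M) (inv_into U \<phi>)"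
proof -
  obtain g where g: "homeomorphic_maps (subtopology (Top M) U) (subtopology (powertop_real C) (\<phi> ` U)) \<phi> g"
    using chart(3)[OF c] by (auto simp: homeomorphic_map_maps)
  then have g1: "continuous_map (subtopology (powertop_real C) (\<phi> ` U)) (Top M) g"
    and g2: "\<And>y. y \<in> U \<Longrightarrow> g (\<phi> y) = y"
    using U_sub by (auto simp: homeomorphic_maps_def continuous_map_in_subtopology)
  show ?thesis by (rule continuous_map_eq[OF g1]) (use g2 in auto)
qed

end

lemma C_infD: "f \<in> C_inf M \<Longrightarrow> (U, \<phi>) \<in> Atlas M \<Longrightarrow> smooth_on C (\<phi> ` U) (f \<circ> inv_into U \<phi>)"
  by (auto simp: C_inf_def)

text \<open>One chart around each point is enough: in any other chart the function is locally the
  same expression composed with a transition map, which is smooth by \<open>trans\<close>.\<close>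

lemma C_infI_chart:
  assumes "\<And>r. r \<in> Carrier M \<Longrightarrow> \<exists>U \<phi> W. (U, \<phi>) \<in> Atlas M \<and> openin (Top M) W \<and> r \<in> W \<and> W \<subseteq> U \<and>
     smooth_on C (\<phi> ` W) (f \<circ> inv_into U \<phi>)"
  shows "f \<in> C_inf M"
  unfolding C_inf_def
proof (intro CollectI ballI, clarify)
  fix V \<psi> assume V: "(V, \<psi>) \<in> Atlas M"
  show "smooth_on C (\<psi> ` V) (f \<circ> inv_into V \<psi>)"
  proof (rule smooth_on_local[OF chart(2)[OF V]])
    fix x assume "x \<in> \<psi> ` V"
    then obtain r where r: "r \<in> V" "x = \<psi> r" by blast
    with assms U_sub[OF V] obtain U \<phi> W where U: "(U, \<phi>) \<in> Atlas M"
      and W: "openin (Top M) W" "r \<in> W" "W \<subseteq> U" "smooth_on C (\<phi> ` W) (f \<circ> inv_into U \<phi>)"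
      by blast
    let ?S = "\<psi> ` (V \<inter> W)"
    have S: "openin (powertop_real C) ?S"
      by (rule chart_open_image[OF V]) (use W chart(1)[OF V] in auto)
    have S2: "openin (powertop_real C) (\<psi> ` (V \<inter> U))"
      by (rule chart_open_image[OF V]) (use chart(1)[OF V] chart(1)[OF U] in auto)
    have "smooth_on C ?S (\<lambda>x. (f \<circ> inv_into U \<phi>) (\<phi> (inv_into V \<psi> x)))"
    proof (rule smooth_on_compose[OF finC S finC chart_open_image[OF U W(1,3)] _ _ W(4)])
      show "\<phi> (inv_into V \<psi> x) \<in> \<phi> ` W" if "x \<in> ?S" for x
        using that inv_chart[OF V] by auto
      show "smooth_on C ?S (\<lambda>x. \<phi> (inv_into V \<psi> x) a)" if "a \<in> C" for a
        by (rule smooth_on_subset[OF S2 trans[OF V U that]]) (use W(3) in auto)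
    qed
    then have "smooth_on C ?S (f \<circ> inv_into V \<psi>)"
      by (rule smooth_on_cong[OF S finC]) (use W(3) inv_chart[OF V] inv_chart[OF U] in auto)
    then show "\<exists>S'. openin (powertop_real C) S' \<and> x \<in> S' \<and> smooth_on C S' (f \<circ> inv_into V \<psi>)"
      using S r W(2) by blast
  qed
qed

lemma C_infI_local:
  assumes "\<And>r. r \<in> Carrier M \<Longrightarrow> \<exists>W h. openin (Top M) W \<and> r \<in> W \<and> h \<in> C_inf M \<and> (\<forall>y\<in>W. f y = h y)"
  shows "f \<in> C_inf M"
proof (rule C_infI_chart)
  fix r assume r: "r \<in> Carrier M"
  then obtain W h where W: "openin (Top M) W" "r \<in> W" "h \<in> C_inf M" "\<forall>y\<in>W. f y = h y"
    using assms by blast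
  obtain U \<phi> where U: "(U, \<phi>) \<in> Atlas M" "r \<in> U" using chart_exists[OF r] .
  have o: "openin (Top M) (U \<inter> W)" using W chart(1)[OF U(1)] by auto
  have "smooth_on C (\<phi> ` (U \<inter> W)) (h \<circ> inv_into U \<phi>)"
    by (rule smooth_on_subset[OF chart(2)[OF U(1)] C_infD[OF W(3) U(1)]]) auto
  then have "smooth_on C (\<phi> ` (U \<inter> W)) (f \<circ> inv_into U \<phi>)"
    by (rule smooth_on_cong[OF chart_open_image[OF U(1) o Int_lower1] finC])
      (use W(4) inv_chart[OF U(1)] in auto)
  then show "\<exists>U \<phi> W. (U, \<phi>) \<in> Atlas M \<and> openin (Top M) W \<and> r \<in> W \<and> W \<subseteq> U \<and>
     smooth_on C (\<phi> ` W) (f \<circ> inv_into U \<phi>)"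
    using U o W(2) by blast
qed

lemma C_inf_cong: "f \<in> C_inf M \<Longrightarrow> (\<And>y. y \<in> Carrier M \<Longrightarrow> h y = f y) \<Longrightarrow> h \<in> C_inf M"
  by (rule C_infI_local) blast

lemma C_inf_const [simp]: "(\<lambda>x. c) \<in> C_inf M"
  unfolding C_inf_def by (auto simp: o_def intro!: smooth_on_const finC chart)

lemma C_inf_add [simp]: "f \<in> C_inf M \<Longrightarrow> h \<in> C_inf M \<Longrightarrow> (\<lambda>x. f x + h x) \<in> C_inf M"
  unfolding C_inf_def by (fastforce simp: o_def intro!: smooth_on_add finC chart)

lemma C_inf_mult [simp]: "f \<in> C_inf M \<Longrightarrow> h \<in> C_inf M \<Longrightarrow> (\<lambda>x. f x * h x) \<in> C_inf M"
  unfolding C_inf_def by (fastforce simp: o_def intro!: smooth_on_mult finC chart)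

lemma C_inf_minus [simp]: "f \<in> C_inf M \<Longrightarrow> (\<lambda>x. - f x) \<in> C_inf M"
  using C_inf_mult[of "\<lambda>x. - 1" f] by simp

lemma C_inf_diff [simp]: "f \<in> C_inf M \<Longrightarrow> h \<in> C_inf M \<Longrightarrow> (\<lambda>x. f x - h x) \<in> C_inf M"
  using C_inf_add[OF _ C_inf_minus, of f h] by simp

lemma C_inf_sum [simp]: "(\<And>a. a \<in> A \<Longrightarrow> f a \<in> C_inf M) \<Longrightarrow> (\<lambda>x. \<Sum>a\<in>A. f a x) \<in> C_inf M"
  by (induction A rule: infinite_finite_induct) auto

lemma C_inf_power2 [simp]: "f \<in> C_inf M \<Longrightarrow> (\<lambda>x. (f x)\<^sup>2) \<in> C_inf M"
  by (simp add: power2_eq_square)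

text \<open>Continuity is phrased with \<open>nhdsin\<close>, so that limit arguments in the
  abstract topology of the manifold can use the filter calculus.\<close>

lemma C_inf_tendsto:
  assumes f: "f \<in> C_inf M" and r: "r \<in> Carrier M"
  shows "(f \<longlongrightarrow> f r) (nhdsin (Top M) r)"
proof (rule topological_tendstoI)
  fix T :: "real set" assume T: "open T" "f r \<in> T"
  obtain U \<phi> where U: "(U, \<phi>) \<in> Atlas M" "r \<in> U" using chart_exists[OF r] .
  have "continuous_on (\<phi> ` U) (f \<circ> inv_into U \<phi>)"
    by (rule smooth_on_continuous[OF chart(2)[OF U(1)] C_infD[OF f U(1)]])
  then have cm: "continuous_map (subtopology (powertop_real C) (\<phi> ` U)) euclideanreal (f \<circ> inv_into U \<phi>)"
    by (simp add: continuous_map_powertop_iff[OF chart_ext[OF U(1)]])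
  have "continuous_map (subtopology (Top M) U) euclideanreal ((f \<circ> inv_into U \<phi>) \<circ> \<phi>)"
    by (rule continuous_map_compose[OF homeomorphic_imp_continuous_map[OF chart(3)[OF U(1)]] cm])
  then have "openin (subtopology (Top M) U) {y \<in> topspace (subtopology (Top M) U). ((f \<circ> inv_into U \<phi>) \<circ> \<phi>) y \<in> T}"
    using T(1) by (simp add: continuous_map_def)
  moreover have "{y \<in> topspace (subtopology (Top M) U). ((f \<circ> inv_into U \<phi>) \<circ> \<phi>) y \<in> T} = {y \<in> U. f y \<in> T}"
    using U_sub[OF U(1)] inv_chart[OF U(1)] by auto
  ultimately have "openin (Top M) {y \<in> U. f y \<in> T}"
    using openin_trans_full chart(1)[OF U(1)] by metis
  then show "\<forall>\<^sub>F y in nhdsin (Top M) r. f y \<in> T"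
    unfolding eventually_nhdsin using U(2) T(2) by blast
qed

lemma C_inf_nonzero_nbhd:
  assumes "f \<in> C_inf M" "r \<in> Carrier M" "f r \<noteq> 0"
  obtains W where "openin (Top M) W" "r \<in> W" "\<And>y. y \<in> W \<Longrightarrow> f y \<noteq> 0"
  using tendsto_imp_eventually_ne[OF C_inf_tendsto[OF assms(1,2)] assms(3)] assms(2)
  unfolding eventually_nhdsin by blast

text \<open>The function is built from the squared distance to \<open>r\<close> in a chart. The
  closed set \<open>K\<close> is part of the conclusion because products with functions defined only
  on \<open>W\<close> are later extended by zero across the complement of \<open>K\<close>.\<close>

lemma bump:
  assumes W: "openin (Top M) W" "r \<in> W"
  shows "\<exists>\<theta> K V. \<theta> \<in> C_inf M \<and> closedin (Top M) K \<and> K \<subseteq> W \<and> openin (Top M) V \<and> r \<in> V \<and> V \<subseteq> K \<and>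
    (\<forall>y\<in>V. \<theta> y = 1) \<and> (\<forall>y. y \<notin> K \<longrightarrow> \<theta> y = 0)"
proof -
  have r: "r \<in> Carrier M" using W openin_subset by blast
  obtain U \<phi> where U: "(U, \<phi>) \<in> Atlas M" "r \<in> U" using chart_exists[OF r] .
  define x0 where "x0 = \<phi> r"
  have o: "openin (Top M) (U \<inter> W)" using W chart(1)[OF U(1)] by auto
  have "x0 \<in> \<phi> ` (U \<inter> W)" using U W x0_def by auto
  from openin_powertop_box[OF chart_open_image[OF U(1) o Int_lower1] this finC]
  obtain \<epsilon> where \<epsilon>: "\<epsilon> > 0"
    "\<And>y. y \<in> extensional C \<Longrightarrow> (\<And>i. i \<in> C \<Longrightarrow> \<bar>y i - x0 i\<bar> \<le> \<epsilon>) \<Longrightarrow> y \<in> \<phi> ` (U \<inter> W)" by blast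
  \<comment> \<open>With this value, leaving the cube \<open>Q\<close> of half side
    \<open>\<epsilon>\<close> forces the squared distance to be at least
    \<open>2 * \<delta>\<close>.\<close>
  define \<delta> where "\<delta> = \<epsilon>\<^sup>2 / 2"
  have \<delta>: "\<delta> > 0" using \<epsilon>(1) by (simp add: \<delta>_def)
  define Q where "Q = (\<Pi>\<^sub>E i\<in>C. {x0 i - \<epsilon>..x0 i + \<epsilon>})"
  have Qsub: "Q \<subseteq> \<phi> ` (U \<inter> W)"
  proof
    fix x assume "x \<in> Q"
    then show "x \<in> \<phi> ` (U \<inter> W)"
      by (intro \<epsilon>(2)) (auto simp: Q_def PiE_def Pi_def abs_le_iff algebra_simps)
  qed
  define \<rho> where "\<rho> x = (\<Sum>a\<in>C. (x a + (- x0 a)) * (x a + (- x0 a)))" for x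
  have smr: "smooth_on C (\<phi> ` U) \<rho>"
    unfolding \<rho>_def[abs_def]
    by (intro smooth_on_sum smooth_on_mult smooth_on_add smooth_on_coord smooth_on_const finC chart(2)[OF U(1)])
  \<comment> \<open>For \<open>\<rho> x < \<delta>\<close> the inner flat function is zero and the
    quotient is 1. For \<open>\<rho> x \<ge> 2 * \<delta>\<close> monotonicity makes the subtracted
    term at least 1, so the outer argument is not positive and \<open>u\<close> vanishes.\<close>
  define u where "u x = bump_fun 0 (1 + (- inverse (bump_fun 0 \<delta>)) * bump_fun 0 (\<rho> x + (- \<delta>))) * inverse (bump_fun 0 1)" for x
  have smu: "smooth_on C (\<phi> ` U) u"
    unfolding u_def[abs_def]
    by (intro smooth_on_bump_fun smooth_on_mult smooth_on_add smooth_on_const smr finC chart(2)[OF U(1)])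
  have u1: "u x = 1" if "\<rho> x < \<delta>" for x
    using that by (simp add: u_def bump_fun_def)
  have bm: "bump_fun 0 s \<le> bump_fun 0 t" if "0 < s" "s \<le> t" for s t :: real
    using that by (simp add: bump_fun_def frac_le)
  have u0: "u x = 0" if "\<rho> x \<ge> 2 * \<delta>" for x
  proof -
    have pos: "bump_fun 0 \<delta> > 0" using \<delta> by (simp add: bump_fun_def)
    have "bump_fun 0 \<delta> \<le> bump_fun 0 (\<rho> x + (- \<delta>))" using that \<delta> by (intro bm) auto
    then have "1 \<le> inverse (bump_fun 0 \<delta>) * bump_fun 0 (\<rho> x + (- \<delta>))"
      using pos by (simp add: field_simps)
    then have "bump_fun 0 (1 + (- inverse (bump_fun 0 \<delta>)) * bump_fun 0 (\<rho> x + (- \<delta>))) = 0"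
      by (subst bump_fun_def) simp
    then show ?thesis by (simp only: u_def mult_zero_left)
  qed
  have \<rho>Q: "\<rho> x \<ge> 2 * \<delta>" if "x \<in> extensional C" "x \<notin> Q" for x
  proof -
    have "\<exists>i\<in>C. x i \<notin> {x0 i - \<epsilon>..x0 i + \<epsilon>}" using that unfolding Q_def PiE_iff by blast
    then obtain i where i: "i \<in> C" "\<not> \<bar>x i - x0 i\<bar> \<le> \<epsilon>"
      by (auto simp: abs_le_iff algebra_simps)
    then have "\<epsilon>\<^sup>2 \<le> (x i - x0 i)\<^sup>2" using \<epsilon>(1) by (metis abs_le_square_iff abs_of_pos linear)
    also have "\<dots> \<le> \<rho> x"
    proof -
      have "(x i + (- x0 i)) * (x i + (- x0 i)) \<le> \<rho> x"
        unfolding \<rho>_def by (rule member_le_sum[OF i(1) _ finC]) simp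
      then show ?thesis by (simp add: power2_eq_square)
    qed
    finally show ?thesis by (simp add: \<delta>_def)
  qed
  define K where "K = inv_into U \<phi> ` Q"
  have KUW: "K \<subseteq> U \<inter> W" using Qsub inv_chart[OF U(1)] by (fastforce simp: K_def)
  have K: "y \<in> K \<longleftrightarrow> y \<in> U \<and> \<phi> y \<in> Q" for y
  proof
    assume "y \<in> K"
    then obtain x where x: "x \<in> Q" "y = inv_into U \<phi> x" by (auto simp: K_def)
    then obtain z where "z \<in> U" "x = \<phi> z" using Qsub by blast
    then show "y \<in> U \<and> \<phi> y \<in> Q" using x inv_chart[OF U(1)] by simp
  next
    assume y: "y \<in> U \<and> \<phi> y \<in> Q"
    then have "y = inv_into U \<phi> (\<phi> y)" using inv_chart[OF U(1)] by simp
    then show "y \<in> K" using y unfolding K_def by blast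
  qed
  \<comment> \<open>The Hausdorff property enters here: the image of the compact cube is closed in
    all of \<open>M\<close>, not merely in the chart domain.\<close>
  have clK: "closedin (Top M) K"
  proof -
    have "compactin (powertop_real C) Q" by (simp add: Q_def compactin_PiE)
    then have "compactin (subtopology (powertop_real C) (\<phi> ` U)) Q"
      using Qsub by (auto simp: compactin_subtopology)
    then have "compactin (Top M) K" unfolding K_def by (rule image_compactin[OF _ inv_continuous[OF U(1)]])
    then show ?thesis by (rule compactin_imp_closedin[OF haus])
  qed
  define \<theta> where "\<theta> y = (if y \<in> U then u (\<phi> y) else 0)" for y
  have \<theta>K: "\<theta> y = 0" if "y \<notin> K" for y
    using that \<rho>Q u0 chart_ext[OF U(1)] by (auto simp: \<theta>_def K)
  have "\<theta> \<in> C_inf M"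
  proof (rule C_infI_chart)
    fix y assume y: "y \<in> Carrier M"
    show "\<exists>U \<phi> W. (U, \<phi>) \<in> Atlas M \<and> openin (Top M) W \<and> y \<in> W \<and> W \<subseteq> U \<and>
     smooth_on C (\<phi> ` W) (\<theta> \<circ> inv_into U \<phi>)"
    proof (cases "y \<in> U")
      case True
      have "smooth_on C (\<phi> ` U) (\<theta> \<circ> inv_into U \<phi>)"
        by (rule smooth_on_cong[OF chart(2)[OF U(1)] finC smu]) (auto simp: \<theta>_def inv_chart[OF U(1)])
      then show ?thesis using U(1) True chart(1)[OF U(1)] by blast
    next
      case False
      then have yK: "y \<in> Carrier M - K" using y KUW by auto
      obtain V \<psi> where V: "(V, \<psi>) \<in> Atlas M" "y \<in> V" using chart_exists[OF y] .
      have o: "openin (Top M) (V \<inter> (Carrier M - K))" using clK chart(1)[OF V(1)] by blast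
      have "smooth_on C (\<psi> ` (V \<inter> (Carrier M - K))) (\<theta> \<circ> inv_into V \<psi>)"
        by (rule smooth_on_cong[OF chart_open_image[OF V(1) o Int_lower1] finC
              smooth_on_const[OF finC chart_open_image[OF V(1) o Int_lower1]], of 0])
          (auto simp: inv_chart[OF V(1)] \<theta>K)
      then show ?thesis using V o yK by blast
    qed
  qed
  moreover define V where "V = {y \<in> U. \<phi> y \<in> {x \<in> extensional C. \<rho> x < \<delta>}}"
  have "openin (Top M) V"
  proof -
    have "openin (powertop_real C) {x \<in> \<phi> ` U. \<rho> x \<in> {..<\<delta>}}"
    proof -
      have "continuous_on (\<phi> ` U) \<rho>"
        by (rule smooth_on_continuous[OF chart(2)[OF U(1)] smr])
      then have "continuous_map (subtopology (powertop_real C) (\<phi> ` U)) euclideanreal \<rho>"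
        by (simp add: continuous_map_powertop_iff[OF chart_ext[OF U(1)]])
      then have "openin (subtopology (powertop_real C) (\<phi> ` U))
          {x \<in> topspace (subtopology (powertop_real C) (\<phi> ` U)). \<rho> x \<in> {..<\<delta>}}"
        by (rule openin_continuous_map_preimage) simp
      moreover have ts: "topspace (subtopology (powertop_real C) (\<phi> ` U)) = \<phi> ` U"
        using openin_subset[OF chart(2)[OF U(1)]] by auto
      ultimately have "openin (subtopology (powertop_real C) (\<phi> ` U)) {x \<in> \<phi> ` U. \<rho> x \<in> {..<\<delta>}}"
        by (simp only: ts)
      then show ?thesis by (rule openin_trans_full[OF _ chart(2)[OF U(1)]])
    qed
    from chart_open_preimage[OF U(1) this] have "openin (Top M) {y \<in> U. \<phi> y \<in> {x \<in> \<phi> ` U. \<rho> x \<in> {..<\<delta>}}}" .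
    moreover have "{y \<in> U. \<phi> y \<in> {x \<in> \<phi> ` U. \<rho> x \<in> {..<\<delta>}}} = V"
      using chart_ext[OF U(1)] by (auto simp: V_def)
    ultimately show ?thesis by simp
  qed
  moreover have "r \<in> V" using U(2) chart_ext[OF U(1)] \<delta> by (auto simp: V_def \<rho>_def x0_def)
  moreover have "V \<subseteq> K"
  proof
    fix y assume y: "y \<in> V"
    then have "y \<in> U" "\<phi> y \<in> extensional C" "\<rho> (\<phi> y) < \<delta>" by (auto simp: V_def)
    then show "y \<in> K" using \<rho>Q[of "\<phi> y"] \<delta> unfolding K by fastforce
  qed
  moreover have "\<forall>y\<in>V. \<theta> y = 1" by (auto simp: V_def \<theta>_def u1)
  ultimately show ?thesis using clK KUW \<theta>K by blast
qed

text \<open>The product with the cut-off is smooth on \<open>W\<close> and zero on the complement of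
  the closed set \<open>K\<close>; these two open sets cover the manifold.\<close>

lemma smooth_extension:
  assumes U: "(U, \<phi>) \<in> Atlas M" and W: "openin (Top M) W" "W \<subseteq> U"
    and K: "closedin (Top M) K" "K \<subseteq> W" and \<theta>: "\<theta> \<in> C_inf M" "\<And>y. y \<notin> K \<Longrightarrow> \<theta> y = 0"
    and u: "smooth_on C (\<phi> ` W) u"
  shows "(\<lambda>y. if y \<in> W then \<theta> y * u (\<phi> y) else 0) \<in> C_inf M" (is "?f \<in> _")
proof (rule C_infI_chart)
  fix y assume y: "y \<in> Carrier M"
  show "\<exists>U \<phi> W. (U, \<phi>) \<in> Atlas M \<and> openin (Top M) W \<and> y \<in> W \<and> W \<subseteq> U \<and>
     smooth_on C (\<phi> ` W) (?f \<circ> inv_into U \<phi>)"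
  proof (cases "y \<in> W")
    case True
    have oi: "openin (powertop_real C) (\<phi> ` W)" by (rule chart_open_image[OF U W])
    have "smooth_on C (\<phi> ` W) (\<theta> \<circ> inv_into U \<phi>)"
      by (rule smooth_on_subset[OF chart(2)[OF U] C_infD[OF \<theta>(1) U]]) (use W in auto)
    from smooth_on_mult[OF finC oi this u]
    have "smooth_on C (\<phi> ` W) (?f \<circ> inv_into U \<phi>)"
      by (rule smooth_on_cong[OF oi finC]) (use W(2) inv_chart[OF U] in auto)
    then show ?thesis using U True W by blast
  next
    case False
    then have yK: "y \<in> Carrier M - K" using y K by auto
    obtain V \<psi> where V: "(V, \<psi>) \<in> Atlas M" "y \<in> V" using chart_exists[OF y] .
    have o: "openin (Top M) (V \<inter> (Carrier M - K))" using K chart(1)[OF V(1)] by blast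
    have "smooth_on C (\<psi> ` (V \<inter> (Carrier M - K))) (?f \<circ> inv_into V \<psi>)"
      by (rule smooth_on_cong[OF chart_open_image[OF V(1) o Int_lower1] finC
            smooth_on_const[OF finC chart_open_image[OF V(1) o Int_lower1]], of 0])
        (auto simp: inv_chart[OF V(1)] \<theta>(2))
    then show ?thesis using V o yK by blast
  qed
qed

text \<open>The neighbourhood \<open>V\<close> is chosen before \<open>u\<close>: several local
  functions, for instance all coordinates of a chart, obtain global extensions that are valid on one
  common neighbourhood.\<close>

lemma smooth_extension_exists:
  assumes U: "(U, \<phi>) \<in> Atlas M" and W: "openin (Top M) W" "W \<subseteq> U" "r \<in> W"
  shows "\<exists>V. openin (Top M) V \<and> r \<in> V \<and> V \<subseteq> W \<and>
    (\<forall>u. smooth_on C (\<phi> ` W) u \<longrightarrow> (\<exists>h\<in>C_inf M. \<forall>y\<in>V. h y = u (\<phi> y)))"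
proof -
  obtain \<theta> K V where *: "\<theta> \<in> C_inf M" "closedin (Top M) K" "K \<subseteq> W" "openin (Top M) V" "r \<in> V" "V \<subseteq> K"
    "\<forall>y\<in>V. \<theta> y = 1" "\<And>y. y \<notin> K \<Longrightarrow> \<theta> y = 0" using bump[OF W(1,3)] by blast
  have "\<exists>h\<in>C_inf M. \<forall>y\<in>V. h y = u (\<phi> y)" if "smooth_on C (\<phi> ` W) u" for u
    by (rule bexI[OF _ smooth_extension[OF U W(1,2) *(2,3,1,8) that]]) (use * in auto)
  then show ?thesis using * by blast
qed

lemma C_inf_reciprocal:
  assumes d: "d \<in> C_inf M" "r \<in> Carrier M" "d r \<noteq> 0"
  shows "\<exists>V e. openin (Top M) V \<and> r \<in> V \<and> e \<in> C_inf M \<and> (\<forall>y\<in>V. e y * d y = 1)"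
proof -
  obtain W where W: "openin (Top M) W" "r \<in> W" "\<And>y. y \<in> W \<Longrightarrow> d y \<noteq> 0"
    using C_inf_nonzero_nbhd[OF d] by blast
  obtain U \<phi> where U: "(U, \<phi>) \<in> Atlas M" "r \<in> U" using chart_exists[OF d(2)] .
  have o: "openin (Top M) (U \<inter> W)" using W chart(1)[OF U(1)] by auto
  have sm: "smooth_on C (\<phi> ` (U \<inter> W)) (\<lambda>x. inverse ((d \<circ> inv_into U \<phi>) x))"
    by (rule smooth_on_inverse[OF finC chart_open_image[OF U(1) o Int_lower1] _
          smooth_on_subset[OF chart(2)[OF U(1)] C_infD[OF d(1) U(1)]]])
       (use W(3) inv_chart[OF U(1)] in auto)
  have "r \<in> U \<inter> W" using U W by simp
  from smooth_extension_exists[OF U(1) o Int_lower1 this] obtain V where V: "openin (Top M) V" "r \<in> V"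
    "V \<subseteq> U \<inter> W" "\<forall>u. smooth_on C (\<phi> ` (U \<inter> W)) u \<longrightarrow> (\<exists>h\<in>C_inf M. \<forall>y\<in>V. h y = u (\<phi> y))"
    by (elim exE conjE)
  from V(4)[rule_format, OF sm] obtain h where h: "h \<in> C_inf M"
    "\<forall>y\<in>V. h y = inverse ((d \<circ> inv_into U \<phi>) (\<phi> y))" by (elim bexE)
  have "h y * d y = 1" if y: "y \<in> V" for y
  proof -
    have "y \<in> U" "y \<in> W" using y V(3) by auto
    then show ?thesis using h(2)[rule_format, OF y] W(3)[of y] inv_chart[OF U(1), of y] by simp
  qed
  with V h show ?thesis by blast
qed

end

section \<open>Tangent vectors as derivations, vector fields and local frames\<close>

context mfd
begin

abbreviation "TS \<equiv> tangent_space M"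
abbreviation "VF \<equiv> vector_fields M"

context
  fixes v p assumes v: "v \<in> TS p"
begin

lemma tan_add: "f \<in> C_inf M \<Longrightarrow> h \<in> C_inf M \<Longrightarrow> v (\<lambda>x. f x + h x) = v f + v h"
  using v by (simp add: tangent_space_def)

lemma tan_cmult: "f \<in> C_inf M \<Longrightarrow> v (\<lambda>x. c * f x) = c * v f"
  using v by (simp add: tangent_space_def)

lemma tan_mult: "f \<in> C_inf M \<Longrightarrow> h \<in> C_inf M \<Longrightarrow> v (\<lambda>x. f x * h x) = f p * v h + h p * v f"
  using v by (simp add: tangent_space_def)

lemma tan_not_smooth: "f \<notin> C_inf M \<Longrightarrow> v f = 0"
  using v by (simp add: tangent_space_def)

lemma tan_const: "v (\<lambda>x. c) = 0"
proof -
  have "v (\<lambda>x. 1 * 1) = 1 * v (\<lambda>x. 1) + 1 * v (\<lambda>x. 1)"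
    by (rule tan_mult[of "\<lambda>x. 1" "\<lambda>x. 1"]) simp_all
  then have "v (\<lambda>x. 1) = 0" by simp
  then show ?thesis using tan_cmult[of "\<lambda>x. 1" c] by simp
qed

lemma tan_minus: "f \<in> C_inf M \<Longrightarrow> v (\<lambda>x. - f x) = - v f"
  using tan_cmult[of f "-1"] by simp

lemma tan_diff: "f \<in> C_inf M \<Longrightarrow> h \<in> C_inf M \<Longrightarrow> v (\<lambda>x. f x - h x) = v f - v h"
  using tan_add[of f "\<lambda>x. - h x"] tan_minus[of h] by simp

lemma tan_sum: "(\<And>a. a \<in> A \<Longrightarrow> f a \<in> C_inf M) \<Longrightarrow> v (\<lambda>x. \<Sum>a\<in>A. f a x) = (\<Sum>a\<in>A. v (f a))"
proof (induction A rule: infinite_finite_induct)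
  case (insert a A)
  then show ?case using tan_add[of "f a" "\<lambda>x. \<Sum>a\<in>A. f a x"] by simp
qed (simp_all add: tan_const)

lemma tan_power2: "f \<in> C_inf M \<Longrightarrow> v (\<lambda>x. (f x)\<^sup>2) = 2 * f p * v f"
  by (simp add: power2_eq_square tan_mult)

text \<open>A bump function \<open>\<theta>\<close> supported in \<open>W\<close> makes
  \<open>\<theta> * (f - h)\<close> identically zero. By the Leibniz rule at \<open>p\<close>, where
  \<open>\<theta>\<close> is 1 and \<open>f - h\<close> is 0, the derivation kills
  \<open>f - h\<close>.\<close>

lemma tan_local:
  assumes f: "f \<in> C_inf M" and h: "h \<in> C_inf M" and W: "openin (Top M) W" "p \<in> W"
    and eq: "\<And>y. y \<in> W \<Longrightarrow> f y = h y"
  shows "v f = v h"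
proof -
  obtain \<theta> K where \<theta>: "\<theta> \<in> C_inf M" "K \<subseteq> W" "\<theta> p = 1" "\<And>y. y \<notin> K \<Longrightarrow> \<theta> y = 0"
    using bump[OF W] by blast
  have "(\<lambda>x. \<theta> x * (f x - h x)) = (\<lambda>x. 0)"
    using \<theta> eq by (fastforce simp: fun_eq_iff)
  then have "v (\<lambda>x. \<theta> x * (f x - h x)) = 0" by (simp add: tan_const)
  then have "v (\<lambda>x. f x - h x) = 0"
    using \<theta> f h eq[OF W(2)] by (simp add: tan_mult)
  then show ?thesis using f h by (simp add: tan_diff)
qed

text \<open>Smoothness of \<open>f\<close> is not assumed: \<open>f\<close> and \<open>h\<close> are
  smooth or not smooth together, and in the second case both sides have the default value 0. This
  allows rewriting under a derivation with identities that hold on the carrier only.\<close>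

lemma tan_cong: "p \<in> Carrier M \<Longrightarrow> (\<And>y. y \<in> Carrier M \<Longrightarrow> f y = h y) \<Longrightarrow> v f = v h"
  by (metis C_inf_cong tan_local tan_not_smooth openin_topspace)

end

lemma TS_add: "v \<in> TS p \<Longrightarrow> w \<in> TS p \<Longrightarrow> (\<lambda>f. v f + w f) \<in> TS p"
  unfolding tangent_space_def by (simp add: algebra_simps)

lemma TS_scale: "v \<in> TS p \<Longrightarrow> (\<lambda>f. c * v f) \<in> TS p"
  unfolding tangent_space_def by (simp add: algebra_simps)

lemma TS_zero: "(\<lambda>f. 0) \<in> TS p"
  unfolding tangent_space_def by simp

lemma TS_sum: "(\<And>a. a \<in> A \<Longrightarrow> v a \<in> TS p) \<Longrightarrow> (\<lambda>f. \<Sum>a\<in>A. c a * v a f) \<in> TS p"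
proof (induction A rule: infinite_finite_induct)
  case (insert a A)
  then show ?case using TS_add[OF TS_scale[of "v a" p "c a"]] by simp
qed (simp_all add: TS_zero)

lemma VF_TS: "X \<in> VF \<Longrightarrow> p \<in> Carrier M \<Longrightarrow> X p \<in> TS p"
  by (simp add: vector_fields_def)

lemma VF_smooth [simp]: "X \<in> VF \<Longrightarrow> f \<in> C_inf M \<Longrightarrow> (\<lambda>p. X p f) \<in> C_inf M"
  by (simp add: vector_fields_def)

lemma VF_add: "X \<in> VF \<Longrightarrow> Y \<in> VF \<Longrightarrow> (\<lambda>p f. X p f + Y p f) \<in> VF"
  unfolding vector_fields_def using TS_add by auto

lemma VF_scale: "X \<in> VF \<Longrightarrow> h \<in> C_inf M \<Longrightarrow> (\<lambda>p f. h p * X p f) \<in> VF"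
  unfolding vector_fields_def using TS_scale by auto

lemma VF_zero: "(\<lambda>p f. 0) \<in> VF"
  unfolding vector_fields_def using TS_zero by auto

lemma VF_sum: "(\<And>a. a \<in> A \<Longrightarrow> X a \<in> VF) \<Longrightarrow> (\<And>a. a \<in> A \<Longrightarrow> h a \<in> C_inf M) \<Longrightarrow>
    (\<lambda>p f. \<Sum>a\<in>A. h a p * X a p f) \<in> VF"
proof (induction A rule: infinite_finite_induct)
  case (insert a A)
  then show ?case using VF_add[OF VF_scale[of "X a" "h a"]] by simp
qed (simp_all add: VF_zero)

text \<open>In the Leibniz rule the products of one derivative along \<open>X\<close> and one along
  \<open>Y\<close> occur in both compositions and cancel. The rules for \<open>X q\<close> and
  \<open>Y q\<close> hold for \<open>q\<close> in the carrier, so they are inserted under the outer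
  derivation by \<open>tan_cong\<close>.\<close>

lemma VF_bracket:
  assumes X: "X \<in> VF" and Y: "Y \<in> VF"
  shows "lie_bracket X Y \<in> VF"
  unfolding vector_fields_def
proof (intro CollectI conjI ballI)
  show "(\<lambda>p. lie_bracket X Y p f) \<in> C_inf M" if "f \<in> C_inf M" for f
    using that X Y by (simp add: lie_bracket_def)
  fix p assume p: "p \<in> Carrier M"
  note x = VF_TS[OF X p] and y = VF_TS[OF Y p]
  show "lie_bracket X Y p \<in> TS p"
    unfolding tangent_space_def
  proof (intro CollectI conjI ballI allI impI)
    fix f h assume f: "f \<in> C_inf M" and h: "h \<in> C_inf M"
    have Ya: "Y p (\<lambda>q. X q (\<lambda>x. f x + h x)) = Y p (\<lambda>q. X q f + X q h)"
      by (rule tan_cong[OF y p]) (rule tan_add[OF VF_TS[OF X] f h])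
    have Xa: "X p (\<lambda>q. Y q (\<lambda>x. f x + h x)) = X p (\<lambda>q. Y q f + Y q h)"
      by (rule tan_cong[OF x p]) (rule tan_add[OF VF_TS[OF Y] f h])
    show "lie_bracket X Y p (\<lambda>x. f x + h x) = lie_bracket X Y p f + lie_bracket X Y p h"
      unfolding lie_bracket_def Xa Ya using f h X Y by (simp add: tan_add[OF x] tan_add[OF y])
    have Ym: "Y p (\<lambda>q. X q (\<lambda>x. f x * h x)) = Y p (\<lambda>q. f q * X q h + h q * X q f)"
      by (rule tan_cong[OF y p]) (rule tan_mult[OF VF_TS[OF X] f h])
    have Xm: "X p (\<lambda>q. Y q (\<lambda>x. f x * h x)) = X p (\<lambda>q. f q * Y q h + h q * Y q f)"
      by (rule tan_cong[OF x p]) (rule tan_mult[OF VF_TS[OF Y] f h])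
    show "lie_bracket X Y p (\<lambda>x. f x * h x) = f p * lie_bracket X Y p h + h p * lie_bracket X Y p f"
      unfolding lie_bracket_def Xm Ym using f h X Y
      by (simp add: tan_add[OF x] tan_add[OF y] tan_mult[OF x] tan_mult[OF y] algebra_simps)
  next
    fix c f assume f: "f \<in> C_inf M"
    have Ya: "Y p (\<lambda>q. X q (\<lambda>x. c * f x)) = Y p (\<lambda>q. c * X q f)"
      by (rule tan_cong[OF y p]) (rule tan_cmult[OF VF_TS[OF X] f])
    have Xa: "X p (\<lambda>q. Y q (\<lambda>x. c * f x)) = X p (\<lambda>q. c * Y q f)"
      by (rule tan_cong[OF x p]) (rule tan_cmult[OF VF_TS[OF Y] f])
    show "lie_bracket X Y p (\<lambda>x. c * f x) = c * lie_bracket X Y p f"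
      unfolding lie_bracket_def Xa Ya using f X Y by (simp add: tan_cmult[OF x] tan_cmult[OF y] algebra_simps)
  next
    fix f assume f: "f \<notin> C_inf M"
    have "Y p (\<lambda>q. X q f) = Y p (\<lambda>q. 0)"
      by (rule tan_cong[OF y p]) (rule tan_not_smooth[OF VF_TS[OF X] f])
    moreover have "X p (\<lambda>q. Y q f) = X p (\<lambda>q. 0)"
      by (rule tan_cong[OF x p]) (rule tan_not_smooth[OF VF_TS[OF Y] f])
    ultimately show "lie_bracket X Y p f = 0"
      by (simp add: lie_bracket_def tan_const[OF x] tan_const[OF y])
  qed
qed

text \<open>Hadamard's lemma in a chart writes \<open>f\<close> near \<open>p\<close> as a constant
  plus products of centred coordinates with smooth functions. The \<open>\<xi> a\<close> are global
  functions that agree with the coordinates near \<open>p\<close>, since a derivation takes only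
  global smooth functions as arguments.\<close>

lemma tangent_coordinates:
  assumes U: "(U, \<phi>) \<in> Atlas M" and W: "openin (Top M) W" "W \<subseteq> U" "p \<in> W"
    and \<xi>: "\<And>a. a \<in> C \<Longrightarrow> \<xi> a \<in> C_inf M" "\<And>a y. a \<in> C \<Longrightarrow> y \<in> W \<Longrightarrow> \<xi> a y = \<phi> y a"
    and v: "v \<in> TS p" and f: "f \<in> C_inf M"
  shows "v f = (\<Sum>a\<in>C. v (\<xi> a) * partial_deriv a (f \<circ> inv_into U \<phi>) (\<phi> p))"
proof -
  let ?f = "f \<circ> inv_into U \<phi>"
  note oW = chart_open_image[OF U W(1,2)]
  have x0: "\<phi> p \<in> extensional C" using chart_ext[OF U] W by auto
  have pW: "\<phi> p \<in> \<phi> ` W" using W(3) by blast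
  obtain \<epsilon> where \<epsilon>: "\<epsilon> > 0"
    "\<And>y. y \<in> extensional C \<Longrightarrow> (\<And>i. i \<in> C \<Longrightarrow> \<bar>y i - \<phi> p i\<bar> \<le> \<epsilon>) \<Longrightarrow> y \<in> \<phi> ` W"
    using openin_powertop_box[OF oW pW finC] by blast
  define S where "S = {y \<in> extensional C. \<forall>i\<in>C. \<bar>y i - \<phi> p i\<bar> < \<epsilon>}"
  have SW: "S \<subseteq> \<phi> ` W" using \<epsilon>(2) less_imp_le unfolding S_def by blast
  have "smooth_on C S ?f"
    by (rule smooth_on_subset[OF chart(2)[OF U] C_infD[OF f U]]) (use SW W in auto)
  from hadamard[OF finC \<epsilon>(1) x0 S_def this]
  obtain G where G: "\<And>a. a \<in> C \<Longrightarrow> smooth_on C S (G a)"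
    "\<And>a. a \<in> C \<Longrightarrow> G a (\<phi> p) = partial_deriv a ?f (\<phi> p)"
    "\<And>x. x \<in> S \<Longrightarrow> ?f x = ?f (\<phi> p) + (\<Sum>a\<in>C. (x a - \<phi> p a) * G a x)" by blast
  define V where "V = {y \<in> U. \<phi> y \<in> S}"
  have oV: "openin (Top M) V" unfolding V_def
    by (rule chart_open_preimage[OF U]) (simp add: S_def openin_powertop_ball finC)
  have VU: "V \<subseteq> U" by (auto simp: V_def)
  have \<phi>V: "\<phi> ` V = S" using SW W(2) by (auto simp: V_def)
  have VW: "V \<subseteq> W"
  proof
    fix y assume "y \<in> V"
    then have "y \<in> U" "\<phi> y \<in> \<phi> ` W" using SW by (auto simp: V_def)
    then show "y \<in> W" using chart_inj[OF U] W(2) by (metis imageE inj_onD subsetD)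
  qed
  have pV: "p \<in> V" using W x0 \<epsilon>(1) by (auto simp: V_def S_def)
  obtain N where N: "openin (Top M) N" "p \<in> N" "N \<subseteq> V"
    "\<forall>u. smooth_on C (\<phi> ` V) u \<longrightarrow> (\<exists>h\<in>C_inf M. \<forall>y\<in>N. h y = u (\<phi> y))"
    using smooth_extension_exists[OF U oV VU pV] by (elim exE conjE)
  have "\<forall>a\<in>C. \<exists>h\<in>C_inf M. \<forall>y\<in>N. h y = G a (\<phi> y)" using N(4) G(1) \<phi>V by simp
  then obtain h where h: "\<And>a. a \<in> C \<Longrightarrow> h a \<in> C_inf M" "\<And>a y. a \<in> C \<Longrightarrow> y \<in> N \<Longrightarrow> h a y = G a (\<phi> y)"
    by metis
  have "v f = v (\<lambda>y. f p + (\<Sum>a\<in>C. (\<xi> a y - \<phi> p a) * h a y))"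
  proof (rule tan_local[OF v f _ N(1,2)])
    show "(\<lambda>y. f p + (\<Sum>a\<in>C. (\<xi> a y - \<phi> p a) * h a y)) \<in> C_inf M"
      using \<xi>(1) h(1) by (intro C_inf_add C_inf_const C_inf_sum C_inf_mult C_inf_diff)
    fix y assume y: "y \<in> N"
    then have yV: "y \<in> V" using N by blast
    then have "\<phi> y \<in> S" "y \<in> U" "y \<in> W" using VW by (auto simp: V_def)
    moreover have "(\<Sum>a\<in>C. (\<phi> y a - \<phi> p a) * G a (\<phi> y)) = (\<Sum>a\<in>C. (\<xi> a y - \<phi> p a) * h a y)"
      using \<xi>(2) h(2) y \<open>y \<in> W\<close> by (intro sum.cong) auto
    ultimately show "f y = f p + (\<Sum>a\<in>C. (\<xi> a y - \<phi> p a) * h a y)"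
      using G(3)[of "\<phi> y"] inv_chart[OF U] W by auto
  qed
  also have "\<dots> = (\<Sum>a\<in>C. v (\<lambda>y. (\<xi> a y - \<phi> p a) * h a y))"
    using \<xi>(1) h(1) by (subst tan_add[OF v]) (auto simp: tan_const[OF v] tan_sum[OF v])
  also have "\<dots> = (\<Sum>a\<in>C. v (\<xi> a) * partial_deriv a ?f (\<phi> p))"
  proof (rule sum.cong[OF refl])
    fix a assume a: "a \<in> C"
    \<comment> \<open>The first factor vanishes at \<open>p\<close>, so only one of the two Leibniz
      terms remains.\<close>
    have "v (\<lambda>y. (\<xi> a y - \<phi> p a) * h a y) = v (\<lambda>y. \<xi> a y - \<phi> p a) * h a p"
      using \<xi>[OF a] h(1)[OF a] W by (simp add: tan_mult[OF v])
    also have "v (\<lambda>y. \<xi> a y - \<phi> p a) = v (\<xi> a)"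
      using \<xi>[OF a] by (simp add: tan_diff[OF v] tan_const[OF v])
    finally show "v (\<lambda>y. (\<xi> a y - \<phi> p a) * h a y) = v (\<xi> a) * partial_deriv a ?f (\<phi> p)"
      using G(2)[OF a] h(2)[OF a N(2)] by simp
  qed
  finally show ?thesis .
qed

text \<open>Fields and functions are global, while duality and spanning hold on \<open>W\<close>
  only. The functions \<open>\<xi>\<close> act as coordinates, so the components of a vector are its
  values on them and depend smoothly on the point when the vector comes from a field.\<close>

definition local_frame :: "'a set \<Rightarrow> 'i set \<Rightarrow> ('i \<Rightarrow> 'a vfield) \<Rightarrow> ('i \<Rightarrow> 'a \<Rightarrow> real) \<Rightarrow> bool"
  where "local_frame W A E \<xi> \<longleftrightarrow> openin (Top M) W \<and> finite A \<and>
    (\<forall>a\<in>A. E a \<in> VF \<and> \<xi> a \<in> C_inf M) \<and>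
    (\<forall>y\<in>W. \<forall>a\<in>A. \<forall>b\<in>A. E a y (\<xi> b) = of_bool (a = b)) \<and>
    (\<forall>y\<in>W. \<forall>v\<in>TS y. v = (\<lambda>f. \<Sum>a\<in>A. v (\<xi> a) * E a y f))"

lemma local_frame_exists:
  assumes r: "r \<in> Carrier M"
  shows "\<exists>W E \<xi>. r \<in> W \<and> local_frame W C E \<xi>"
proof -
  obtain U \<phi> where U: "(U, \<phi>) \<in> Atlas M" "r \<in> U" using chart_exists[OF r] .
  note oU = chart(1)[OF U(1)] and oi = chart(2)[OF U(1)]
  obtain \<theta> K V where *: "\<theta> \<in> C_inf M" "closedin (Top M) K" "K \<subseteq> U" "openin (Top M) V" "r \<in> V" "V \<subseteq> K"
    "\<And>y. y \<in> V \<Longrightarrow> \<theta> y = 1" "\<And>y. y \<notin> K \<Longrightarrow> \<theta> y = 0" using bump[OF oU U(2)] by blast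
  have ex: "(\<lambda>y. if y \<in> U then \<theta> y * u (\<phi> y) else 0) \<in> C_inf M" if "smooth_on C (\<phi> ` U) u" for u
    by (rule smooth_extension[OF U(1) oU order_refl *(2,3,1) _ that]) (use *(8) in blast)
  define \<xi> where "\<xi> a y = (if y \<in> U then \<theta> y * \<phi> y a else 0)" for a y
  \<comment> \<open>Cut-off coordinate derivatives: \<open>\<theta>\<close> is 1 on
    \<open>V\<close>, so the cut-off is invisible there, and the value 0 on functions outside
    \<open>C_inf M\<close> is what \<open>tangent_space\<close> demands.\<close>
  define E where "E a y f = (if f \<in> C_inf M \<and> y \<in> U
    then \<theta> y * partial_deriv a (f \<circ> inv_into U \<phi>) (\<phi> y) else 0)" for a y f
  have VU: "V \<subseteq> U" using * by blast
  have \<xi>C: "\<xi> a \<in> C_inf M" if "a \<in> C" for a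
    unfolding \<xi>_def by (rule ex[OF smooth_on_coord[OF finC oi that]])
  have \<xi>V: "\<xi> a y = \<phi> y a" if "y \<in> V" for a y
    using that VU *(7) by (auto simp: \<xi>_def)
  have pd: "has_pd a (f \<circ> inv_into U \<phi>) (\<phi> y) (partial_deriv a (f \<circ> inv_into U \<phi>) (\<phi> y))"
    if "f \<in> C_inf M" "y \<in> U" "a \<in> C" for f a y
    by (rule smooth_on_has_pd[OF oi C_infD[OF that(1) U(1)] that(3)]) (use that in auto)
  have E: "E a \<in> VF" if a: "a \<in> C" for a
    unfolding vector_fields_def
  proof (intro CollectI conjI ballI)
    fix f assume f: "f \<in> C_inf M"
    show "(\<lambda>y. E a y f) \<in> C_inf M"
      unfolding E_def using f ex[OF smooth_on_partial_deriv[OF oi C_infD[OF f U(1)] a]] by simp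
  next
    fix y assume y: "y \<in> Carrier M"
    have add: "partial_deriv a ((\<lambda>x. f x + h x) \<circ> inv_into U \<phi>) (\<phi> y) =
        partial_deriv a (f \<circ> inv_into U \<phi>) (\<phi> y) + partial_deriv a (h \<circ> inv_into U \<phi>) (\<phi> y)"
      if "f \<in> C_inf M" "h \<in> C_inf M" "y \<in> U" for f h
      using DERIV_add[OF pd[OF that(1,3) a, unfolded has_pd_def] pd[OF that(2,3) a, unfolded has_pd_def]]
      by (intro has_pd_imp_partial_deriv) (simp add: has_pd_def o_def)
    have mult: "partial_deriv a ((\<lambda>x. f x * h x) \<circ> inv_into U \<phi>) (\<phi> y) =
        f y * partial_deriv a (h \<circ> inv_into U \<phi>) (\<phi> y) + h y * partial_deriv a (f \<circ> inv_into U \<phi>) (\<phi> y)"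
      if "f \<in> C_inf M" "h \<in> C_inf M" "y \<in> U" for f h
      using DERIV_mult[OF pd[OF that(1,3) a, unfolded has_pd_def] pd[OF that(2,3) a, unfolded has_pd_def]]
        inv_chart[OF U(1) that(3)]
      by (intro has_pd_imp_partial_deriv) (simp add: has_pd_def o_def algebra_simps)
    have cmult: "partial_deriv a ((\<lambda>x. c * f x) \<circ> inv_into U \<phi>) (\<phi> y) =
        c * partial_deriv a (f \<circ> inv_into U \<phi>) (\<phi> y)"
      if "f \<in> C_inf M" "y \<in> U" for f c
      using DERIV_cmult[OF pd[OF that a, unfolded has_pd_def], of c]
      by (intro has_pd_imp_partial_deriv) (simp add: has_pd_def o_def)
    show "E a y \<in> TS y"
    proof (cases "y \<in> U")
      case True
      show ?thesis unfolding tangent_space_def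
      proof (intro CollectI conjI ballI allI impI)
        fix c f assume "f \<in> C_inf M"
        then show "E a y (\<lambda>x. c * f x) = c * E a y f"
          using True cmult by (simp add: E_def algebra_simps)
      qed (use True in \<open>simp_all add: E_def add mult algebra_simps\<close>)
    next
      case False
      then have "E a y = (\<lambda>f. 0)" by (simp add: E_def fun_eq_iff)
      then show ?thesis by (simp add: TS_zero)
    qed
  qed
  have span: "v f = (\<Sum>a\<in>C. v (\<xi> a) * E a y f)" if y: "y \<in> V" and v: "v \<in> TS y" for y v f
  proof (cases "f \<in> C_inf M")
    case True
    then show ?thesis
      using tangent_coordinates[OF U(1) *(4) VU y \<xi>C \<xi>V v True] y VU *(7) by (auto simp: E_def)
  next
    case False
    then show ?thesis using tan_not_smooth[OF v] by (simp add: E_def)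
  qed
  have dual: "E a y (\<xi> b) = of_bool (a = b)" if y: "y \<in> V" and a: "a \<in> C" and b: "b \<in> C" for a b y
  proof -
    have o: "openin (powertop_real C) (\<phi> ` V)" by (rule chart_open_image[OF U(1) *(4) VU])
    have "partial_deriv a (\<xi> b \<circ> inv_into U \<phi>) (\<phi> y) = partial_deriv a (\<lambda>x. x b) (\<phi> y)"
      by (rule partial_deriv_cong[OF o finC _ _ a]) (use y VU inv_chart[OF U(1)] \<xi>V in auto)
    also have "\<dots> = of_bool (a = b)"
      by (rule has_pd_imp_partial_deriv) (auto simp: has_pd_def intro!: derivative_eq_intros)
    finally show ?thesis using y VU \<xi>C[OF b] *(7) by (auto simp: E_def)
  qed
  have "local_frame V C E \<xi>"
    unfolding local_frame_def using *(4) finC E \<xi>C dual span by (simp add: fun_eq_iff)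
  then show ?thesis using *(5) by blast
qed

lemma vector_extension:
  assumes "r \<in> Carrier M" "v \<in> TS r"
  obtains Z where "Z \<in> VF" "Z r = v"
proof -
  obtain W E \<xi> where W: "r \<in> W" "local_frame W C E \<xi>" using local_frame_exists[OF assms(1)] by blast
  have 1: "v = (\<lambda>f. \<Sum>a\<in>C. v (\<xi> a) * E a r f)" using W assms(2) unfolding local_frame_def by blast
  have 2: "(\<lambda>p f. \<Sum>a\<in>C. v (\<xi> a) * E a p f) \<in> VF"
    using W(2) by (intro VF_sum) (auto simp: local_frame_def)
  show ?thesis by (rule that[OF 2 1[symmetric]])
qed

section \<open>One-forms\<close>

definition one_form :: "('a vfield \<Rightarrow> 'a \<Rightarrow> real) \<Rightarrow> bool"
  where "one_form \<omega> \<longleftrightarrow>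
    (\<forall>Z\<in>VF. \<omega> Z \<in> C_inf M) \<and>
    (\<forall>Z\<in>VF. \<forall>Z'\<in>VF. \<forall>p\<in>Carrier M. \<omega> (\<lambda>p f. Z p f + Z' p f) p = \<omega> Z p + \<omega> Z' p) \<and>
    (\<forall>Z\<in>VF. \<forall>h\<in>C_inf M. \<forall>p\<in>Carrier M. \<omega> (\<lambda>p f. h p * Z p f) p = h p * \<omega> Z p) \<and>
    (\<forall>Z\<in>VF. \<forall>Z'\<in>VF. \<forall>p\<in>Carrier M. Z p = Z' p \<longrightarrow> \<omega> Z p = \<omega> Z' p)"

text \<open>Locality and linearity over smooth functions already give dependence on the value at the
  point: near \<open>p\<close> a field is the combination of a frame with smooth coefficients
  \<open>X y (\<xi> a)\<close>, and only the values of these coefficients at \<open>p\<close> enter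
  the result.\<close>

lemma one_formI:
  assumes smooth: "\<And>Z. Z \<in> VF \<Longrightarrow> \<omega> Z \<in> C_inf M"
    and add: "\<And>Z Z' p. Z \<in> VF \<Longrightarrow> Z' \<in> VF \<Longrightarrow> p \<in> Carrier M \<Longrightarrow> \<omega> (\<lambda>p f. Z p f + Z' p f) p = \<omega> Z p + \<omega> Z' p"
    and scale: "\<And>Z h p. Z \<in> VF \<Longrightarrow> h \<in> C_inf M \<Longrightarrow> p \<in> Carrier M \<Longrightarrow> \<omega> (\<lambda>p f. h p * Z p f) p = h p * \<omega> Z p"
    and loc: "\<And>Z Z' W p. Z \<in> VF \<Longrightarrow> Z' \<in> VF \<Longrightarrow> openin (Top M) W \<Longrightarrow> p \<in> W \<Longrightarrow> (\<And>y. y \<in> W \<Longrightarrow> Z y = Z' y) \<Longrightarrow>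
        \<omega> Z p = \<omega> Z' p"
  shows "one_form \<omega>"
proof -
  have zero: "\<omega> (\<lambda>p f. 0) p = 0" if "p \<in> Carrier M" for p
    using scale[OF VF_zero C_inf_const[of 0] that] by simp
  have sum: "\<omega> (\<lambda>p f. \<Sum>a\<in>A. h a p * X a p f) p = (\<Sum>a\<in>A. h a p * \<omega> (X a) p)"
    if "p \<in> Carrier M" "\<And>a. a \<in> A \<Longrightarrow> X a \<in> VF" "\<And>a. a \<in> A \<Longrightarrow> h a \<in> C_inf M" for p A X and h :: "'i \<Rightarrow> _"
    using that(2,3)
  proof (induction A rule: infinite_finite_induct)
    case (insert a A)
    then show ?case
      using add[OF VF_scale[of "X a" "h a"] VF_sum[of A X h] that(1)] scale[of "X a" "h a", OF _ _ that(1)] by simp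
  qed (simp_all add: zero[OF that(1)])
  have "\<omega> Z p = \<omega> Z' p" if Z: "Z \<in> VF" and Z': "Z' \<in> VF" and p: "p \<in> Carrier M" and eq: "Z p = Z' p" for Z Z' p
  proof -
    obtain W E \<xi> where W: "p \<in> W" "local_frame W C E \<xi>" using local_frame_exists[OF p] by blast
    have o: "openin (Top M) W" and E: "\<And>a. a \<in> C \<Longrightarrow> E a \<in> VF" "\<And>a. a \<in> C \<Longrightarrow> \<xi> a \<in> C_inf M"
      and sp: "\<And>y v. y \<in> W \<Longrightarrow> v \<in> TS y \<Longrightarrow> v = (\<lambda>f. \<Sum>a\<in>C. v (\<xi> a) * E a y f)"
      using W(2) unfolding local_frame_def by blast+
    have WC: "W \<subseteq> Carrier M" using openin_subset[OF o] .
    have rep: "\<omega> X p = (\<Sum>a\<in>C. X p (\<xi> a) * \<omega> (E a) p)" if X: "X \<in> VF" for X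
    proof -
      have "\<omega> X p = \<omega> (\<lambda>y f. \<Sum>a\<in>C. X y (\<xi> a) * E a y f) p"
      proof (rule loc[OF X _ o W(1)])
        show "(\<lambda>y f. \<Sum>a\<in>C. X y (\<xi> a) * E a y f) \<in> VF"
          using E X by (intro VF_sum[of C E "\<lambda>a y. X y (\<xi> a)"]) auto
        show "X y = (\<lambda>f. \<Sum>a\<in>C. X y (\<xi> a) * E a y f)" if "y \<in> W" for y
          by (rule sp[OF that VF_TS[OF X]]) (use that WC in auto)
      qed
      also have "\<dots> = (\<Sum>a\<in>C. X p (\<xi> a) * \<omega> (E a) p)"
        using E X by (intro sum[OF p, of C E "\<lambda>a y. X y (\<xi> a)"]) auto
      finally show ?thesis .
    qed
    show ?thesis unfolding rep[OF Z] rep[OF Z'] eq ..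
  qed
  then show ?thesis unfolding one_form_def using smooth add scale by blast
qed

context
  fixes \<omega> assumes \<omega>: "one_form \<omega>"
begin

lemma one_form_smooth [simp]: "Z \<in> VF \<Longrightarrow> \<omega> Z \<in> C_inf M"
  using \<omega> by (simp add: one_form_def)

lemma one_form_add: "Z \<in> VF \<Longrightarrow> Z' \<in> VF \<Longrightarrow> p \<in> Carrier M \<Longrightarrow> \<omega> (\<lambda>p f. Z p f + Z' p f) p = \<omega> Z p + \<omega> Z' p"
  using \<omega> unfolding one_form_def by blast

lemma one_form_scale: "Z \<in> VF \<Longrightarrow> h \<in> C_inf M \<Longrightarrow> p \<in> Carrier M \<Longrightarrow> \<omega> (\<lambda>p f. h p * Z p f) p = h p * \<omega> Z p"
  using \<omega> unfolding one_form_def by blast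

lemma one_form_tensorial: "Z \<in> VF \<Longrightarrow> Z' \<in> VF \<Longrightarrow> p \<in> Carrier M \<Longrightarrow> Z p = Z' p \<Longrightarrow> \<omega> Z p = \<omega> Z' p"
  using \<omega> unfolding one_form_def by blast

lemma one_form_sum:
  assumes "p \<in> Carrier M" "\<And>a. a \<in> A \<Longrightarrow> X a \<in> VF" "\<And>a. a \<in> A \<Longrightarrow> h a \<in> C_inf M"
  shows "\<omega> (\<lambda>p f. \<Sum>a\<in>A. h a p * X a p f) p = (\<Sum>a\<in>A. h a p * \<omega> (X a) p)"
  using assms(2,3)
proof (induction A rule: infinite_finite_induct)
  case (insert a A)
  then show ?case
    using one_form_add[OF VF_scale[of "X a" "h a"] VF_sum[of A X h] assms(1)]
      one_form_scale[of "X a" "h a", OF _ _ assms(1)] by simp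
qed (use one_form_scale[OF VF_zero C_inf_const[of 0] assms(1)] in simp_all)

lemma form_at_eq:
  assumes "Z \<in> VF" "p \<in> Carrier M"
  shows "form_at M \<omega> p (Z p) = \<omega> Z p"
proof -
  let ?Z = "SOME Z'. Z' \<in> VF \<and> Z' p = Z p"
  have "?Z \<in> VF \<and> ?Z p = Z p" by (rule someI[of _ Z]) (use assms in simp)
  then have "\<omega> ?Z p = \<omega> Z p" by (intro one_form_tensorial assms) auto
  then show ?thesis by (simp only: form_at_def VF_TS[OF assms] if_True)
qed

end

end

section \<open>Singular semi-Riemannian manifolds\<close>

locale ssr = mfd M for M :: "('a, 'c) manifold" +
  fixes g :: "'a bform"
  assumes g_sym: "p \<in> Carrier M \<Longrightarrow> u \<in> tangent_space M p \<Longrightarrow> v \<in> tangent_space M p \<Longrightarrow> g p u v = g p v u"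
    and g_add: "p \<in> Carrier M \<Longrightarrow> u \<in> tangent_space M p \<Longrightarrow> v \<in> tangent_space M p \<Longrightarrow> w \<in> tangent_space M p \<Longrightarrow>
      g p (\<lambda>f. u f + v f) w = g p u w + g p v w"
    and g_scale: "p \<in> Carrier M \<Longrightarrow> u \<in> tangent_space M p \<Longrightarrow> w \<in> tangent_space M p \<Longrightarrow>
      g p (\<lambda>f. c * u f) w = c * g p u w"
    and g_smooth [simp]: "X \<in> vector_fields M \<Longrightarrow> Y \<in> vector_fields M \<Longrightarrow> (\<lambda>p. g p (X p) (Y p)) \<in> C_inf M"

lemma singular_semi_riemannian_imp_ssr: "singular_semi_riemannian M g \<Longrightarrow> ssr M g"
proof -
  assume "singular_semi_riemannian M g"
  then have *: "smooth_manifold M"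
    "\<And>p u v w c. p \<in> Carrier M \<Longrightarrow> u \<in> tangent_space M p \<Longrightarrow> v \<in> tangent_space M p \<Longrightarrow> w \<in> tangent_space M p \<Longrightarrow>
        g p u v = g p v u \<and> g p (\<lambda>f. u f + v f) w = g p u w + g p v w \<and> g p (\<lambda>f. c * u f) w = c * g p u w"
    "\<And>X Y. X \<in> vector_fields M \<Longrightarrow> Y \<in> vector_fields M \<Longrightarrow> (\<lambda>p. g p (X p) (Y p)) \<in> C_inf M"
    unfolding singular_semi_riemannian_def by simp_all
  show "ssr M g"
  proof (intro ssr.intro smooth_manifold_imp_mfd *(1) ssr_axioms.intro)
    fix p u v assume p: "p \<in> Carrier M" "u \<in> tangent_space M p" "v \<in> tangent_space M p"
    show "g p u v = g p v u" using *(2)[OF p(1,2,3,3)] by simp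
  next
    fix p u v w assume p: "p \<in> Carrier M" "u \<in> tangent_space M p" "v \<in> tangent_space M p" "w \<in> tangent_space M p"
    show "g p (\<lambda>f. u f + v f) w = g p u w + g p v w" using *(2)[OF p] by simp
  next
    fix p u w c assume p: "p \<in> Carrier M" "u \<in> tangent_space M p" "w \<in> tangent_space M p"
    show "g p (\<lambda>f. c * u f) w = c * g p u w" using *(2)[OF p(1,2,2,3)] by simp
  qed (rule *(3))
qed

context ssr
begin

lemma g_addR: "p \<in> Carrier M \<Longrightarrow> u \<in> TS p \<Longrightarrow> v \<in> TS p \<Longrightarrow> w \<in> TS p \<Longrightarrow>
    g p w (\<lambda>f. u f + v f) = g p w u + g p w v"
  using g_sym[of p w "\<lambda>f. u f + v f"] g_add[of p u v w] g_sym[of p u w] g_sym[of p v w] TS_add[of u p v] by simp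

lemma g_scaleR: "p \<in> Carrier M \<Longrightarrow> u \<in> TS p \<Longrightarrow> w \<in> TS p \<Longrightarrow> g p w (\<lambda>f. c * u f) = c * g p w u"
  using g_sym[of p w "\<lambda>f. c * u f"] g_scale[of p u w c] g_sym[of p u w] TS_scale[of u p c] by simp

lemma g_zero: "p \<in> Carrier M \<Longrightarrow> w \<in> TS p \<Longrightarrow> g p (\<lambda>f. 0) w = 0"
  using g_scale[OF _ TS_zero, of p w 0] by simp

lemma g_zeroR: "p \<in> Carrier M \<Longrightarrow> w \<in> TS p \<Longrightarrow> g p w (\<lambda>f. 0) = 0"
  using g_scaleR[OF _ TS_zero, of p w 0] by simp

lemma g_sum: "p \<in> Carrier M \<Longrightarrow> w \<in> TS p \<Longrightarrow> (\<And>a. a \<in> A \<Longrightarrow> v a \<in> TS p) \<Longrightarrow>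
    g p (\<lambda>f. \<Sum>a\<in>A. c a * v a f) w = (\<Sum>a\<in>A. c a * g p (v a) w)"
proof (induction A rule: infinite_finite_induct)
  case (insert a A)
  then show ?case
    using g_add[OF insert.prems(1) TS_scale[of "v a" p "c a"] TS_sum[of A v p c] insert.prems(2)]
      g_scale[of p "v a" w "c a"] by simp
qed (simp_all add: g_zero)

lemma TS_eqI: "v \<in> TS p \<Longrightarrow> w \<in> TS p \<Longrightarrow> (\<And>f. f \<in> C_inf M \<Longrightarrow> v f = w f) \<Longrightarrow> v = w"
proof
  fix f
  assume "v \<in> TS p" "w \<in> TS p" "\<And>f. f \<in> C_inf M \<Longrightarrow> v f = w f"
  then show "v f = w f" by (cases "f \<in> C_inf M") (simp_all add: tan_not_smooth)
qed

lemma bracket_TS: "X \<in> VF \<Longrightarrow> Y \<in> VF \<Longrightarrow> p \<in> Carrier M \<Longrightarrow> lie_bracket X Y p \<in> TS p"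
  by (rule VF_TS[OF VF_bracket])

lemma bracket_antisym: "lie_bracket Z X p = (\<lambda>f. (- 1) * lie_bracket X Z p f)"
  by (simp add: lie_bracket_def fun_eq_iff)

lemma bracket_add:
  assumes "Y \<in> VF" "Z \<in> VF" "Z' \<in> VF" "p \<in> Carrier M"
  shows "lie_bracket Y (\<lambda>p f. Z p f + Z' p f) p = (\<lambda>f. lie_bracket Y Z p f + lie_bracket Y Z' p f)"
proof (rule TS_eqI)
  fix f assume f: "f \<in> C_inf M"
  show "lie_bracket Y (\<lambda>p f. Z p f + Z' p f) p f = lie_bracket Y Z p f + lie_bracket Y Z' p f"
    using assms f by (simp add: lie_bracket_def tan_add[OF VF_TS[OF assms(1,4)]])
qed (use assms in \<open>auto intro!: bracket_TS VF_add TS_add\<close>)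

lemma bracket_scale:
  assumes "Y \<in> VF" "Z \<in> VF" "h \<in> C_inf M" "p \<in> Carrier M"
  shows "lie_bracket Y (\<lambda>p f. h p * Z p f) p = (\<lambda>f. h p * lie_bracket Y Z p f + Y p h * Z p f)"
proof (rule TS_eqI)
  fix f assume f: "f \<in> C_inf M"
  show "lie_bracket Y (\<lambda>p f. h p * Z p f) p f = h p * lie_bracket Y Z p f + Y p h * Z p f"
    using assms f by (simp add: lie_bracket_def tan_mult[OF VF_TS[OF assms(1,4)]] algebra_simps)
qed (use assms VF_TS[of Z] in \<open>auto intro!: bracket_TS VF_scale TS_add TS_scale\<close>)

lemma bracket_local:
  assumes "Y \<in> VF" "Z \<in> VF" "Z' \<in> VF" "openin (Top M) W" "p \<in> W" "\<And>y. y \<in> W \<Longrightarrow> Z y = Z' y"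
  shows "lie_bracket Y Z p = lie_bracket Y Z' p"
proof (rule TS_eqI)
  have p: "p \<in> Carrier M" using assms openin_subset by blast
  show "lie_bracket Y Z p \<in> TS p" "lie_bracket Y Z' p \<in> TS p"
    using assms p by (auto intro!: bracket_TS)
  fix f assume f: "f \<in> C_inf M"
  have "Y p (\<lambda>q. Z q f) = Y p (\<lambda>q. Z' q f)"
    by (rule tan_local[OF VF_TS[OF assms(1) p] _ _ assms(4,5)]) (use assms f in auto)
  then show "lie_bracket Y Z p f = lie_bracket Y Z' p f"
    using assms by (simp add: lie_bracket_def)
qed

section \<open>The Koszul form and the inner product of flat covectors\<close>

abbreviation "K \<equiv> koszul g"

lemma koszul_smooth [simp]: "X \<in> VF \<Longrightarrow> Y \<in> VF \<Longrightarrow> Z \<in> VF \<Longrightarrow> K X Y Z \<in> C_inf M"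
  unfolding koszul_def
  by (rule C_inf_mult[OF C_inf_const], rule C_inf_add[OF C_inf_add[OF C_inf_diff[OF C_inf_diff[OF C_inf_add]]]])
     (rule g_smooth VF_smooth, simp_all add: VF_bracket)+

lemma bracket_antisym_ip:
  assumes "p \<in> Carrier M" "X \<in> VF" "Z \<in> VF" "w \<in> TS p"
  shows "g p w (lie_bracket Z X p) = - g p w (lie_bracket X Z p)"
  unfolding bracket_antisym[of Z X] using g_scaleR[of p "lie_bracket X Z p" w "- 1"] assms
  by (simp add: bracket_TS)

lemma ip_comm: "X \<in> VF \<Longrightarrow> Y \<in> VF \<Longrightarrow> v \<in> TS p \<Longrightarrow> p \<in> Carrier M \<Longrightarrow>
    v (\<lambda>q. g q (X q) (Y q)) = v (\<lambda>q. g q (Y q) (X q))"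
  by (rule tan_cong) (auto intro: g_sym VF_TS)

text \<open>Replacing \<open>Z\<close> by \<open>h * Z\<close> produces derivatives of
  \<open>h\<close> that cancel in pairs: \<open>X(h) g(Y,Z)\<close> from the first term against the
  one from \<open>g(Y,[hZ,X])\<close>, and \<open>Y(h) g(Z,X)\<close> against the one from
  \<open>g(X,[Y,hZ])\<close>.\<close>

lemma one_form_koszul:
  assumes X: "X \<in> VF" and Y: "Y \<in> VF"
  shows "one_form (K X Y)"
proof (rule one_formI)
  fix Z assume "Z \<in> VF"
  then show "K X Y Z \<in> C_inf M" using X Y by simp
next
  fix Z Z' p assume Z: "Z \<in> VF" and Z': "Z' \<in> VF" and p: "p \<in> Carrier M"
  have 1: "X p (\<lambda>q. g q (Y q) (\<lambda>f. Z q f + Z' q f)) = X p (\<lambda>q. g q (Y q) (Z q) + g q (Y q) (Z' q))"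
    by (rule tan_cong[OF VF_TS[OF X p] p]) (use Y Z Z' in \<open>auto intro!: g_addR VF_TS\<close>)
  have 2: "Y p (\<lambda>q. g q (\<lambda>f. Z q f + Z' q f) (X q)) = Y p (\<lambda>q. g q (Z q) (X q) + g q (Z' q) (X q))"
    by (rule tan_cong[OF VF_TS[OF Y p] p]) (use X Z Z' in \<open>auto intro!: g_add VF_TS\<close>)
  note T = VF_TS[OF X p] VF_TS[OF Y p] VF_TS[OF Z p] VF_TS[OF Z' p] VF_TS[OF VF_bracket[OF X Z] p]
    VF_TS[OF VF_bracket[OF X Z'] p] VF_TS[OF VF_bracket[OF Y Z] p] VF_TS[OF VF_bracket[OF Y Z'] p]
    VF_TS[OF VF_bracket[OF X Y] p]
  have 3: "g p (Y p) (lie_bracket (\<lambda>p f. Z p f + Z' p f) X p) = - g p (Y p) (lie_bracket X Z p) - g p (Y p) (lie_bracket X Z' p)"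
    using T p by (simp add: bracket_antisym_ip[OF p X VF_add[OF Z Z']] bracket_add[OF X Z Z' p] g_addR)
  show "K X Y (\<lambda>p f. Z p f + Z' p f) p = K X Y Z p + K X Y Z' p"
    unfolding koszul_def 1 2 3 using X Y Z Z' p T
    by (simp add: bracket_add bracket_antisym_ip[of p X Z] bracket_antisym_ip[of p X Z']
        g_add g_addR tan_add[OF T(1)] tan_add[OF T(2)] field_simps)
next
  fix Z h p assume Z: "Z \<in> VF" and h: "h \<in> C_inf M" and p: "p \<in> Carrier M"
  have 1: "X p (\<lambda>q. g q (Y q) (\<lambda>f. h q * Z q f)) = X p (\<lambda>q. h q * g q (Y q) (Z q))"
    by (rule tan_cong[OF VF_TS[OF X p] p]) (use Y Z in \<open>auto intro!: g_scaleR VF_TS\<close>)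
  have 2: "Y p (\<lambda>q. g q (\<lambda>f. h q * Z q f) (X q)) = Y p (\<lambda>q. h q * g q (Z q) (X q))"
    by (rule tan_cong[OF VF_TS[OF Y p] p]) (use X Z in \<open>auto intro!: g_scale VF_TS\<close>)
  note T = VF_TS[OF X p] VF_TS[OF Y p] VF_TS[OF Z p] VF_TS[OF VF_bracket[OF X Z] p]
    VF_TS[OF VF_bracket[OF Y Z] p] VF_TS[OF VF_bracket[OF X Y] p]
  have 3: "g p (Y p) (lie_bracket (\<lambda>p f. h p * Z p f) X p) = - (h p * g p (Y p) (lie_bracket X Z p) + X p h * g p (Y p) (Z p))"
    using T p by (simp add: bracket_antisym_ip[OF p X VF_scale[OF Z h]] bracket_scale[OF X Z h p] g_addR g_scaleR TS_scale)
  show "K X Y (\<lambda>p f. h p * Z p f) p = h p * K X Y Z p"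
    unfolding koszul_def 1 2 3 using X Y Z h p T
    by (simp add: bracket_scale bracket_antisym_ip[of p X Z] g_sym[of p "Z p" "X p"]
        g_scale g_addR g_scaleR TS_scale tan_mult[OF T(1)] tan_mult[OF T(2)] field_simps)
next
  fix Z Z' W p assume Z: "Z \<in> VF" and Z': "Z' \<in> VF" and W: "openin (Top M) W" "p \<in> W"
    and eq: "\<And>y. y \<in> W \<Longrightarrow> Z y = Z' y"
  have p: "p \<in> Carrier M" using W openin_subset by blast
  have 1: "X p (\<lambda>q. g q (Y q) (Z q)) = X p (\<lambda>q. g q (Y q) (Z' q))"
    by (rule tan_local[OF VF_TS[OF X p] _ _ W]) (use Y Z Z' eq in auto)
  have 2: "Y p (\<lambda>q. g q (Z q) (X q)) = Y p (\<lambda>q. g q (Z' q) (X q))"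
    by (rule tan_local[OF VF_TS[OF Y p] _ _ W]) (use X Z Z' eq in auto)
  show "K X Y Z p = K X Y Z' p"
    using bracket_local[OF Y Z Z' W eq] bracket_local[OF X Z Z' W eq] eq[OF W(2)]
    by (simp add: koszul_def 1 2 bracket_antisym[of Z X] bracket_antisym[of Z' X])
qed

text \<open>Metric compatibility and, in the next lemma, vanishing torsion: the two classical
  properties of the Levi-Civita connection hold in lowered form, where no inverse metric is
  involved.\<close>

lemma koszul_metric:
  assumes "X \<in> VF" "Y \<in> VF" "Z \<in> VF" "p \<in> Carrier M"
  shows "X p (\<lambda>q. g q (Y q) (Z q)) = K X Y Z p + K X Z Y p"
  unfolding koszul_def using assms
  by (simp add: ip_comm[of Z Y "X p" p] ip_comm[of Z X "Y p" p] ip_comm[of Y X "Z p" p]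
      bracket_antisym_ip[of p Z Y] bracket_antisym_ip[of p Z X] bracket_antisym_ip[of p X Y] VF_TS field_simps)

lemma koszul_torsion:
  assumes "X \<in> VF" "Y \<in> VF" "Z \<in> VF" "p \<in> Carrier M"
  shows "g p (lie_bracket X Y p) (Z p) = K X Y Z p - K Y X Z p"
  unfolding koszul_def using assms
  by (simp add: ip_comm[of Z Y "X p" p] ip_comm[of Z X "Y p" p] ip_comm[of Y X "Z p" p] g_sym[of p "lie_bracket X Y p"]
      bracket_antisym_ip[of p Z Y] bracket_antisym_ip[of p Z X] bracket_antisym_ip[of p X Y] VF_TS bracket_TS field_simps)

text \<open>Vectors with the same flat pair equally with every tangent vector, so by symmetry the
  value does not depend on the representatives and \<open>THE\<close> is well defined even for a
  degenerate metric.\<close>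

lemma g_bullet_flat:
  assumes p: "p \<in> Carrier M" and v: "v \<in> TS p" and w: "w \<in> TS p"
  shows "g_bullet M g p (flat_at M g p v) (flat_at M g p w) = g p v w"
  unfolding g_bullet_def
proof (rule the_equality)
  show "\<exists>v'\<in>TS p. \<exists>w'\<in>TS p. flat_at M g p v = flat_at M g p v' \<and> flat_at M g p w = flat_at M g p w' \<and> g p v w = g p v' w'"
    using v w by blast
  fix r assume "\<exists>v'\<in>TS p. \<exists>w'\<in>TS p. flat_at M g p v = flat_at M g p v' \<and> flat_at M g p w = flat_at M g p w' \<and> r = g p v' w'"
  then obtain v' w' where *: "v' \<in> TS p" "w' \<in> TS p" "flat_at M g p v = flat_at M g p v'"
    "flat_at M g p w = flat_at M g p w'" "r = g p v' w'" by blast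
  have "g p v w = g p v' w" using fun_cong[OF *(3), of w] w by (simp add: flat_at_def)
  also have "\<dots> = g p w v'" by (rule g_sym[OF p *(1) w])
  also have "\<dots> = g p w' v'" using fun_cong[OF *(4), of v'] *(1) by (simp add: flat_at_def)
  also have "\<dots> = g p v' w'" by (rule g_sym[OF p *(2,1)])
  finally show "r = g p v w" using *(5) by simp
qed

text \<open>A pointwise sharp without uniqueness: for a degenerate metric the vector is determined
  only up to the radical. Existence of such a vector is membership of the covector in
  \<open>T_bullet\<close>.\<close>

definition represents :: "('a vfield \<Rightarrow> 'a \<Rightarrow> real) \<Rightarrow> 'a \<Rightarrow> 'a tvec \<Rightarrow> bool"
  where "represents \<omega> p v \<longleftrightarrow> v \<in> TS p \<and> (\<forall>Z\<in>VF. \<omega> Z p = g p v (Z p))"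

lemma form_at_flat:
  assumes \<omega>: "one_form \<omega>" and p: "p \<in> Carrier M" and v: "v \<in> TS p"
  shows "form_at M \<omega> p = flat_at M g p v \<longleftrightarrow> represents \<omega> p v"
proof
  assume eq: "form_at M \<omega> p = flat_at M g p v"
  have "\<omega> Z p = g p v (Z p)" if Z: "Z \<in> VF" for Z
    using form_at_eq[OF \<omega> Z p] VF_TS[OF Z p] unfolding eq by (simp add: flat_at_def)
  then show "represents \<omega> p v" using v by (simp add: represents_def)
next
  assume R: "represents \<omega> p v"
  show "form_at M \<omega> p = flat_at M g p v"
  proof
    fix w
    show "form_at M \<omega> p w = flat_at M g p v w"
    proof (cases "w \<in> TS p")
      case True
      then obtain Z where "Z \<in> VF" "Z p = w" using vector_extension[OF p] by blast
      then show ?thesis using form_at_eq[OF \<omega> _ p] R True by (auto simp: represents_def flat_at_def)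
    qed (simp add: form_at_def flat_at_def)
  qed
qed

lemma form_at_in_T_bullet:
  assumes "one_form \<omega>" "p \<in> Carrier M"
  shows "form_at M \<omega> p \<in> T_bullet M g p \<longleftrightarrow> (\<exists>v. represents \<omega> p v)"
  unfolding T_bullet_def using form_at_flat[OF assms] by (auto simp: represents_def)

lemma g_bullet_represents:
  assumes "one_form \<omega>" "one_form \<tau>" "p \<in> Carrier M" "represents \<omega> p v" "represents \<tau> p w"
  shows "g_bullet M g p (form_at M \<omega> p) (form_at M \<tau> p) = g p v w"
proof -
  have v: "v \<in> TS p" and w: "w \<in> TS p" using assms by (auto simp: represents_def)
  have "form_at M \<omega> p = flat_at M g p v" "form_at M \<tau> p = flat_at M g p w"
    using form_at_flat[OF assms(1,3) v] form_at_flat[OF assms(2,3) w] assms(4,5) by simp_all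
  then show ?thesis using g_bullet_flat[OF assms(3) v w] by simp
qed

end

section \<open>The rank\<close>

interpretation covec: vector_space "\<lambda>(c::real) (\<alpha>::'x covec) w. c * \<alpha> w"
  by unfold_locales (auto simp: fun_eq_iff algebra_simps)

lemma sum_fun_apply: "(\<Sum>a\<in>A. f a) x = (\<Sum>a\<in>A. f a x :: real)"
  by (induction A rule: infinite_finite_induct) auto

text \<open>If the matrix differs from the identity by at most 1/2 in the sum of entries, then the
  sum \<open>s\<close> of the \<open>\<bar>c a\<bar>\<close> is at most that of the right-hand side
  plus \<open>s / 2\<close>, hence at most twice the former. The case \<open>w = 0\<close> gives
  independence near a point, the error bound gives continuity of the solution.\<close>

lemma near_identity:
  fixes m :: "'i \<Rightarrow> 'i \<Rightarrow> real"
  assumes A: "finite A" and e: "(\<Sum>a\<in>A. \<Sum>b\<in>A. \<bar>m a b - of_bool (a = b)\<bar>) \<le> 1/2" (is "?e \<le> _")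
    and eq: "\<And>b. b \<in> A \<Longrightarrow> (\<Sum>a\<in>A. c a * m a b) = w b" and b: "b \<in> A"
  shows "\<bar>c b - w b\<bar> \<le> 2 * (\<Sum>a\<in>A. \<bar>w a\<bar>) * ?e"
proof -
  define s where "s = (\<Sum>a\<in>A. \<bar>c a\<bar>)"
  have s0: "s \<ge> 0" by (simp add: s_def sum_nonneg)
  have d: "\<bar>c b - w b\<bar> \<le> (\<Sum>a\<in>A. s * \<bar>m a b - of_bool (a = b)\<bar>)" if b: "b \<in> A" for b
  proof -
    have "(\<Sum>a\<in>A. c a * (m a b - of_bool (a = b))) = w b - (\<Sum>a\<in>A. if a = b then c a else 0)"
      unfolding eq[OF b, symmetric] sum_subtractf[symmetric] by (intro sum.cong) (auto simp: algebra_simps)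
    also have "\<dots> = w b - c b" using A b by simp
    finally have "\<bar>c b - w b\<bar> = \<bar>\<Sum>a\<in>A. c a * (m a b - of_bool (a = b))\<bar>" by simp
    also have "\<dots> \<le> (\<Sum>a\<in>A. \<bar>c a * (m a b - of_bool (a = b))\<bar>)" by (rule sum_abs)
    also have "\<dots> \<le> (\<Sum>a\<in>A. s * \<bar>m a b - of_bool (a = b)\<bar>)"
    proof (rule sum_mono)
      fix a assume "a \<in> A"
      then have "\<bar>c a\<bar> \<le> s" unfolding s_def by (rule member_le_sum) (use A in auto)
      then show "\<bar>c a * (m a b - of_bool (a = b))\<bar> \<le> s * \<bar>m a b - of_bool (a = b)\<bar>"
        by (simp add: abs_mult mult_right_mono)
    qed
    finally show ?thesis .
  qed
  have "s \<le> (\<Sum>b\<in>A. \<bar>w b\<bar> + (\<Sum>a\<in>A. s * \<bar>m a b - of_bool (a = b)\<bar>))"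
    unfolding s_def using d s_def by (intro sum_mono) fastforce
  also have "\<dots> = (\<Sum>b\<in>A. \<bar>w b\<bar>) + s * ?e"
    using sum.swap[of "\<lambda>b a. s * \<bar>m a b - of_bool (a = b)\<bar>" A A]
    by (simp add: sum.distrib sum_distrib_left)
  also have "\<dots> \<le> (\<Sum>b\<in>A. \<bar>w b\<bar>) + s * (1/2)"
    using e s0 by (intro add_left_mono mult_left_mono)
  finally have s: "s \<le> 2 * (\<Sum>b\<in>A. \<bar>w b\<bar>)" by simp
  have "(\<Sum>a\<in>A. s * \<bar>m a b - of_bool (a = b)\<bar>) \<le> s * ?e"
    unfolding sum_distrib_left[symmetric] using b A s0
    by (intro mult_left_mono sum_mono member_le_sum) auto
  also have "\<dots> \<le> 2 * (\<Sum>b\<in>A. \<bar>w b\<bar>) * ?e"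
    using s by (intro mult_right_mono) (auto intro!: sum_nonneg)
  finally show ?thesis using d[OF b] by simp
qed

context ssr
begin

lemma flat_sum:
  assumes "p \<in> Carrier M" "\<And>a. a \<in> A \<Longrightarrow> v a \<in> TS p"
  shows "flat_at M g p (\<lambda>f. \<Sum>a\<in>A. c a * v a f) = (\<Sum>a\<in>A. (\<lambda>w. c a * flat_at M g p (v a) w))"
  using assms by (auto simp: fun_eq_iff sum_fun_apply flat_at_def g_sum)

text \<open>Independence of the covectors \<open>g p (v a)\<close> as an indexed family, tested on
  tangent vectors. The indexed form also excludes repetitions, so cardinalities of index sets can be
  compared with the rank.\<close>

definition flat_independent :: "'i set \<Rightarrow> ('i \<Rightarrow> 'a tvec) \<Rightarrow> 'a \<Rightarrow> bool"
  where "flat_independent A v p \<longleftrightarrow> finite A \<and> (\<forall>a\<in>A. v a \<in> TS p) \<and>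
    (\<forall>c. (\<forall>w\<in>TS p. (\<Sum>a\<in>A. c a * g p (v a) w) = 0) \<longrightarrow> (\<forall>a\<in>A. c a = 0))"

lemma T_bullet_span:
  assumes "p \<in> Carrier M"
  shows "\<exists>S. finite S \<and> card S \<le> card C \<and> T_bullet M g p \<subseteq> covec.span S"
proof -
  obtain W E \<xi> where W: "p \<in> W" "local_frame W C E \<xi>" using local_frame_exists[OF assms] by blast
  let ?S = "(\<lambda>a. flat_at M g p (E a p)) ` C"
  have E: "E a p \<in> TS p" if "a \<in> C" for a
    using W(2) that VF_TS[OF _ assms] by (auto simp: local_frame_def)
  have "flat_at M g p v \<in> covec.span ?S" if v: "v \<in> TS p" for v
  proof -
    have "v = (\<lambda>f. \<Sum>a\<in>C. v (\<xi> a) * E a p f)" using W v unfolding local_frame_def by blast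
    then have "flat_at M g p v = flat_at M g p (\<lambda>f. \<Sum>a\<in>C. v (\<xi> a) * E a p f)" by (rule arg_cong)
    also have "\<dots> = (\<Sum>a\<in>C. (\<lambda>w. v (\<xi> a) * flat_at M g p (E a p) w))"
      by (rule flat_sum[OF assms E])
    also have "\<dots> \<in> covec.span ?S"
      by (intro covec.span_sum covec.span_scale covec.span_base imageI)
    finally show ?thesis .
  qed
  then have "T_bullet M g p \<subseteq> covec.span ?S" by (auto simp: T_bullet_def)
  moreover have "finite ?S" "card ?S \<le> card C" using finC by (auto intro: card_image_le)
  ultimately show ?thesis by blast
qed

lemma rank_le: "p \<in> Carrier M \<Longrightarrow> rank_at M g p \<le> card C"
proof -
  assume "p \<in> Carrier M"
  then obtain S where S: "finite S" "card S \<le> card C" "T_bullet M g p \<subseteq> covec.span S"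
    using T_bullet_span by blast
  have "covec.dim (T_bullet M g p) \<le> card S" by (rule covec.dim_le_card[OF S(3,1)])
  then show ?thesis using S(2) unfolding rank_at_def by simp
qed

lemma rank_basis:
  assumes p: "p \<in> Carrier M"
  obtains B where "finite B" "B \<subseteq> T_bullet M g p" "covec.independent B" "T_bullet M g p \<subseteq> covec.span B"
    "card B = rank_at M g p"
proof -
  obtain B where B: "B \<subseteq> T_bullet M g p" "covec.independent B" "T_bullet M g p \<subseteq> covec.span B"
    "card B = rank_at M g p" unfolding rank_at_def using covec.basis_exists by blast
  obtain S where "finite S" "T_bullet M g p \<subseteq> covec.span S" using T_bullet_span[OF p] by blast
  then have "finite B" using covec.independent_span_bound[of S B] B by blast
  then show ?thesis using that B by blast
qed

lemma flat_independent_covec: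
  assumes p: "p \<in> Carrier M" and A: "flat_independent A v p"
  shows "inj_on (\<lambda>a. flat_at M g p (v a)) A" "covec.independent ((\<lambda>a. flat_at M g p (v a)) ` A)"
proof -
  let ?f = "\<lambda>a. flat_at M g p (v a)"
  have fin: "finite A" and ind: "\<And>c. \<forall>w\<in>TS p. (\<Sum>a\<in>A. c a * g p (v a) w) = 0 \<Longrightarrow> \<forall>a\<in>A. c a = 0"
    using A by (auto simp: flat_independent_def)
  show inj: "inj_on ?f A"
  proof (rule inj_onI, rule ccontr)
    fix a b assume ab: "a \<in> A" "b \<in> A" "?f a = ?f b" "a \<noteq> b"
    let ?c = "\<lambda>x. of_bool (x = a) - of_bool (x = b) :: real"
    have "\<forall>w\<in>TS p. (\<Sum>x\<in>A. ?c x * g p (v x) w) = 0"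
    proof
      fix w assume w: "w \<in> TS p"
      have "(\<Sum>x\<in>A. ?c x * g p (v x) w) = (\<Sum>x\<in>A. (if x = a then g p (v x) w else 0) - (if x = b then g p (v x) w else 0))"
        by (rule sum.cong) (auto simp: of_bool_def)
      also have "\<dots> = g p (v a) w - g p (v b) w" using fin ab by (simp add: sum_subtractf)
      also have "\<dots> = 0" using fun_cong[OF ab(3), of w] w by (simp add: flat_at_def)
      finally show "(\<Sum>x\<in>A. ?c x * g p (v x) w) = 0" .
    qed
    from ind[OF this] show False using ab by (auto dest!: bspec[of A _ a])
  qed
  show "covec.independent (?f ` A)"
  proof
    assume "covec.dependent (?f ` A)"
    then obtain u \<alpha> where u: "\<alpha> \<in> ?f ` A" "u \<alpha> \<noteq> 0" "(\<Sum>\<beta>\<in>?f ` A. (\<lambda>w. u \<beta> * \<beta> w)) = 0"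
      using covec.dependent_finite[of "?f ` A"] fin by auto
    have "\<forall>w\<in>TS p. (\<Sum>a\<in>A. u (?f a) * g p (v a) w) = 0"
    proof
      fix w assume w: "w \<in> TS p"
      have "(\<Sum>a\<in>A. u (?f a) * g p (v a) w) = (\<Sum>a\<in>A. u (?f a) * ?f a w)" using w by (simp add: flat_at_def)
      also have "\<dots> = (\<Sum>\<beta>\<in>?f ` A. u \<beta> * \<beta> w)" using inj by (simp add: sum.reindex)
      also have "\<dots> = (\<Sum>\<beta>\<in>?f ` A. (\<lambda>w. u \<beta> * \<beta> w)) w" by (simp add: sum_fun_apply)
      finally show "(\<Sum>a\<in>A. u (?f a) * g p (v a) w) = 0" using u(3) by simp
    qed
    from ind[OF this] u(1,2) show False by blast
  qed
qed

lemma flat_independent_card: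
  assumes p: "p \<in> Carrier M" and A: "flat_independent A v p"
  shows "card A \<le> rank_at M g p"
    "card A = rank_at M g p \<Longrightarrow> T_bullet M g p \<subseteq> covec.span ((\<lambda>a. flat_at M g p (v a)) ` A)"
proof -
  let ?S = "(\<lambda>a. flat_at M g p (v a)) ` A"
  note ind = flat_independent_covec[OF p A]
  have fin: "finite ?S" and ST: "?S \<subseteq> T_bullet M g p" and cS: "card ?S = card A"
    using A ind(1) by (auto simp: flat_independent_def T_bullet_def card_image)
  obtain B where B: "finite B" "B \<subseteq> T_bullet M g p" "T_bullet M g p \<subseteq> covec.span B" "card B = rank_at M g p"
    using rank_basis[OF p] by metis
  have bound: "card S' \<le> rank_at M g p" if "covec.independent S'" "S' \<subseteq> T_bullet M g p" for S'
    using covec.independent_span_bound[OF B(1) that(1)] that(2) B(3,4) by auto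
  show "card A \<le> rank_at M g p" using bound[OF ind(2) ST] cS by simp
  assume eq: "card A = rank_at M g p"
  show "T_bullet M g p \<subseteq> covec.span ?S"
  proof (rule subsetI, rule ccontr)
    fix \<alpha> assume \<alpha>: "\<alpha> \<in> T_bullet M g p" "\<alpha> \<notin> covec.span ?S"
    then have "covec.independent (insert \<alpha> ?S)" by (intro covec.independent_insertI ind(2))
    from bound[OF this] have "card (insert \<alpha> ?S) \<le> card A" using ST \<alpha>(1) eq by simp
    moreover have "\<alpha> \<notin> ?S" using \<alpha>(2) covec.span_base by metis
    ultimately show False using fin cS by simp
  qed
qed

text \<open>Induction over the family in the manner of Gram-Schmidt: each new covector receives a
  vector on which it is 1 and the earlier ones vanish, and the earlier dual vectors are corrected by
  multiples of it.\<close>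

lemma flat_independent_dual:
  assumes p: "p \<in> Carrier M" and A: "flat_independent A v p"
  shows "\<exists>w. (\<forall>a\<in>A. w a \<in> TS p) \<and> (\<forall>a\<in>A. \<forall>b\<in>A. g p (v a) (w b) = of_bool (a = b))"
proof -
  have fin: "finite A" and v: "\<And>a. a \<in> A \<Longrightarrow> v a \<in> TS p"
    and ind: "\<And>c. \<forall>w\<in>TS p. (\<Sum>a\<in>A. c a * g p (v a) w) = 0 \<Longrightarrow> \<forall>a\<in>A. c a = 0"
    using A by (auto simp: flat_independent_def)
  have "\<exists>w. (\<forall>a\<in>A'. w a \<in> TS p) \<and> (\<forall>a\<in>A'. \<forall>b\<in>A'. g p (v a) (w b) = of_bool (a = b))" if "A' \<subseteq> A" for A'
    using finite_subset[OF that fin] that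
  proof (induction A' rule: finite_induct)
    case (insert a A')
    then obtain w where w: "\<And>a. a \<in> A' \<Longrightarrow> w a \<in> TS p"
      "\<And>a b. a \<in> A' \<Longrightarrow> b \<in> A' \<Longrightarrow> g p (v a) (w b) = of_bool (a = b)" by blast
    have a: "a \<in> A" "a \<notin> A'" and sub: "A' \<subseteq> A" using insert by auto
    \<comment> \<open>The coefficients of \<open>v a\<close> minus its combination of the earlier
      covectors, that is, of the part of \<open>v a\<close> that vanishes on the dual vectors found
      so far. The coefficient 1 at \<open>a\<close> is what independence acts on.\<close>
    define d where "d x = (if x = a then 1 else if x \<in> A' then - g p (v a) (w x) else 0)" for x
    have dsum: "(\<Sum>x\<in>A. d x * g p (v x) u) = g p (v a) u - (\<Sum>x\<in>A'. g p (v a) (w x) * g p (v x) u)" for u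
    proof -
      have "(\<Sum>x\<in>A. d x * g p (v x) u) = (\<Sum>x\<in>insert a A'. d x * g p (v x) u)"
        by (rule sum.mono_neutral_right[OF fin]) (use a sub in \<open>auto simp: d_def\<close>)
      also have "\<dots> = g p (v a) u + (\<Sum>x\<in>A'. d x * g p (v x) u)"
        using insert.hyps by (simp add: d_def)
      also have "(\<Sum>x\<in>A'. d x * g p (v x) u) = - (\<Sum>x\<in>A'. g p (v a) (w x) * g p (v x) u)"
        unfolding sum_negf[symmetric] using a by (intro sum.cong) (auto simp: d_def)
      finally show ?thesis by simp
    qed
    have "\<not> (\<forall>u\<in>TS p. (\<Sum>x\<in>A. d x * g p (v x) u) = 0)"
    proof
      assume "\<forall>u\<in>TS p. (\<Sum>x\<in>A. d x * g p (v x) u) = 0"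
      from ind[OF this] have "d a = 0" using a(1) by blast
      then show False by (simp add: d_def)
    qed
    then obtain u where u: "u \<in> TS p" "g p (v a) u - (\<Sum>x\<in>A'. g p (v a) (w x) * g p (v x) u) \<noteq> 0"
      unfolding dsum by blast
    define n where "n = g p (v a) u - (\<Sum>x\<in>A'. g p (v a) (w x) * g p (v x) u)"
    \<comment> \<open>From \<open>u\<close> its components along the earlier dual vectors are
      removed, so that all earlier covectors vanish on \<open>z\<close>; the factor normalises the
      value of \<open>v a\<close> to 1.\<close>
    define z where "z = (\<lambda>f. inverse n * (u f + (\<Sum>x\<in>A'. (- g p (v x) u) * w x f)))"
    have z: "z \<in> TS p" unfolding z_def by (intro TS_scale TS_add u TS_sum w)
    have gz: "g p (v x) z = inverse n * (g p (v x) u + (\<Sum>y\<in>A'. (- g p (v y) u) * g p (v x) (w y)))" if "x \<in> A" for x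
    proof -
      have "g p (v x) z = g p z (v x)" by (rule g_sym[OF p v[OF that] z])
      also have "\<dots> = inverse n * (g p u (v x) + (\<Sum>y\<in>A'. (- g p (v y) u) * g p (w y) (v x)))"
      proof -
        have S: "(\<lambda>f. \<Sum>x\<in>A'. (- g p (v x) u) * w x f) \<in> TS p" by (rule TS_sum[OF w(1)])
        have gs: "g p (\<lambda>f. \<Sum>x\<in>A'. (- g p (v x) u) * w x f) (v x) =
            (\<Sum>y\<in>A'. (- g p (v y) u) * g p (w y) (v x))"
          by (rule g_sum[OF p v[OF that] w(1)])
        show ?thesis
          unfolding z_def g_scale[OF p TS_add[OF u(1) S] v[OF that]] g_add[OF p u(1) S v[OF that]] gs
          by (rule refl)
      qed
      also have "\<dots> = inverse n * (g p (v x) u + (\<Sum>y\<in>A'. (- g p (v y) u) * g p (v x) (w y)))"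
        using g_sym[OF p u(1) v[OF that]] g_sym[OF p _ v[OF that]] w by simp
      finally show ?thesis .
    qed
    have za: "g p (v a) z = 1"
    proof -
      have "g p (v a) u + (\<Sum>y\<in>A'. (- g p (v y) u) * g p (v a) (w y)) = n"
        by (simp add: n_def sum_negf mult.commute)
      then show ?thesis using u(2) gz[OF a(1)] by (simp add: n_def)
    qed
    have zx: "g p (v x) z = 0" if "x \<in> A'" for x
    proof -
      have "(\<Sum>y\<in>A'. (- g p (v y) u) * g p (v x) (w y)) = (\<Sum>y\<in>A'. if x = y then - g p (v y) u else 0)"
        using w(2) that by (intro sum.cong) auto
      also have "\<dots> = - g p (v x) u" using insert.hyps that by simp
      finally show ?thesis using gz[of x] that sub by auto
    qed
    \<comment> \<open>Earlier dual vectors lose the multiple of \<open>z\<close> on which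
      \<open>v a\<close> would see them; the earlier covectors do not notice because they vanish on
      \<open>z\<close>.\<close>
    define w' where "w' x = (if x = a then z else (\<lambda>f. w x f + (- g p (v a) (w x)) * z f))" for x
    have "g p (v x) (w' y) = of_bool (x = y)" if xy: "x \<in> insert a A'" "y \<in> insert a A'" for x y
    proof (cases "y = a")
      case True
      then show ?thesis using za zx xy by (auto simp: w'_def)
    next
      case False
      then have y: "y \<in> A'" using xy by simp
      have "g p (v x) (w' y) = g p (v x) (w y) - g p (v a) (w y) * g p (v x) z"
      proof -
        have vx: "v x \<in> TS p" using v sub a xy by auto
        have "w' y = (\<lambda>f. w y f + (- g p (v a) (w y)) * z f)" using False by (simp add: w'_def)
        then have "g p (v x) (w' y) = g p (v x) (w y) + (- g p (v a) (w y)) * g p (v x) z"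
          using g_addR[OF p w(1)[OF y] TS_scale[OF z] vx, of "- g p (v a) (w y)"]
            g_scaleR[OF p z vx, of "- g p (v a) (w y)"] by simp
        then show ?thesis by simp
      qed
      then show ?thesis using y xy za zx w(2) False a(2) by auto
    qed
    moreover have "w' x \<in> TS p" if "x \<in> insert a A'" for x
    proof (cases "x = a")
      case True
      then show ?thesis using z by (simp add: w'_def)
    next
      case False
      then have "x \<in> A'" using that by simp
      from TS_add[OF w(1)[OF this] TS_scale[OF z, of "- g p (v a) (w x)"]] False
      show ?thesis by (simp only: w'_def if_False)
    qed
    ultimately show ?case by blast
  qed simp
  then show ?thesis by blast
qed

end

section \<open>Regular points and contractions\<close>

context ssr
begin

text \<open>Despite the name, \<open>r\<close> is any point. A basis of \<open>T_bullet\<close> at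
  \<open>r\<close> and its dual vectors are extended to fields; their pairing matrix is continuous
  and equals the identity at \<open>r\<close>, so it stays within 1/2 of the identity nearby, which
  keeps the covectors independent.\<close>

lemma regular_frame:
  assumes r: "r \<in> Carrier M"
  obtains A :: "'a covec set" and V W where
    "finite A" "card A = rank_at M g r" "\<And>a. a \<in> A \<Longrightarrow> V a \<in> VF" "\<And>a. a \<in> A \<Longrightarrow> W a \<in> VF"
    "\<And>a b. a \<in> A \<Longrightarrow> b \<in> A \<Longrightarrow> g r (V a r) (W b r) = of_bool (a = b)"
    "\<forall>\<^sub>F y in nhdsin (Top M) r. flat_independent A (\<lambda>a. V a y) y \<and>
      (\<Sum>a\<in>A. \<Sum>b\<in>A. \<bar>g y (V a y) (W b y) - of_bool (a = b)\<bar>) \<le> 1/2"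
proof -
  obtain A where A: "finite A" "A \<subseteq> T_bullet M g r" "covec.independent A" "card A = rank_at M g r"
    using rank_basis[OF r] by metis
  have "\<forall>\<alpha>\<in>A. \<exists>v. v \<in> TS r \<and> \<alpha> = flat_at M g r v" using A(2) by (auto simp: T_bullet_def)
  then obtain v where v: "\<And>\<alpha>. \<alpha> \<in> A \<Longrightarrow> v \<alpha> \<in> TS r" "\<And>\<alpha>. \<alpha> \<in> A \<Longrightarrow> \<alpha> = flat_at M g r (v \<alpha>)"
    by metis
  have "flat_independent A v r"
    unfolding flat_independent_def
  proof (intro conjI allI impI)
    fix c assume c: "\<forall>w\<in>TS r. (\<Sum>a\<in>A. c a * g r (v a) w) = 0"
    have z: "(\<Sum>a\<in>A. (\<lambda>w. c a * a w)) = 0"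
    proof
      fix w
      show "(\<Sum>a\<in>A. (\<lambda>w. c a * a w)) w = 0 w"
      proof (cases "w \<in> TS r")
        case True
        have "(\<Sum>a\<in>A. c a * a w) = (\<Sum>a\<in>A. c a * g r (v a) w)"
        proof (rule sum.cong[OF refl])
          fix a assume "a \<in> A"
          from fun_cong[OF v(2)[OF this], of w] show "c a * a w = c a * g r (v a) w"
            using True by (simp add: flat_at_def)
        qed
        then show ?thesis using c True by (simp add: sum_fun_apply)
      next
        case False
        have "c a * a w = 0" if "a \<in> A" for a
          using fun_cong[OF v(2)[OF that], of w] False by (simp add: flat_at_def)
        then have "(\<Sum>a\<in>A. c a * a w) = 0" by (intro sum.neutral ballI)
        then show ?thesis by (simp add: sum_fun_apply)
      qed
    qed
    show "\<forall>a\<in>A. c a = 0"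
    proof (rule ccontr)
      assume "\<not> (\<forall>a\<in>A. c a = 0)"
      then have "(\<exists>a\<in>A. c a \<noteq> 0) \<and> (\<Sum>a\<in>A. (\<lambda>w. c a * a w)) = 0" using z by simp
      then have "covec.dependent A" unfolding covec.dependent_finite[OF A(1)] by (intro exI[of _ c])
      then show False using A(3) by simp
    qed
  qed (use A v in auto)
  from flat_independent_dual[OF r this] obtain w where
    w: "\<And>a. a \<in> A \<Longrightarrow> w a \<in> TS r" "\<And>a b. a \<in> A \<Longrightarrow> b \<in> A \<Longrightarrow> g r (v a) (w b) = of_bool (a = b)" by blast
  have "\<exists>V. V \<in> VF \<and> V r = v a" if "a \<in> A" for a
    by (rule vector_extension[OF r v(1)[OF that]]) blast
  then obtain V where V: "\<And>a. a \<in> A \<Longrightarrow> V a \<in> VF" "\<And>a. a \<in> A \<Longrightarrow> V a r = v a" by metis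
  have "\<exists>W. W \<in> VF \<and> W r = w a" if "a \<in> A" for a
    by (rule vector_extension[OF r w(1)[OF that]]) blast
  then obtain W where W: "\<And>a. a \<in> A \<Longrightarrow> W a \<in> VF" "\<And>a. a \<in> A \<Longrightarrow> W a r = w a" by metis
  let ?e = "\<lambda>y. \<Sum>a\<in>A. \<Sum>b\<in>A. \<bar>g y (V a y) (W b y) - of_bool (a = b)\<bar>"
  have dual: "g r (V a r) (W b r) = of_bool (a = b)" if "a \<in> A" "b \<in> A" for a b
    using that V W w by simp
  have "(?e \<longlongrightarrow> ?e r) (nhdsin (Top M) r)"
    by (intro tendsto_sum tendsto_rabs tendsto_diff tendsto_const C_inf_tendsto[of "\<lambda>y. g y (V _ y) (W _ y)"] g_smooth V W r)
  moreover have "?e r = 0" using dual by simp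
  ultimately have "\<forall>\<^sub>F y in nhdsin (Top M) r. ?e y < 1/2" using order_tendstoD(2)[of ?e 0 _ "1/2"] by simp
  moreover have "\<forall>\<^sub>F y in nhdsin (Top M) r. y \<in> Carrier M"
    using r by (auto simp: eventually_nhdsin)
  ultimately have ev: "\<forall>\<^sub>F y in nhdsin (Top M) r. flat_independent A (\<lambda>a. V a y) y \<and> ?e y \<le> 1/2"
  proof eventually_elim
    fix y assume e: "?e y < 1/2" and y: "y \<in> Carrier M"
    have "c b = 0" if c: "\<forall>w\<in>TS y. (\<Sum>a\<in>A. c a * g y (V a y) w) = 0" and b: "b \<in> A" for c b
    proof -
      have "\<bar>c b - 0\<bar> \<le> 2 * (\<Sum>a\<in>A. \<bar>0\<bar>) * ?e y"
        by (rule near_identity[OF A(1) _ _ b]) (use e c W VF_TS[OF _ y] in auto)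
      then show ?thesis by simp
    qed
    then show "flat_independent A (\<lambda>a. V a y) y \<and> ?e y \<le> 1/2"
      using e A(1) V VF_TS[OF _ y] by (auto simp: flat_independent_def)
  qed
  show thesis by (rule that[OF A(1,4) V(1) W(1) dual ev])
qed

lemma rank_lower_semicontinuous:
  assumes r: "r \<in> Carrier M"
  shows "\<forall>\<^sub>F y in nhdsin (Top M) r. y \<in> Carrier M \<and> rank_at M g r \<le> rank_at M g y"
proof -
  obtain A :: "'a covec set" and V W where A: "card A = rank_at M g r"
    "\<forall>\<^sub>F y in nhdsin (Top M) r. flat_independent A (\<lambda>a. V a y) y \<and>
      (\<Sum>a\<in>A. \<Sum>b\<in>A. \<bar>g y (V a y) (W b y) - of_bool (a = b)\<bar>) \<le> 1/2"
    by (rule regular_frame[OF r]) blast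
  have "\<forall>\<^sub>F y in nhdsin (Top M) r. y \<in> Carrier M"
    using r by (auto simp: eventually_nhdsin)
  with A(2) show ?thesis
  proof eventually_elim
    fix y assume "flat_independent A (\<lambda>a. V a y) y \<and>
      (\<Sum>a\<in>A. \<Sum>b\<in>A. \<bar>g y (V a y) (W b y) - of_bool (a = b)\<bar>) \<le> 1/2" "y \<in> Carrier M"
    with flat_independent_card(1)[of y A "\<lambda>a. V a y"] A(1)
    show "y \<in> Carrier M \<and> rank_at M g r \<le> rank_at M g y" by simp
  qed
qed

text \<open>The rank is bounded by the dimension, so it attains a maximum on \<open>U\<close>; at a
  point of maximal rank lower semicontinuity makes it locally constant.\<close>

lemma regular_points_dense:
  assumes U: "openin (Top M) U" "U \<noteq> {}"
  shows "U \<inter> regular_points M g \<noteq> {}"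
proof -
  have UC: "U \<subseteq> Carrier M" using openin_subset[OF U(1)] .
  have fin: "finite (rank_at M g ` U)"
    by (rule finite_subset[of _ "{..card C}"]) (use rank_le UC in auto)
  have "Max (rank_at M g ` U) \<in> rank_at M g ` U" by (rule Max_in[OF fin]) (use U in simp)
  then obtain r where r: "r \<in> U" "\<And>y. y \<in> U \<Longrightarrow> rank_at M g y \<le> rank_at M g r"
  proof -
    from \<open>Max (rank_at M g ` U) \<in> rank_at M g ` U\<close> obtain r where "r \<in> U" "Max (rank_at M g ` U) = rank_at M g r" by blast
    moreover have "rank_at M g y \<le> Max (rank_at M g ` U)" if "y \<in> U" for y
      by (rule Max_ge[OF fin]) (use that in blast)
    ultimately show thesis using that by simp
  qed
  have "r \<in> Carrier M" using r UC by blast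
  from rank_lower_semicontinuous[OF this] this obtain S where S: "openin (Top M) S" "r \<in> S"
    "\<forall>y\<in>S. rank_at M g r \<le> rank_at M g y" unfolding eventually_nhdsin by blast
  have "openin (Top M) (U \<inter> S) \<and> r \<in> U \<inter> S \<and> (\<forall>q\<in>U \<inter> S. rank_at M g q = rank_at M g r)"
    using U S r by (auto intro!: antisym)
  then have "r \<in> regular_points M g" unfolding regular_points_def by blast
  then show ?thesis using r by blast
qed

lemma regular_points_Carrier: "p \<in> regular_points M g \<Longrightarrow> p \<in> Carrier M"
  unfolding regular_points_def using openin_subset by blast

text \<open>Near a regular point, the coefficients of a form with respect to a basis of \<open>T\<^sup>\<bullet>M\<close> solve a
  linear system that is close to the identity.\<close>

lemma g_bullet_tendsto_regular:
  assumes \<omega>: "one_form \<omega>" "\<And>p. p \<in> Carrier M \<Longrightarrow> \<exists>v. represents \<omega> p v"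
    and \<tau>: "one_form \<tau>" "\<And>p. p \<in> Carrier M \<Longrightarrow> \<exists>v. represents \<tau> p v"
    and r: "r \<in> regular_points M g"
  defines "G \<equiv> \<lambda>y. g_bullet M g y (form_at M \<omega> y) (form_at M \<tau> y)"
  shows "(G \<longlongrightarrow> G r) (nhdsin (Top M) r)"
proof -
  have rC: "r \<in> Carrier M" by (rule regular_points_Carrier[OF r])
  let ?F = "nhdsin (Top M) r"
  obtain A :: "'a covec set" and V W where A: "finite A" "card A = rank_at M g r"
    and V: "\<And>a. a \<in> A \<Longrightarrow> V a \<in> VF" and W: "\<And>a. a \<in> A \<Longrightarrow> W a \<in> VF"
    and dual: "\<And>a b. a \<in> A \<Longrightarrow> b \<in> A \<Longrightarrow> g r (V a r) (W b r) = of_bool (a = b)"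
    and ev: "\<forall>\<^sub>F y in ?F. flat_independent A (\<lambda>a. V a y) y \<and>
      (\<Sum>a\<in>A. \<Sum>b\<in>A. \<bar>g y (V a y) (W b y) - of_bool (a = b)\<bar>) \<le> 1/2"
    by (rule regular_frame[OF rC]) blast
  let ?e = "\<lambda>y. \<Sum>a\<in>A. \<Sum>b\<in>A. \<bar>g y (V a y) (W b y) - of_bool (a = b)\<bar>"
  have "(?e \<longlongrightarrow> ?e r) ?F"
    by (intro tendsto_sum tendsto_rabs tendsto_diff tendsto_const C_inf_tendsto[of "\<lambda>y. g y (V _ y) (W _ y)"] g_smooth V W rC)
  then have e0: "(?e \<longlongrightarrow> 0) ?F" using dual by simp
  have er: "?e r = 0" using dual by simp
  have reg: "\<forall>\<^sub>F y in ?F. y \<in> Carrier M \<and> rank_at M g y = card A"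
  proof -
    obtain U where "openin (Top M) U" "r \<in> U" "\<forall>q\<in>U. rank_at M g q = rank_at M g r"
      using r unfolding regular_points_def by blast
    moreover from this have "\<forall>q\<in>U. q \<in> Carrier M" using openin_subset by blast
    ultimately have "\<exists>S. openin (Top M) S \<and> r \<in> S \<and> (\<forall>y\<in>S. y \<in> Carrier M \<and> rank_at M g y = card A)"
      unfolding A(2) by blast
    then show ?thesis unfolding eventually_nhdsin by blast
  qed
  define good where "good y \<longleftrightarrow> y \<in> Carrier M \<and> rank_at M g y = card A \<and> flat_independent A (\<lambda>a. V a y) y \<and> ?e y \<le> 1/2" for y
  have evgood: "\<forall>\<^sub>F y in ?F. good y"
    using ev reg by eventually_elim (simp add: good_def)
  then have goodr: "good r" using rC unfolding eventually_nhdsin by blast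
  \<comment> \<open>Since the rank is constant near \<open>r\<close>, the flats of the frame are as
    many as the rank also at \<open>y\<close>; they therefore span \<open>T_bullet\<close>, and the
    form has coefficients with respect to them.\<close>
  have ex: "\<exists>c. good y \<longrightarrow> (\<forall>Z\<in>VF. \<omega> Z y = (\<Sum>a\<in>A. c a * g y (V a y) (Z y)))" for y
  proof (cases "good y")
    case True
    then have y: "y \<in> Carrier M" by (simp add: good_def)
    let ?f = "\<lambda>a. flat_at M g y (V a y)"
    have fi: "flat_independent A (\<lambda>a. V a y) y" using True by (simp add: good_def)
    have "form_at M \<omega> y \<in> covec.span (?f ` A)"
      using flat_independent_card(2)[OF y fi] form_at_in_T_bullet[OF \<omega>(1) y] \<omega>(2)[OF y] True
      by (auto simp: good_def)
    then obtain c where c: "form_at M \<omega> y = (\<Sum>\<alpha>\<in>?f ` A. (\<lambda>w. c \<alpha> * \<alpha> w))"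
      using covec.span_finite[of "?f ` A"] A(1) by auto
    have "\<omega> Z y = (\<Sum>a\<in>A. c (?f a) * g y (V a y) (Z y))" if Z: "Z \<in> VF" for Z
    proof -
      have "\<omega> Z y = form_at M \<omega> y (Z y)" by (rule form_at_eq[OF \<omega>(1) Z y, symmetric])
      also have "\<dots> = (\<Sum>\<alpha>\<in>?f ` A. c \<alpha> * \<alpha> (Z y))" unfolding c by (simp add: sum_fun_apply)
      also have "\<dots> = (\<Sum>a\<in>A. c (?f a) * ?f a (Z y))"
        using flat_independent_covec(1)[OF y fi] by (simp add: sum.reindex)
      finally show ?thesis using VF_TS[OF Z y] by (simp add: flat_at_def)
    qed
    then show ?thesis by (intro exI[of _ "\<lambda>a. c (?f a)"]) blast
  qed blast
  have "\<forall>y. \<exists>c. good y \<longrightarrow> (\<forall>Z\<in>VF. \<omega> Z y = (\<Sum>a\<in>A. c a * g y (V a y) (Z y)))"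
    by (rule allI, rule ex)
  from choice[OF this] obtain c where
    c0: "\<forall>y. good y \<longrightarrow> (\<forall>Z\<in>VF. \<omega> Z y = (\<Sum>a\<in>A. c y a * g y (V a y) (Z y)))" by (elim exE)
  note c = c0[rule_format]
  \<comment> \<open>Testing with the fields \<open>W b\<close> turns the expansion into a linear
    system whose matrix is the pairing of the two frames. Its distance to the identity tends to 0 at
    \<open>r\<close>, and the coefficients tend to their values there.\<close>
  have cb: "\<bar>c y b - \<omega> (W b) y\<bar> \<le> 2 * (\<Sum>a\<in>A. \<bar>\<omega> (W a) y\<bar>) * ?e y" if "good y" "b \<in> A" for y b
    by (rule near_identity[OF A(1) _ _ that(2)]) (use that c W in \<open>auto simp: good_def\<close>)
  have cr: "c r b = \<omega> (W b) r" if "b \<in> A" for b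
    using cb[OF goodr that] unfolding er by simp
  have climit: "((\<lambda>y. c y b) \<longlongrightarrow> c r b) ?F" if b: "b \<in> A" for b
  proof -
    have "((\<lambda>y. 2 * (\<Sum>a\<in>A. \<bar>\<omega> (W a) y\<bar>) * ?e y) \<longlongrightarrow> 2 * (\<Sum>a\<in>A. \<bar>\<omega> (W a) r\<bar>) * 0) ?F"
      by (intro tendsto_mult tendsto_const tendsto_sum tendsto_rabs e0 C_inf_tendsto one_form_smooth[OF \<omega>(1)] W rC)
    then have lim: "((\<lambda>y. 2 * (\<Sum>a\<in>A. \<bar>\<omega> (W a) y\<bar>) * ?e y) \<longlongrightarrow> 0) ?F" by simp
    have "((\<lambda>y. c y b - \<omega> (W b) y) \<longlongrightarrow> 0) ?F"
    proof (rule Lim_null_comparison[OF _ lim])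
      show "\<forall>\<^sub>F y in ?F. norm (c y b - \<omega> (W b) y) \<le> 2 * (\<Sum>a\<in>A. \<bar>\<omega> (W a) y\<bar>) * ?e y"
        using evgood by eventually_elim (use cb[OF _ b] in simp)
    qed
    from tendsto_add[OF this C_inf_tendsto[OF one_form_smooth[OF \<omega>(1) W[OF b]] rC]]
    show ?thesis using cr[OF b] by simp
  qed
  \<comment> \<open>The frame combination is a representative of \<open>\<omega>\<close>, so the
    inner product reduces to values of \<open>\<tau>\<close> on the frame: smooth functions with
    coefficients that are continuous at \<open>r\<close>.\<close>
  have Geq: "G y = (\<Sum>a\<in>A. c y a * \<tau> (V a) y)" if y: "good y" for y
  proof -
    have yC: "y \<in> Carrier M" using y by (simp add: good_def)
    let ?v = "\<lambda>f. \<Sum>a\<in>A. c y a * V a y f"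
    have V': "a \<in> A \<Longrightarrow> V a y \<in> TS y" for a using V VF_TS[OF _ yC] by blast
    have "represents \<omega> y ?v"
      unfolding represents_def
    proof (intro conjI ballI)
      show "?v \<in> TS y" by (rule TS_sum[OF V'])
      fix Z assume Z: "Z \<in> VF"
      have "g y ?v (Z y) = (\<Sum>a\<in>A. c y a * g y (V a y) (Z y))"
        by (rule g_sum[OF yC VF_TS[OF Z yC] V'])
      then show "\<omega> Z y = g y ?v (Z y)" using c[OF y Z] by simp
    qed
    moreover obtain w where w: "represents \<tau> y w" using \<tau>(2)[OF yC] by blast
    ultimately have "G y = g y ?v w"
      unfolding G_def by (rule g_bullet_represents[OF \<omega>(1) \<tau>(1) yC])
    also have "\<dots> = (\<Sum>a\<in>A. c y a * g y (V a y) w)"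
      by (rule g_sum[OF yC _ V']) (use w in \<open>auto simp: represents_def\<close>)
    also have "\<dots> = (\<Sum>a\<in>A. c y a * \<tau> (V a) y)"
      using w V V' by (intro sum.cong) (auto simp: represents_def g_sym[OF yC])
    finally show ?thesis .
  qed
  have "((\<lambda>y. \<Sum>a\<in>A. c y a * \<tau> (V a) y) \<longlongrightarrow> (\<Sum>a\<in>A. c r a * \<tau> (V a) r)) ?F"
    by (intro tendsto_sum tendsto_mult climit C_inf_tendsto one_form_smooth[OF \<tau>(1)] V rC)
  then show ?thesis
    unfolding Geq[OF goodr]
    by (rule Lim_transform_eventually) (use evgood in \<open>eventually_elim, simp add: Geq\<close>)
qed

text \<open>At a regular point the difference of \<open>h\<close> and the pointwise inner product is
  continuous. If it were non-zero there, it would be non-zero on a neighbourhood, which contains a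
  point where the two agree.\<close>

lemma is_contractionI_dense:
  assumes \<omega>: "one_form \<omega>" "\<And>p. p \<in> Carrier M \<Longrightarrow> \<exists>v. represents \<omega> p v"
    and \<tau>: "one_form \<tau>" "\<And>p. p \<in> Carrier M \<Longrightarrow> \<exists>v. represents \<tau> p v"
    and h: "h \<in> C_inf M"
    and D: "\<And>U. openin (Top M) U \<Longrightarrow> U \<noteq> {} \<Longrightarrow> \<exists>y\<in>U. g_bullet M g y (form_at M \<omega> y) (form_at M \<tau> y) = h y"
  shows "is_contraction M g \<omega> \<tau> h"
  unfolding is_contraction_def
proof (intro conjI ballI h)
  fix r assume r: "r \<in> regular_points M g"
  then have rC: "r \<in> Carrier M" by (rule regular_points_Carrier)
  let ?G = "\<lambda>y. g_bullet M g y (form_at M \<omega> y) (form_at M \<tau> y)"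
  have lim: "((\<lambda>y. h y - ?G y) \<longlongrightarrow> h r - ?G r) (nhdsin (Top M) r)"
    by (intro tendsto_diff C_inf_tendsto h rC g_bullet_tendsto_regular \<omega> \<tau> r)
  show "h r = ?G r"
  proof (rule ccontr)
    assume "h r \<noteq> ?G r"
    then have "h r - ?G r \<noteq> 0" by simp
    from tendsto_imp_eventually_ne[OF lim this] rC obtain S
      where "openin (Top M) S" "r \<in> S" "\<forall>y\<in>S. h y - ?G y \<noteq> 0" unfolding eventually_nhdsin by blast
    moreover from this obtain y where "y \<in> S" "?G y = h y" using D[of S] by blast
    ultimately show False by fastforce
  qed
qed

lemma contraction_eq:
  assumes h: "is_contraction M g \<omega> \<tau> h" and p: "p \<in> Carrier M"
  shows "contraction M g \<omega> \<tau> p = h p"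
proof -
  let ?c = "contraction M g \<omega> \<tau>"
  have c: "is_contraction M g \<omega> \<tau> ?c" unfolding contraction_def by (rule someI[of "is_contraction M g \<omega> \<tau>", OF h])
  have lim: "((\<lambda>y. ?c y - h y) \<longlongrightarrow> ?c p - h p) (nhdsin (Top M) p)"
    using c h unfolding is_contraction_def by (intro tendsto_diff C_inf_tendsto p) blast+
  show ?thesis
  proof (rule ccontr)
    assume "?c p \<noteq> h p"
    then have "?c p - h p \<noteq> 0" by simp
    from tendsto_imp_eventually_ne[OF lim this] p obtain S
      where S: "openin (Top M) S" "p \<in> S" "\<forall>y\<in>S. ?c y - h y \<noteq> 0" unfolding eventually_nhdsin by blast
    then obtain y where "y \<in> S" "y \<in> regular_points M g" using regular_points_dense[of S] by blast
    then show False using S(3) c h unfolding is_contraction_def by auto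
  qed
qed

section \<open>The semi-symmetric metric curvature\<close>

definition flat_valued :: "('a vfield \<Rightarrow> 'a \<Rightarrow> real) \<Rightarrow> bool"
  where "flat_valued \<omega> \<longleftrightarrow> (\<forall>p\<in>Carrier M. \<exists>v. represents \<omega> p v)"

context
  fixes P assumes P: "P \<in> VF"
begin

abbreviation "KP \<equiv> ssm_koszul g P"

text \<open>The two correction terms of the semi-symmetric Koszul form are multiples of the flats of
  \<open>X\<close> and \<open>P\<close>, so a representative of the Koszul form is corrected by the
  same multiples of these vectors.\<close>

lemma represents_KP:
  assumes p: "p \<in> Carrier M" and X: "X \<in> VF" and Y: "Y \<in> VF" and v: "represents (K X Y) p v"
  shows "represents (KP X Y) p (\<lambda>f. v f + (g p (Y p) (P p) * X p f + (- g p (X p) (Y p)) * P p f))"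
proof -
  note T = VF_TS[OF X p] VF_TS[OF Y p] VF_TS[OF P p]
  have vT: "v \<in> TS p" using v by (simp add: represents_def)
  show ?thesis
    unfolding represents_def
  proof (intro conjI ballI)
    show "(\<lambda>f. v f + (g p (Y p) (P p) * X p f + (- g p (X p) (Y p)) * P p f)) \<in> TS p"
      by (intro TS_add TS_scale T vT)
    fix Z assume Z: "Z \<in> VF"
    have "g p (\<lambda>f. v f + (g p (Y p) (P p) * X p f + (- g p (X p) (Y p)) * P p f)) (Z p) =
        g p v (Z p) + (g p (Y p) (P p) * g p (X p) (Z p) + (- g p (X p) (Y p)) * g p (P p) (Z p))"
      using p T vT VF_TS[OF Z p] by (simp only: g_add g_scale TS_add TS_scale)
    then show "KP X Y Z p = g p (\<lambda>f. v f + (g p (Y p) (P p) * X p f + (- g p (X p) (Y p)) * P p f)) (Z p)"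
      using v Z by (simp add: represents_def ssm_koszul_def)
  qed
qed

lemma one_form_KP:
  assumes X: "X \<in> VF" and Y: "Y \<in> VF"
  shows "one_form (KP X Y)"
  unfolding one_form_def
proof (intro conjI ballI impI)
  note k = one_form_koszul[OF X Y]
  show "KP X Y Z \<in> C_inf M" if "Z \<in> VF" for Z
    using that X Y P by (simp add: ssm_koszul_def)
  show "KP X Y (\<lambda>p f. Z p f + Z' p f) p = KP X Y Z p + KP X Y Z' p"
    if "Z \<in> VF" "Z' \<in> VF" "p \<in> Carrier M" for Z Z' p
    using that X Y P by (simp add: ssm_koszul_def one_form_add[OF k] g_addR VF_TS algebra_simps)
  show "KP X Y (\<lambda>p f. h p * Z p f) p = h p * KP X Y Z p"
    if "Z \<in> VF" "h \<in> C_inf M" "p \<in> Carrier M" for Z h p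
    using that X Y P by (simp add: ssm_koszul_def one_form_scale[OF k] g_scaleR VF_TS algebra_simps)
  show "KP X Y Z p = KP X Y Z' p" if "Z \<in> VF" "Z' \<in> VF" "p \<in> Carrier M" "Z p = Z' p" for Z Z' p
    using that one_form_tensorial[OF k that] by (simp add: ssm_koszul_def)
qed

text \<open>The inner product of the two corrected representatives is expanded bilinearly. Mixed
  terms pair a representative with a vector and are therefore plain values of the Koszul form; only
  the leading term needs a contraction, supplied by \<open>h\<close>.\<close>

lemma contraction_KP:
  assumes X: "X \<in> VF" and Y: "Y \<in> VF" and Z: "Z \<in> VF" and T: "T \<in> VF"
    and f: "flat_valued (K X Z)" "flat_valued (K Y T)" and h: "is_contraction M g (K X Z) (K Y T) h"
    and p: "p \<in> Carrier M"
  shows "contraction M g (KP X Z) (KP Y T) p = contraction M g (K X Z) (K Y T) p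
    + g p (T p) (P p) * K X Z Y p - g p (Y p) (T p) * K X Z P p
    + g p (Z p) (P p) * K Y T X p - g p (X p) (Z p) * K Y T P p
    + g p (Z p) (P p) * g p (T p) (P p) * g p (X p) (Y p)
    - g p (Z p) (P p) * g p (Y p) (T p) * g p (X p) (P p)
    - g p (X p) (Z p) * g p (T p) (P p) * g p (P p) (Y p)
    + g p (X p) (Z p) * g p (Y p) (T p) * g p (P p) (P p)"
proof -
  let ?h = "\<lambda>p. h p + g p (T p) (P p) * K X Z Y p - g p (Y p) (T p) * K X Z P p
    + g p (Z p) (P p) * K Y T X p - g p (X p) (Z p) * K Y T P p
    + g p (Z p) (P p) * g p (T p) (P p) * g p (X p) (Y p)
    - g p (Z p) (P p) * g p (Y p) (T p) * g p (X p) (P p)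
    - g p (X p) (Z p) * g p (T p) (P p) * g p (P p) (Y p)
    + g p (X p) (Z p) * g p (Y p) (T p) * g p (P p) (P p)"
  have hC: "h \<in> C_inf M" using h by (simp add: is_contraction_def)
  have "is_contraction M g (KP X Z) (KP Y T) ?h"
    unfolding is_contraction_def
  proof (intro conjI ballI)
    show "?h \<in> C_inf M"
      by (intro C_inf_add C_inf_diff C_inf_mult hC koszul_smooth g_smooth X Y Z T P)
    fix q assume q: "q \<in> regular_points M g"
    have qC: "q \<in> Carrier M" by (rule regular_points_Carrier[OF q])
    obtain v w where v: "represents (K X Z) q v" and w: "represents (K Y T) q w"
      using f qC unfolding flat_valued_def by meson
    have vT: "v \<in> TS q" and wT: "w \<in> TS q" using v w by (auto simp: represents_def)
    note S = VF_TS[OF X qC] VF_TS[OF Y qC] VF_TS[OF Z qC] VF_TS[OF T qC] VF_TS[OF P qC] vT wT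
    have "h q = g_bullet M g q (form_at M (K X Z) q) (form_at M (K Y T) q)"
      using h q by (simp add: is_contraction_def)
    also have "\<dots> = g q v w"
      by (rule g_bullet_represents[OF one_form_koszul[OF X Z] one_form_koszul[OF Y T] qC v w])
    finally have h0: "g q v w = h q" by simp
    have k: "g q v (Y q) = K X Z Y q" "g q v (P q) = K X Z P q"
      "g q w (X q) = K Y T X q" "g q w (P q) = K Y T P q"
      using v w X Y P by (auto simp: represents_def)
    have k': "g q (X q) w = K Y T X q" "g q (P q) w = K Y T P q"
      using k g_sym[OF qC S(1,7)] g_sym[OF qC S(5,7)] by auto
    have "g_bullet M g q (form_at M (KP X Z) q) (form_at M (KP Y T) q) =
      g q (\<lambda>f. v f + (g q (Z q) (P q) * X q f + (- g q (X q) (Z q)) * P q f))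
          (\<lambda>f. w f + (g q (T q) (P q) * Y q f + (- g q (Y q) (T q)) * P q f))"
      by (rule g_bullet_represents[OF one_form_KP[OF X Z] one_form_KP[OF Y T] qC
            represents_KP[OF qC X Z v] represents_KP[OF qC Y T w]])
    also have "\<dots> = g q v w + (g q (T q) (P q) * g q v (Y q) + (- g q (Y q) (T q)) * g q v (P q)) +
      (g q (Z q) (P q) * (g q (X q) w + (g q (T q) (P q) * g q (X q) (Y q) + (- g q (Y q) (T q)) * g q (X q) (P q))) +
       (- g q (X q) (Z q)) * (g q (P q) w + (g q (T q) (P q) * g q (P q) (Y q) + (- g q (Y q) (T q)) * g q (P q) (P q))))"
      using qC S by (simp only: g_add g_scale g_addR g_scaleR TS_add TS_scale)
    finally show "?h q = g_bullet M g q (form_at M (KP X Z) q) (form_at M (KP Y T) q)"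
      unfolding h0 k k' by (simp add: algebra_simps)
  qed
  from contraction_eq[OF this p] contraction_eq[OF h p] show ?thesis by simp
qed

text \<open>Derivatives of the correction terms are rewritten by metric compatibility, and the
  bracket by vanishing torsion. Against the mixed terms of the contractions everything cancels
  except the Koszul terms with \<open>P\<close> in the second slot, the lowered covariant derivative
  of \<open>P\<close>, and products of metric values.\<close>

lemma ssm_curvature_eq:
  assumes X: "X \<in> VF" and Y: "Y \<in> VF" and Z: "Z \<in> VF" and T: "T \<in> VF"
    and f: "\<And>A B. A \<in> {X, Y} \<Longrightarrow> B \<in> {Z, T} \<Longrightarrow> flat_valued (K A B)"
    and h: "is_contraction M g (K X Z) (K Y T) h" "is_contraction M g (K Y Z) (K X T) h'"
    and p: "p \<in> Carrier M"
  shows "ssm_curvature M g P X Y Z T p = curvature M g X Y Z T p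
    + g p (Y p) (T p) * K X P Z p - g p (Y p) (Z p) * K X P T p
    - g p (X p) (T p) * K Y P Z p + g p (X p) (Z p) * K Y P T p
    + (g p (X p) (Z p) * g p (Y p) (T p) - g p (Y p) (Z p) * g p (X p) (T p)) * g p (P p) (P p)
    - g p (X p) (P p) * (g p (Z p) (P p) * g p (Y p) (T p) - g p (T p) (P p) * g p (Y p) (Z p))
    + g p (Y p) (P p) * (g p (Z p) (P p) * g p (X p) (T p) - g p (X p) (Z p) * g p (T p) (P p))"
proof -
  note TX = VF_TS[OF X p] and TY = VF_TS[OF Y p]
  have D: "v (KP Y' Z T) = v (K Y' Z T)
      + (g p (Z p) (P p) * v (\<lambda>q. g q (Y' q) (T q)) + g p (Y' p) (T p) * v (\<lambda>q. g q (Z q) (P q)))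
      - (g p (Y' p) (Z p) * v (\<lambda>q. g q (P q) (T q)) + g p (P p) (T p) * v (\<lambda>q. g q (Y' q) (Z q)))"
    if v: "v \<in> TS p" and Y': "Y' \<in> VF" for v Y'
    unfolding ssm_koszul_def using Y' Z T P
    by (simp add: tan_diff[OF v] tan_add[OF v] tan_mult[OF v])
  note m = koszul_metric[OF _ _ _ p]
  have b: "KP (lie_bracket X Y) Z T p = K (lie_bracket X Y) Z T p
     + g p (Z p) (P p) * (K X Y T p - K Y X T p) - (K X Y Z p - K Y X Z p) * g p (P p) (T p)"
    using koszul_torsion[OF X Y Z p] koszul_torsion[OF X Y T p] by (simp add: ssm_koszul_def)
  note s = g_sym[OF p VF_TS[OF _ p] VF_TS[OF _ p]]
  note sy = s[OF Y X] s[OF P X] s[OF P Y] s[OF P Z] s[OF P T]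
  show ?thesis
    unfolding ssm_curvature_def curvature_def curvature_of_def D[OF TX Y] D[OF TY X] b
      contraction_KP[OF X Y Z T f f h(1) p, simplified] contraction_KP[OF Y X Z T f f h(2) p, simplified]
      m[OF X Y T] m[OF X Z P] m[OF X P T] m[OF X Y Z] m[OF Y X T] m[OF Y Z P] m[OF Y P T] m[OF Y X Z] sy
    by (simp add: algebra_simps)
qed

end

section \<open>Musical isomorphism of a non-degenerate metric\<close>

text \<open>Gaussian elimination on the unknowns. It needs a smooth reciprocal of one pivot at a
  time, and injectivity at the single point \<open>r\<close> suffices because a pivot that is
  non-zero at \<open>r\<close> stays so nearby.\<close>

lemma (in mfd) linear_system_smooth:
  assumes "finite A" "finite B" "card A = card B" "r \<in> Carrier M"
    and "\<And>a b. m a b \<in> C_inf M" "\<And>b. w b \<in> C_inf M"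
    and "\<And>c. (\<forall>b\<in>B. (\<Sum>a\<in>A. c a * m a b r) = 0) \<Longrightarrow> \<forall>a\<in>A. c a = 0"
  shows "\<exists>c U. (\<forall>a. c a \<in> C_inf M) \<and> openin (Top M) U \<and> r \<in> U \<and>
    (\<forall>y\<in>U. \<forall>b\<in>B. (\<Sum>a\<in>A. c a y * m a b y) = w b y)"
  using assms
proof (induction A arbitrary: B m w rule: finite_induct)
  case empty
  then have "B = {}" by simp
  then show ?case using empty by (intro exI[of _ "\<lambda>_ _. 0"] exI[of _ "Carrier M"]) auto
next
  case (insert a0 A)
  note inj = insert.prems(6)
  \<comment> \<open>Without a pivot the unit vector of \<open>a0\<close> would solve the homogeneous
    system at \<open>r\<close>.\<close>
  have "\<exists>b0\<in>B. m a0 b0 r \<noteq> 0"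
  proof (rule ccontr)
    assume "\<not> ?thesis"
    then have "\<forall>b\<in>B. (\<Sum>a\<in>insert a0 A. of_bool (a = a0) * m a b r) = 0"
      using insert.hyps by (auto intro!: sum.neutral)
    from inj[OF this] show False by simp
  qed
  then obtain b0 where b0: "b0 \<in> B" "m a0 b0 r \<noteq> 0" by blast
  obtain V e where V: "openin (Top M) V" "r \<in> V" "e \<in> C_inf M" "\<And>y. y \<in> V \<Longrightarrow> e y * m a0 b0 y = 1"
    using C_inf_reciprocal[OF insert.prems(4) insert.prems(3) b0(2)] by blast
  \<comment> \<open>Equation \<open>b\<close> minus the multiple of equation \<open>b0\<close> that
    removes the unknown \<open>a0\<close>; \<open>e\<close> is a global smooth function that is the
    reciprocal of the pivot on \<open>V\<close>.\<close>
  define m' where "m' a b = (\<lambda>y. m a b y - m a b0 y * (e y * m a0 b y))" for a b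
  define w' where "w' b = (\<lambda>y. w b y - w b0 y * (e y * m a0 b y))" for b
  have split: "(\<Sum>a\<in>A. c a * m' a b y) = (\<Sum>a\<in>A. c a * m a b y) - (\<Sum>a\<in>A. c a * m a b0 y) * (e y * m a0 b y)"
    for c b y
    unfolding m'_def by (simp add: right_diff_distrib sum_subtractf sum_distrib_right mult.assoc)
  have "\<exists>c U. (\<forall>a. c a \<in> C_inf M) \<and> openin (Top M) U \<and> r \<in> U \<and>
    (\<forall>y\<in>U. \<forall>b\<in>B - {b0}. (\<Sum>a\<in>A. c a y * m' a b y) = w' b y)"
  proof (rule insert.IH)
    show "finite (B - {b0})" "r \<in> Carrier M" using insert.prems by auto
    show "card A = card (B - {b0})" using insert.prems(1,2) insert.hyps b0(1) by simp
    show "m' a b \<in> C_inf M" "w' b \<in> C_inf M" for a b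
      unfolding m'_def w'_def using insert.prems V by simp_all
    fix c assume c: "\<forall>b\<in>B - {b0}. (\<Sum>a\<in>A. c a * m' a b r) = 0"
    \<comment> \<open>A solution of the reduced homogeneous system is completed by solving equation
      \<open>b0\<close> for the unknown \<open>a0\<close>; it then solves the full system, and
      injectivity applies.\<close>
    define c' where "c' a = (if a = a0 then - (\<Sum>a\<in>A. c a * m a b0 r) * e r else c a)" for a
    have c'A: "(\<Sum>a\<in>A. c' a * m a b r) = (\<Sum>a\<in>A. c a * m a b r)" for b
      using insert.hyps by (intro sum.cong) (auto simp: c'_def)
    have full: "(\<Sum>a\<in>insert a0 A. c' a * m a b r) = (\<Sum>a\<in>A. c a * m' a b r)" for b
      unfolding split using insert.hyps c'A by (simp add: c'_def algebra_simps)
    have "\<forall>b\<in>B. (\<Sum>a\<in>insert a0 A. c' a * m a b r) = 0"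
    proof
      fix b assume "b \<in> B"
      show "(\<Sum>a\<in>insert a0 A. c' a * m a b r) = 0"
      proof (cases "b = b0")
        case True
        then show ?thesis unfolding full split using V(4)[OF V(2)] by simp
      qed (use full c \<open>b \<in> B\<close> in auto)
    qed
    from inj[OF this] have "\<forall>a\<in>A. c' a = 0" by blast
    then show "\<forall>a\<in>A. c a = 0" using insert.hyps by (auto simp: c'_def split: if_splits)
  qed
  then obtain c U where c: "\<And>a. c a \<in> C_inf M" "openin (Top M) U" "r \<in> U"
    "\<And>y b. y \<in> U \<Longrightarrow> b \<in> B - {b0} \<Longrightarrow> (\<Sum>a\<in>A. c a y * m' a b y) = w' b y" by blast
  define c' where "c' a = (if a = a0 then (\<lambda>y. (w b0 y - (\<Sum>a\<in>A. c a y * m a b0 y)) * e y) else c a)" for a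
  have "(\<Sum>a\<in>insert a0 A. c' a y * m a b y) = w b y" if y: "y \<in> U \<inter> V" and b: "b \<in> B" for y b
  proof -
    have "(\<Sum>a\<in>A. c' a y * m a b y) = (\<Sum>a\<in>A. c a y * m a b y)"
      using insert.hyps by (intro sum.cong) (auto simp: c'_def)
    then have full: "(\<Sum>a\<in>insert a0 A. c' a y * m a b y) = (\<Sum>a\<in>A. c a y * m' a b y) + w b0 y * (e y * m a0 b y)"
      unfolding split using insert.hyps by (simp add: c'_def algebra_simps)
    show ?thesis
    proof (cases "b = b0")
      case True
      then show ?thesis unfolding full split using V(4)[of y] y by simp
    next
      case False
      then show ?thesis unfolding full using c(4)[of y b] y b by (simp add: w'_def)
    qed
  qed
  moreover have "c' a \<in> C_inf M" for a
    using c(1) insert.prems(4,5) V(3) by (simp add: c'_def)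
  ultimately show ?case
    using c(2,3) V(1,2) by (intro exI[of _ c'] exI[of _ "U \<inter> V"]) auto
qed

text \<open>Locally the components of the sharp solve a linear system with the Gram matrix of a
  frame, injective by non-degeneracy. Non-degeneracy also makes the sharp unique at each point, so
  the local solutions agree and no partition of unity is needed.\<close>

lemma sharp_field_exists:
  assumes nd: "non_degenerate M g" and \<omega>: "one_form \<omega>"
  shows "\<exists>S\<in>VF. \<forall>p\<in>Carrier M. represents \<omega> p (S p)"
proof -
  have uniq: "v = v'" if "represents \<omega> y v" "represents \<omega> y v'" "y \<in> Carrier M" for y v v'
  proof -
    have T: "v \<in> TS y" "v' \<in> TS y" using that by (auto simp: represents_def)
    have d: "(\<lambda>f. v f + (- 1) * v' f) \<in> TS y" by (intro TS_add TS_scale T)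
    have "g y (\<lambda>f. v f + (- 1) * v' f) w = 0" if w: "w \<in> TS y" for w
    proof -
      obtain Z where Z: "Z \<in> VF" "Z y = w" using vector_extension[OF \<open>y \<in> Carrier M\<close> w] by blast
      have "g y v w = g y v' w" using \<open>represents \<omega> y v\<close> \<open>represents \<omega> y v'\<close> Z by (auto simp: represents_def)
      moreover have "g y (\<lambda>f. v f + (- 1) * v' f) w = g y v w + (- 1) * g y v' w"
        using \<open>y \<in> Carrier M\<close> T w by (simp only: g_add g_scale TS_scale)
      ultimately show ?thesis by simp
    qed
    then have "(\<lambda>f. v f + (- 1) * v' f) = (\<lambda>f. 0)"
      using nd d \<open>y \<in> Carrier M\<close> unfolding non_degenerate_def by blast
    then show ?thesis by (simp add: fun_eq_iff)
  qed
  have "\<exists>S U. S \<in> VF \<and> openin (Top M) U \<and> r \<in> U \<and> (\<forall>y\<in>U. represents \<omega> y (S y))" if r: "r \<in> Carrier M" for r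
  proof -
    obtain W E \<xi> where W: "r \<in> W" "local_frame W C E \<xi>" using local_frame_exists[OF r] by blast
    have o: "openin (Top M) W" and E: "\<And>a. a \<in> C \<Longrightarrow> E a \<in> VF" "\<And>a. a \<in> C \<Longrightarrow> \<xi> a \<in> C_inf M"
      and dual: "\<And>y a b. y \<in> W \<Longrightarrow> a \<in> C \<Longrightarrow> b \<in> C \<Longrightarrow> E a y (\<xi> b) = of_bool (a = b)"
      and sp: "\<And>y v. y \<in> W \<Longrightarrow> v \<in> TS y \<Longrightarrow> v = (\<lambda>f. \<Sum>a\<in>C. v (\<xi> a) * E a y f)"
      using W(2) unfolding local_frame_def by blast+
    have WC: "W \<subseteq> Carrier M" using openin_subset[OF o] .
    \<comment> \<open>Extended by zero because \<open>linear_system_smooth\<close> asks for smooth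
      entries at all indices, not only at those in \<open>C\<close>.\<close>
    define E' where "E' a = (if a \<in> C then E a else (\<lambda>p f. 0))" for a
    have E': "E' a \<in> VF" for a using E VF_zero by (simp add: E'_def)
    have "\<exists>c U. (\<forall>a. c a \<in> C_inf M) \<and> openin (Top M) U \<and> r \<in> U \<and>
      (\<forall>y\<in>U. \<forall>b\<in>C. (\<Sum>a\<in>C. c a y * g y (E' a y) (E' b y)) = \<omega> (E' b) y)"
    proof (rule linear_system_smooth[OF finC finC refl r])
      show "(\<lambda>y. g y (E' a y) (E' b y)) \<in> C_inf M" "\<omega> (E' b) \<in> C_inf M" for a b
        by (intro g_smooth one_form_smooth[OF \<omega>] E')+
      fix c assume c: "\<forall>b\<in>C. (\<Sum>a\<in>C. c a * g r (E' a r) (E' b r)) = 0"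
      let ?v = "\<lambda>f. \<Sum>a\<in>C. c a * E a r f"
      have ET: "E a r \<in> TS r" if "a \<in> C" for a by (rule VF_TS[OF E(1)[OF that] r])
      have vT: "?v \<in> TS r" by (rule TS_sum[OF ET])
      have vE: "g r ?v (E b r) = 0" if b: "b \<in> C" for b
      proof -
        have "g r ?v (E b r) = (\<Sum>a\<in>C. c a * g r (E a r) (E b r))" by (rule g_sum[OF r ET[OF b] ET])
        then show ?thesis using c b by (simp add: E'_def)
      qed
      have "g r ?v w = 0" if w: "w \<in> TS r" for w
      proof -
        have "g r ?v w = g r w ?v" by (rule g_sym[OF r vT w])
        also have "\<dots> = g r (\<lambda>f. \<Sum>a\<in>C. w (\<xi> a) * E a r f) ?v" using sp[OF W(1) w] by simp
        also have "\<dots> = (\<Sum>a\<in>C. w (\<xi> a) * g r (E a r) ?v)" by (rule g_sum[OF r vT ET])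
        also have "\<dots> = 0" using vE g_sym[OF r ET vT] by (intro sum.neutral) auto
        finally show ?thesis .
      qed
      then have "?v = (\<lambda>f. 0)" using nd r vT unfolding non_degenerate_def by blast
      then have v0: "(\<Sum>a\<in>C. c a * E a r f) = 0" for f by (rule fun_cong)
      show "\<forall>b\<in>C. c b = 0"
      proof
        fix b assume b: "b \<in> C"
        have "(\<Sum>a\<in>C. c a * E a r (\<xi> b)) = (\<Sum>a\<in>C. if a = b then c a else 0)"
          using dual[OF W(1) _ b] by (intro sum.cong) auto
        then show "c b = 0" using v0[of "\<xi> b"] b finC by simp
      qed
    qed
    then obtain c U where c: "\<And>a. c a \<in> C_inf M" and U: "openin (Top M) U" "r \<in> U"
      and eq: "\<And>y b. y \<in> U \<Longrightarrow> b \<in> C \<Longrightarrow> (\<Sum>a\<in>C. c a y * g y (E' a y) (E' b y)) = \<omega> (E' b) y" by blast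
    let ?S = "\<lambda>y f. \<Sum>a\<in>C. c a y * E a y f"
    have SVF: "?S \<in> VF" by (rule VF_sum[OF E(1) c])
    have "represents \<omega> y (?S y)" if y: "y \<in> U \<inter> W" for y
      unfolding represents_def
    proof (intro conjI ballI)
      have yC: "y \<in> Carrier M" using y WC by blast
      have ET: "E a y \<in> TS y" if "a \<in> C" for a by (rule VF_TS[OF E(1)[OF that] yC])
      show ST: "?S y \<in> TS y" by (rule TS_sum[OF ET])
      fix Z assume Z: "Z \<in> VF"
      have Zy: "Z y = (\<lambda>f. \<Sum>b\<in>C. Z y (\<xi> b) * E b y f)" using sp[of y "Z y"] y VF_TS[OF Z yC] by blast
      have "\<omega> Z y = \<omega> (\<lambda>q f. \<Sum>b\<in>C. Z q (\<xi> b) * E b q f) y"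
      proof (rule one_form_tensorial[where Z = Z and Z' = "\<lambda>q f. \<Sum>b\<in>C. Z q (\<xi> b) * E b q f" and p = y, OF \<omega> Z _ yC Zy])
        show "(\<lambda>q f. \<Sum>b\<in>C. Z q (\<xi> b) * E b q f) \<in> VF"
          by (rule VF_sum[of C E "\<lambda>b q. Z q (\<xi> b)"]) (use E Z in auto)
      qed
      also have "\<dots> = (\<Sum>b\<in>C. Z y (\<xi> b) * \<omega> (E b) y)"
        by (rule one_form_sum[OF \<omega> yC, of C E "\<lambda>b q. Z q (\<xi> b)"]) (use E Z in auto)
      also have "\<dots> = (\<Sum>b\<in>C. Z y (\<xi> b) * g y (E b y) (?S y))"
      proof (rule sum.cong[OF refl])
        fix b assume b: "b \<in> C"
        have "\<omega> (E b) y = (\<Sum>a\<in>C. c a y * g y (E a y) (E b y))"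
          using eq[of y b] y b by (simp add: E'_def)
        also have "\<dots> = g y (?S y) (E b y)" by (rule g_sum[OF yC ET[OF b] ET, symmetric])
        also have "\<dots> = g y (E b y) (?S y)" by (rule g_sym[OF yC ST ET[OF b]])
        finally show "Z y (\<xi> b) * \<omega> (E b) y = Z y (\<xi> b) * g y (E b y) (?S y)" by simp
      qed
      also have "\<dots> = g y (\<lambda>f. \<Sum>b\<in>C. Z y (\<xi> b) * E b y f) (?S y)"
        by (rule g_sum[OF yC ST ET, symmetric])
      also have "\<dots> = g y (?S y) (Z y)"
        using g_sym[OF yC VF_TS[OF Z yC] ST] Zy by simp
      finally show "\<omega> Z y = g y (?S y) (Z y)" .
    qed
    then show ?thesis using SVF U o W(1) by (intro exI[of _ ?S] exI[of _ "U \<inter> W"]) auto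
  qed
  then obtain S U where S: "\<And>r. r \<in> Carrier M \<Longrightarrow> S r \<in> VF" "\<And>r. r \<in> Carrier M \<Longrightarrow> openin (Top M) (U r)"
    "\<And>r. r \<in> Carrier M \<Longrightarrow> r \<in> U r" "\<And>r y. r \<in> Carrier M \<Longrightarrow> y \<in> U r \<Longrightarrow> represents \<omega> y (S r y)" by metis
  have rep: "represents \<omega> y (S y y)" if "y \<in> Carrier M" for y using S(3,4) that by blast
  have eq: "S y y = S r y" if "r \<in> Carrier M" "y \<in> U r" for r y
    using uniq[OF rep S(4)[OF that]] that S(2) openin_subset by blast
  \<comment> \<open>The local solution belonging to \<open>p\<close> is evaluated at
    \<open>p\<close>; near \<open>r\<close> this diagonal equals the smooth field \<open>S r\<close>
    by uniqueness.\<close>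
  have "(\<lambda>p. S p p) \<in> VF"
    unfolding vector_fields_def
  proof (intro CollectI conjI ballI)
    show "S p p \<in> TS p" if "p \<in> Carrier M" for p using rep[OF that] by (simp add: represents_def)
    show "(\<lambda>p. S p p f) \<in> C_inf M" if f: "f \<in> C_inf M" for f
    proof (rule C_infI_local)
      fix r assume r: "r \<in> Carrier M"
      show "\<exists>W h. openin (Top M) W \<and> r \<in> W \<and> h \<in> C_inf M \<and> (\<forall>y\<in>W. S y y f = h y)"
        using S(1-3)[OF r] eq[OF r] f by (intro exI[of _ "U r"] exI[of _ "\<lambda>y. S r y f"]) auto
    qed
  qed
  then show ?thesis using rep by (intro bexI[of _ "\<lambda>p. S p p"] ballI)
qed

lemma sharp_at_eq:
  assumes nd: "non_degenerate M g" and p: "p \<in> Carrier M" and v: "v \<in> TS p"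
  shows "sharp_at M g p (flat_at M g p v) = v"
  unfolding sharp_at_def
proof (rule the_equality)
  fix u assume u: "u \<in> TS p \<and> flat_at M g p u = flat_at M g p v"
  have d: "(\<lambda>f. u f + (- 1) * v f) \<in> TS p" using u v by (intro TS_add TS_scale) auto
  have "g p (\<lambda>f. u f + (- 1) * v f) w = 0" if w: "w \<in> TS p" for w
  proof -
    have "g p u w = g p v w" using fun_cong[OF conjunct2[OF u], of w] w by (simp add: flat_at_def)
    moreover have "g p (\<lambda>f. u f + (- 1) * v f) w = g p u w + (- 1) * g p v w"
      using p u v w by (simp only: g_add g_scale TS_scale)
    ultimately show ?thesis by simp
  qed
  then have "(\<lambda>f. u f + (- 1) * v f) = (\<lambda>f. 0)"
    using nd d p unfolding non_degenerate_def by blast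
  then show "u = v" by (simp add: fun_eq_iff)
qed (use v in simp)

lemma inverse_metric_represents:
  assumes "non_degenerate M g" "p \<in> Carrier M" "one_form \<omega>" "one_form \<tau>" "represents \<omega> p v" "represents \<tau> p w"
  shows "inverse_metric M g p (form_at M \<omega> p) (form_at M \<tau> p) = g p v w"
proof -
  have v: "v \<in> TS p" and w: "w \<in> TS p" using assms by (auto simp: represents_def)
  have "form_at M \<omega> p = flat_at M g p v" "form_at M \<tau> p = flat_at M g p w"
    using form_at_flat[OF assms(3,2) v] form_at_flat[OF assms(4,2) w] assms(5,6) by simp_all
  then show ?thesis by (simp add: inverse_metric_def sharp_at_eq[OF assms(1,2)] v w)
qed

end

section \<open>Factors of a product\<close>

lemma partial_deriv_cong_line:
  assumes "\<forall>\<^sub>F t in nhds (x i). f (x(i := t)) = h (y(j := t))" "x i = y j"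
  shows "partial_deriv i f x = partial_deriv j h y"
  unfolding partial_deriv_def using assms by (intro deriv_cong_ev) auto

lemma partial_deriv_const_line:
  assumes "\<forall>\<^sub>F t in nhds (x i). f (x(i := t)) = c"
  shows "partial_deriv i f x = 0"
proof -
  have "partial_deriv i f x = deriv (\<lambda>t. c) (x i)"
    unfolding partial_deriv_def using assms by (intro deriv_cong_ev) auto
  then show ?thesis by simp
qed

text \<open>In such a pair of charts \<open>\<pi>\<close> drops the coordinates outside the range of
  \<open>e\<close>, and \<open>\<iota> y\<close> overwrites those inside it. With each of its points
  \<open>V\<close> contains the slice over all of \<open>U\<close>, so the two charts can be
  compared along an entire slice.\<close>

definition adapted_charts ::
  "('a, 'c) manifold \<Rightarrow> ('b, 'd) manifold \<Rightarrow> ('a \<Rightarrow> 'b) \<Rightarrow> ('a \<Rightarrow> 'b \<Rightarrow> 'a) \<Rightarrow> ('d \<Rightarrow> 'c) \<Rightarrow>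
   'a set \<Rightarrow> ('a \<Rightarrow> 'c \<Rightarrow> real) \<Rightarrow> 'b set \<Rightarrow> ('b \<Rightarrow> 'd \<Rightarrow> real) \<Rightarrow> bool"
  where "adapted_charts M N \<pi> \<iota> e V \<Phi> U \<phi> \<longleftrightarrow> (V, \<Phi>) \<in> Atlas M \<and> (U, \<phi>) \<in> Atlas N \<and>
    (\<forall>y\<in>V. \<pi> y \<in> U \<and> (\<forall>a\<in>Coord N. \<Phi> y (e a) = \<phi> (\<pi> y) a) \<and>
      (\<forall>z\<in>U. \<iota> y z \<in> V \<and> (\<forall>a\<in>Coord N. \<Phi> (\<iota> y z) (e a) = \<phi> z a) \<and>
        (\<forall>c\<in>Coord M - e ` Coord N. \<Phi> (\<iota> y z) c = \<Phi> y c)))"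

text \<open>\<open>\<pi>\<close> is the projection onto the factor \<open>N\<close>, \<open>\<iota> x\<close> the inclusion of \<open>N\<close> as the slice through \<open>x\<close>,
  and \<open>e\<close> embeds the coordinates of \<open>N\<close> into those of the product.\<close>

locale factor = M: mfd M + N: mfd N for M :: "('a, 'c) manifold" and N :: "('b, 'd) manifold" +
  fixes \<pi> :: "'a \<Rightarrow> 'b" and \<iota> :: "'a \<Rightarrow> 'b \<Rightarrow> 'a" and e :: "'d \<Rightarrow> 'c"
  assumes pi_C [simp]: "x \<in> Carrier M \<Longrightarrow> \<pi> x \<in> Carrier N"
    and iota_C [simp]: "x \<in> Carrier M \<Longrightarrow> z \<in> Carrier N \<Longrightarrow> \<iota> x z \<in> Carrier M"
    and pi_iota [simp]: "x \<in> Carrier M \<Longrightarrow> z \<in> Carrier N \<Longrightarrow> \<pi> (\<iota> x z) = z"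
    and iota_pi [simp]: "x \<in> Carrier M \<Longrightarrow> \<iota> x (\<pi> x) = x"
    and iota_iota [simp]: "x \<in> Carrier M \<Longrightarrow> z \<in> Carrier N \<Longrightarrow> \<iota> (\<iota> x z) = \<iota> x"
    and e: "e ` Coord N \<subseteq> Coord M" "inj_on e (Coord N)"
    and adapted_exists: "x \<in> Carrier M \<Longrightarrow> \<exists>V \<Phi> U \<phi>. x \<in> V \<and> adapted_charts M N \<pi> \<iota> e V \<Phi> U \<phi>"
begin

abbreviation "adapted \<equiv> adapted_charts M N \<pi> \<iota> e"

lemma adaptedD:
  assumes "adapted V \<Phi> U \<phi>" "y \<in> V"
  shows "\<pi> y \<in> U" "\<And>a. a \<in> Coord N \<Longrightarrow> \<Phi> y (e a) = \<phi> (\<pi> y) a"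
    "\<And>z. z \<in> U \<Longrightarrow> \<iota> y z \<in> V" "\<And>z a. z \<in> U \<Longrightarrow> a \<in> Coord N \<Longrightarrow> \<Phi> (\<iota> y z) (e a) = \<phi> z a"
    "\<And>z c. z \<in> U \<Longrightarrow> c \<in> Coord M - e ` Coord N \<Longrightarrow> \<Phi> (\<iota> y z) c = \<Phi> y c"
  using assms unfolding adapted_charts_def by blast+

lemma pullback_smooth [simp]:
  assumes f: "f \<in> C_inf N"
  shows "(\<lambda>x. f (\<pi> x)) \<in> C_inf M"
proof (rule M.C_infI_chart)
  fix x assume "x \<in> Carrier M"
  then obtain V \<Phi> U \<phi> where x: "x \<in> V" and A: "adapted V \<Phi> U \<phi>" using adapted_exists by blast
  have V: "(V, \<Phi>) \<in> Atlas M" and U: "(U, \<phi>) \<in> Atlas N" using A by (auto simp: adapted_charts_def)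
  have y: "\<pi> y \<in> U" "restrict (\<lambda>a. \<Phi> y (e a)) (Coord N) = \<phi> (\<pi> y)" if "y \<in> V" for y
  proof -
    show p: "\<pi> y \<in> U" using A that by (auto simp: adapted_charts_def)
    have "\<phi> (\<pi> y) \<in> extensional (Coord N)" using N.chart_ext[OF U] p by blast
    then show "restrict (\<lambda>a. \<Phi> y (e a)) (Coord N) = \<phi> (\<pi> y)"
      using A that by (auto simp: adapted_charts_def fun_eq_iff extensional_def)
  qed
  note oV = M.chart(2)[OF V] and oU = N.chart(2)[OF U]
  have "smooth_on (Coord M) (\<Phi> ` V) (\<lambda>u. (f \<circ> inv_into U \<phi>) (restrict (\<lambda>a. u (e a)) (Coord N)))"
  proof (rule smooth_on_compose[where f = "f \<circ> inv_into U \<phi>" and h = "\<lambda>u. restrict (\<lambda>a. u (e a)) (Coord N)",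
        OF M.finC oV N.finC oU])
    show "restrict (\<lambda>a. u (e a)) (Coord N) \<in> \<phi> ` U" if "u \<in> \<Phi> ` V" for u
      using that y by auto
    show "smooth_on (Coord M) (\<Phi> ` V) (\<lambda>u. restrict (\<lambda>a. u (e a)) (Coord N) a)" if "a \<in> Coord N" for a
      using that e smooth_on_coord[OF M.finC oV, of "e a"] by auto
  qed (rule N.C_infD[OF f U])
  then have "smooth_on (Coord M) (\<Phi> ` V) ((\<lambda>x. f (\<pi> x)) \<circ> inv_into V \<Phi>)"
    by (rule smooth_on_cong[OF oV M.finC])
      (use y M.inv_chart[OF V] N.inv_chart[OF U] in auto)
  then show "\<exists>U \<phi> W. (U, \<phi>) \<in> Atlas M \<and> openin (Top M) W \<and> x \<in> W \<and> W \<subseteq> U \<and>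
     smooth_on (Coord M) (\<phi> ` W) ((\<lambda>x. f (\<pi> x)) \<circ> inv_into U \<phi>)"
    using V x M.chart(1)[OF V] by blast
qed

text \<open>Varying the coordinate \<open>e a\<close> in the product is the same as varying the
  coordinate \<open>a\<close> in the factor and including the result as a slice. This reduces
  partial derivatives along a factor to those of the factor.\<close>

lemma adapted_line:
  assumes A: "adapted V \<Phi> U \<phi>" and y: "y \<in> V" and a: "a \<in> Coord N"
  shows "\<forall>\<^sub>F t in nhds (\<Phi> y (e a)). \<exists>z\<in>U. (\<phi> (\<pi> y))(a := t) = \<phi> z \<and> inv_into U \<phi> ((\<phi> (\<pi> y))(a := t)) = z \<and>
    inv_into V \<Phi> ((\<Phi> y)(e a := t)) = \<iota> y z"
proof -
  have V: "(V, \<Phi>) \<in> Atlas M" and U: "(U, \<phi>) \<in> Atlas N" using A by (auto simp: adapted_charts_def)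
  have yy: "\<pi> y \<in> U" "\<And>a. a \<in> Coord N \<Longrightarrow> \<Phi> y (e a) = \<phi> (\<pi> y) a" using A y by (auto simp: adapted_charts_def)
  have "\<phi> (\<pi> y) \<in> \<phi> ` U" using yy by blast
  from eventually_line_in_open[OF N.chart(2)[OF U] this N.finC a] show ?thesis
    unfolding yy(2)[OF a]
  proof eventually_elim
    fix t assume "(\<phi> (\<pi> y))(a := t) \<in> \<phi> ` U"
    then obtain z where z: "z \<in> U" "(\<phi> (\<pi> y))(a := t) = \<phi> z" by auto
    have iz: "\<iota> y z \<in> V" "\<And>b. b \<in> Coord N \<Longrightarrow> \<Phi> (\<iota> y z) (e b) = \<phi> z b"
      "\<And>c. c \<in> Coord M - e ` Coord N \<Longrightarrow> \<Phi> (\<iota> y z) c = \<Phi> y c"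
      by (rule adaptedD(3-5)[OF A y z(1)]; assumption)+
    have "\<Phi> (\<iota> y z) = (\<Phi> y)(e a := t)"
    proof
      fix c
      consider "c \<notin> Coord M" | b where "b \<in> Coord N" "c = e b" | "c \<in> Coord M - e ` Coord N" by blast
      then show "\<Phi> (\<iota> y z) c = ((\<Phi> y)(e a := t)) c"
      proof cases
        case 1
        have "\<Phi> y \<in> extensional (Coord M)" "\<Phi> (\<iota> y z) \<in> extensional (Coord M)"
          using M.chart_ext[OF V] y iz(1) by auto
        then show ?thesis using 1 e(1) a by (auto simp: extensional_def)
      next
        case 2
        then have "\<Phi> (\<iota> y z) c = ((\<phi> (\<pi> y))(a := t)) b" using iz(2) z(2) by simp
        then show ?thesis using 2 yy(2) a inj_on_eq_iff[OF e(2), of b a] by auto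
      next
        case 3
        then have "c \<noteq> e a" using a by auto
        then show ?thesis using iz(3)[OF 3] by simp
      qed
    qed
    from this[symmetric] have "inv_into V \<Phi> ((\<Phi> y)(e a := t)) = \<iota> y z" using M.inv_chart[OF V iz(1)] by simp
    then show "\<exists>z\<in>U. (\<phi> (\<pi> y))(a := t) = \<phi> z \<and> inv_into U \<phi> ((\<phi> (\<pi> y))(a := t)) = z \<and>
        inv_into V \<Phi> ((\<Phi> y)(e a := t)) = \<iota> y z"
      using z N.inv_chart[OF U z(1)] by (intro bexI[of _ z]) auto
  qed
qed

lemma slice_smooth [simp]:
  assumes f: "f \<in> C_inf M" and x: "x \<in> Carrier M"
  shows "(\<lambda>z. f (\<iota> x z)) \<in> C_inf N"
proof (rule N.C_infI_chart)
  fix z assume z: "z \<in> Carrier N"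
  define y where "y = \<iota> x z"
  have yC: "y \<in> Carrier M" and iy: "\<iota> y = \<iota> x" and piy: "\<pi> y = z" using x z by (auto simp: y_def)
  obtain V \<Phi> U \<phi> where y: "y \<in> V" and A: "adapted V \<Phi> U \<phi>" using adapted_exists[OF yC] by blast
  have V: "(V, \<Phi>) \<in> Atlas M" and U: "(U, \<phi>) \<in> Atlas N" using A by (auto simp: adapted_charts_def)
  note oV = M.chart(2)[OF V] and oU = N.chart(2)[OF U]
  define h where "h u = restrict (\<lambda>c. if c \<in> e ` Coord N then u (inv_into (Coord N) e c) else \<Phi> y c) (Coord M)" for u
  have hz: "h (\<phi> z') = \<Phi> (\<iota> y z')" "\<iota> y z' \<in> V" if z': "z' \<in> U" for z'
  proof -
    show iz: "\<iota> y z' \<in> V" using A y z' by (auto simp: adapted_charts_def)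
    have ext: "\<Phi> (\<iota> y z') \<in> extensional (Coord M)" using M.chart_ext[OF V] iz by blast
    show "h (\<phi> z') = \<Phi> (\<iota> y z')"
    proof
      fix c
      show "h (\<phi> z') c = \<Phi> (\<iota> y z') c"
      proof (cases "c \<in> Coord M")
        case True
        show ?thesis
        proof (cases "c \<in> e ` Coord N")
          case True
          then obtain b where b: "b \<in> Coord N" "c = e b" by blast
          then show ?thesis using \<open>c \<in> Coord M\<close> adaptedD(4)[OF A y z' b(1)] inv_into_f_f[OF e(2) b(1)]
            by (simp add: h_def)
        next
          case False
          then show ?thesis using \<open>c \<in> Coord M\<close> adaptedD(5)[OF A y z', of c] by (simp add: h_def)
        qed
      next
        case False
        then show ?thesis using ext by (simp add: h_def extensional_def)
      qed
    qed
  qed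
  have "smooth_on (Coord N) (\<phi> ` U) (\<lambda>u. (f \<circ> inv_into V \<Phi>) (h u))"
  proof (rule smooth_on_compose[where f = "f \<circ> inv_into V \<Phi>" and h = h, OF N.finC oU M.finC oV])
    show "h u \<in> \<Phi> ` V" if "u \<in> \<phi> ` U" for u using that hz by auto
    show "smooth_on (Coord N) (\<phi> ` U) (\<lambda>u. h u c)" if "c \<in> Coord M" for c
    proof (cases "c \<in> e ` Coord N")
      case True
      then have "inv_into (Coord N) e c \<in> Coord N" by (rule inv_into_into)
      then show ?thesis using True that smooth_on_coord[OF N.finC oU] by (simp add: h_def)
    next
      case False
      then show ?thesis using that smooth_on_const[OF N.finC oU] by (simp add: h_def)
    qed
  qed (rule M.C_infD[OF f V])
  then have "smooth_on (Coord N) (\<phi> ` U) ((\<lambda>z. f (\<iota> x z)) \<circ> inv_into U \<phi>)"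
    by (rule smooth_on_cong[OF oU N.finC])
      (use hz M.inv_chart[OF V] N.inv_chart[OF U] iy in auto)
  moreover have "z \<in> U" using A y piy by (auto simp: adapted_charts_def)
  ultimately show "\<exists>U \<phi> W. (U, \<phi>) \<in> Atlas N \<and> openin (Top N) W \<and> z \<in> W \<and> W \<subseteq> U \<and>
     smooth_on (Coord N) (\<phi> ` W) ((\<lambda>z. f (\<iota> x z)) \<circ> inv_into U \<phi>)"
    using U N.chart(1)[OF U] by blast
qed

lemma partial_deriv_slice:
  assumes A: "adapted V \<Phi> U \<phi>" and y: "y \<in> V" and a: "a \<in> Coord N"
  shows "partial_deriv a ((\<lambda>z. f (\<iota> y z)) \<circ> inv_into U \<phi>) (\<phi> (\<pi> y)) = partial_deriv (e a) (f \<circ> inv_into V \<Phi>) (\<Phi> y)"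
proof (rule partial_deriv_cong_line)
  have eq: "\<phi> (\<pi> y) a = \<Phi> y (e a)" using A y a by (auto simp: adapted_charts_def)
  then show "\<phi> (\<pi> y) a = \<Phi> y (e a)" .
  show "\<forall>\<^sub>F t in nhds (\<phi> (\<pi> y) a). ((\<lambda>z. f (\<iota> y z)) \<circ> inv_into U \<phi>) ((\<phi> (\<pi> y))(a := t)) =
      (f \<circ> inv_into V \<Phi>) ((\<Phi> y)(e a := t))"
    unfolding eq using adapted_line[OF A y a] by eventually_elim auto
qed

text \<open>Restricting \<open>f\<close> to a slice and pulling it back keeps exactly the partial
  derivatives in the directions of that factor. Summed over all factors, such functions recover the
  full differential of \<open>f\<close> at the point.\<close>

lemma partial_deriv_slice_pullback:
  assumes A: "adapted V \<Phi> U \<phi>" and y: "y \<in> V" and c: "c \<in> Coord M"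
  shows "partial_deriv c ((\<lambda>x. f (\<iota> y (\<pi> x))) \<circ> inv_into V \<Phi>) (\<Phi> y) =
    (if c \<in> e ` Coord N then partial_deriv c (f \<circ> inv_into V \<Phi>) (\<Phi> y) else 0)"
proof -
  have V: "(V, \<Phi>) \<in> Atlas M" and U: "(U, \<phi>) \<in> Atlas N" using A by (auto simp: adapted_charts_def)
  have yC: "y \<in> Carrier M" using M.U_sub[OF V] y by blast
  show ?thesis
  proof (cases "c \<in> e ` Coord N")
    case True
    then obtain a where a: "a \<in> Coord N" "c = e a" by blast
    have "partial_deriv c ((\<lambda>x. f (\<iota> y (\<pi> x))) \<circ> inv_into V \<Phi>) (\<Phi> y) = partial_deriv c (f \<circ> inv_into V \<Phi>) (\<Phi> y)"
    proof (rule partial_deriv_cong_line)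
      show "\<forall>\<^sub>F t in nhds (\<Phi> y c). ((\<lambda>x. f (\<iota> y (\<pi> x))) \<circ> inv_into V \<Phi>) ((\<Phi> y)(c := t)) =
          (f \<circ> inv_into V \<Phi>) ((\<Phi> y)(c := t))"
        unfolding a(2) using adapted_line[OF A y a(1)]
      proof eventually_elim
        fix t assume "\<exists>z\<in>U. (\<phi> (\<pi> y))(a := t) = \<phi> z \<and> inv_into U \<phi> ((\<phi> (\<pi> y))(a := t)) = z \<and>
          inv_into V \<Phi> ((\<Phi> y)(e a := t)) = \<iota> y z"
        then obtain z where "z \<in> U" "inv_into V \<Phi> ((\<Phi> y)(e a := t)) = \<iota> y z" by blast
        moreover from this have "z \<in> Carrier N" using N.U_sub[OF U] by blast
        ultimately show "((\<lambda>x. f (\<iota> y (\<pi> x))) \<circ> inv_into V \<Phi>) ((\<Phi> y)(e a := t)) =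
          (f \<circ> inv_into V \<Phi>) ((\<Phi> y)(e a := t))" using yC by simp
      qed
    qed simp
    then show ?thesis using True by simp
  next
    case False
    have "partial_deriv c ((\<lambda>x. f (\<iota> y (\<pi> x))) \<circ> inv_into V \<Phi>) (\<Phi> y) = 0"
    proof (rule partial_deriv_const_line)
      have "\<Phi> y \<in> \<Phi> ` V" using y by blast
      from eventually_line_in_open[OF M.chart(2)[OF V] this M.finC c]
      show "\<forall>\<^sub>F t in nhds (\<Phi> y c). ((\<lambda>x. f (\<iota> y (\<pi> x))) \<circ> inv_into V \<Phi>) ((\<Phi> y)(c := t)) = f y"
      proof eventually_elim
        fix t assume "(\<Phi> y)(c := t) \<in> \<Phi> ` V"
        then obtain w where w: "w \<in> V" "(\<Phi> y)(c := t) = \<Phi> w" by auto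
        have pw: "\<pi> w \<in> U" "\<pi> y \<in> U" "\<And>a. a \<in> Coord N \<Longrightarrow> \<Phi> w (e a) = \<phi> (\<pi> w) a"
          "\<And>a. a \<in> Coord N \<Longrightarrow> \<Phi> y (e a) = \<phi> (\<pi> y) a"
          using A w(1) y by (auto simp: adapted_charts_def)
        have ext: "\<phi> (\<pi> w) \<in> extensional (Coord N)" "\<phi> (\<pi> y) \<in> extensional (Coord N)"
          using N.chart_ext[OF U] pw by auto
        have "\<phi> (\<pi> w) = \<phi> (\<pi> y)"
        proof
          fix a
          show "\<phi> (\<pi> w) a = \<phi> (\<pi> y) a"
          proof (cases "a \<in> Coord N")
            case True
            then have "e a \<noteq> c" using False by auto
            then have "\<Phi> w (e a) = \<Phi> y (e a)" using w(2)[symmetric] by simp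
            then show ?thesis using pw(3,4)[OF True] by simp
          next
            case False
            then show ?thesis using ext by (simp add: extensional_def)
          qed
        qed
        then have "\<pi> w = \<pi> y" using inj_onD[OF N.chart_inj[OF U]] pw by blast
        then show "((\<lambda>x. f (\<iota> y (\<pi> x))) \<circ> inv_into V \<Phi>) ((\<Phi> y)(c := t)) = f y"
          using w M.inv_chart[OF V w(1)] yC by simp
      qed
    qed
    then show ?thesis using False by simp
  qed
qed

section \<open>Lifting vector fields from a factor and projecting tangent vectors\<close>

definition lift :: "'b vfield \<Rightarrow> 'a vfield"
  where "lift X = (\<lambda>x. pushforward M (\<iota> x) (X (\<pi> x)))"

lemma lift_apply: "f \<in> C_inf M \<Longrightarrow> lift X x f = X (\<pi> x) (\<lambda>z. f (\<iota> x z))"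
  by (simp add: lift_def pushforward_def o_def)

lemma lift_TS:
  assumes X: "X \<in> vector_fields N" and x: "x \<in> Carrier M"
  shows "lift X x \<in> tangent_space M x"
proof -
  note v = N.VF_TS[OF X pi_C[OF x]]
  show ?thesis
    unfolding tangent_space_def
  proof (intro CollectI conjI ballI allI impI)
    fix f h assume "f \<in> C_inf M" "h \<in> C_inf M"
    then show "lift X x (\<lambda>y. f y + h y) = lift X x f + lift X x h"
      "lift X x (\<lambda>y. f y * h y) = f x * lift X x h + h x * lift X x f"
      using x by (simp_all add: lift_apply N.tan_add[OF v] N.tan_mult[OF v])
  next
    fix c f assume "f \<in> C_inf M"
    then show "lift X x (\<lambda>y. c * f y) = c * lift X x f"
      using x M.C_inf_mult[OF M.C_inf_const, of f c] by (simp add: lift_apply N.tan_cmult[OF v])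
  qed (simp add: lift_def pushforward_def)
qed

text \<open>The function \<open>\<lambda>x. lift X x f\<close> must be smooth in the position on the
  slice and in the slice together, which smoothness on each slice does not give. In adapted charts
  it is a sum of components of \<open>X\<close>, pulled back, times partial derivatives of
  \<open>f\<close>, both smooth on the product.\<close>

lemma lift_VF:
  assumes X: "X \<in> vector_fields N"
  shows "lift X \<in> vector_fields M"
  unfolding vector_fields_def
proof (intro CollectI conjI ballI lift_TS X)
  fix f assume f: "f \<in> C_inf M"
  show "(\<lambda>x. lift X x f) \<in> C_inf M"
  proof (rule M.C_infI_local)
    fix x assume x: "x \<in> Carrier M"
    obtain V \<Phi> U \<phi> where xV: "x \<in> V" and A: "adapted V \<Phi> U \<phi>" using adapted_exists[OF x] by blast
    have V: "(V, \<Phi>) \<in> Atlas M" and U: "(U, \<phi>) \<in> Atlas N" and pxU: "\<pi> x \<in> U"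
      using A xV by (auto simp: adapted_charts_def)
    obtain U' where U': "openin (Top N) U'" "\<pi> x \<in> U'" "U' \<subseteq> U"
      "\<forall>u. smooth_on (Coord N) (\<phi> ` U) u \<longrightarrow> (\<exists>h\<in>C_inf N. \<forall>y\<in>U'. h y = u (\<phi> y))"
      using N.smooth_extension_exists[OF U N.chart(1)[OF U] order_refl pxU] by (elim exE conjE)
    have "\<exists>h. h \<in> C_inf N \<and> (\<forall>y\<in>U'. h y = \<phi> y a)" if "a \<in> Coord N" for a
      using U'(4)[rule_format, OF smooth_on_coord[OF N.finC N.chart(2)[OF U] that]] by blast
    then have "\<forall>a\<in>Coord N. \<exists>h. h \<in> C_inf N \<and> (\<forall>y\<in>U'. h y = \<phi> y a)" by blast
    then obtain \<xi> where \<xi>0: "\<forall>a\<in>Coord N. \<xi> a \<in> C_inf N \<and> (\<forall>y\<in>U'. \<xi> a y = \<phi> y a)"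
      by (rule bchoice[THEN exE])
    have \<xi>: "\<And>a. a \<in> Coord N \<Longrightarrow> \<xi> a \<in> C_inf N"
      "\<And>a y. a \<in> Coord N \<Longrightarrow> y \<in> U' \<Longrightarrow> \<xi> a y = \<phi> y a" using \<xi>0 by auto
    obtain V' where V': "openin (Top M) V'" "x \<in> V'" "V' \<subseteq> V"
      "\<forall>u. smooth_on (Coord M) (\<Phi> ` V) u \<longrightarrow> (\<exists>h\<in>C_inf M. \<forall>y\<in>V'. h y = u (\<Phi> y))"
      using M.smooth_extension_exists[OF V M.chart(1)[OF V] order_refl xV] by (elim exE conjE)
    have "\<exists>h\<in>C_inf M. \<forall>y\<in>V'. h y = partial_deriv (e a) (f \<circ> inv_into V \<Phi>) (\<Phi> y)" if a: "a \<in> Coord N" for a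
    proof -
      have "smooth_on (Coord M) (\<Phi> ` V) (partial_deriv (e a) (f \<circ> inv_into V \<Phi>))"
        by (rule smooth_on_partial_deriv[OF M.chart(2)[OF V] M.C_infD[OF f V]]) (use e a in blast)
      then show ?thesis using V'(4) by blast
    qed
    then have "\<forall>a\<in>Coord N. \<exists>h. h \<in> C_inf M \<and> (\<forall>y\<in>V'. h y = partial_deriv (e a) (f \<circ> inv_into V \<Phi>) (\<Phi> y))" by blast
    then obtain h where h: "\<forall>a\<in>Coord N. h a \<in> C_inf M \<and> (\<forall>y\<in>V'. h a y = partial_deriv (e a) (f \<circ> inv_into V \<Phi>) (\<Phi> y))"
      by (rule bchoice[THEN exE])
    \<comment> \<open>A neighbourhood that \<open>\<pi>\<close> maps into \<open>U'\<close> is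
      obtained as a set where the pullback of \<open>\<theta>\<close> does not vanish; the smooth
      pullback replaces a separate continuity statement for \<open>\<pi>\<close>.\<close>
    obtain \<theta> where \<theta>: "\<theta> \<in> C_inf N" "\<theta> (\<pi> x) = 1" "\<And>y. y \<notin> U' \<Longrightarrow> \<theta> y = 0"
      using N.bump[OF U'(1,2)] by blast
    have \<theta>M: "(\<lambda>x. \<theta> (\<pi> x)) \<in> C_inf M" using \<theta>(1) by simp
    obtain V'' where V'': "openin (Top M) V''" "x \<in> V''" "\<And>y. y \<in> V'' \<Longrightarrow> \<theta> (\<pi> y) \<noteq> 0"
      using M.C_inf_nonzero_nbhd[OF \<theta>M x] \<theta>(2) by auto
    let ?h = "\<lambda>y. \<Sum>a\<in>Coord N. X (\<pi> y) (\<xi> a) * h a y"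
    have "?h \<in> C_inf M"
    proof (intro M.C_inf_sum M.C_inf_mult)
      fix a assume a: "a \<in> Coord N"
      show "(\<lambda>y. X (\<pi> y) (\<xi> a)) \<in> C_inf M"
        using pullback_smooth[OF N.VF_smooth[OF X \<xi>(1)[OF a]]] .
      show "h a \<in> C_inf M" using h a by blast
    qed
    moreover have "lift X y f = ?h y" if y: "y \<in> V' \<inter> V''" for y
    proof -
      have yV: "y \<in> V" and yC: "y \<in> Carrier M" using y V'(3) M.U_sub[OF V] by auto
      have py: "\<pi> y \<in> U'" using \<theta>(3) V''(3) y by blast
      have "lift X y f = X (\<pi> y) (\<lambda>z. f (\<iota> y z))" by (rule lift_apply[OF f])
      also have "\<dots> = (\<Sum>a\<in>Coord N. X (\<pi> y) (\<xi> a) * partial_deriv a ((\<lambda>z. f (\<iota> y z)) \<circ> inv_into U \<phi>) (\<phi> (\<pi> y)))"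
        by (rule N.tangent_coordinates[OF U U'(1,3) py \<xi> N.VF_TS[OF X pi_C[OF yC]] slice_smooth[OF f yC]])
      also have "\<dots> = ?h y"
        using h y by (intro sum.cong refl) (simp add: partial_deriv_slice[OF A yV])
      finally show ?thesis .
    qed
    ultimately show "\<exists>W h. openin (Top M) W \<and> x \<in> W \<and> h \<in> C_inf M \<and> (\<forall>y\<in>W. lift X y f = h y)"
      using V'(1,2) V''(1,2) by (intro exI[of _ "V' \<inter> V''"] exI[of _ ?h]) auto
  qed
qed

lemma lift_pullback:
  assumes X: "X \<in> vector_fields N" and x: "x \<in> Carrier M" and h: "h \<in> C_inf N"
  shows "lift X x (\<lambda>y. h (\<pi> y)) = X (\<pi> x) h"
  unfolding lift_apply[OF pullback_smooth[OF h]]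
  by (rule N.tan_cong[OF N.VF_TS[OF X pi_C[OF x]]]) (use x in auto)

lemma lift_const_slice:
  assumes X: "X \<in> vector_fields N" and x: "x \<in> Carrier M" and f: "f \<in> C_inf M"
    and c: "\<And>z. z \<in> Carrier N \<Longrightarrow> f (\<iota> x z) = c"
  shows "lift X x f = 0"
proof -
  note v = N.VF_TS[OF X pi_C[OF x]]
  have "lift X x f = X (\<pi> x) (\<lambda>z. c)"
    unfolding lift_apply[OF f] by (rule N.tan_cong[OF v]) (use x c in auto)
  then show ?thesis by (simp add: N.tan_const[OF v])
qed

lemma pushforward_TS:
  assumes v: "v \<in> tangent_space M x" and x: "x \<in> Carrier M"
  shows "pushforward N \<pi> v \<in> tangent_space N (\<pi> x)"
  unfolding tangent_space_def
proof (intro CollectI conjI ballI allI impI)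
  fix f h assume f: "f \<in> C_inf N" and h: "h \<in> C_inf N"
  show "pushforward N \<pi> v (\<lambda>y. f y + h y) = pushforward N \<pi> v f + pushforward N \<pi> v h"
    using f h pullback_smooth M.tan_add[OF v, of "\<lambda>x. f (\<pi> x)" "\<lambda>x. h (\<pi> x)"] by (simp add: pushforward_def o_def)
  show "pushforward N \<pi> v (\<lambda>y. f y * h y) = f (\<pi> x) * pushforward N \<pi> v h + h (\<pi> x) * pushforward N \<pi> v f"
    using f h pullback_smooth M.tan_mult[OF v, of "\<lambda>x. f (\<pi> x)" "\<lambda>x. h (\<pi> x)"] by (simp add: pushforward_def o_def)
next
  fix c f assume f: "f \<in> C_inf N"
  show "pushforward N \<pi> v (\<lambda>y. c * f y) = c * pushforward N \<pi> v f"
    using f N.C_inf_mult[OF N.C_inf_const f, of c] pullback_smooth M.tan_cmult[OF v, of "\<lambda>x. f (\<pi> x)" c]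
    by (simp add: pushforward_def o_def)
qed (simp add: pushforward_def)

text \<open>A field on the product need not project to a field on the factor. Its projection is
  expanded in a frame of the factor along \<open>\<pi>\<close>, with coefficients
  \<open>Z y (\<xi> a o \<pi>)\<close> that are smooth on the product.\<close>

lemma pullback_metric_smooth:
  assumes g: "ssr N g" and Z: "Z \<in> vector_fields M" and Z': "Z' \<in> vector_fields M"
  shows "(\<lambda>y. g (\<pi> y) (pushforward N \<pi> (Z y)) (pushforward N \<pi> (Z' y))) \<in> C_inf M"
proof (rule M.C_infI_local)
  interpret g: ssr N g by (rule g)
  fix x assume x: "x \<in> Carrier M"
  obtain W E \<xi> where W: "\<pi> x \<in> W" "N.local_frame W (Coord N) E \<xi>"
    using N.local_frame_exists[OF pi_C[OF x]] by blast
  have o: "openin (Top N) W" and E: "\<And>a. a \<in> Coord N \<Longrightarrow> E a \<in> vector_fields N" "\<And>a. a \<in> Coord N \<Longrightarrow> \<xi> a \<in> C_inf N"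
    and sp: "\<And>y v. y \<in> W \<Longrightarrow> v \<in> tangent_space N y \<Longrightarrow> v = (\<lambda>f. \<Sum>a\<in>Coord N. v (\<xi> a) * E a y f)"
    using W(2) unfolding N.local_frame_def by blast+
  obtain \<theta> where \<theta>: "\<theta> \<in> C_inf N" "\<theta> (\<pi> x) = 1" "\<And>y. y \<notin> W \<Longrightarrow> \<theta> y = 0"
    using N.bump[OF o W(1)] by blast
  have \<theta>M: "(\<lambda>x. \<theta> (\<pi> x)) \<in> C_inf M" using \<theta>(1) by simp
  obtain V where V: "openin (Top M) V" "x \<in> V" "\<And>y. y \<in> V \<Longrightarrow> \<theta> (\<pi> y) \<noteq> 0"
    using M.C_inf_nonzero_nbhd[OF \<theta>M x] \<theta>(2) by auto
  let ?h = "\<lambda>y. \<Sum>a\<in>Coord N. Z y (\<lambda>x. \<xi> a (\<pi> x)) * (\<Sum>b\<in>Coord N. Z' y (\<lambda>x. \<xi> b (\<pi> x)) * g (\<pi> y) (E b (\<pi> y)) (E a (\<pi> y)))"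
  have "?h \<in> C_inf M"
  proof (intro M.C_inf_sum M.C_inf_mult)
    fix a b assume "a \<in> Coord N" "b \<in> Coord N"
    then show "(\<lambda>y. g (\<pi> y) (E b (\<pi> y)) (E a (\<pi> y))) \<in> C_inf M"
      using pullback_smooth[OF g.g_smooth[OF E(1) E(1)], of b a] by simp
  qed (use Z Z' E in auto)
  moreover have "g (\<pi> y) (pushforward N \<pi> (Z y)) (pushforward N \<pi> (Z' y)) = ?h y" if y: "y \<in> V" for y
  proof -
    have yC: "y \<in> Carrier M" using V(1) openin_subset y by blast
    have py: "\<pi> y \<in> W" using V(3)[OF y] \<theta>(3) by blast
    note pC = pi_C[OF yC]
    let ?u = "pushforward N \<pi> (Z y)" and ?w = "pushforward N \<pi> (Z' y)"
    have T: "?u \<in> tangent_space N (\<pi> y)" "?w \<in> tangent_space N (\<pi> y)"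
      using pushforward_TS[OF M.VF_TS yC] Z Z' yC by auto
    have ET: "E a (\<pi> y) \<in> tangent_space N (\<pi> y)" if "a \<in> Coord N" for a by (rule N.VF_TS[OF E(1)[OF that] pC])
    have ps: "pushforward N \<pi> (Z y) (\<xi> a) = Z y (\<lambda>x. \<xi> a (\<pi> x))"
      "pushforward N \<pi> (Z' y) (\<xi> a) = Z' y (\<lambda>x. \<xi> a (\<pi> x))" if "a \<in> Coord N" for a
      using E(2)[OF that] by (simp_all add: pushforward_def o_def)
    have "g (\<pi> y) ?u ?w = g (\<pi> y) (\<lambda>f. \<Sum>a\<in>Coord N. ?u (\<xi> a) * E a (\<pi> y) f) ?w" using sp[OF py T(1)] by simp
    also have "\<dots> = (\<Sum>a\<in>Coord N. ?u (\<xi> a) * g (\<pi> y) (E a (\<pi> y)) ?w)" by (rule g.g_sum[OF pC T(2) ET])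
    also have "\<dots> = ?h y"
    proof (rule sum.cong[OF refl])
      fix a assume a: "a \<in> Coord N"
      have "g (\<pi> y) (E a (\<pi> y)) ?w = g (\<pi> y) ?w (E a (\<pi> y))" by (rule g.g_sym[OF pC ET[OF a] T(2)])
      also have "\<dots> = g (\<pi> y) (\<lambda>f. \<Sum>b\<in>Coord N. ?w (\<xi> b) * E b (\<pi> y) f) (E a (\<pi> y))" using sp[OF py T(2)] by simp
      also have "\<dots> = (\<Sum>b\<in>Coord N. ?w (\<xi> b) * g (\<pi> y) (E b (\<pi> y)) (E a (\<pi> y)))" by (rule g.g_sum[OF pC ET[OF a] ET])
      finally show "?u (\<xi> a) * g (\<pi> y) (E a (\<pi> y)) ?w = Z y (\<lambda>x. \<xi> a (\<pi> x)) *
          (\<Sum>b\<in>Coord N. Z' y (\<lambda>x. \<xi> b (\<pi> x)) * g (\<pi> y) (E b (\<pi> y)) (E a (\<pi> y)))"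
        using a by (simp add: ps)
    qed
    finally show ?thesis .
  qed
  ultimately show "\<exists>W h. openin (Top M) W \<and> x \<in> W \<and> h \<in> C_inf M \<and>
      (\<forall>y\<in>W. g (\<pi> y) (pushforward N \<pi> (Z y)) (pushforward N \<pi> (Z' y)) = h y)"
    using V(1,2) by (intro exI[of _ V] exI[of _ ?h]) auto
qed

end

section \<open>The product manifold\<close>

locale mfd_product =
  fixes B :: "('b, 'c) manifold" and F :: "nat \<Rightarrow> ('f, 'd) manifold" and J :: "nat set"
  assumes mB: "mfd B" and mF: "\<And>j. j \<in> J \<Longrightarrow> mfd (F j)" and finJ: "finite J"
begin

abbreviation "M \<equiv> prod_manifold B F J"

section \<open>Charts of the product\<close>

definition join :: "('b \<Rightarrow> 'c \<Rightarrow> real) \<Rightarrow> (nat \<Rightarrow> 'f \<Rightarrow> 'd \<Rightarrow> real) \<Rightarrow> 'b \<times> (nat \<Rightarrow> 'f) \<Rightarrow> 'c + nat \<times> 'd \<Rightarrow> real"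
  where "join \<phi> \<psi> = (\<lambda>(p, q). restrict (case_sum (\<phi> p) (\<lambda>(j, a). \<psi> j (q j) a)) (Coord M))"

lemma Top_M: "Top M = prod_topology (Top B) (product_topology (\<lambda>j. Top (F j)) J)"
  by (simp add: prod_manifold_def Let_def)

lemma Coord_M: "Coord M = Coord B <+> (SIGMA j:J. Coord (F j))"
  by (simp add: prod_manifold_def Let_def)

lemma Carrier_M: "Carrier M = Carrier B \<times> (\<Pi>\<^sub>E j\<in>J. Carrier (F j))"
  by (simp add: Top_M)

lemma Atlas_M: "(V, \<Phi>) \<in> Atlas M \<longleftrightarrow> (\<exists>U \<phi> W \<psi>. (U, \<phi>) \<in> Atlas B \<and> (\<forall>j\<in>J. (W j, \<psi> j) \<in> Atlas (F j)) \<and>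
    V = U \<times> Pi\<^sub>E J W \<and> \<Phi> = join \<phi> \<psi>)"
  unfolding join_def Coord_M by (simp add: prod_manifold_def Let_def) blast

definition pB :: "('c + nat \<times> 'd \<Rightarrow> real) \<Rightarrow> 'c \<Rightarrow> real"
  where "pB x = restrict (\<lambda>a. x (Inl a)) (Coord B)"

definition pF :: "nat \<Rightarrow> ('c + nat \<times> 'd \<Rightarrow> real) \<Rightarrow> 'd \<Rightarrow> real"
  where "pF j x = restrict (\<lambda>a. x (Inr (j, a))) (Coord (F j))"

lemma pB_continuous: "continuous_map (powertop_real (Coord M)) (powertop_real (Coord B)) pB"
  unfolding continuous_map_componentwise
proof (intro conjI ballI)
  show "pB ` topspace (powertop_real (Coord M)) \<subseteq> extensional (Coord B)" by (auto simp: pB_def)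
  show "continuous_map (powertop_real (Coord M)) euclideanreal (\<lambda>x. pB x k)" if "k \<in> Coord B" for k
    using that by (auto simp: pB_def Coord_M intro: continuous_map_product_projection)
qed

lemma pF_continuous: "j \<in> J \<Longrightarrow> continuous_map (powertop_real (Coord M)) (powertop_real (Coord (F j))) (pF j)"
  unfolding continuous_map_componentwise
proof (intro conjI ballI)
  show "pF j ` topspace (powertop_real (Coord M)) \<subseteq> extensional (Coord (F j))" by (auto simp: pF_def)
  show "continuous_map (powertop_real (Coord M)) euclideanreal (\<lambda>x. pF j x k)" if "k \<in> Coord (F j)" "j \<in> J" for k
    using that by (auto simp: pF_def Coord_M intro: continuous_map_product_projection)
qed

context
  fixes U \<phi> W \<psi> assumes cB: "(U, \<phi>) \<in> Atlas B" and cF: "\<And>j. j \<in> J \<Longrightarrow> (W j, \<psi> j) \<in> Atlas (F j)"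
begin

lemma pB_join: "p \<in> U \<Longrightarrow> pB (join \<phi> \<psi> (p, q)) = \<phi> p"
proof -
  assume "p \<in> U"
  then have "\<phi> p \<in> extensional (Coord B)" using mfd.chart_ext[OF mB cB] by blast
  then show ?thesis by (auto simp: pB_def join_def Coord_M fun_eq_iff extensional_def)
qed

lemma pF_join: "j \<in> J \<Longrightarrow> q j \<in> W j \<Longrightarrow> pF j (join \<phi> \<psi> (p, q)) = \<psi> j (q j)"
proof -
  assume j: "j \<in> J" and "q j \<in> W j"
  then have "\<psi> j (q j) \<in> extensional (Coord (F j))" using mfd.chart_ext[OF mF[OF j] cF[OF j]] by blast
  then show ?thesis using j by (auto simp: pF_def join_def Coord_M fun_eq_iff extensional_def)
qed

definition "unjoin x = (inv_into U \<phi> (pB x), \<lambda>j\<in>J. inv_into (W j) (\<psi> j) (pF j x))"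

lemma unjoin_join: "y \<in> U \<times> Pi\<^sub>E J W \<Longrightarrow> unjoin (join \<phi> \<psi> y) = y"
proof -
  assume y: "y \<in> U \<times> Pi\<^sub>E J W"
  obtain p q where pq: "y = (p, q)" by (cases y)
  have q: "q j \<in> W j" if "j \<in> J" for j using y that by (auto simp: pq)
  have "inv_into (W j) (\<psi> j) (pF j (join \<phi> \<psi> y)) = q j" if "j \<in> J" for j
    using mfd.inv_chart[OF mF[OF that] cF[OF that] q[OF that]] pF_join[OF that, of q p] q[OF that] by (simp add: pq)
  moreover have "inv_into U \<phi> (pB (join \<phi> \<psi> y)) = p"
    using y pB_join[of p q] mfd.inv_chart[OF mB cB, of p] by (simp add: pq)
  moreover have "q \<in> extensional J" using y by (auto simp: pq PiE_def)
  ultimately show ?thesis by (auto simp: unjoin_def pq fun_eq_iff extensional_def)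
qed

lemma join_unjoin:
  assumes x: "x \<in> extensional (Coord M)" "pB x \<in> \<phi> ` U" "\<And>j. j \<in> J \<Longrightarrow> pF j x \<in> \<psi> j ` W j"
  shows "join \<phi> \<psi> (unjoin x) = x"
proof
  fix c
  have b: "\<phi> (inv_into U \<phi> (pB x)) = pB x" by (rule f_inv_into_f[OF x(2)])
  have f: "\<psi> j (inv_into (W j) (\<psi> j) (pF j x)) = pF j x" if "j \<in> J" for j by (rule f_inv_into_f[OF x(3)[OF that]])
  show "join \<phi> \<psi> (unjoin x) c = x c"
  proof (cases c)
    case (Inl a)
    then show ?thesis using x(1) b by (auto simp: join_def unjoin_def pB_def Coord_M extensional_def)
  next
    case (Inr ja)
    obtain j a where ja: "ja = (j, a)" by (cases ja)
    show ?thesis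
    proof (cases "j \<in> J \<and> a \<in> Coord (F j)")
      case True
      then show ?thesis using f[of j] Inr ja by (auto simp: join_def unjoin_def pF_def Coord_M)
    next
      case False
      then show ?thesis using x(1) Inr ja by (auto simp: join_def Coord_M extensional_def split_beta)
    qed
  qed
qed

text \<open>The image is described by conditions on the coordinate projections \<open>pB\<close> and
  \<open>pF\<close>, so that its openness becomes that of a finite intersection of
  preimages.\<close>

lemma join_image:
  assumes A: "A \<subseteq> U" "\<And>j. j \<in> J \<Longrightarrow> D j \<subseteq> W j"
  shows "join \<phi> \<psi> ` (A \<times> Pi\<^sub>E J D) =
    {x \<in> extensional (Coord M). pB x \<in> \<phi> ` A \<and> (\<forall>j\<in>J. pF j x \<in> \<psi> j ` D j)}" (is "?L = ?R")
proof
  show "?L \<subseteq> ?R"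
  proof
    fix x assume "x \<in> ?L"
    then obtain p q where x: "x = join \<phi> \<psi> (p, q)" "p \<in> A" "q \<in> Pi\<^sub>E J D" by auto
    have "q j \<in> D j" if "j \<in> J" for j using x(3) that by auto
    then have "\<forall>j\<in>J. pF j x \<in> \<psi> j ` D j" unfolding x(1) using pF_join A(2) by (metis imageI subsetD)
    moreover have "pB x \<in> \<phi> ` A" unfolding x(1) using pB_join[of p q] x(2) A(1) by auto
    moreover have "x \<in> extensional (Coord M)" unfolding x(1) by (simp add: join_def)
    ultimately show "x \<in> ?R" by simp
  qed
  show "?R \<subseteq> ?L"
  proof
    fix x assume x: "x \<in> ?R"
    have eq: "join \<phi> \<psi> (unjoin x) = x"
      by (rule join_unjoin) (use x A in blast)+
    have "inv_into U \<phi> (pB x) \<in> A"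
    proof -
      obtain p where p: "p \<in> A" "pB x = \<phi> p" using x by auto
      moreover from p(1) A(1) have "p \<in> U" by blast
      ultimately show ?thesis using mfd.inv_chart[OF mB cB] by simp
    qed
    moreover have "inv_into (W j) (\<psi> j) (pF j x) \<in> D j" if j: "j \<in> J" for j
    proof -
      obtain p where p: "p \<in> D j" "pF j x = \<psi> j p" using x j by auto
      moreover from p(1) A(2)[OF j] have "p \<in> W j" by blast
      ultimately show ?thesis using mfd.inv_chart[OF mF[OF j] cF[OF j]] by simp
    qed
    ultimately have "unjoin x \<in> A \<times> Pi\<^sub>E J D" by (simp add: unjoin_def)
    then show "x \<in> ?L" using eq by (metis imageI)
  qed
qed

lemma join_image_open:
  assumes A: "A \<subseteq> U" "\<And>j. j \<in> J \<Longrightarrow> D j \<subseteq> W j" "openin (Top B) A" "\<And>j. j \<in> J \<Longrightarrow> openin (Top (F j)) (D j)"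
  shows "openin (powertop_real (Coord M)) (join \<phi> \<psi> ` (A \<times> Pi\<^sub>E J D))"
proof -
  let ?X = "powertop_real (Coord M)"
  have 1: "openin ?X {x \<in> topspace ?X. pB x \<in> \<phi> ` A}"
    by (rule openin_continuous_map_preimage[OF pB_continuous mfd.chart_open_image[OF mB cB A(3,1)]])
  have 2: "openin ?X {x \<in> topspace ?X. pF j x \<in> \<psi> j ` D j}" if "j \<in> J" for j
    by (rule openin_continuous_map_preimage[OF pF_continuous[OF that] mfd.chart_open_image[OF mF[OF that] cF[OF that] A(4,2)[OF that]]])
  have "openin ?X ({x \<in> topspace ?X. pB x \<in> \<phi> ` A} \<inter> ((\<Inter>j\<in>J. {x \<in> topspace ?X. pF j x \<in> \<psi> j ` D j}) \<inter> topspace ?X))"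
    by (intro openin_Int 1 openin_INT finJ 2)
  moreover have "{x \<in> topspace ?X. pB x \<in> \<phi> ` A} \<inter> ((\<Inter>j\<in>J. {x \<in> topspace ?X. pF j x \<in> \<psi> j ` D j}) \<inter> topspace ?X) =
      {x \<in> extensional (Coord M). pB x \<in> \<phi> ` A \<and> (\<forall>j\<in>J. pF j x \<in> \<psi> j ` D j)}"
    by (auto simp: PiE_def)
  moreover have "join \<phi> \<psi> ` (A \<times> Pi\<^sub>E J D) =
      {x \<in> extensional (Coord M). pB x \<in> \<phi> ` A \<and> (\<forall>j\<in>J. pF j x \<in> \<psi> j ` D j)}"
    by (rule join_image[OF A(1,2)])
  ultimately show ?thesis by (simp only:)
qed

lemma chart_domain_open: "openin (Top M) (U \<times> Pi\<^sub>E J W)"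
  unfolding Top_M openin_prod_Times_iff
  using mfd.chart(1)[OF mB cB] mfd.chart(1)[OF mF cF] finJ by (simp add: openin_PiE)

lemma join_homeomorphic:
  "homeomorphic_map (subtopology (Top M) (U \<times> Pi\<^sub>E J W))
    (subtopology (powertop_real (Coord M)) (join \<phi> \<psi> ` (U \<times> Pi\<^sub>E J W))) (join \<phi> \<psi>)"
proof -
  let ?V = "U \<times> Pi\<^sub>E J W"
  let ?X = "subtopology (Top M) ?V" and ?Y = "subtopology (powertop_real (Coord M)) (join \<phi> \<psi> ` ?V)"
  have tX: "topspace ?X = ?V" using openin_subset[OF chart_domain_open] by auto
  have im: "join \<phi> \<psi> ` ?V = {x \<in> extensional (Coord M). pB x \<in> \<phi> ` U \<and> (\<forall>j\<in>J. pF j x \<in> \<psi> j ` W j)}"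
    by (rule join_image) auto
  have tY: "topspace ?Y = join \<phi> \<psi> ` ?V" using im by (auto simp: PiE_def)
  have f1: "continuous_map ?X (subtopology (Top B) U) fst"
    unfolding continuous_map_in_subtopology
  proof
    show "continuous_map ?X (Top B) fst"
      unfolding Top_M by (rule continuous_map_from_subtopology[OF continuous_map_fst])
  qed (use tX in auto)
  have f2: "continuous_map ?X (subtopology (Top (F j)) (W j)) (\<lambda>x. snd x j)" if j: "j \<in> J" for j
    unfolding continuous_map_in_subtopology
  proof
    have "continuous_map (Top M) (Top (F j)) ((\<lambda>x. x j) \<circ> snd)"
      unfolding Top_M by (rule continuous_map_compose[OF continuous_map_snd continuous_map_product_projection[OF j]])
    then show "continuous_map ?X (Top (F j)) (\<lambda>x. snd x j)"
      by (simp add: o_def continuous_map_from_subtopology)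
    show "(\<lambda>x. snd x j) \<in> topspace ?X \<rightarrow> W j" unfolding tX using j by auto
  qed
  have c1: "continuous_map ?X (powertop_real (Coord M)) (join \<phi> \<psi>)"
    unfolding continuous_map_componentwise
  proof (intro conjI ballI)
    show "join \<phi> \<psi> ` topspace ?X \<subseteq> extensional (Coord M)" by (auto simp: join_def)
    fix c assume c: "c \<in> Coord M"
    show "continuous_map ?X euclideanreal (\<lambda>x. join \<phi> \<psi> x c)"
    proof (cases c)
      case (Inl a)
      then have a: "a \<in> Coord B" using c by (auto simp: Coord_M)
      have "continuous_map ?X euclideanreal ((\<lambda>x. x a) \<circ> (\<phi> \<circ> fst))"
        by (intro continuous_map_compose[OF _ continuous_map_product_projection[OF a]]
            continuous_map_compose[OF f1 mfd.chart_continuous[OF mB cB]])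
      then show ?thesis using c Inl by (simp add: join_def o_def split_beta)
    next
      case (Inr ja)
      then obtain j a where ja: "ja = (j, a)" "j \<in> J" "a \<in> Coord (F j)" using c by (auto simp: Coord_M)
      have "continuous_map ?X euclideanreal ((\<lambda>x. x a) \<circ> (\<psi> j \<circ> (\<lambda>x. snd x j)))"
        by (intro continuous_map_compose[OF _ continuous_map_product_projection[OF ja(3)]]
            continuous_map_compose[OF f2[OF ja(2)] mfd.chart_continuous[OF mF[OF ja(2)] cF[OF ja(2)]]])
      then show ?thesis using c Inr ja by (simp add: join_def o_def split_beta)
    qed
  qed
  have g1: "continuous_map ?Y (Top B) (\<lambda>x. inv_into U \<phi> (pB x))"
  proof -
    have "continuous_map ?Y (subtopology (powertop_real (Coord B)) (\<phi> ` U)) pB"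
      unfolding continuous_map_in_subtopology
    proof
      show "continuous_map ?Y (powertop_real (Coord B)) pB"
        by (rule continuous_map_from_subtopology[OF pB_continuous])
      show "pB \<in> topspace ?Y \<rightarrow> \<phi> ` U" unfolding tY im by auto
    qed
    from continuous_map_compose[OF this mfd.inv_continuous[OF mB cB]] show ?thesis by (simp add: o_def)
  qed
  have g2: "continuous_map ?Y (Top (F j)) (\<lambda>x. inv_into (W j) (\<psi> j) (pF j x))" if j: "j \<in> J" for j
  proof -
    have "continuous_map ?Y (subtopology (powertop_real (Coord (F j))) (\<psi> j ` W j)) (pF j)"
      unfolding continuous_map_in_subtopology
    proof
      show "continuous_map ?Y (powertop_real (Coord (F j))) (pF j)"
        by (rule continuous_map_from_subtopology[OF pF_continuous[OF j]])
      show "pF j \<in> topspace ?Y \<rightarrow> \<psi> j ` W j" unfolding tY im using j by auto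
    qed
    from continuous_map_compose[OF this mfd.inv_continuous[OF mF[OF j] cF[OF j]]] show ?thesis by (simp add: o_def)
  qed
  have "continuous_map ?Y (product_topology (\<lambda>j. Top (F j)) J) (\<lambda>x. \<lambda>j\<in>J. inv_into (W j) (\<psi> j) (pF j x))"
    unfolding continuous_map_componentwise using g2 by auto
  then have c2: "continuous_map ?Y (Top M) unjoin"
    unfolding Top_M continuous_map_pairwise using g1 by (simp add: o_def unjoin_def)
  have "homeomorphic_maps ?X ?Y (join \<phi> \<psi>) unjoin"
    unfolding homeomorphic_maps_def
  proof (intro conjI ballI)
    show "continuous_map ?X ?Y (join \<phi> \<psi>)"
      unfolding continuous_map_in_subtopology using c1 tX by auto
    show "continuous_map ?Y ?X unjoin"
      unfolding continuous_map_in_subtopology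
    proof
      show "unjoin \<in> topspace ?Y \<rightarrow> ?V" unfolding tY using unjoin_join by auto
    qed (rule c2)
    show "unjoin (join \<phi> \<psi> y) = y" if "y \<in> topspace ?X" for y using that tX unjoin_join by blast
    show "join \<phi> \<psi> (unjoin x) = x" if "x \<in> topspace ?Y" for x
      using that unfolding tY im by (intro join_unjoin) auto
  qed
  then show ?thesis by (rule homeomorphic_maps_imp_map)
qed

lemma inv_join: "y \<in> U \<times> Pi\<^sub>E J W \<Longrightarrow> inv_into (U \<times> Pi\<^sub>E J W) (join \<phi> \<psi>) (join \<phi> \<psi> y) = y"
  by (rule inv_into_f_f) (metis inj_onI unjoin_join)

end

text \<open>A transition map splits: a base coordinate of the result depends on \<open>pB\<close>
  alone and a coordinate of \<open>F j\<close> on \<open>pF j\<close> alone, so each is a transition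
  function of one factor composed with a coordinate projection.\<close>

lemma mfd_M: "mfd M"
proof
  show "Hausdorff_space (Top M)"
    unfolding Top_M using mfd.haus[OF mB] mfd.haus[OF mF]
    by (auto simp: Hausdorff_space_prod_topology Hausdorff_space_product_topology)
  show "finite (Coord M)"
    unfolding Coord_M using mfd.finC[OF mB] mfd.finC[OF mF] finJ by (intro finite_Plus finite_SigmaI)
  show "(\<Union>(U, \<phi>)\<in>Atlas M. U) = Carrier M"
  proof
    show "(\<Union>(U, \<phi>)\<in>Atlas M. U) \<subseteq> Carrier M"
    proof
      fix x assume "x \<in> (\<Union>(U, \<phi>)\<in>Atlas M. U)"
      then obtain V \<Phi> where V: "(V, \<Phi>) \<in> Atlas M" "x \<in> V" by blast
      then obtain U \<phi> W \<psi> where c: "(U, \<phi>) \<in> Atlas B" "\<And>j. j \<in> J \<Longrightarrow> (W j, \<psi> j) \<in> Atlas (F j)" "V = U \<times> Pi\<^sub>E J W"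
        unfolding Atlas_M by blast
      from openin_subset[OF chart_domain_open[where \<psi> = \<psi>, OF c(1,2)]] show "x \<in> Carrier M" using c(3) V(2) by blast
    qed
    show "Carrier M \<subseteq> (\<Union>(U, \<phi>)\<in>Atlas M. U)"
    proof
      fix x assume "x \<in> Carrier M"
      then obtain p q where x: "x = (p, q)" "p \<in> Carrier B" "q \<in> (\<Pi>\<^sub>E j\<in>J. Carrier (F j))" by (auto simp: Carrier_M)
      obtain U \<phi> where U: "(U, \<phi>) \<in> Atlas B" "p \<in> U" using mfd.chart_exists[OF mB x(2)] .
      have "\<exists>c. c \<in> Atlas (F j) \<and> q j \<in> fst c" if j: "j \<in> J" for j
      proof -
        have "q j \<in> Carrier (F j)" using x(3) j by auto
        then obtain W \<psi> where "(W, \<psi>) \<in> Atlas (F j)" "q j \<in> W" using mfd.chart_exists[OF mF[OF j]] by blast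
        then show ?thesis by (intro exI[of _ "(W, \<psi>)"]) simp
      qed
      then have "\<forall>j\<in>J. \<exists>c. c \<in> Atlas (F j) \<and> q j \<in> fst c" by blast
      then obtain c where c: "\<forall>j\<in>J. c j \<in> Atlas (F j) \<and> q j \<in> fst (c j)" by (rule bchoice[THEN exE])
      have "(U \<times> Pi\<^sub>E J (\<lambda>j. fst (c j)), join \<phi> (\<lambda>j. snd (c j))) \<in> Atlas M"
        unfolding Atlas_M using U(1) c
        by (intro exI[of _ U] exI[of _ \<phi>] exI[of _ "\<lambda>j. fst (c j)"] exI[of _ "\<lambda>j. snd (c j)"]) simp
      moreover have "x \<in> U \<times> Pi\<^sub>E J (\<lambda>j. fst (c j))" using x U(2) c by (auto simp: PiE_def)
      ultimately show "x \<in> (\<Union>(U, \<phi>)\<in>Atlas M. U)" by blast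
    qed
  qed
next
  fix V \<Phi> assume "(V, \<Phi>) \<in> Atlas M"
  then obtain U \<phi> W \<psi> where c: "(U, \<phi>) \<in> Atlas B" "\<And>j. j \<in> J \<Longrightarrow> (W j, \<psi> j) \<in> Atlas (F j)"
    "V = U \<times> Pi\<^sub>E J W" "\<Phi> = join \<phi> \<psi>" unfolding Atlas_M by blast
  show "openin (Top M) V" unfolding c(3) by (rule chart_domain_open[where \<psi> = \<psi>, OF c(1,2)])
  show "openin (powertop_real (Coord M)) (\<Phi> ` V)" unfolding c(3,4)
    by (rule join_image_open[OF c(1,2)])
      (use mfd.chart(1)[OF mB c(1)] mfd.chart(1)[OF mF c(2)] in auto)
  show "homeomorphic_map (subtopology (Top M) V) (subtopology (powertop_real (Coord M)) (\<Phi> ` V)) \<Phi>"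
    unfolding c(3,4) by (rule join_homeomorphic[OF c(1,2)])
  fix V' \<Phi>' i assume "(V', \<Phi>') \<in> Atlas M" and i: "i \<in> Coord M"
  then obtain U' \<phi>' W' \<psi>' where c': "(U', \<phi>') \<in> Atlas B" "\<And>j. j \<in> J \<Longrightarrow> (W' j, \<psi>' j) \<in> Atlas (F j)"
    "V' = U' \<times> Pi\<^sub>E J W'" "\<Phi>' = join \<phi>' \<psi>'" unfolding Atlas_M by blast
  have VV: "V \<inter> V' = (U \<inter> U') \<times> Pi\<^sub>E J (\<lambda>j. W j \<inter> W' j)" unfolding c(3) c'(3) by (auto simp: PiE_def Pi_def)
  have finM: "finite (Coord M)"
    unfolding Coord_M using mfd.finC[OF mB] mfd.finC[OF mF] finJ by (intro finite_Plus finite_SigmaI)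
  have oS: "openin (powertop_real (Coord M)) (\<Phi> ` (V \<inter> V'))"
    unfolding VV c(4)
  proof (rule join_image_open[OF c(1,2)])
    show "openin (Top B) (U \<inter> U')" by (intro openin_Int mfd.chart(1)[OF mB c(1)] mfd.chart(1)[OF mB c'(1)])
    show "openin (Top (F j)) (W j \<inter> W' j)" if "j \<in> J" for j
      by (intro openin_Int mfd.chart(1)[OF mF[OF that] c(2)[OF that]] mfd.chart(1)[OF mF[OF that] c'(2)[OF that]])
  qed auto
  show "smooth_on (Coord M) (\<Phi> ` (V \<inter> V')) (\<lambda>x. \<Phi>' (inv_into V \<Phi> x) i)"
  proof (cases i)
    case (Inl a)
    then have a: "a \<in> Coord B" using i by (auto simp: Coord_M)
    have oU: "openin (powertop_real (Coord B)) (\<phi> ` (U \<inter> U'))"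
      by (rule mfd.chart_open_image[OF mB c(1)]) (use mfd.chart(1)[OF mB] c c' in auto)
    have "smooth_on (Coord M) (\<Phi> ` (V \<inter> V')) (\<lambda>x. (\<lambda>u. \<phi>' (inv_into U \<phi> u) a) (pB x))"
    proof (rule smooth_on_compose[where f = "\<lambda>u. \<phi>' (inv_into U \<phi> u) a" and h = pB, OF finM oS mfd.finC[OF mB] oU])
      show "pB x \<in> \<phi> ` (U \<inter> U')" if "x \<in> \<Phi> ` (V \<inter> V')" for x
        using that pB_join[where U = U, OF c(1,2)] unfolding VV c(4) by auto
      show "smooth_on (Coord M) (\<Phi> ` (V \<inter> V')) (\<lambda>x. pB x b)" if "b \<in> Coord B" for b
      proof -
        have "Inl b \<in> Coord M" using that by (auto simp: Coord_M)
        from smooth_on_coord[OF finM oS this] show ?thesis using that by (simp add: pB_def)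
      qed
    qed (rule mfd.trans[OF mB c(1) c'(1) a])
    then show ?thesis
    proof (rule smooth_on_cong[OF oS finM])
      fix x assume "x \<in> \<Phi> ` (V \<inter> V')"
      then obtain p q where pq: "x = join \<phi> \<psi> (p, q)" "(p, q) \<in> V" "(p, q) \<in> V'" unfolding c(4) by auto
      then have p: "p \<in> U" unfolding c(3) by simp
      have r: "inv_into V \<Phi> x = (p, q)" unfolding pq(1) c(3,4)
        by (rule inv_join[OF c(1,2)]) (use pq c(3) in auto)
      have "pB x = \<phi> p" unfolding pq(1) by (rule pB_join[OF c(1,2) p])
      then have "\<phi>' (inv_into U \<phi> (pB x)) a = \<phi>' p a" using mfd.inv_chart[OF mB c(1) p] by simp
      then show "\<phi>' (inv_into U \<phi> (pB x)) a = \<Phi>' (inv_into V \<Phi> x) i"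
        unfolding r using i Inl by (simp add: c'(4) join_def)
    qed
  next
    case (Inr ja)
    then obtain j a where ja: "ja = (j, a)" and j: "j \<in> J" and a: "a \<in> Coord (F j)" using i by (auto simp: Coord_M)
    have oU: "openin (powertop_real (Coord (F j))) (\<psi> j ` (W j \<inter> W' j))"
      by (rule mfd.chart_open_image[OF mF[OF j] c(2)[OF j]]) (use mfd.chart(1)[OF mF[OF j]] c(2)[OF j] c'(2)[OF j] in auto)
    have "smooth_on (Coord M) (\<Phi> ` (V \<inter> V')) (\<lambda>x. (\<lambda>u. \<psi>' j (inv_into (W j) (\<psi> j) u) a) (pF j x))"
    proof (rule smooth_on_compose[where f = "\<lambda>u. \<psi>' j (inv_into (W j) (\<psi> j) u) a" and h = "pF j",
          OF finM oS mfd.finC[OF mF[OF j]] oU])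
      show "pF j x \<in> \<psi> j ` (W j \<inter> W' j)" if x: "x \<in> \<Phi> ` (V \<inter> V')" for x
      proof -
        obtain p q where pq: "x = join \<phi> \<psi> (p, q)" "q \<in> Pi\<^sub>E J (\<lambda>j. W j \<inter> W' j)"
          using x unfolding VV c(4) by auto
        then have "q j \<in> W j \<inter> W' j" using j by auto
        then show ?thesis using pF_join[OF c(1,2) j, of q p] pq(1) by auto
      qed
      show "smooth_on (Coord M) (\<Phi> ` (V \<inter> V')) (\<lambda>x. pF j x b)" if "b \<in> Coord (F j)" for b
      proof -
        have "Inr (j, b) \<in> Coord M" using that j by (auto simp: Coord_M)
        from smooth_on_coord[OF finM oS this] show ?thesis using that by (simp add: pF_def)
      qed
    qed (rule mfd.trans[OF mF[OF j] c(2)[OF j] c'(2)[OF j] a])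
    then show ?thesis
    proof (rule smooth_on_cong[OF oS finM])
      fix x assume "x \<in> \<Phi> ` (V \<inter> V')"
      then obtain p q where pq: "x = join \<phi> \<psi> (p, q)" "(p, q) \<in> V" "(p, q) \<in> V'" unfolding c(4) by auto
      then have p: "q j \<in> W j" unfolding c(3) using j by auto
      have r: "inv_into V \<Phi> x = (p, q)" unfolding pq(1) c(3,4)
        by (rule inv_join[OF c(1,2)]) (use pq c(3) in auto)
      have "pF j x = \<psi> j (q j)" unfolding pq(1) by (rule pF_join[where q = q and W = W, OF c(1,2) j p])
      then have "\<psi>' j (inv_into (W j) (\<psi> j) (pF j x)) a = \<psi>' j (q j) a"
        using mfd.inv_chart[OF mF[OF j] c(2)[OF j] p] by simp
      then show "\<psi>' j (inv_into (W j) (\<psi> j) (pF j x)) a = \<Phi>' (inv_into V \<Phi> x) i"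
        unfolding r using i Inr ja by (simp add: c'(4) join_def)
    qed
  qed
qed

sublocale M: mfd M by (rule mfd_M)

text \<open>One chart that is adapted to all factors at once; the tangent decomposition compares the
  partial derivatives of different slice functions at the same coordinate point.\<close>

lemma adapted_product_charts:
  assumes "x \<in> Carrier M"
  shows "\<exists>V \<Phi> U \<phi> W \<psi>. x \<in> V \<and>
    adapted_charts M B fst (\<lambda>x z. (z, snd x)) Inl V \<Phi> U \<phi> \<and>
    (\<forall>j\<in>J. adapted_charts M (F j) (\<lambda>x. snd x j) (\<lambda>x z. (fst x, (snd x)(j := z))) (\<lambda>a. Inr (j, a)) V \<Phi> (W j) (\<psi> j))"
proof -
  obtain V \<Phi> where V: "(V, \<Phi>) \<in> Atlas M" "x \<in> V" using M.chart_exists[OF assms] .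
  then obtain U \<phi> W \<psi> where c: "(U, \<phi>) \<in> Atlas B" "\<And>j. j \<in> J \<Longrightarrow> (W j, \<psi> j) \<in> Atlas (F j)"
    "V = U \<times> Pi\<^sub>E J W" "\<Phi> = join \<phi> \<psi>" unfolding Atlas_M by blast
  have "adapted_charts M B fst (\<lambda>x z. (z, snd x)) Inl V \<Phi> U \<phi>"
    unfolding adapted_charts_def using V(1) c(1) by (auto simp: c(3,4) join_def Coord_M)
  moreover have "adapted_charts M (F j) (\<lambda>x. snd x j) (\<lambda>x z. (fst x, (snd x)(j := z))) (\<lambda>a. Inr (j, a)) V \<Phi> (W j) (\<psi> j)"
    if j: "j \<in> J" for j
    unfolding adapted_charts_def
  proof (intro conjI ballI)
    show "(V, \<Phi>) \<in> Atlas M" "(W j, \<psi> j) \<in> Atlas (F j)" by (rule V(1), rule c(2)[OF j])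
    fix y assume y: "y \<in> V"
    then show "snd y j \<in> W j" using j by (auto simp: c(3))
    show "\<Phi> y (Inr (j, a)) = \<psi> j (snd y j) a" if "a \<in> Coord (F j)" for a
      using that j by (auto simp: c(4) join_def Coord_M split_beta)
    fix z assume z: "z \<in> W j"
    show "(fst y, (snd y)(j := z)) \<in> V" using y z j by (auto simp: c(3) PiE_def extensional_def)
    show "\<Phi> (fst y, (snd y)(j := z)) (Inr (j, a)) = \<psi> j z a" if "a \<in> Coord (F j)" for a
      using that j by (auto simp: c(4) join_def Coord_M)
    show "\<Phi> (fst y, (snd y)(j := z)) d = \<Phi> y d" if "d \<in> Coord M - (\<lambda>a. Inr (j, a)) ` Coord (F j)" for d
      using that by (auto simp: c(4) join_def Coord_M split_beta)
  qed
  ultimately show ?thesis using V(2) by blast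
qed

sublocale base: factor M B fst "\<lambda>x z. (z, snd x)" Inl
proof (rule factor.intro[OF mfd_M mB], unfold_locales)
  fix x assume x: "x \<in> Carrier M"
  show "\<exists>V \<Phi> U \<phi>. x \<in> V \<and> adapted_charts M B fst (\<lambda>x z. (z, snd x)) Inl V \<Phi> U \<phi>"
    using adapted_product_charts[OF x] by blast
qed (auto simp: Carrier_M Coord_M)

lemma fibre: "j \<in> J \<Longrightarrow> factor M (F j) (\<lambda>x. snd x j) (\<lambda>x z. (fst x, (snd x)(j := z))) (\<lambda>a. Inr (j, a))"
proof (rule factor.intro[OF mfd_M mF], assumption, unfold_locales)
  assume j: "j \<in> J"
  fix x assume x: "x \<in> Carrier M"
  show "\<exists>V \<Phi> U \<phi>. x \<in> V \<and> adapted_charts M (F j) (\<lambda>x. snd x j) (\<lambda>x z. (fst x, (snd x)(j := z))) (\<lambda>a. Inr (j, a)) V \<Phi> U \<phi>"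
    using adapted_product_charts[OF x] j by blast
qed (auto simp: Carrier_M Coord_M PiE_def extensional_def inj_on_def)

text \<open>The coordinates of the product are partitioned among the factors, and the function
  attached to a factor keeps just the partial derivatives of its own block. Linearity in the partial
  derivatives then gives the splitting of the tangent space in terms of derivations.\<close>

lemma tangent_decomposition:
  assumes x: "x \<in> Carrier M" and v: "v \<in> tangent_space M x" and f: "f \<in> C_inf M"
  shows "v f = v (\<lambda>y. f (fst y, snd x)) + (\<Sum>j\<in>J. v (\<lambda>y. f (fst x, (snd x)(j := snd y j))))"
proof -
  obtain V \<Phi> U \<phi> W \<psi> where xV: "x \<in> V" and aB: "adapted_charts M B fst (\<lambda>x z. (z, snd x)) Inl V \<Phi> U \<phi>"
    and aF: "\<And>j. j \<in> J \<Longrightarrow> adapted_charts M (F j) (\<lambda>x. snd x j) (\<lambda>x z. (fst x, (snd x)(j := z))) (\<lambda>a. Inr (j, a)) V \<Phi> (W j) (\<psi> j)"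
    using adapted_product_charts[OF x] by blast
  have V: "(V, \<Phi>) \<in> Atlas M" using aB by (auto simp: adapted_charts_def)
  obtain N where N: "openin (Top M) N" "x \<in> N" "N \<subseteq> V"
    "\<forall>u. smooth_on (Coord M) (\<Phi> ` V) u \<longrightarrow> (\<exists>h\<in>C_inf M. \<forall>y\<in>N. h y = u (\<Phi> y))"
    using M.smooth_extension_exists[OF V M.chart(1)[OF V] order_refl xV] by (elim exE conjE)
  have "\<exists>h. h \<in> C_inf M \<and> (\<forall>y\<in>N. h y = \<Phi> y a)" if "a \<in> Coord M" for a
    using N(4)[rule_format, OF smooth_on_coord[OF M.finC M.chart(2)[OF V] that]] by blast
  then have "\<forall>a\<in>Coord M. \<exists>h. h \<in> C_inf M \<and> (\<forall>y\<in>N. h y = \<Phi> y a)" by blast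
  then obtain \<xi> where \<xi>0: "\<forall>a\<in>Coord M. \<xi> a \<in> C_inf M \<and> (\<forall>y\<in>N. \<xi> a y = \<Phi> y a)"
    by (rule bchoice[THEN exE])
  have \<xi>: "\<And>a. a \<in> Coord M \<Longrightarrow> \<xi> a \<in> C_inf M" "\<And>a y. a \<in> Coord M \<Longrightarrow> y \<in> N \<Longrightarrow> \<xi> a y = \<Phi> y a"
    using \<xi>0 by auto
  let ?d = "\<lambda>h c. partial_deriv c (h \<circ> inv_into V \<Phi>) (\<Phi> x)"
  have rep: "v h = (\<Sum>c\<in>Coord M. v (\<xi> c) * ?d h c)" if "h \<in> C_inf M" for h
    by (rule M.tangent_coordinates[OF V N(1,3,2) \<xi> v that])
  let ?fB = "\<lambda>y. f (fst y, snd x)" and ?fF = "\<lambda>j y. f (fst x, (snd x)(j := snd y j))"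
  have fB: "?fB \<in> C_inf M" using base.pullback_smooth[OF base.slice_smooth[OF f x]] by simp
  have fF: "?fF j \<in> C_inf M" if "j \<in> J" for j
    using factor.pullback_smooth[OF fibre[OF that] factor.slice_smooth[OF fibre[OF that] f x]] by simp
  have dB: "?d ?fB c = (if c \<in> Inl ` Coord B then ?d f c else 0)" if "c \<in> Coord M" for c
    using base.partial_deriv_slice_pullback[OF aB xV that, of f] by simp
  have dF: "?d (?fF j) c = (if c \<in> (\<lambda>a. Inr (j, a)) ` Coord (F j) then ?d f c else 0)" if "c \<in> Coord M" "j \<in> J" for c j
    using factor.partial_deriv_slice_pullback[OF fibre[OF that(2)] aF[OF that(2)] xV that(1), of f] by simp
  have "?d f c = ?d ?fB c + (\<Sum>j\<in>J. ?d (?fF j) c)" if c: "c \<in> Coord M" for c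
  proof (cases c)
    case (Inl a)
    have "?d (?fF j) c = 0" if "j \<in> J" for j using dF[OF c that] Inl by auto
    then have "(\<Sum>j\<in>J. ?d (?fF j) c) = 0" by (intro sum.neutral ballI)
    moreover have "c \<in> Inl ` Coord B" using c Inl by (auto simp: Coord_M)
    ultimately show ?thesis using dB[OF c] by simp
  next
    case (Inr ja)
    then obtain j a where ja: "c = Inr (j, a)" "j \<in> J" "a \<in> Coord (F j)" using c by (auto simp: Coord_M)
    have "(\<Sum>j'\<in>J. ?d (?fF j') c) = (\<Sum>j'\<in>J. if j' = j then ?d f c else 0)"
    proof (rule sum.cong[OF refl])
      fix j' assume "j' \<in> J"
      from dF[OF c this] show "?d (?fF j') c = (if j' = j then ?d f c else 0)" using ja by auto
    qed
    also have "\<dots> = ?d f c" using ja finJ by simp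
    finally show ?thesis using ja dB[OF c] by auto
  qed
  then have "v f = (\<Sum>c\<in>Coord M. v (\<xi> c) * ?d ?fB c + (\<Sum>j\<in>J. v (\<xi> c) * ?d (?fF j) c))"
    unfolding rep[OF f] by (intro sum.cong refl) (simp add: distrib_left sum_distrib_left)
  also have "\<dots> = v ?fB + (\<Sum>j\<in>J. v (?fF j))"
    unfolding sum.distrib rep[OF fB] sum.swap[of _ J "Coord M"] using rep[OF fF] by simp
  finally show ?thesis .
qed

lemma tangent_eqI:
  assumes x: "x \<in> Carrier M" and v: "v \<in> tangent_space M x" and w: "w \<in> tangent_space M x"
    and eB: "\<And>h. h \<in> C_inf B \<Longrightarrow> v (\<lambda>y. h (fst y)) = w (\<lambda>y. h (fst y))"
    and eF: "\<And>j h. j \<in> J \<Longrightarrow> h \<in> C_inf (F j) \<Longrightarrow> v (\<lambda>y. h (snd y j)) = w (\<lambda>y. h (snd y j))"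
  shows "v = w"
proof
  fix f
  show "v f = w f"
  proof (cases "f \<in> C_inf M")
    case True
    have "v (\<lambda>y. f (fst y, snd x)) = w (\<lambda>y. f (fst y, snd x))"
      by (rule eB) (use base.slice_smooth[OF True x] in simp)
    moreover have "v (\<lambda>y. f (fst x, (snd x)(j := snd y j))) = w (\<lambda>y. f (fst x, (snd x)(j := snd y j)))" if "j \<in> J" for j
      by (rule eF[OF that, of "\<lambda>z. f (fst x, (snd x)(j := z))"])
        (use factor.slice_smooth[OF fibre[OF that] True x] in simp)
    ultimately show ?thesis
      unfolding tangent_decomposition[OF x v True] tangent_decomposition[OF x w True] by simp
  next
    case False
    then show ?thesis using M.tan_not_smooth[OF v] M.tan_not_smooth[OF w] by simp
  qed
qed

section \<open>Fields with a component in every factor\<close>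

definition PF :: "'b vfield \<Rightarrow> (nat \<Rightarrow> 'f vfield) \<Rightarrow> ('b \<times> (nat \<Rightarrow> 'f)) vfield"
  where "PF X V = (\<lambda>x f. lift_base B F J X x f + (\<Sum>j\<in>J. 1 * lift_fibre B F J j (V j) x f))"

lemma lift_base_eq: "lift_base B F J X = base.lift X"
  by (auto simp: lift_base_def base.lift_def fun_eq_iff)

lemma lift_fibre_eq: "j \<in> J \<Longrightarrow> lift_fibre B F J j V = factor.lift M (\<lambda>x. snd x j) (\<lambda>x z. (fst x, (snd x)(j := z))) V"
  by (auto simp: lift_fibre_def factor.lift_def[OF fibre] fun_eq_iff)

context
  fixes X V assumes X: "X \<in> vector_fields B" and V: "\<And>j. j \<in> J \<Longrightarrow> V j \<in> vector_fields (F j)"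
begin

lemma PF_VF [simp]: "PF X V \<in> vector_fields M"
  unfolding PF_def
proof (intro M.VF_add)
  show "lift_base B F J X \<in> vector_fields M" by (simp add: lift_base_eq base.lift_VF[OF X])
  \<comment> \<open>The factor 1 in the sum gives it the shape of a combination with coefficients,
    as in \<open>VF_sum\<close>.\<close>
  show "(\<lambda>x f. \<Sum>j\<in>J. 1 * lift_fibre B F J j (V j) x f) \<in> vector_fields M"
    by (rule M.VF_sum[of J "\<lambda>j. lift_fibre B F J j (V j)" "\<lambda>_ _. 1"])
      (auto simp: lift_fibre_eq intro: factor.lift_VF[OF fibre] V)
qed

lemma PF_base:
  assumes x: "x \<in> Carrier M" and h: "h \<in> C_inf B"
  shows "PF X V x (\<lambda>y. h (fst y)) = X (fst x) h"
proof -
  have "lift_fibre B F J j (V j) x (\<lambda>y. h (fst y)) = 0" if j: "j \<in> J" for j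
    unfolding lift_fibre_eq[OF j]
    by (rule factor.lift_const_slice[OF fibre[OF j] V[OF j] x, where c = "h (fst x)"]) (use base.pullback_smooth[OF h] in auto)
  then show ?thesis using base.lift_pullback[OF X x h] by (simp add: PF_def lift_base_eq)
qed

lemma PF_fibre:
  assumes x: "x \<in> Carrier M" and i: "i \<in> J" and h: "h \<in> C_inf (F i)"
  shows "PF X V x (\<lambda>y. h (snd y i)) = V i (snd x i) h"
proof -
  have hM: "(\<lambda>y. h (snd y i)) \<in> C_inf M" by (rule factor.pullback_smooth[OF fibre[OF i] h])
  have "lift_fibre B F J j (V j) x (\<lambda>y. h (snd y i)) = (if j = i then V i (snd x i) h else 0)" if j: "j \<in> J" for j
  proof (cases "j = i")
    case True
    then show ?thesis using factor.lift_pullback[OF fibre[OF i] V[OF i] x h] by (simp add: lift_fibre_eq[OF i])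
  next
    case False
    have "lift_fibre B F J j (V j) x (\<lambda>y. h (snd y i)) = 0"
      unfolding lift_fibre_eq[OF j]
      by (rule factor.lift_const_slice[OF fibre[OF j] V[OF j] x hM, where c = "h (snd x i)"]) (use False in auto)
    then show ?thesis using False by simp
  qed
  then have "(\<Sum>j\<in>J. 1 * lift_fibre B F J j (V j) x (\<lambda>y. h (snd y i))) = V i (snd x i) h"
    using i finJ by simp
  moreover have "lift_base B F J X x (\<lambda>y. h (snd y i)) = 0"
    unfolding lift_base_eq by (rule base.lift_const_slice[OF X x hM, where c = "h (snd x i)"]) simp
  ultimately show ?thesis by (simp add: PF_def)
qed

lemma pushforward_PF_base:
  assumes x: "x \<in> Carrier M" shows "pushforward B fst (PF X V x) = X (fst x)"
proof
  fix h
  have v: "X (fst x) \<in> tangent_space B (fst x)" by (rule base.N.VF_TS[OF X]) (use x in simp)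
  show "pushforward B fst (PF X V x) h = X (fst x) h"
    using PF_base[OF x] base.N.tan_not_smooth[OF v] by (simp add: pushforward_def o_def)
qed

lemma pushforward_PF_fibre:
  assumes x: "x \<in> Carrier M" and j: "j \<in> J" shows "pushforward (F j) (\<lambda>x. snd x j) (PF X V x) = V j (snd x j)"
proof
  fix h
  have v: "V j (snd x j) \<in> tangent_space (F j) (snd x j)"
    by (rule mfd.VF_TS[OF mF[OF j] V[OF j]]) (rule factor.pi_C[OF fibre[OF j] x])
  show "pushforward (F j) (\<lambda>x. snd x j) (PF X V x) h = V j (snd x j) h"
    using PF_fibre[OF x j] mfd.tan_not_smooth[OF mF[OF j] v] by (simp add: pushforward_def o_def)
qed

end

text \<open>Derivations on the product are determined by their values on functions pulled back from
  one factor. On such a function each field acts through its component in that factor, so the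
  bracket is formed componentwise and components of different factors commute.\<close>

lemma PF_bracket:
  assumes X: "X \<in> vector_fields B" and V: "\<And>j. j \<in> J \<Longrightarrow> V j \<in> vector_fields (F j)"
    and Y: "Y \<in> vector_fields B" and W: "\<And>j. j \<in> J \<Longrightarrow> W j \<in> vector_fields (F j)" and x: "x \<in> Carrier M"
  shows "lie_bracket (PF X V) (PF Y W) x = PF (lie_bracket X Y) (\<lambda>j. lie_bracket (V j) (W j)) x"
proof (rule tangent_eqI[OF x])
  have XV: "PF X V \<in> vector_fields M" and YW: "PF Y W \<in> vector_fields M"
    by (rule PF_VF[OF X V], assumption) (rule PF_VF[OF Y W])
  have bB: "lie_bracket X Y \<in> vector_fields B" by (rule base.N.VF_bracket[OF X Y])
  have bF: "lie_bracket (V j) (W j) \<in> vector_fields (F j)" if "j \<in> J" for j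
    by (rule mfd.VF_bracket[OF mF[OF that] V[OF that] W[OF that]])
  show "lie_bracket (PF X V) (PF Y W) x \<in> tangent_space M x"
    by (rule M.VF_TS[OF M.VF_bracket[OF XV YW] x])
  show "PF (lie_bracket X Y) (\<lambda>j. lie_bracket (V j) (W j)) x \<in> tangent_space M x"
    by (rule M.VF_TS[OF PF_VF[OF bB bF] x])
  fix h assume h: "h \<in> C_inf B"
  have 1: "PF X V x (\<lambda>q. PF Y W q (\<lambda>y. h (fst y))) = PF X V x (\<lambda>q. Y (fst q) h)"
    by (rule M.tan_cong[OF M.VF_TS[OF XV x] x]) (rule PF_base[OF Y W _ h])
  have 2: "PF Y W x (\<lambda>q. PF X V q (\<lambda>y. h (fst y))) = PF Y W x (\<lambda>q. X (fst q) h)"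
    by (rule M.tan_cong[OF M.VF_TS[OF YW x] x]) (rule PF_base[OF X V _ h])
  show "lie_bracket (PF X V) (PF Y W) x (\<lambda>y. h (fst y)) =
      PF (lie_bracket X Y) (\<lambda>j. lie_bracket (V j) (W j)) x (\<lambda>y. h (fst y))"
  proof -
    have e: "PF (lie_bracket X Y) (\<lambda>j. lie_bracket (V j) (W j)) x (\<lambda>y. h (fst y)) = lie_bracket X Y (fst x) h"
      by (rule PF_base[OF bB bF x h])
    have "PF X V x (\<lambda>y. Y (fst y) h) = X (fst x) (\<lambda>p. Y p h)"
      by (rule PF_base[OF X V x base.N.VF_smooth[OF Y h]])
    moreover have "PF Y W x (\<lambda>y. X (fst y) h) = Y (fst x) (\<lambda>p. X p h)"
      by (rule PF_base[OF Y W x base.N.VF_smooth[OF X h]])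
    ultimately show ?thesis unfolding e unfolding lie_bracket_def 1 2 by simp
  qed
next
  have XV: "PF X V \<in> vector_fields M" and YW: "PF Y W \<in> vector_fields M"
    by (rule PF_VF[OF X V], assumption) (rule PF_VF[OF Y W])
  have bB: "lie_bracket X Y \<in> vector_fields B" by (rule base.N.VF_bracket[OF X Y])
  have bF: "lie_bracket (V j) (W j) \<in> vector_fields (F j)" if "j \<in> J" for j
    by (rule mfd.VF_bracket[OF mF[OF that] V[OF that] W[OF that]])
  fix j h assume j: "j \<in> J" and h: "h \<in> C_inf (F j)"
  have 1: "PF X V x (\<lambda>q. PF Y W q (\<lambda>y. h (snd y j))) = PF X V x (\<lambda>q. W j (snd q j) h)"
    by (rule M.tan_cong[OF M.VF_TS[OF XV x] x]) (rule PF_fibre[OF Y W _ j h])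
  have 2: "PF Y W x (\<lambda>q. PF X V q (\<lambda>y. h (snd y j))) = PF Y W x (\<lambda>q. V j (snd q j) h)"
    by (rule M.tan_cong[OF M.VF_TS[OF YW x] x]) (rule PF_fibre[OF X V _ j h])
  show "lie_bracket (PF X V) (PF Y W) x (\<lambda>y. h (snd y j)) =
      PF (lie_bracket X Y) (\<lambda>j. lie_bracket (V j) (W j)) x (\<lambda>y. h (snd y j))"
  proof -
    have e: "PF (lie_bracket X Y) (\<lambda>j. lie_bracket (V j) (W j)) x (\<lambda>y. h (snd y j)) = lie_bracket (V j) (W j) (snd x j) h"
      by (rule PF_fibre[OF bB bF x j h])
    have "PF X V x (\<lambda>y. W j (snd y j) h) = V j (snd x j) (\<lambda>p. W j p h)"
      by (rule PF_fibre[OF X V x j mfd.VF_smooth[OF mF[OF j] W[OF j] h]])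
    moreover have "PF Y W x (\<lambda>y. V j (snd y j) h) = W j (snd x j) (\<lambda>p. V j p h)"
      by (rule PF_fibre[OF Y W x j mfd.VF_smooth[OF mF[OF j] V[OF j] h]])
    ultimately show ?thesis unfolding e unfolding lie_bracket_def 1 2 by simp
  qed
qed

text \<open>Every tangent vector is the value of such a field, so a one-form on the product is known
  as soon as it is known on these fields.\<close>

lemma PF_extension:
  assumes x: "x \<in> Carrier M" and v: "v \<in> tangent_space M x"
  obtains X V where "X \<in> vector_fields B" "\<And>j. j \<in> J \<Longrightarrow> V j \<in> vector_fields (F j)" "PF X V x = v"
proof -
  obtain X where X: "X \<in> vector_fields B" "X (fst x) = pushforward B fst v"
    by (rule base.N.vector_extension[OF _ base.pushforward_TS[OF v x]]) (use x in auto)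
  have "\<exists>V. V \<in> vector_fields (F j) \<and> V (snd x j) = pushforward (F j) (\<lambda>x. snd x j) v" if j: "j \<in> J" for j
    by (rule mfd.vector_extension[OF mF[OF j] factor.pi_C[OF fibre[OF j] x] factor.pushforward_TS[OF fibre[OF j] v x]]) blast
  then have "\<forall>j\<in>J. \<exists>V. V \<in> vector_fields (F j) \<and> V (snd x j) = pushforward (F j) (\<lambda>x. snd x j) v" by blast
  then obtain V where V: "\<forall>j\<in>J. V j \<in> vector_fields (F j) \<and> V j (snd x j) = pushforward (F j) (\<lambda>x. snd x j) v"
    by (rule bchoice[THEN exE])
  have V': "V j \<in> vector_fields (F j)" if "j \<in> J" for j using V that by blast
  have "PF X V x = v"
  proof (rule tangent_eqI[OF x M.VF_TS[OF PF_VF[OF X(1) V'] x] v])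
    show "PF X V x (\<lambda>y. h (fst y)) = v (\<lambda>y. h (fst y))" if "h \<in> C_inf B" for h
      using that by (simp add: PF_base[OF X(1) V' x that] X(2) pushforward_def o_def)
    show "PF X V x (\<lambda>y. h (snd y j)) = v (\<lambda>y. h (snd y j))" if "j \<in> J" "h \<in> C_inf (F j)" for j h
      using that V by (simp add: PF_fibre[OF X(1) V' x that] pushforward_def o_def)
  qed
  then show ?thesis using that X(1) V' by blast
qed

end

section \<open>Multiply warped products\<close>

lemma pushforward_add: "pushforward N \<pi> (\<lambda>f. u f + v f) = (\<lambda>f. pushforward N \<pi> u f + pushforward N \<pi> v f)"
  by (auto simp: pushforward_def)

lemma pushforward_scale: "pushforward N \<pi> (\<lambda>f. c * u f) = (\<lambda>f. c * pushforward N \<pi> u f)"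
  by (auto simp: pushforward_def)

locale warped = mfd_product B F J for B :: "('b, 'c) manifold" and F :: "nat \<Rightarrow> ('f, 'd) manifold" and J +
  fixes gB :: "'b bform" and gF :: "nat \<Rightarrow> 'f bform" and b :: "nat \<Rightarrow> 'b \<Rightarrow> real"
  assumes sB: "ssr B gB" and ndB: "non_degenerate B gB"
    and sF: "\<And>j. j \<in> J \<Longrightarrow> ssr (F j) (gF j)"
    and regF: "\<And>j. j \<in> J \<Longrightarrow> semi_regular (F j) (gF j)"
    and bC: "\<And>j. j \<in> J \<Longrightarrow> b j \<in> C_inf B"
begin

abbreviation "gM \<equiv> warped_metric B gB F gF b J"

lemma gM_eq: "gM x v w = gB (fst x) (pushforward B fst v) (pushforward B fst w) +
  (\<Sum>j\<in>J. (b j (fst x))\<^sup>2 * gF j (snd x j) (pushforward (F j) (\<lambda>x. snd x j) v) (pushforward (F j) (\<lambda>x. snd x j) w))"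
  by (simp add: warped_metric_def split_beta)

lemma warp_smooth: "j \<in> J \<Longrightarrow> (\<lambda>x. b j (fst x)) \<in> C_inf M"
  by (rule base.pullback_smooth[OF bC])

lemma ssr_M: "ssr M gM"
proof (rule ssr.intro[OF mfd_M], unfold_locales)
  fix x u v assume x: "x \<in> Carrier M" and u: "u \<in> tangent_space M x" and v: "v \<in> tangent_space M x"
  have xB: "fst x \<in> Carrier B" using x by simp
  have xF: "snd x j \<in> Carrier (F j)" if "j \<in> J" for j using factor.pi_C[OF fibre[OF that] x] .
  note TB = base.pushforward_TS[OF _ x]
  have TF: "pushforward (F j) (\<lambda>x. snd x j) w \<in> tangent_space (F j) (snd x j)"
    if "j \<in> J" "w \<in> tangent_space M x" for j w by (rule factor.pushforward_TS[OF fibre[OF that(1)] that(2) x])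
  show "gM x u v = gM x v u"
    unfolding gM_eq ssr.g_sym[OF sB xB TB[OF u] TB[OF v]]
    using ssr.g_sym[OF sF xF TF[OF _ u] TF[OF _ v]] by simp
  fix w assume w: "w \<in> tangent_space M x"
  show "gM x (\<lambda>f. u f + v f) w = gM x u w + gM x v w"
    unfolding gM_eq pushforward_add ssr.g_add[OF sB xB TB[OF u] TB[OF v] TB[OF w]]
    using ssr.g_add[OF sF xF TF[OF _ u] TF[OF _ v] TF[OF _ w]]
    by (simp add: distrib_left sum.distrib)
next
  fix x u w c assume x: "x \<in> Carrier M" and u: "u \<in> tangent_space M x" and w: "w \<in> tangent_space M x"
  have xB: "fst x \<in> Carrier B" using x by simp
  have xF: "snd x j \<in> Carrier (F j)" if "j \<in> J" for j using factor.pi_C[OF fibre[OF that] x] .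
  note TB = base.pushforward_TS[OF _ x]
  have TF: "pushforward (F j) (\<lambda>x. snd x j) w \<in> tangent_space (F j) (snd x j)"
    if "j \<in> J" "w \<in> tangent_space M x" for j w by (rule factor.pushforward_TS[OF fibre[OF that(1)] that(2) x])
  show "gM x (\<lambda>f. c * u f) w = c * gM x u w"
    unfolding gM_eq pushforward_scale ssr.g_scale[OF sB xB TB[OF u] TB[OF w]]
    using ssr.g_scale[OF sF xF TF[OF _ u] TF[OF _ w]]
    by (simp add: distrib_left sum_distrib_left mult_ac)
next
  fix X Y assume X: "X \<in> vector_fields M" and Y: "Y \<in> vector_fields M"
  show "(\<lambda>x. gM x (X x) (Y x)) \<in> C_inf M"
    unfolding gM_eq
    by (intro M.C_inf_add M.C_inf_sum M.C_inf_mult M.C_inf_power2 base.pullback_metric_smooth[OF sB X Y]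
        factor.pullback_metric_smooth[OF fibre sF X Y] warp_smooth)
qed

sublocale W: ssr M gM by (rule ssr_M)
sublocale gB: ssr B gB by (rule sB)

definition pf :: "'b vfield \<Rightarrow> (nat \<Rightarrow> 'f vfield) \<Rightarrow> bool"
  where "pf X V \<longleftrightarrow> X \<in> vector_fields B \<and> (\<forall>j\<in>J. V j \<in> vector_fields (F j))"

lemma pfD: "pf X V \<Longrightarrow> X \<in> vector_fields B" "pf X V \<Longrightarrow> j \<in> J \<Longrightarrow> V j \<in> vector_fields (F j)"
  by (auto simp: pf_def)

lemma pf_VF [simp]: "pf X V \<Longrightarrow> PF X V \<in> vector_fields M"
  by (rule PF_VF) (auto simp: pf_def)

lemma pf_bracket: "pf X V \<Longrightarrow> pf Y W \<Longrightarrow> pf (lie_bracket X Y) (\<lambda>j. lie_bracket (V j) (W j))"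
  using base.N.VF_bracket mfd.VF_bracket[OF mF] by (auto simp: pf_def)

section \<open>Metric and Koszul form of the warped product\<close>

abbreviation "bb j x \<equiv> b j (fst x)"
abbreviation "gj j V W x \<equiv> gF j (snd x j) (V j (snd x j)) (W j (snd x j))"
abbreviation "Kj j V W U x \<equiv> koszul (gF j) (V j) (W j) (U j) (snd x j)"

lemma fst_C: "x \<in> Carrier M \<Longrightarrow> fst x \<in> Carrier B" by simp

lemma snd_C: "x \<in> Carrier M \<Longrightarrow> j \<in> J \<Longrightarrow> snd x j \<in> Carrier (F j)"
  using factor.pi_C[OF fibre] by blast

lemma gM_PF:
  assumes "pf X V" "pf Y W" "x \<in> Carrier M"
  shows "gM x (PF X V x) (PF Y W x) = gB (fst x) (X (fst x)) (Y (fst x)) + (\<Sum>j\<in>J. (bb j x)\<^sup>2 * gj j V W x)"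
proof -
  have 1: "pushforward B fst (PF X V x) = X (fst x)" "pushforward B fst (PF Y W x) = Y (fst x)"
    using assms by (auto intro!: pushforward_PF_base simp: pf_def)
  have 2: "pushforward (F j) (\<lambda>x. snd x j) (PF X V x) = V j (snd x j)"
    "pushforward (F j) (\<lambda>x. snd x j) (PF Y W x) = W j (snd x j)" if "j \<in> J" for j
    using assms that by (auto intro!: pushforward_PF_fibre simp: pf_def)
  show ?thesis unfolding gM_eq 1 using 2 by simp
qed

lemma gj_smooth: "pf X V \<Longrightarrow> pf Y W \<Longrightarrow> j \<in> J \<Longrightarrow> (\<lambda>x. gj j V W x) \<in> C_inf M"
  by (rule factor.pullback_smooth[OF fibre ssr.g_smooth[OF sF]]) (auto simp: pf_def)

lemma Kj_smooth: "pf X V \<Longrightarrow> pf Y W \<Longrightarrow> pf Z U \<Longrightarrow> j \<in> J \<Longrightarrow> (\<lambda>x. Kj j V W U x) \<in> C_inf M"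
  by (rule factor.pullback_smooth[OF fibre ssr.koszul_smooth[OF sF]]) (auto simp: pf_def)

lemma base_smooth: "f \<in> C_inf B \<Longrightarrow> (\<lambda>x. f (fst x)) \<in> C_inf M"
  by (rule base.pullback_smooth)

lemma Xb_smooth: "pf X V \<Longrightarrow> j \<in> J \<Longrightarrow> (\<lambda>x. X (fst x) (b j)) \<in> C_inf M"
  by (rule base_smooth) (auto simp: pf_def bC)

context
  fixes X V x assumes pf: "pf X V" and x: "x \<in> Carrier M"
begin

lemma PF_TS: "PF X V x \<in> tangent_space M x"
  by (rule M.VF_TS[OF pf_VF[OF pf] x])

lemma PF_of_base: "f \<in> C_inf B \<Longrightarrow> PF X V x (\<lambda>y. f (fst y)) = X (fst x) f"
  by (rule PF_base[OF pfD(1)[OF pf] pfD(2)[OF pf] x])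

lemma PF_of_gj: "pf Y W \<Longrightarrow> pf Z U \<Longrightarrow> j \<in> J \<Longrightarrow>
    PF X V x (\<lambda>y. gj j W U y) = V j (snd x j) (\<lambda>z. gF j z (W j z) (U j z))"
  by (rule PF_fibre[OF pfD(1)[OF pf] pfD(2)[OF pf] x _ ssr.g_smooth[OF sF]]) (auto simp: pf_def)

lemma gj_deriv: "pf Y W \<Longrightarrow> pf Z U \<Longrightarrow> j \<in> J \<Longrightarrow>
    V j (snd x j) (\<lambda>z. gF j z (W j z) (U j z)) = Kj j V W U x + Kj j V U W x"
  by (rule ssr.koszul_metric[OF sF _ _ _ snd_C[OF x]]) (use pf in \<open>auto simp: pf_def\<close>)

lemma PF_of_Kj: "pf Y W \<Longrightarrow> pf Z U \<Longrightarrow> pf T Q \<Longrightarrow> j \<in> J \<Longrightarrow>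
    PF X V x (\<lambda>y. Kj j W U Q y) = V j (snd x j) (koszul (gF j) (W j) (U j) (Q j))"
  by (rule PF_fibre[OF pfD(1)[OF pf] pfD(2)[OF pf] x _ ssr.koszul_smooth[OF sF]]) (auto simp: pf_def)

lemma PF_of_gM:
  assumes "pf Y W" "pf Z U"
  shows "PF X V x (\<lambda>y. gM y (PF Y W y) (PF Z U y)) = X (fst x) (\<lambda>p. gB p (Y p) (Z p)) +
    (\<Sum>j\<in>J. 2 * bb j x * X (fst x) (b j) * gj j W U x + (bb j x)\<^sup>2 * V j (snd x j) (\<lambda>z. gF j z (W j z) (U j z)))"
proof -
  note T = PF_TS
  have gBs: "(\<lambda>p. gB p (Y p) (Z p)) \<in> C_inf B" using assms by (simp add: pf_def)
  have "PF X V x (\<lambda>y. gM y (PF Y W y) (PF Z U y)) =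
      PF X V x (\<lambda>y. gB (fst y) (Y (fst y)) (Z (fst y)) + (\<Sum>j\<in>J. (bb j y)\<^sup>2 * gj j W U y))"
    by (rule M.tan_cong[OF T x]) (rule gM_PF[OF assms])
  also have "\<dots> = PF X V x (\<lambda>y. gB (fst y) (Y (fst y)) (Z (fst y))) + (\<Sum>j\<in>J. PF X V x (\<lambda>y. (bb j y)\<^sup>2 * gj j W U y))"
    using gj_smooth[OF assms] warp_smooth base_smooth[OF gBs]
    by (simp add: M.tan_add[OF T] M.tan_sum[OF T])
  also have "PF X V x (\<lambda>y. gB (fst y) (Y (fst y)) (Z (fst y))) = X (fst x) (\<lambda>p. gB p (Y p) (Z p))"
    using PF_of_base[OF gBs] by simp
  also have "(\<Sum>j\<in>J. PF X V x (\<lambda>y. (bb j y)\<^sup>2 * gj j W U y)) =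
    (\<Sum>j\<in>J. 2 * bb j x * X (fst x) (b j) * gj j W U x + (bb j x)\<^sup>2 * V j (snd x j) (\<lambda>z. gF j z (W j z) (U j z)))"
  proof (rule sum.cong[OF refl])
    fix j assume j: "j \<in> J"
    show "PF X V x (\<lambda>y. (bb j y)\<^sup>2 * gj j W U y) =
        2 * bb j x * X (fst x) (b j) * gj j W U x + (bb j x)\<^sup>2 * V j (snd x j) (\<lambda>z. gF j z (W j z) (U j z))"
      using gj_smooth[OF assms j] warp_smooth[OF j] PF_of_base[OF bC[OF j]] PF_of_gj[OF assms j]
      by (simp add: M.tan_mult[OF T] M.tan_power2[OF T] mult_ac)
  qed
  finally show ?thesis .
qed

end

text \<open>Differentiating \<open>(b j)\<^sup>2\<close> yields \<open>2 * b j\<close> times a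
  derivative, halved by the factor in front of the Koszul form. Every fibre term thus keeps a factor
  \<open>b j\<close> and vanishes together with it, which is why the form remains flat-valued at
  zeros of \<open>b j\<close>.\<close>

lemma koszul_PF:
  assumes X: "pf X V" and Y: "pf Y W" and Z: "pf Z U" and x: "x \<in> Carrier M"
  shows "koszul gM (PF X V) (PF Y W) (PF Z U) x = koszul gB X Y Z (fst x) +
    (\<Sum>j\<in>J. (bb j x)\<^sup>2 * Kj j V W U x +
      bb j x * (X (fst x) (b j) * gj j W U x + Y (fst x) (b j) * gj j U V x - Z (fst x) (b j) * gj j V W x))"
proof -
  have br: "lie_bracket (PF X V) (PF Y W) x = PF (lie_bracket X Y) (\<lambda>j. lie_bracket (V j) (W j)) x"
    if "pf X V" "pf Y W" for X V Y W
    by (rule PF_bracket[OF pfD(1)[OF that(1)] pfD(2)[OF that(1)] pfD(1)[OF that(2)] pfD(2)[OF that(2)] x])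
  have sums: "(\<Sum>j\<in>J. (bb j x)\<^sup>2 * Kj j V W U x +
      bb j x * (X (fst x) (b j) * gj j W U x + Y (fst x) (b j) * gj j U V x - Z (fst x) (b j) * gj j V W x)) = 1/2 *
     ((\<Sum>j\<in>J. 2 * bb j x * X (fst x) (b j) * gj j W U x + (bb j x)\<^sup>2 * V j (snd x j) (\<lambda>z. gF j z (W j z) (U j z)))
      + (\<Sum>j\<in>J. 2 * bb j x * Y (fst x) (b j) * gj j U V x + (bb j x)\<^sup>2 * W j (snd x j) (\<lambda>z. gF j z (U j z) (V j z)))
      - (\<Sum>j\<in>J. 2 * bb j x * Z (fst x) (b j) * gj j V W x + (bb j x)\<^sup>2 * U j (snd x j) (\<lambda>z. gF j z (V j z) (W j z)))
      - (\<Sum>j\<in>J. (bb j x)\<^sup>2 * gj j V (\<lambda>j. lie_bracket (W j) (U j)) x)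
      + (\<Sum>j\<in>J. (bb j x)\<^sup>2 * gj j W (\<lambda>j. lie_bracket (U j) (V j)) x)
      + (\<Sum>j\<in>J. (bb j x)\<^sup>2 * gj j U (\<lambda>j. lie_bracket (V j) (W j)) x))"
    unfolding sum.distrib[symmetric] sum_subtractf[symmetric] sum_distrib_left
    by (rule sum.cong[OF refl]) (simp add: koszul_def field_simps)
  show ?thesis
    unfolding sums
    unfolding koszul_def[of gM] br[OF Y Z] br[OF Z X] br[OF X Y]
      gM_PF[OF X pf_bracket[OF Y Z] x] gM_PF[OF Y pf_bracket[OF Z X] x] gM_PF[OF Z pf_bracket[OF X Y] x]
      PF_of_gM[OF X x Y Z] PF_of_gM[OF Y x Z X] PF_of_gM[OF Z x X Y]
    unfolding koszul_def[of gB] by (simp add: field_simps)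
qed

section \<open>Sharps of Koszul forms and their contractions\<close>

definition nab :: "'b vfield \<Rightarrow> 'b vfield \<Rightarrow> 'b vfield"
  where "nab X Y = (SOME S. S \<in> vector_fields B \<and> (\<forall>p\<in>Carrier B. gB.represents (koszul gB X Y) p (S p)))"

text \<open>On the non-degenerate base the covariant derivative is a smooth field; on the fibres
  only pointwise representatives up to the radical are available.\<close>

lemma nab:
  assumes "X \<in> vector_fields B" "Y \<in> vector_fields B"
  shows "nab X Y \<in> vector_fields B" "\<And>p. p \<in> Carrier B \<Longrightarrow> gB.represents (koszul gB X Y) p (nab X Y p)"
proof -
  have "\<exists>S. S \<in> vector_fields B \<and> (\<forall>p\<in>Carrier B. gB.represents (koszul gB X Y) p (S p))"
    using gB.sharp_field_exists[OF ndB gB.one_form_koszul[OF assms]] by blast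
  from someI_ex[OF this] show "nab X Y \<in> vector_fields B"
    "\<And>p. p \<in> Carrier B \<Longrightarrow> gB.represents (koszul gB X Y) p (nab X Y p)"
    unfolding nab_def by blast+
qed

lemma one_form_differential: "f \<in> C_inf B \<Longrightarrow> base.N.one_form (\<lambda>Z p. Z p f)"
  unfolding base.N.one_form_def by (simp add: base.N.VF_smooth)

definition grad :: "nat \<Rightarrow> 'b vfield"
  where "grad j = (SOME S. S \<in> vector_fields B \<and> (\<forall>p\<in>Carrier B. gB.represents (\<lambda>Z p. Z p (b j)) p (S p)))"

lemma grad:
  assumes "j \<in> J"
  shows "grad j \<in> vector_fields B" "\<And>p. p \<in> Carrier B \<Longrightarrow> gB.represents (\<lambda>Z p. Z p (b j)) p (grad j p)"
proof -
  have "\<exists>S. S \<in> vector_fields B \<and> (\<forall>p\<in>Carrier B. gB.represents (\<lambda>Z p. Z p (b j)) p (S p))"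
    using gB.sharp_field_exists[OF ndB one_form_differential[OF bC[OF assms]]] by blast
  from someI_ex[OF this] show "grad j \<in> vector_fields B"
    "\<And>p. p \<in> Carrier B \<Longrightarrow> gB.represents (\<lambda>Z p. Z p (b j)) p (grad j p)"
    unfolding grad_def by blast+
qed

lemma contraction_base:
  assumes "X \<in> vector_fields B" "Y \<in> vector_fields B" "Z \<in> vector_fields B" "T \<in> vector_fields B" "p \<in> Carrier B"
  shows "contraction B gB (koszul gB X Y) (koszul gB Z T) p = gB p (nab X Y p) (nab Z T p)"
proof -
  have "is_contraction B gB (koszul gB X Y) (koszul gB Z T) (\<lambda>p. gB p (nab X Y p) (nab Z T p))"
    unfolding is_contraction_def
  proof (intro conjI ballI)
    show "(\<lambda>p. gB p (nab X Y p) (nab Z T p)) \<in> C_inf B" using assms by (simp add: nab)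
    fix r assume "r \<in> regular_points B gB"
    then have r: "r \<in> Carrier B" by (rule gB.regular_points_Carrier)
    show "gB r (nab X Y r) (nab Z T r) = g_bullet B gB r (form_at B (koszul gB X Y) r) (form_at B (koszul gB Z T) r)"
      by (rule gB.g_bullet_represents[OF gB.one_form_koszul gB.one_form_koszul r nab(2) nab(2), symmetric]) (use assms r in auto)
  qed
  from gB.contraction_eq[OF this assms(5)] show ?thesis .
qed

lemma represents_fibre:
  assumes "j \<in> J" "V \<in> vector_fields (F j)" "W \<in> vector_fields (F j)" "z \<in> Carrier (F j)"
  shows "\<exists>k. ssr.represents (F j) (gF j) (koszul (gF j) V W) z k"
  using regF[OF assms(1)] assms ssr.form_at_in_T_bullet[OF sF[OF assms(1)] ssr.one_form_koszul[OF sF[OF assms(1)] assms(2,3)] assms(4)]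
  unfolding semi_regular_def radical_stationary_def by blast

text \<open>This is \<open>b j\<close> times the component along \<open>F j\<close> of the sharp of
  the Koszul form. Keeping it undivided isolates the only place where the reciprocal of
  \<open>b j\<close> occurs; \<open>k\<close> is a representative of the Koszul form of the
  fibre.\<close>

definition fibre_sharp :: "'b vfield \<Rightarrow> (nat \<Rightarrow> 'f vfield) \<Rightarrow> 'b vfield \<Rightarrow> (nat \<Rightarrow> 'f vfield) \<Rightarrow> nat \<Rightarrow> 'b \<times> (nat \<Rightarrow> 'f) \<Rightarrow> 'f tvec \<Rightarrow> 'f tvec"
  where "fibre_sharp X V Y W j x k = (\<lambda>f. bb j x * k f + (X (fst x) (b j) * W j (snd x j) f + Y (fst x) (b j) * V j (snd x j) f))"

text \<open>The base component familiar from warped products: the covariant derivative of the base,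
  bent by the gradients of the warping functions in proportion to the fibre metrics.\<close>

definition base_sharp :: "'b vfield \<Rightarrow> (nat \<Rightarrow> 'f vfield) \<Rightarrow> 'b vfield \<Rightarrow> (nat \<Rightarrow> 'f vfield) \<Rightarrow> 'b \<times> (nat \<Rightarrow> 'f) \<Rightarrow> 'b tvec"
  where "base_sharp X V Y W x = (\<lambda>f. nab X Y (fst x) f + (\<Sum>j\<in>J. (- (bb j x * gj j V W x)) * grad j (fst x) f))"

lemma base_sharp_TS:
  assumes "pf X V" "pf Y W" "x \<in> Carrier M"
  shows "base_sharp X V Y W x \<in> tangent_space B (fst x)"
  unfolding base_sharp_def using assms
  by (intro base.N.TS_add base.N.TS_sum) (auto intro!: base.N.VF_TS nab grad simp: pf_def)

text \<open>The sharp of a Koszul form: the inverse \<open>1 / b\<^sub>j\<close> is \<open>0\<close> where \<open>b\<^sub>j\<close> vanishes, and there the form has no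
  component along \<open>F\<^sub>j\<close> either.\<close>

lemma koszul_PF_represents:
  assumes X: "pf X V" and Y: "pf Y W" and x: "x \<in> Carrier M"
    and k: "\<And>j. j \<in> J \<Longrightarrow> ssr.represents (F j) (gF j) (koszul (gF j) (V j) (W j)) (snd x j) (k j)"
  shows "\<exists>v. W.represents (koszul gM (PF X V) (PF Y W)) x v \<and>
    pushforward B fst v = base_sharp X V Y W x \<and>
    (\<forall>j\<in>J. pushforward (F j) (\<lambda>x. snd x j) v = (\<lambda>f. inverse (bb j x) * fibre_sharp X V Y W j x (k j) f))"
proof -
  note xB = fst_C[OF x] and xF = snd_C[OF x]
  have kT: "k j \<in> tangent_space (F j) (snd x j)" if "j \<in> J" for j
    using k[OF that] by (simp add: ssr.represents_def[OF sF[OF that]])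
  have tT: "fibre_sharp X V Y W j x (k j) \<in> tangent_space (F j) (snd x j)" if j: "j \<in> J" for j
    unfolding fibre_sharp_def
    by (intro mfd.TS_add[OF mF[OF j]] mfd.TS_scale[OF mF[OF j]] kT j mfd.VF_TS[OF mF[OF j] _ xF[OF j]] pfD(2)[OF X] pfD(2)[OF Y])
  obtain X' where X': "X' \<in> vector_fields B" "X' (fst x) = base_sharp X V Y W x"
    by (rule base.N.vector_extension[OF xB base_sharp_TS[OF X Y x]])
  have "\<exists>V'. V' \<in> vector_fields (F j) \<and> V' (snd x j) = (\<lambda>f. inverse (bb j x) * fibre_sharp X V Y W j x (k j) f)"
    if j: "j \<in> J" for j
    by (rule mfd.vector_extension[OF mF[OF j] xF[OF j] mfd.TS_scale[OF mF[OF j] tT[OF j]]]) blast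
  then have "\<forall>j\<in>J. \<exists>V'. V' \<in> vector_fields (F j) \<and> V' (snd x j) = (\<lambda>f. inverse (bb j x) * fibre_sharp X V Y W j x (k j) f)"
    by blast
  then obtain V' where V': "\<forall>j\<in>J. V' j \<in> vector_fields (F j) \<and> V' j (snd x j) = (\<lambda>f. inverse (bb j x) * fibre_sharp X V Y W j x (k j) f)"
    by (rule bchoice[THEN exE])
  have pf': "pf X' V'" using X' V' by (simp add: pf_def)
  let ?v = "PF X' V' x"
  have pB: "pushforward B fst ?v = base_sharp X V Y W x"
    using pushforward_PF_base[OF pfD(1)[OF pf'] pfD(2)[OF pf'] x] X'(2) by simp
  have pF: "pushforward (F j) (\<lambda>x. snd x j) ?v = (\<lambda>f. inverse (bb j x) * fibre_sharp X V Y W j x (k j) f)" if "j \<in> J" for j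
    using pushforward_PF_fibre[OF pfD(1)[OF pf'] pfD(2)[OF pf'] x that] V' that by simp
  have "W.represents (koszul gM (PF X V) (PF Y W)) x ?v"
    unfolding W.represents_def
  proof (intro conjI ballI)
    show "?v \<in> tangent_space M x" by (rule PF_TS[OF pf' x])
    fix Z0 assume Z0: "Z0 \<in> vector_fields M"
    \<comment> \<open>Since the Koszul form is tensorial in its last slot, an arbitrary test field
      may be replaced by one with explicit components and the same value at
      \<open>x\<close>.\<close>
    obtain Z U where ZU: "Z \<in> vector_fields B" "\<And>j. j \<in> J \<Longrightarrow> U j \<in> vector_fields (F j)" "PF Z U x = Z0 x"
      using PF_extension[OF x M.VF_TS[OF Z0 x]] by blast
    have Z: "pf Z U" using ZU by (simp add: pf_def)
    have "koszul gM (PF X V) (PF Y W) Z0 x = koszul gM (PF X V) (PF Y W) (PF Z U) x"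
      by (rule M.one_form_tensorial[OF W.one_form_koszul[OF pf_VF[OF X] pf_VF[OF Y]] Z0 pf_VF[OF Z] x ZU(3)[symmetric]])
    also have "\<dots> = gM x ?v (PF Z U x)"
    proof -
      have nT: "nab X Y (fst x) \<in> tangent_space B (fst x)"
        by (rule base.N.VF_TS[OF nab(1)[OF pfD(1)[OF X] pfD(1)[OF Y]] xB])
      have gT: "grad j (fst x) \<in> tangent_space B (fst x)" if "j \<in> J" for j by (rule base.N.VF_TS[OF grad(1)[OF that] xB])
      have ZT: "Z (fst x) \<in> tangent_space B (fst x)" by (rule base.N.VF_TS[OF pfD(1)[OF Z] xB])
      have sT: "(\<lambda>f. \<Sum>j\<in>J. (- (bb j x * gj j V W x)) * grad j (fst x) f) \<in> tangent_space B (fst x)"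
        by (rule base.N.TS_sum[OF gT])
      have sg: "gB (fst x) (\<lambda>f. \<Sum>j\<in>J. (- (bb j x * gj j V W x)) * grad j (fst x) f) (Z (fst x)) =
          (\<Sum>j\<in>J. (- (bb j x * gj j V W x)) * gB (fst x) (grad j (fst x)) (Z (fst x)))"
        by (rule gB.g_sum[OF xB ZT gT])
      have "gB (fst x) (base_sharp X V Y W x) (Z (fst x)) = gB (fst x) (nab X Y (fst x)) (Z (fst x)) +
          (\<Sum>j\<in>J. (- (bb j x * gj j V W x)) * gB (fst x) (grad j (fst x)) (Z (fst x)))"
        unfolding base_sharp_def gB.g_add[OF xB nT sT ZT] sg by (rule refl)
      also have "gB (fst x) (nab X Y (fst x)) (Z (fst x)) = koszul gB X Y Z (fst x)"
        using nab(2)[OF pfD(1)[OF X] pfD(1)[OF Y] xB] pfD(1)[OF Z] by (simp add: gB.represents_def)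
      also have "(\<Sum>j\<in>J. (- (bb j x * gj j V W x)) * gB (fst x) (grad j (fst x)) (Z (fst x))) =
          (\<Sum>j\<in>J. - bb j x * gj j V W x * Z (fst x) (b j))"
      proof (rule sum.cong[OF refl])
        fix j assume "j \<in> J"
        from grad(2)[OF this xB] pfD(1)[OF Z]
        show "(- (bb j x * gj j V W x)) * gB (fst x) (grad j (fst x)) (Z (fst x)) = - bb j x * gj j V W x * Z (fst x) (b j)"
          by (simp add: gB.represents_def)
      qed
      finally have gBeq: "gB (fst x) (base_sharp X V Y W x) (Z (fst x)) = koszul gB X Y Z (fst x) +
        (\<Sum>j\<in>J. - bb j x * gj j V W x * Z (fst x) (b j))" .
      have gFeq: "(bb j x)\<^sup>2 * gj j V' U x = (bb j x)\<^sup>2 * Kj j V W U x +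
          bb j x * (X (fst x) (b j) * gj j W U x + Y (fst x) (b j) * gj j U V x)" if j: "j \<in> J" for j
      proof -
        interpret Fj: ssr "F j" "gF j" by (rule sF[OF j])
        note z = xF[OF j]
        have T: "V j (snd x j) \<in> Fj.TS (snd x j)" "W j (snd x j) \<in> Fj.TS (snd x j)" "U j (snd x j) \<in> Fj.TS (snd x j)"
          using Fj.VF_TS[OF pfD(2)[OF X j] z] Fj.VF_TS[OF pfD(2)[OF Y j] z] Fj.VF_TS[OF pfD(2)[OF Z j] z] by auto
        have "gj j V' U x = inverse (bb j x) * gF j (snd x j) (fibre_sharp X V Y W j x (k j)) (U j (snd x j))"
          using V' j Fj.g_scale[OF z tT[OF j] T(3)] by simp
        also have "gF j (snd x j) (fibre_sharp X V Y W j x (k j)) (U j (snd x j)) =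
            bb j x * gF j (snd x j) (k j) (U j (snd x j)) + (X (fst x) (b j) * gj j W U x + Y (fst x) (b j) * gj j V U x)"
          unfolding fibre_sharp_def using z T kT[OF j] by (simp only: Fj.g_add Fj.g_scale Fj.TS_add Fj.TS_scale)
        also have "gF j (snd x j) (k j) (U j (snd x j)) = Kj j V W U x"
          using k[OF j] pfD(2)[OF Z j] by (simp add: Fj.represents_def)
        also have "gj j V U x = gj j U V x" by (rule Fj.g_sym[OF z T(1,3)])
        finally show ?thesis by (cases "bb j x = 0") (simp_all add: power2_eq_square field_simps)
      qed
      have "gM x ?v (PF Z U x) = gB (fst x) (base_sharp X V Y W x) (Z (fst x)) + (\<Sum>j\<in>J. (bb j x)\<^sup>2 * gj j V' U x)"
        unfolding gM_PF[OF pf' Z x] X'(2) by (rule refl)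
      also have "\<dots> = koszul gB X Y Z (fst x) + ((\<Sum>j\<in>J. - bb j x * gj j V W x * Z (fst x) (b j)) +
          (\<Sum>j\<in>J. (bb j x)\<^sup>2 * Kj j V W U x + bb j x * (X (fst x) (b j) * gj j W U x + Y (fst x) (b j) * gj j U V x)))"
        unfolding gBeq using gFeq by simp
      also have "\<dots> = koszul gM (PF X V) (PF Y W) (PF Z U) x"
      proof -
        have "(\<Sum>j\<in>J. - bb j x * gj j V W x * Z (fst x) (b j)) +
          (\<Sum>j\<in>J. (bb j x)\<^sup>2 * Kj j V W U x + bb j x * (X (fst x) (b j) * gj j W U x + Y (fst x) (b j) * gj j U V x)) =
          (\<Sum>j\<in>J. (bb j x)\<^sup>2 * Kj j V W U x +
            bb j x * (X (fst x) (b j) * gj j W U x + Y (fst x) (b j) * gj j U V x - Z (fst x) (b j) * gj j V W x))"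
          unfolding sum.distrib[symmetric] by (rule sum.cong[OF refl]) (simp add: algebra_simps)
        then show ?thesis unfolding koszul_PF[OF X Y Z x] by simp
      qed
      finally show ?thesis by simp
    qed
    finally show "koszul gM (PF X V) (PF Y W) Z0 x = gM x ?v (Z0 x)" using ZU(3) by simp
  qed
  then show ?thesis using pB pF by blast
qed

lemma koszul_PF_flat: "pf X V \<Longrightarrow> pf Y W \<Longrightarrow> W.flat_valued (koszul gM (PF X V) (PF Y W))"
  unfolding W.flat_valued_def
proof
  fix x assume X: "pf X V" and Y: "pf Y W" and x: "x \<in> Carrier M"
  have "\<forall>j\<in>J. \<exists>k. ssr.represents (F j) (gF j) (koszul (gF j) (V j) (W j)) (snd x j) k"
    using represents_fibre[OF _ pfD(2)[OF X] pfD(2)[OF Y] snd_C[OF x]] by blast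
  then obtain k where "\<forall>j\<in>J. ssr.represents (F j) (gF j) (koszul (gF j) (V j) (W j)) (snd x j) (k j)"
    by (rule bchoice[THEN exE])
  then show "\<exists>v. W.represents (koszul gM (PF X V) (PF Y W)) x v"
    using koszul_PF_represents[OF X Y x, of k] by blast
qed

text \<open>The finitely many \<open>b j\<close> are treated one after another: either
  \<open>b j\<close> vanishes on the whole current open set of the base, or the set shrinks to a
  part where \<open>b j\<close> has no zero. Vanishing on an open set, rather than at the point, is
  needed so that the derivatives of \<open>b j\<close> vanish too.\<close>

lemma good_points_dense:
  assumes O: "openin (Top M) O'" "O' \<noteq> {}"
  shows "\<exists>x\<in>O'. \<forall>j\<in>J. snd x j \<in> regular_points (F j) (gF j) \<and>
    (bb j x \<noteq> 0 \<or> (\<exists>U. openin (Top B) U \<and> fst x \<in> U \<and> (\<forall>p\<in>U. b j p = 0)))"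
proof -
  obtain x where x: "x \<in> O'" using O by blast
  obtain U Q where UQ: "openin (Top B) U" "openin (product_topology (\<lambda>j. Top (F j)) J) Q" "fst x \<in> U" "snd x \<in> Q" "U \<times> Q \<subseteq> O'"
    using O(1) x unfolding Top_M openin_prod_topology_alt by (metis prod.collapse)
  obtain W where W: "\<forall>j\<in>J. openin (Top (F j)) (W j)" "snd x \<in> Pi\<^sub>E J W" "Pi\<^sub>E J W \<subseteq> Q"
    using UQ(2,4) unfolding openin_product_topology_alt by blast
  have "\<exists>U'. openin (Top B) U' \<and> U' \<noteq> {} \<and> U' \<subseteq> U \<and> (\<forall>j\<in>J'. (\<forall>p\<in>U'. b j p \<noteq> 0) \<or> (\<forall>p\<in>U'. b j p = 0))"
    if "J' \<subseteq> J" for J'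
    using finite_subset[OF that finJ] that
  proof (induction J' rule: finite_induct)
    case empty
    then show ?case using UQ(1,3) by blast
  next
    case (insert j J')
    then obtain U' where U': "openin (Top B) U'" "U' \<noteq> {}" "U' \<subseteq> U"
      "\<forall>j\<in>J'. (\<forall>p\<in>U'. b j p \<noteq> 0) \<or> (\<forall>p\<in>U'. b j p = 0)" by blast
    have j: "j \<in> J" using insert.prems by simp
    show ?case
    proof (cases "\<forall>p\<in>U'. b j p = 0")
      case True
      then show ?thesis using U' by blast
    next
      case False
      then obtain p where p: "p \<in> U'" "b j p \<noteq> 0" by blast
      then have "p \<in> Carrier B" using U'(1) openin_subset by blast
      from base.N.C_inf_nonzero_nbhd[OF bC[OF j] this p(2)] obtain N
        where N: "openin (Top B) N" "p \<in> N" "\<And>y. y \<in> N \<Longrightarrow> b j y \<noteq> 0" by blast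
      have "openin (Top B) (U' \<inter> N)" using U'(1) N(1) by blast
      moreover have "U' \<inter> N \<noteq> {}" using p N by blast
      moreover have "\<forall>i\<in>insert j J'. (\<forall>p\<in>U' \<inter> N. b i p \<noteq> 0) \<or> (\<forall>p\<in>U' \<inter> N. b i p = 0)"
        using U'(4) N(3) by blast
      ultimately show ?thesis using U'(3) by blast
    qed
  qed
  from this[OF order_refl] obtain U' p where U': "openin (Top B) U'" "p \<in> U'" "U' \<subseteq> U"
    "\<forall>j\<in>J. (\<forall>p\<in>U'. b j p \<noteq> 0) \<or> (\<forall>p\<in>U'. b j p = 0)" by blast
  have "\<forall>j\<in>J. \<exists>z. z \<in> W j \<and> z \<in> regular_points (F j) (gF j)"
  proof
    fix j assume j: "j \<in> J"
    have "W j \<noteq> {}" using W(2) j by auto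
    from ssr.regular_points_dense[OF sF[OF j] W(1)[rule_format, OF j] this]
    show "\<exists>z. z \<in> W j \<and> z \<in> regular_points (F j) (gF j)" by blast
  qed
  then obtain q where q: "\<forall>j\<in>J. q j \<in> W j \<and> q j \<in> regular_points (F j) (gF j)" by (rule bchoice[THEN exE])
  have "restrict q J \<in> Pi\<^sub>E J W" using q by auto
  then have "(p, restrict q J) \<in> O'" using UQ(5) W(3) U'(2,3) by blast
  moreover have "\<forall>j\<in>J. snd (p, restrict q J) j \<in> regular_points (F j) (gF j) \<and>
    (bb j (p, restrict q J) \<noteq> 0 \<or> (\<exists>U. openin (Top B) U \<and> fst (p, restrict q J) \<in> U \<and> (\<forall>p\<in>U. b j p = 0)))"
  proof (intro ballI conjI)
    fix j assume j: "j \<in> J"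
    show "snd (p, restrict q J) j \<in> regular_points (F j) (gF j)" using q j by simp
    have "(\<forall>p\<in>U'. b j p \<noteq> 0) \<or> (\<forall>p\<in>U'. b j p = 0)" using U'(4) j by blast
    then show "bb j (p, restrict q J) \<noteq> 0 \<or> (\<exists>U. openin (Top B) U \<and> fst (p, restrict q J) \<in> U \<and> (\<forall>p\<in>U. b j p = 0))"
      using U'(1,2) unfolding fst_conv by blast
  qed
  ultimately show ?thesis by blast
qed

abbreviation "Cj j V W V' W' x \<equiv> contraction (F j) (gF j) (koszul (gF j) (V j) (W j)) (koszul (gF j) (V' j) (W' j)) (snd x j)"

lemma contraction_fibre:
  assumes "j \<in> J" "pf X V" "pf Y W" "pf X' V'" "pf Y' W'"
  shows "is_contraction (F j) (gF j) (koszul (gF j) (V j) (W j)) (koszul (gF j) (V' j) (W' j))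
    (contraction (F j) (gF j) (koszul (gF j) (V j) (W j)) (koszul (gF j) (V' j) (W' j)))"
proof -
  have "\<exists>h. is_contraction (F j) (gF j) (koszul (gF j) (V j) (W j)) (koszul (gF j) (V' j) (W' j)) h"
    using regF[OF assms(1)] assms unfolding semi_regular_def pf_def by blast
  then show ?thesis unfolding contraction_def by (rule someI_ex)
qed

text \<open>The inner product of two sharps after \<open>(b j)\<^sup>2\<close> has absorbed both
  reciprocals. The last four terms of the fibre sum carry no factor \<open>b j\<close>; they are
  what the pointwise inner product would miss at an isolated zero of \<open>b j\<close>.\<close>

definition contraction_formula ::
  "'b vfield \<Rightarrow> (nat \<Rightarrow> 'f vfield) \<Rightarrow> 'b vfield \<Rightarrow> (nat \<Rightarrow> 'f vfield) \<Rightarrow>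
   'b vfield \<Rightarrow> (nat \<Rightarrow> 'f vfield) \<Rightarrow> 'b vfield \<Rightarrow> (nat \<Rightarrow> 'f vfield) \<Rightarrow> 'b \<times> (nat \<Rightarrow> 'f) \<Rightarrow> real"
  where "contraction_formula X V Y W X' V' Y' W' x =
    gB (fst x) (nab X Y (fst x)) (nab X' Y' (fst x))
    - (\<Sum>j\<in>J. bb j x * gj j V' W' x * nab X Y (fst x) (b j))
    - (\<Sum>j\<in>J. bb j x * gj j V W x * nab X' Y' (fst x) (b j))
    + (\<Sum>j\<in>J. \<Sum>k\<in>J. bb j x * bb k x * gj j V W x * gj k V' W' x * gB (fst x) (grad j (fst x)) (grad k (fst x)))
    + (\<Sum>j\<in>J. (bb j x)\<^sup>2 * Cj j V W V' W' x
        + bb j x * (X' (fst x) (b j) * Kj j V W W' x + Y' (fst x) (b j) * Kj j V W V' x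
          + X (fst x) (b j) * Kj j V' W' W x + Y (fst x) (b j) * Kj j V' W' V x)
        + X (fst x) (b j) * X' (fst x) (b j) * gj j W W' x + X (fst x) (b j) * Y' (fst x) (b j) * gj j W V' x
        + Y (fst x) (b j) * X' (fst x) (b j) * gj j V W' x + Y (fst x) (b j) * Y' (fst x) (b j) * gj j V V' x)"

text \<open>Both forms are flat-valued everywhere and the formula is smooth, so comparing it with
  the inner product of explicit representatives at good points is enough; these lie in every
  non-empty open set.\<close>

lemma contraction_PF:
  assumes X: "pf X V" and Y: "pf Y W" and X': "pf X' V'" and Y': "pf Y' W'"
  shows "is_contraction M gM (koszul gM (PF X V) (PF Y W)) (koszul gM (PF X' V') (PF Y' W'))
    (contraction_formula X V Y W X' V' Y' W')" (is "is_contraction M gM ?\<omega> ?\<tau> ?h")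
proof (rule W.is_contractionI_dense)
  show "M.one_form ?\<omega>" "M.one_form ?\<tau>"
    by (intro W.one_form_koszul pf_VF X Y X' Y')+
  show "\<exists>v. W.represents ?\<omega> x v" if "x \<in> Carrier M" for x
    using koszul_PF_flat[OF X Y] that by (simp add: W.flat_valued_def)
  show "\<exists>v. W.represents ?\<tau> x v" if "x \<in> Carrier M" for x
    using koszul_PF_flat[OF X' Y'] that by (simp add: W.flat_valued_def)
  have n: "nab X Y \<in> vector_fields B" "nab X' Y' \<in> vector_fields B"
    by (rule nab(1); rule pfD(1)[OF X] pfD(1)[OF Y] pfD(1)[OF X'] pfD(1)[OF Y'])+
  have nb: "(\<lambda>x. nab X Y (fst x) (b j)) \<in> C_inf M" "(\<lambda>x. nab X' Y' (fst x) (b j)) \<in> C_inf M" if "j \<in> J" for j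
    by (rule base_smooth, rule base.N.VF_smooth[OF n(1) bC[OF that]])
       (rule base_smooth, rule base.N.VF_smooth[OF n(2) bC[OF that]])
  have gg: "(\<lambda>x. gB (fst x) (grad j (fst x)) (grad k (fst x))) \<in> C_inf M" if "j \<in> J" "k \<in> J" for j k
    using base_smooth[OF gB.g_smooth[OF grad(1)[OF that(1)] grad(1)[OF that(2)]]] .
  have nn: "(\<lambda>x. gB (fst x) (nab X Y (fst x)) (nab X' Y' (fst x))) \<in> C_inf M"
    using base_smooth[OF gB.g_smooth[OF n]] .
  have cc: "(\<lambda>x. Cj j V W V' W' x) \<in> C_inf M" if "j \<in> J" for j
    using factor.pullback_smooth[OF fibre[OF that]] contraction_fibre[OF that X Y X' Y'] by (simp add: is_contraction_def)
  show "?h \<in> C_inf M"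
    unfolding contraction_formula_def[abs_def]
    by (intro M.C_inf_add M.C_inf_diff M.C_inf_sum M.C_inf_mult M.C_inf_power2 nn nb gg cc warp_smooth
        gj_smooth[OF X Y] gj_smooth[OF X' Y'] gj_smooth[OF Y Y'] gj_smooth[OF Y X'] gj_smooth[OF X Y'] gj_smooth[OF X X']
        Kj_smooth[OF X Y Y'] Kj_smooth[OF X Y X'] Kj_smooth[OF X' Y' Y] Kj_smooth[OF X' Y' X]
        Xb_smooth[OF X] Xb_smooth[OF Y] Xb_smooth[OF X'] Xb_smooth[OF Y'])
  fix O' assume O': "openin (Top M) O'" "O' \<noteq> {}"
  obtain x where xO: "x \<in> O'" and good: "\<And>j. j \<in> J \<Longrightarrow> snd x j \<in> regular_points (F j) (gF j)"
    "\<And>j. j \<in> J \<Longrightarrow> bb j x \<noteq> 0 \<or> (\<exists>U. openin (Top B) U \<and> fst x \<in> U \<and> (\<forall>p\<in>U. b j p = 0))"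
    using good_points_dense[OF O'] by blast
  have x: "x \<in> Carrier M" using xO O'(1) openin_subset by blast
  note xB = fst_C[OF x] and xF = snd_C[OF x]
  have "\<forall>j\<in>J. \<exists>k. ssr.represents (F j) (gF j) (koszul (gF j) (V j) (W j)) (snd x j) k"
    using represents_fibre[OF _ pfD(2)[OF X] pfD(2)[OF Y] snd_C[OF x]] by blast
  then obtain k where k0: "\<forall>j\<in>J. ssr.represents (F j) (gF j) (koszul (gF j) (V j) (W j)) (snd x j) (k j)"
    by (rule bchoice[THEN exE])
  have "\<forall>j\<in>J. \<exists>k. ssr.represents (F j) (gF j) (koszul (gF j) (V' j) (W' j)) (snd x j) k"
    using represents_fibre[OF _ pfD(2)[OF X'] pfD(2)[OF Y'] snd_C[OF x]] by blast
  then obtain k' where k'0: "\<forall>j\<in>J. ssr.represents (F j) (gF j) (koszul (gF j) (V' j) (W' j)) (snd x j) (k' j)"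
    by (rule bchoice[THEN exE])
  note k = k0[rule_format] and k' = k'0[rule_format]
  obtain v where v: "W.represents ?\<omega> x v" "pushforward B fst v = base_sharp X V Y W x"
    "\<forall>j\<in>J. pushforward (F j) (\<lambda>x. snd x j) v = (\<lambda>f. inverse (bb j x) * fibre_sharp X V Y W j x (k j) f)"
    using koszul_PF_represents[OF X Y x, of k] k0 by blast
  obtain v' where v': "W.represents ?\<tau> x v'" "pushforward B fst v' = base_sharp X' V' Y' W' x"
    "\<forall>j\<in>J. pushforward (F j) (\<lambda>x. snd x j) v' = (\<lambda>f. inverse (bb j x) * fibre_sharp X' V' Y' W' j x (k' j) f)"
    using koszul_PF_represents[OF X' Y' x, of k'] k'0 by blast
  have "g_bullet M gM x (form_at M ?\<omega> x) (form_at M ?\<tau> x) = gM x v v'"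
    by (rule W.g_bullet_represents[OF _ _ x v(1) v'(1)]) (intro W.one_form_koszul pf_VF X Y X' Y')+
  also have "\<dots> = gB (fst x) (base_sharp X V Y W x) (base_sharp X' V' Y' W' x) +
      (\<Sum>j\<in>J. (bb j x)\<^sup>2 * gF j (snd x j) (\<lambda>f. inverse (bb j x) * fibre_sharp X V Y W j x (k j) f)
        (\<lambda>f. inverse (bb j x) * fibre_sharp X' V' Y' W' j x (k' j) f))"
    unfolding gM_eq v(2) v'(2) using v(3) v'(3) by simp
  finally have bullet: "g_bullet M gM x (form_at M ?\<omega> x) (form_at M ?\<tau> x) =
      gB (fst x) (base_sharp X V Y W x) (base_sharp X' V' Y' W' x) +
      (\<Sum>j\<in>J. (bb j x)\<^sup>2 * gF j (snd x j) (\<lambda>f. inverse (bb j x) * fibre_sharp X V Y W j x (k j) f)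
        (\<lambda>f. inverse (bb j x) * fibre_sharp X' V' Y' W' j x (k' j) f))" .
  have fibre_part: "(\<Sum>j\<in>J. (bb j x)\<^sup>2 * gF j (snd x j) (\<lambda>f. inverse (bb j x) * fibre_sharp X V Y W j x (k j) f)
        (\<lambda>f. inverse (bb j x) * fibre_sharp X' V' Y' W' j x (k' j) f)) =
    (\<Sum>j\<in>J. (bb j x)\<^sup>2 * Cj j V W V' W' x
        + bb j x * (X' (fst x) (b j) * Kj j V W W' x + Y' (fst x) (b j) * Kj j V W V' x
          + X (fst x) (b j) * Kj j V' W' W x + Y (fst x) (b j) * Kj j V' W' V x)
        + X (fst x) (b j) * X' (fst x) (b j) * gj j W W' x + X (fst x) (b j) * Y' (fst x) (b j) * gj j W V' x
        + Y (fst x) (b j) * X' (fst x) (b j) * gj j V W' x + Y (fst x) (b j) * Y' (fst x) (b j) * gj j V V' x)"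
  proof (rule sum.cong[OF refl])
    fix j assume j: "j \<in> J"
    interpret Fj: ssr "F j" "gF j" by (rule sF[OF j])
    note z = xF[OF j]
    have kT: "k j \<in> Fj.TS (snd x j)" "k' j \<in> Fj.TS (snd x j)"
      using k[OF j] k'[OF j] by (simp_all add: Fj.represents_def)
    note T = kT Fj.VF_TS[OF pfD(2)[OF X j] z] Fj.VF_TS[OF pfD(2)[OF Y j] z] Fj.VF_TS[OF pfD(2)[OF X' j] z] Fj.VF_TS[OF pfD(2)[OF Y' j] z]
    \<comment> \<open>Here the fibre component must be a regular point: only there is the
      contraction of the fibre given by the pointwise inner product.\<close>
    have C: "gF j (snd x j) (k j) (k' j) = Cj j V W V' W' x"
    proof -
      have "gF j (snd x j) (k j) (k' j) = g_bullet (F j) (gF j) (snd x j)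
          (form_at (F j) (koszul (gF j) (V j) (W j)) (snd x j)) (form_at (F j) (koszul (gF j) (V' j) (W' j)) (snd x j))"
        by (rule Fj.g_bullet_represents[OF _ _ z k[OF j] k'[OF j], symmetric])
          (intro Fj.one_form_koszul pfD(2)[OF X j] pfD(2)[OF Y j] pfD(2)[OF X' j] pfD(2)[OF Y' j])+
      also have "\<dots> = Cj j V W V' W' x"
        using contraction_fibre[OF j X Y X' Y'] good(1)[OF j] by (simp add: is_contraction_def)
      finally show ?thesis .
    qed
    have kk: "gF j (snd x j) (k j) (W' j (snd x j)) = Kj j V W W' x" "gF j (snd x j) (k j) (V' j (snd x j)) = Kj j V W V' x"
      using k[OF j] pfD(2)[OF X' j] pfD(2)[OF Y' j] by (simp_all add: Fj.represents_def)
    have "gF j (snd x j) (k' j) (W j (snd x j)) = Kj j V' W' W x" "gF j (snd x j) (k' j) (V j (snd x j)) = Kj j V' W' V x"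
      using k'[OF j] pfD(2)[OF X j] pfD(2)[OF Y j] by (simp_all add: Fj.represents_def)
    then have kk': "gF j (snd x j) (W j (snd x j)) (k' j) = Kj j V' W' W x" "gF j (snd x j) (V j (snd x j)) (k' j) = Kj j V' W' V x"
      using Fj.g_sym[OF z T(2) T(4)] Fj.g_sym[OF z T(2) T(3)] by simp_all
    have e: "gF j (snd x j) (\<lambda>f. inverse (bb j x) * fibre_sharp X V Y W j x (k j) f)
        (\<lambda>f. inverse (bb j x) * fibre_sharp X' V' Y' W' j x (k' j) f) =
      inverse (bb j x) * (inverse (bb j x) *
       (bb j x * (bb j x * Cj j V W V' W' x + (X' (fst x) (b j) * Kj j V W W' x + Y' (fst x) (b j) * Kj j V W V' x)) +
        (X (fst x) (b j) * (bb j x * Kj j V' W' W x + (X' (fst x) (b j) * gj j W W' x + Y' (fst x) (b j) * gj j W V' x)) +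
         Y (fst x) (b j) * (bb j x * Kj j V' W' V x + (X' (fst x) (b j) * gj j V W' x + Y' (fst x) (b j) * gj j V V' x)))))"
      unfolding fibre_sharp_def C[symmetric] kk[symmetric] kk'[symmetric]
      using z T by (simp only: Fj.g_add Fj.g_scale Fj.g_addR Fj.g_scaleR Fj.TS_add Fj.TS_scale) (simp add: algebra_simps)
    show "(bb j x)\<^sup>2 * gF j (snd x j) (\<lambda>f. inverse (bb j x) * fibre_sharp X V Y W j x (k j) f)
        (\<lambda>f. inverse (bb j x) * fibre_sharp X' V' Y' W' j x (k' j) f) =
      (bb j x)\<^sup>2 * Cj j V W V' W' x
        + bb j x * (X' (fst x) (b j) * Kj j V W W' x + Y' (fst x) (b j) * Kj j V W V' x
          + X (fst x) (b j) * Kj j V' W' W x + Y (fst x) (b j) * Kj j V' W' V x)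
        + X (fst x) (b j) * X' (fst x) (b j) * gj j W W' x + X (fst x) (b j) * Y' (fst x) (b j) * gj j W V' x
        + Y (fst x) (b j) * X' (fst x) (b j) * gj j V W' x + Y (fst x) (b j) * Y' (fst x) (b j) * gj j V V' x"
    proof (cases "bb j x = 0")
      case False
      then show ?thesis unfolding e by (simp add: power2_eq_square) (simp add: field_simps)
    next
      case True
      \<comment> \<open>Where \<open>b j\<close> vanishes on a neighbourhood, its derivatives along
        base fields vanish as well, and both sides are zero.\<close>
      then obtain U where U: "openin (Top B) U" "fst x \<in> U" "\<forall>p\<in>U. b j p = 0" using good(2)[OF j] by blast
      have d: "A (fst x) (b j) = 0" if A: "A \<in> vector_fields B" for A
      proof -
        note t = base.N.VF_TS[OF A xB]
        have "A (fst x) (b j) = A (fst x) (\<lambda>p. 0)"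
          by (rule base.N.tan_local[OF t bC[OF j] _ U(1,2)]) (use U(3) in auto)
        then show ?thesis by (simp add: base.N.tan_const[OF t])
      qed
      show ?thesis
        by (simp add: True d[OF pfD(1)[OF X]] d[OF pfD(1)[OF Y]] d[OF pfD(1)[OF X']] d[OF pfD(1)[OF Y']])
    qed
  qed
  have base_part: "gB (fst x) (base_sharp X V Y W x) (base_sharp X' V' Y' W' x) =
    gB (fst x) (nab X Y (fst x)) (nab X' Y' (fst x))
    - (\<Sum>j\<in>J. bb j x * gj j V' W' x * nab X Y (fst x) (b j))
    - (\<Sum>j\<in>J. bb j x * gj j V W x * nab X' Y' (fst x) (b j))
    + (\<Sum>j\<in>J. \<Sum>k\<in>J. bb j x * bb k x * gj j V W x * gj k V' W' x * gB (fst x) (grad j (fst x)) (grad k (fst x)))"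
  proof -
    let ?p = "fst x"
    define c where "c j = - (bb j x * gj j V W x)" for j
    define c' where "c' j = - (bb j x * gj j V' W' x)" for j
    let ?s = "\<lambda>f. \<Sum>j\<in>J. c j * grad j ?p f" and ?s' = "\<lambda>f. \<Sum>j\<in>J. c' j * grad j ?p f"
    have nT: "nab X Y ?p \<in> tangent_space B ?p" "nab X' Y' ?p \<in> tangent_space B ?p"
      by (rule base.N.VF_TS[OF n(1) xB], rule base.N.VF_TS[OF n(2) xB])
    have gT: "grad j ?p \<in> tangent_space B ?p" if "j \<in> J" for j by (rule base.N.VF_TS[OF grad(1)[OF that] xB])
    have sT: "?s \<in> tangent_space B ?p" "?s' \<in> tangent_space B ?p" by (rule base.N.TS_sum[OF gT], assumption)+
    have gr: "gB ?p (grad j ?p) (A ?p) = A ?p (b j)" if "j \<in> J" "A \<in> vector_fields B" for j A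
      using grad(2)[OF that(1) xB] that(2) by (simp add: gB.represents_def)
    have b2: "gB ?p ?s (nab X' Y' ?p) = (\<Sum>j\<in>J. c j * nab X' Y' ?p (b j))"
    proof -
      have "gB ?p ?s (nab X' Y' ?p) = (\<Sum>j\<in>J. c j * gB ?p (grad j ?p) (nab X' Y' ?p))"
        by (rule gB.g_sum[OF xB nT(2) gT])
      then show ?thesis using gr[OF _ n(2)] by simp
    qed
    have b1: "gB ?p (nab X Y ?p) ?s' = (\<Sum>j\<in>J. c' j * nab X Y ?p (b j))"
    proof -
      have "gB ?p (nab X Y ?p) ?s' = gB ?p ?s' (nab X Y ?p)" by (rule gB.g_sym[OF xB nT(1) sT(2)])
      also have "\<dots> = (\<Sum>j\<in>J. c' j * gB ?p (grad j ?p) (nab X Y ?p))"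
        by (rule gB.g_sum[OF xB nT(1) gT])
      finally show ?thesis using gr[OF _ n(1)] by simp
    qed
    have b3: "gB ?p ?s ?s' = (\<Sum>j\<in>J. \<Sum>k\<in>J. c j * (c' k * gB ?p (grad j ?p) (grad k ?p)))"
    proof -
      have "gB ?p ?s ?s' = (\<Sum>j\<in>J. c j * gB ?p (grad j ?p) ?s')" by (rule gB.g_sum[OF xB sT(2) gT])
      also have "\<dots> = (\<Sum>j\<in>J. c j * (\<Sum>k\<in>J. c' k * gB ?p (grad j ?p) (grad k ?p)))"
      proof (rule sum.cong[OF refl])
        fix j assume j: "j \<in> J"
        have "gB ?p (grad j ?p) ?s' = gB ?p ?s' (grad j ?p)" by (rule gB.g_sym[OF xB gT[OF j] sT(2)])
        also have "\<dots> = (\<Sum>k\<in>J. c' k * gB ?p (grad k ?p) (grad j ?p))" by (rule gB.g_sum[OF xB gT[OF j] gT])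
        also have "\<dots> = (\<Sum>k\<in>J. c' k * gB ?p (grad j ?p) (grad k ?p))"
          using gB.g_sym[OF xB gT gT[OF j]] by (intro sum.cong) auto
        finally show "c j * gB ?p (grad j ?p) ?s' = c j * (\<Sum>k\<in>J. c' k * gB ?p (grad j ?p) (grad k ?p))" by simp
      qed
      finally show ?thesis by (simp add: sum_distrib_left)
    qed
    have "gB ?p (base_sharp X V Y W x) (base_sharp X' V' Y' W' x) =
      gB ?p (\<lambda>f. nab X Y ?p f + ?s f) (\<lambda>f. nab X' Y' ?p f + ?s' f)"
      by (simp only: base_sharp_def c_def c'_def)
    also have "\<dots> = gB ?p (nab X Y ?p) (nab X' Y' ?p) + gB ?p (nab X Y ?p) ?s' + (gB ?p ?s (nab X' Y' ?p) + gB ?p ?s ?s')"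
      using gB.g_add[OF xB nT(1) sT(1) base.N.TS_add[OF nT(2) sT(2)]]
        gB.g_addR[OF xB nT(2) sT(2) nT(1)] gB.g_addR[OF xB nT(2) sT(2) sT(1)] by simp
    also have "\<dots> = gB ?p (nab X Y ?p) (nab X' Y' ?p) + (\<Sum>j\<in>J. c' j * nab X Y ?p (b j))
       + ((\<Sum>j\<in>J. c j * nab X' Y' ?p (b j)) + (\<Sum>j\<in>J. \<Sum>k\<in>J. c j * (c' k * gB ?p (grad j ?p) (grad k ?p))))"
      unfolding b1 b2 b3 by (rule refl)
    finally show ?thesis by (simp add: c_def c'_def sum_negf mult_ac)
  qed
  have "g_bullet M gM x (form_at M ?\<omega> x) (form_at M ?\<tau> x) = ?h x"
    unfolding bullet fibre_part base_part contraction_formula_def by (rule refl)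
  then show "\<exists>y\<in>O'. g_bullet M gM y (form_at M ?\<omega> y) (form_at M ?\<tau> y) = ?h y" using xO by blast
qed

end

section \<open>Zero fields as arguments\<close>

context ssr
begin

text \<open>Fields are functions on the whole type, and the bracket of two product fields agrees
  with the expected field on the carrier only. This congruence carries such an agreement through the
  derivatives inside the Koszul form.\<close>

lemma koszul_cong_first:
  assumes X: "X \<in> VF" "X' \<in> VF" and Y: "Y \<in> VF" and Z: "Z \<in> VF" and p: "p \<in> Carrier M"
    and eq: "\<And>q. q \<in> Carrier M \<Longrightarrow> X q = X' q"
  shows "K X Y Z p = K X' Y Z p"
proof -
  have 1: "Y p (\<lambda>q. g q (Z q) (X q)) = Y p (\<lambda>q. g q (Z q) (X' q))"
    by (rule tan_cong[OF VF_TS[OF Y p] p]) (simp add: eq)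
  have 2: "Z p (\<lambda>q. g q (X q) (Y q)) = Z p (\<lambda>q. g q (X' q) (Y q))"
    by (rule tan_cong[OF VF_TS[OF Z p] p]) (simp add: eq)
  have 3: "lie_bracket A X p = lie_bracket A X' p" if "A \<in> VF" for A
    by (rule bracket_local[OF that X _ p]) (auto simp: eq)
  show ?thesis
    unfolding koszul_def 1 2 3[OF Z] bracket_antisym[of X Y] bracket_antisym[of X' Y] 3[OF Y] eq[OF p] by simp
qed

abbreviation (input) "Zero \<equiv> \<lambda>_ _. 0 :: real"

lemma bracket_zero: "Y \<in> VF \<Longrightarrow> p \<in> Carrier M \<Longrightarrow> lie_bracket Zero Y p = (\<lambda>f. 0)"
  "Y \<in> VF \<Longrightarrow> p \<in> Carrier M \<Longrightarrow> lie_bracket Y Zero p = (\<lambda>f. 0)"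
  by (auto simp: lie_bracket_def tan_const[OF VF_TS])

lemma tan_zero_on_carrier: "v \<in> TS p \<Longrightarrow> p \<in> Carrier M \<Longrightarrow> (\<And>q. q \<in> Carrier M \<Longrightarrow> f q = 0) \<Longrightarrow> v f = 0"
  using tan_cong[of v p f "\<lambda>_. 0"] tan_const[of v p 0] by simp

lemma koszul_zero:
  assumes "Y \<in> VF" "Z \<in> VF" "p \<in> Carrier M"
  shows "K Zero Y Z p = 0" "K Y Zero Z p = 0" "K Y Z Zero p = 0"
proof -
  have z: "A p (\<lambda>q. g q (D q) (\<lambda>_. 0)) = 0" "A p (\<lambda>q. g q (\<lambda>_. 0) (D q)) = 0"
    if "A \<in> VF" "D \<in> VF" for A D
    by (rule tan_zero_on_carrier[OF VF_TS[OF that(1) assms(3)] assms(3)]; simp add: g_zero g_zeroR VF_TS that)+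
  show "K Zero Y Z p = 0" "K Y Zero Z p = 0" "K Y Z Zero p = 0"
    unfolding koszul_def using assms
    by (simp_all add: bracket_zero g_zero g_zeroR VF_TS bracket_TS z)
qed

text \<open>The zero vector represents the vanishing form. A representative of the other form is
  needed as well, since otherwise no pair of vectors determines the value of
  \<open>g_bullet\<close>.\<close>

lemma contraction_zero:
  assumes \<omega>: "one_form \<omega>" and \<tau>: "one_form \<tau>" and f: "flat_valued \<tau>"
    and z: "\<And>Z q. Z \<in> VF \<Longrightarrow> q \<in> Carrier M \<Longrightarrow> \<omega> Z q = 0" and p: "p \<in> Carrier M"
  shows "contraction M g \<omega> \<tau> p = 0" "contraction M g \<tau> \<omega> p = 0"
proof -
  have r: "represents \<omega> q (\<lambda>f. 0)" if "q \<in> Carrier M" for q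
    unfolding represents_def using z that by (simp add: TS_zero g_zero VF_TS)
  have *: "g_bullet M g q (form_at M \<omega> q) (form_at M \<tau> q) = 0 \<and> g_bullet M g q (form_at M \<tau> q) (form_at M \<omega> q) = 0"
    if q: "q \<in> Carrier M" for q
  proof -
    obtain w where w: "represents \<tau> q w" using f q by (auto simp: flat_valued_def)
    then have "w \<in> TS q" by (simp add: represents_def)
    then show ?thesis
      using g_bullet_represents[OF \<omega> \<tau> q r[OF q] w] g_bullet_represents[OF \<tau> \<omega> q w r[OF q]] q
      by (simp add: g_zero g_zeroR)
  qed
  have "is_contraction M g \<omega> \<tau> (\<lambda>_. 0)" "is_contraction M g \<tau> \<omega> (\<lambda>_. 0)"
    unfolding is_contraction_def using * regular_points_Carrier by auto
  from contraction_eq[OF this(1) p] contraction_eq[OF this(2) p]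
  show "contraction M g \<omega> \<tau> p = 0" "contraction M g \<tau> \<omega> p = 0" by simp_all
qed

lemma curvature_zero:
  assumes X: "X \<in> VF" and Y: "Y \<in> VF" and Z: "Z \<in> VF" and p: "p \<in> Carrier M"
    and f: "\<And>X Y. X \<in> VF \<Longrightarrow> Y \<in> VF \<Longrightarrow> flat_valued (K X Y)"
  shows "curvature M g Zero X Y Z p = 0" "curvature M g X Zero Y Z p = 0"
    "curvature M g X Y Zero Z p = 0" "curvature M g X Y Z Zero p = 0"
proof -
  note o = one_form_koszul
  have c: "contraction M g (K A A') (K D D') p = 0" "contraction M g (K D D') (K A A') p = 0"
    if "A \<in> VF" "A' \<in> VF" "D \<in> VF" "D' \<in> VF" "A = Zero \<or> A' = Zero" for A A' D D'
  proof -
    have "K A A' E q = 0" if "E \<in> VF" "q \<in> Carrier M" for E q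
      using \<open>A = Zero \<or> A' = Zero\<close> koszul_zero(1)[OF \<open>A' \<in> VF\<close> that] koszul_zero(2)[OF \<open>A \<in> VF\<close> that] by auto
    then show "contraction M g (K A A') (K D D') p = 0" "contraction M g (K D D') (K A A') p = 0"
      using contraction_zero[OF o[OF that(1,2)] o[OF that(3,4)] f[OF that(3,4)] _ p] by blast+
  qed
  have b: "K (lie_bracket Zero X) Y Z p = 0" "K (lie_bracket X Zero) Y Z p = 0"
  proof -
    have "K (lie_bracket Zero X) Y Z p = K Zero Y Z p"
      by (rule koszul_cong_first[OF VF_bracket[OF VF_zero X] VF_zero Y Z p]) (simp add: bracket_zero X)
    then show "K (lie_bracket Zero X) Y Z p = 0" using koszul_zero(1)[OF Y Z p] by simp
    have "K (lie_bracket X Zero) Y Z p = K Zero Y Z p"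
      by (rule koszul_cong_first[OF VF_bracket[OF X VF_zero] VF_zero Y Z p]) (simp add: bracket_zero X)
    then show "K (lie_bracket X Zero) Y Z p = 0" using koszul_zero(1)[OF Y Z p] by simp
  qed
  have t: "A p (K X' Y' Z') = 0"
    if "A \<in> VF" "X' \<in> VF" "Y' \<in> VF" "Z' \<in> VF" "X' = Zero \<or> Y' = Zero \<or> Z' = Zero" for A X' Y' Z'
  proof (rule tan_zero_on_carrier[OF VF_TS[OF that(1) p] p])
    fix q assume "q \<in> Carrier M"
    then show "K X' Y' Z' q = 0"
      using that(5) koszul_zero(1)[OF that(3,4)] koszul_zero(2)[OF that(2,4)] koszul_zero(3)[OF that(2,3)] by auto
  qed
  note br = VF_bracket[OF X Y]
  show "curvature M g Zero X Y Z p = 0"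
    unfolding curvature_def curvature_of_def using t[OF X VF_zero Y Z] b(1) c[OF VF_zero Y X Z] c[OF VF_zero Z X Y] by simp
  show "curvature M g X Zero Y Z p = 0"
    unfolding curvature_def curvature_of_def using t[OF X VF_zero Y Z] b(2) c[OF VF_zero Z X Y] c[OF VF_zero Y X Z] by simp
  show "curvature M g X Y Zero Z p = 0"
    unfolding curvature_def curvature_of_def
    using t[OF X Y VF_zero Z] t[OF Y X VF_zero Z] koszul_zero(2)[OF br Z p] c[OF X VF_zero Y Z] c[OF Y VF_zero X Z] by simp
  show "curvature M g X Y Z Zero p = 0"
    unfolding curvature_def curvature_of_def
    using t[OF X Y Z VF_zero] t[OF Y X Z VF_zero] koszul_zero(3)[OF br Z p] c[OF X VF_zero Y Z] c[OF Y VF_zero X Z] by simp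
qed

end

section \<open>Riemann curvature of the warped product\<close>

context warped
begin

text \<open>The Hessian of \<open>b j\<close>: the subtracted term is the derivative of
  \<open>b j\<close> along the base covariant derivative of \<open>Y\<close> in the direction
  \<open>X\<close>. Written through the Koszul form, it matches the pairing of the lowered covariant
  derivative with the differential of \<open>b j\<close> under the inverse metric.\<close>

definition Hess :: "'b vfield \<Rightarrow> 'b vfield \<Rightarrow> nat \<Rightarrow> 'b \<times> (nat \<Rightarrow> 'f) \<Rightarrow> real"
  where "Hess X Y j x = X (fst x) (\<lambda>p. Y p (b j)) - koszul gB X Y (grad j) (fst x)"

lemma nab_warp:
  assumes "X \<in> vector_fields B" "Y \<in> vector_fields B" "j \<in> J" "p \<in> Carrier B"
  shows "nab X Y p (b j) = koszul gB X Y (grad j) p"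
proof -
  note n = nab[OF assms(1,2)] and gr = grad[OF assms(3)]
  have "nab X Y p (b j) = gB p (grad j p) (nab X Y p)" using gr(2)[OF assms(4)] n(1) by (simp add: gB.represents_def)
  also have "\<dots> = gB p (nab X Y p) (grad j p)"
    by (rule gB.g_sym[OF assms(4) base.N.VF_TS[OF gr(1) assms(4)] base.N.VF_TS[OF n(1) assms(4)]])
  also have "\<dots> = koszul gB X Y (grad j) p" using n(2)[OF assms(4)] gr(1) by (simp add: gB.represents_def)
  finally show ?thesis .
qed

lemma PF_of_koszul:
  assumes X: "pf X U" and Y: "pf Y V" and Z: "pf Z W" and T: "pf T Q" and x: "x \<in> Carrier M"
  shows "PF X U x (koszul gM (PF Y V) (PF Z W) (PF T Q)) = X (fst x) (koszul gB Y Z T) +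
    (\<Sum>j\<in>J. 2 * bb j x * X (fst x) (b j) * Kj j V W Q x + (bb j x)\<^sup>2 * U j (snd x j) (koszul (gF j) (V j) (W j) (Q j))
      + X (fst x) (b j) * (Y (fst x) (b j) * gj j W Q x + Z (fst x) (b j) * gj j Q V x - T (fst x) (b j) * gj j V W x)
      + bb j x * (X (fst x) (\<lambda>p. Y p (b j)) * gj j W Q x + Y (fst x) (b j) * (Kj j U W Q x + Kj j U Q W x)
        + X (fst x) (\<lambda>p. Z p (b j)) * gj j Q V x + Z (fst x) (b j) * (Kj j U Q V x + Kj j U V Q x)
        - X (fst x) (\<lambda>p. T p (b j)) * gj j V W x - T (fst x) (b j) * (Kj j U V W x + Kj j U W V x)))"
proof -
  note t = PF_TS[OF X x]
  let ?f = "\<lambda>j y. (bb j y)\<^sup>2 * Kj j V W Q y +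
      bb j y * (Y (fst y) (b j) * gj j W Q y + Z (fst y) (b j) * gj j Q V y - T (fst y) (b j) * gj j V W y)"
  have kB: "koszul gB Y Z T \<in> C_inf B" using Y Z T by (simp add: pf_def)
  note sm = warp_smooth Kj_smooth[OF Y Z T] gj_smooth[OF Z T] gj_smooth[OF T Y] gj_smooth[OF Y Z]
    Xb_smooth[OF Y] Xb_smooth[OF Z] Xb_smooth[OF T]
  have fs: "?f j \<in> C_inf M" if "j \<in> J" for j using sm that by simp
  have "PF X U x (koszul gM (PF Y V) (PF Z W) (PF T Q)) = PF X U x (\<lambda>y. koszul gB Y Z T (fst y) + (\<Sum>j\<in>J. ?f j y))"
    by (rule M.tan_cong[OF t x]) (rule koszul_PF[OF Y Z T])
  also have "\<dots> = PF X U x (\<lambda>y. koszul gB Y Z T (fst y)) + (\<Sum>j\<in>J. PF X U x (?f j))"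
    using fs base_smooth[OF kB] by (simp only: M.tan_add[OF t] M.tan_sum[OF t] M.C_inf_sum)
  also have "PF X U x (\<lambda>y. koszul gB Y Z T (fst y)) = X (fst x) (koszul gB Y Z T)"
    by (rule PF_of_base[OF X x kB])
  also have "(\<Sum>j\<in>J. PF X U x (?f j)) =
    (\<Sum>j\<in>J. 2 * bb j x * X (fst x) (b j) * Kj j V W Q x + (bb j x)\<^sup>2 * U j (snd x j) (koszul (gF j) (V j) (W j) (Q j))
      + X (fst x) (b j) * (Y (fst x) (b j) * gj j W Q x + Z (fst x) (b j) * gj j Q V x - T (fst x) (b j) * gj j V W x)
      + bb j x * (X (fst x) (\<lambda>p. Y p (b j)) * gj j W Q x + Y (fst x) (b j) * (Kj j U W Q x + Kj j U Q W x)
        + X (fst x) (\<lambda>p. Z p (b j)) * gj j Q V x + Z (fst x) (b j) * (Kj j U Q V x + Kj j U V Q x)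
        - X (fst x) (\<lambda>p. T p (b j)) * gj j V W x - T (fst x) (b j) * (Kj j U V W x + Kj j U W V x)))"
  proof (rule sum.cong[OF refl])
    fix j assume j: "j \<in> J"
    note s = sm[OF j]
    have d: "PF X U x (\<lambda>y. A (fst y) (b j)) = X (fst x) (\<lambda>p. A p (b j))" if "pf A D" for A D
      by (rule PF_of_base[OF X x base.N.VF_smooth[OF pfD(1)[OF that] bC[OF j]]])
    have dg: "PF X U x (\<lambda>y. gj j D E y) = Kj j U D E x + Kj j U E D x" if "pf A D" "pf A' E" for A D A' E
      using PF_of_gj[OF X x that j] gj_deriv[OF X x that j] by simp
    have db: "PF X U x (\<lambda>y. bb j y) = X (fst x) (b j)" by (rule PF_of_base[OF X x bC[OF j]])
    note dK = PF_of_Kj[OF X x Y Z T j]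
    show "PF X U x (?f j) = 2 * bb j x * X (fst x) (b j) * Kj j V W Q x + (bb j x)\<^sup>2 * U j (snd x j) (koszul (gF j) (V j) (W j) (Q j))
      + X (fst x) (b j) * (Y (fst x) (b j) * gj j W Q x + Z (fst x) (b j) * gj j Q V x - T (fst x) (b j) * gj j V W x)
      + bb j x * (X (fst x) (\<lambda>p. Y p (b j)) * gj j W Q x + Y (fst x) (b j) * (Kj j U W Q x + Kj j U Q W x)
        + X (fst x) (\<lambda>p. Z p (b j)) * gj j Q V x + Z (fst x) (b j) * (Kj j U Q V x + Kj j U V Q x)
        - X (fst x) (\<lambda>p. T p (b j)) * gj j V W x - T (fst x) (b j) * (Kj j U V W x + Kj j U W V x))"
      using s by (simp add: M.tan_add[OF t] M.tan_diff[OF t] M.tan_mult[OF t] M.tan_power2[OF t]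
          db dK d[OF Y] d[OF Z] d[OF T] dg[OF Z T] dg[OF T Y] dg[OF Y Z] algebra_simps)
  qed
  finally show ?thesis .
qed

text \<open>Within one fibre all products of first derivatives of \<open>b j\<close> with the fibre
  metric or its Koszul form cancel, and second derivatives combine with the base connection to
  Hessians. Only the double sums, which stem from the base part of the contractions, couple
  different fibres.\<close>

lemma curvature_PF:
  assumes X: "pf X U" and Y: "pf Y V" and Z: "pf Z W" and T: "pf T Q" and x: "x \<in> Carrier M"
  shows "curvature M gM (PF X U) (PF Y V) (PF Z W) (PF T Q) x = curvature B gB X Y Z T (fst x)
    + (\<Sum>j\<in>J. (bb j x)\<^sup>2 * curvature (F j) (gF j) (U j) (V j) (W j) (Q j) (snd x j))
    - (\<Sum>j\<in>J. bb j x * Hess X T j x * gj j V W x) + (\<Sum>j\<in>J. bb j x * Hess X Z j x * gj j V Q x)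
    + (\<Sum>j\<in>J. bb j x * Hess Y T j x * gj j U W x) - (\<Sum>j\<in>J. bb j x * Hess Y Z j x * gj j U Q x)
    + (\<Sum>j\<in>J. \<Sum>k\<in>J. bb j x * bb k x * gj j U W x * gj k V Q x * gB (fst x) (grad j (fst x)) (grad k (fst x)))
    - (\<Sum>j\<in>J. \<Sum>k\<in>J. bb j x * bb k x * gj j V W x * gj k U Q x * gB (fst x) (grad j (fst x)) (grad k (fst x)))"
proof -
  note xB = fst_C[OF x] and xF = snd_C[OF x]
  note bXY = pf_bracket[OF X Y]
  have br: "koszul gM (lie_bracket (PF X U) (PF Y V)) (PF Z W) (PF T Q) x =
      koszul gM (PF (lie_bracket X Y) (\<lambda>j. lie_bracket (U j) (V j))) (PF Z W) (PF T Q) x"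
    by (rule W.koszul_cong_first[OF M.VF_bracket[OF pf_VF[OF X] pf_VF[OF Y]] pf_VF[OF bXY] pf_VF[OF Z] pf_VF[OF T] x],
        rule PF_bracket[OF pfD(1)[OF X] pfD(2)[OF X] pfD(1)[OF Y] pfD(2)[OF Y]])
  have c1: "contraction M gM (koszul gM (PF X U) (PF Z W)) (koszul gM (PF Y V) (PF T Q)) x = contraction_formula X U Z W Y V T Q x"
    by (rule W.contraction_eq[OF contraction_PF[OF X Z Y T] x])
  have c2: "contraction M gM (koszul gM (PF Y V) (PF Z W)) (koszul gM (PF X U) (PF T Q)) x = contraction_formula Y V Z W X U T Q x"
    by (rule W.contraction_eq[OF contraction_PF[OF Y Z X T] x])
  let ?Rj = "\<lambda>j. curvature (F j) (gF j) (U j) (V j) (W j) (Q j) (snd x j)"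
  let ?D = "\<lambda>X Y Z T U V W Q j. 2 * bb j x * X (fst x) (b j) * Kj j V W Q x + (bb j x)\<^sup>2 * U j (snd x j) (koszul (gF j) (V j) (W j) (Q j))
      + X (fst x) (b j) * (Y (fst x) (b j) * gj j W Q x + Z (fst x) (b j) * gj j Q V x - T (fst x) (b j) * gj j V W x)
      + bb j x * (X (fst x) (\<lambda>p. Y p (b j)) * gj j W Q x + Y (fst x) (b j) * (Kj j U W Q x + Kj j U Q W x)
        + X (fst x) (\<lambda>p. Z p (b j)) * gj j Q V x + Z (fst x) (b j) * (Kj j U Q V x + Kj j U V Q x)
        - X (fst x) (\<lambda>p. T p (b j)) * gj j V W x - T (fst x) (b j) * (Kj j U V W x + Kj j U W V x))"
  let ?L = "\<lambda>j. lie_bracket (U j) (V j)" and ?l = "lie_bracket X Y"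
  let ?B = "\<lambda>j. (bb j x)\<^sup>2 * Kj j ?L W Q x +
      bb j x * (?l (fst x) (b j) * gj j W Q x + Z (fst x) (b j) * gj j Q ?L x - T (fst x) (b j) * gj j ?L W x)"
  let ?E = "\<lambda>X V Y W X' V' Y' W' j. (bb j x)\<^sup>2 * Cj j V W V' W' x
        + bb j x * (X' (fst x) (b j) * Kj j V W W' x + Y' (fst x) (b j) * Kj j V W V' x
          + X (fst x) (b j) * Kj j V' W' W x + Y (fst x) (b j) * Kj j V' W' V x)
        + X (fst x) (b j) * X' (fst x) (b j) * gj j W W' x + X (fst x) (b j) * Y' (fst x) (b j) * gj j W V' x
        + Y (fst x) (b j) * X' (fst x) (b j) * gj j V W' x + Y (fst x) (b j) * Y' (fst x) (b j) * gj j V V' x"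
  \<comment> \<open>The contribution of a single fibre. The cancellation is checked here, outside
    the sums, with metric pairings brought into one order and the torsion of the fibre fields
    removed.\<close>
  have per: "?D X Y Z T U V W Q j - ?D Y X Z T V U W Q j - ?B j
      - bb j x * gj j V Q x * nab X Z (fst x) (b j) - bb j x * gj j U W x * nab Y T (fst x) (b j) + ?E X U Z W Y V T Q j
      + bb j x * gj j U Q x * nab Y Z (fst x) (b j) + bb j x * gj j V W x * nab X T (fst x) (b j) - ?E Y V Z W X U T Q j
    = (bb j x)\<^sup>2 * ?Rj j - bb j x * Hess X T j x * gj j V W x + bb j x * Hess X Z j x * gj j V Q x
      + bb j x * Hess Y T j x * gj j U W x - bb j x * Hess Y Z j x * gj j U Q x" if j: "j \<in> J" for j
  proof -
    interpret Fj: ssr "F j" "gF j" by (rule sF[OF j])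
    note z = xF[OF j]
    note u = pfD(2)[OF X j] and v = pfD(2)[OF Y j] and w = pfD(2)[OF Z j] and q = pfD(2)[OF T j]
    note sy = Fj.g_sym[OF z Fj.VF_TS[OF _ z] Fj.VF_TS[OF _ z]]
    have s: "gj j Q V x = gj j V Q x" "gj j Q U x = gj j U Q x" "gj j W V x = gj j V W x" "gj j W U x = gj j U W x"
      "gj j V U x = gj j U V x" "gj j Q W x = gj j W Q x"
      by (rule sy[OF q v], rule sy[OF q u], rule sy[OF w v], rule sy[OF w u], rule sy[OF v u], rule sy[OF q w])
    have L: "gj j ?L W x = Kj j U V W x - Kj j V U W x" "gj j Q ?L x = Kj j U V Q x - Kj j V U Q x"
      using Fj.koszul_torsion[OF u v w z] Fj.koszul_torsion[OF u v q z] sy[OF q Fj.VF_bracket[OF u v]] by simp_all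
    have l: "?l (fst x) (b j) = X (fst x) (\<lambda>p. Y p (b j)) - Y (fst x) (\<lambda>p. X p (b j))"
      by (simp add: lie_bracket_def)
    note n = nab_warp[OF pfD(1)[OF X] pfD(1)[OF Z] j xB] nab_warp[OF pfD(1)[OF X] pfD(1)[OF T] j xB]
      nab_warp[OF pfD(1)[OF Y] pfD(1)[OF Z] j xB] nab_warp[OF pfD(1)[OF Y] pfD(1)[OF T] j xB]
    show ?thesis
      unfolding s L l n Hess_def curvature_def curvature_of_def by (simp add: algebra_simps power2_eq_square)
  qed
  have RB: "curvature B gB X Y Z T (fst x) = X (fst x) (koszul gB Y Z T) - Y (fst x) (koszul gB X Z T)
     - koszul gB ?l Z T (fst x) + gB (fst x) (nab X Z (fst x)) (nab Y T (fst x)) - gB (fst x) (nab Y Z (fst x)) (nab X T (fst x))"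
    unfolding curvature_def curvature_of_def
    using contraction_base[OF pfD(1)[OF X] pfD(1)[OF Z] pfD(1)[OF Y] pfD(1)[OF T] xB]
      contraction_base[OF pfD(1)[OF Y] pfD(1)[OF Z] pfD(1)[OF X] pfD(1)[OF T] xB] by simp
  have "(\<Sum>j\<in>J. ?D X Y Z T U V W Q j) - (\<Sum>j\<in>J. ?D Y X Z T V U W Q j) - (\<Sum>j\<in>J. ?B j)
      - (\<Sum>j\<in>J. bb j x * gj j V Q x * nab X Z (fst x) (b j)) - (\<Sum>j\<in>J. bb j x * gj j U W x * nab Y T (fst x) (b j))
      + (\<Sum>j\<in>J. ?E X U Z W Y V T Q j)
      + (\<Sum>j\<in>J. bb j x * gj j U Q x * nab Y Z (fst x) (b j)) + (\<Sum>j\<in>J. bb j x * gj j V W x * nab X T (fst x) (b j))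
      - (\<Sum>j\<in>J. ?E Y V Z W X U T Q j)
    = (\<Sum>j\<in>J. (bb j x)\<^sup>2 * ?Rj j)
    - (\<Sum>j\<in>J. bb j x * Hess X T j x * gj j V W x) + (\<Sum>j\<in>J. bb j x * Hess X Z j x * gj j V Q x)
    + (\<Sum>j\<in>J. bb j x * Hess Y T j x * gj j U W x) - (\<Sum>j\<in>J. bb j x * Hess Y Z j x * gj j U Q x)"
    unfolding sum_subtractf[symmetric] sum.distrib[symmetric] by (rule sum.cong[OF refl per])
  then show ?thesis
    unfolding RB curvature_def[of M] curvature_of_def[of M] br c1 c2 contraction_formula_def
      PF_of_koszul[OF X Y Z T x] PF_of_koszul[OF Y X Z T x] koszul_PF[OF bXY Z T x]
    by linarith
qed

lemma diff_at_eq: "diff_at B f p = form_at B (\<lambda>Z p. Z p f) p" if p: "p \<in> Carrier B"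
proof
  fix w
  show "diff_at B f p w = form_at B (\<lambda>Z p. Z p f) p w"
  proof (cases "w \<in> tangent_space B p")
    case True
    let ?Z = "SOME Z. Z \<in> vector_fields B \<and> Z p = w"
    have "\<exists>Z. Z \<in> vector_fields B \<and> Z p = w" by (rule base.N.vector_extension[OF p True]) blast
    from someI_ex[OF this] have "?Z p = w" by blast
    then show ?thesis using True by (simp add: diff_at_def form_at_def)
  qed (simp add: diff_at_def form_at_def)
qed

lemma inverse_metric_nab:
  assumes "X \<in> vector_fields B" "Y \<in> vector_fields B" "j \<in> J" "p \<in> Carrier B"
  shows "inverse_metric B gB p (form_at B (koszul gB X Y) p) (diff_at B (b j) p) = koszul gB X Y (grad j) p"
proof -
  have "inverse_metric B gB p (form_at B (koszul gB X Y) p) (diff_at B (b j) p) = gB p (nab X Y p) (grad j p)"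
    unfolding diff_at_eq[OF assms(4)]
    by (rule gB.inverse_metric_represents[OF ndB assms(4) gB.one_form_koszul[OF assms(1,2)]
        one_form_differential[OF bC[OF assms(3)]] nab(2)[OF assms(1,2,4)] grad(2)[OF assms(3,4)]])
  also have "\<dots> = koszul gB X Y (grad j) p"
    using nab(2)[OF assms(1,2,4)] grad(1)[OF assms(3)] by (simp add: gB.represents_def)
  finally show ?thesis .
qed

lemma inverse_metric_grad:
  assumes "i \<in> J" "j \<in> J" "p \<in> Carrier B"
  shows "inverse_metric B gB p (diff_at B (b i) p) (diff_at B (b j) p) = gB p (grad i p) (grad j p)"
  unfolding diff_at_eq[OF assms(3)]
  by (rule gB.inverse_metric_represents[OF ndB assms(3) one_form_differential[OF bC[OF assms(1)]]
        one_form_differential[OF bC[OF assms(2)]] grad(2)[OF assms(1,3)] grad(2)[OF assms(2,3)]])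

subsection \<open>Lifts of vector fields on the factors\<close>

abbreviation "nil \<equiv> \<lambda>_ _ _. 0"
abbreviation "single i V \<equiv> \<lambda>j. if j = i then V else (\<lambda>_ _. 0)"
abbreviation "H \<equiv> lift_base B F J"
abbreviation "L \<equiv> lift_fibre B F J"

lemma pf_nil: "X \<in> vector_fields B \<Longrightarrow> pf X nil"
  using mfd.VF_zero[OF mF] by (simp add: pf_def)

lemma pf_single: "V \<in> vector_fields (F i) \<Longrightarrow> pf (\<lambda>_ _. 0) (single i V)"
  using mfd.VF_zero[OF mF] base.N.VF_zero by (simp add: pf_def)

lemma H_eq_PF: "H X = PF X nil"
proof -
  have "lift_fibre B F J j (\<lambda>_ _. 0) x f = 0" for j x f
    by (simp add: lift_fibre_def pushforward_def split_beta)
  then show ?thesis by (simp add: PF_def fun_eq_iff)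
qed

lemma L_eq_PF: "i \<in> J \<Longrightarrow> L i V = PF (\<lambda>_ _. 0) (single i V)"
proof -
  assume i: "i \<in> J"
  have "lift_fibre B F J j (single i V j) x f = (if j = i then L i V x f else 0)" for j x f
    by (auto simp: lift_fibre_def pushforward_def split_beta)
  moreover have "lift_base B F J (\<lambda>_ _. 0) x f = 0" for x f
    by (simp add: lift_base_def pushforward_def split_beta)
  ultimately show ?thesis using i finJ by (simp add: PF_def fun_eq_iff)
qed

lemma sum_single: "i \<in> J \<Longrightarrow> (\<And>j. j \<in> J \<Longrightarrow> j \<noteq> i \<Longrightarrow> f j = 0) \<Longrightarrow> sum f J = (f i :: real)"
  using finJ by (subst sum.remove[of J i]) (auto intro!: sum.neutral)

lemma koszul_fibre_zero:
  assumes "j \<in> J" "V \<in> vector_fields (F j)" "W \<in> vector_fields (F j)" "z \<in> Carrier (F j)"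
  shows "koszul (gF j) (\<lambda>_ _. 0) V W z = 0" "koszul (gF j) V (\<lambda>_ _. 0) W z = 0" "koszul (gF j) V W (\<lambda>_ _. 0) z = 0"
  using ssr.koszul_zero[OF sF[OF assms(1)] assms(2-4)] by simp_all

lemma curvature_fibre_zero:
  assumes "j \<in> J" "U \<in> vector_fields (F j)" "V \<in> vector_fields (F j)" "W \<in> vector_fields (F j)" "z \<in> Carrier (F j)"
  shows "curvature (F j) (gF j) (\<lambda>_ _. 0) U V W z = 0" "curvature (F j) (gF j) U (\<lambda>_ _. 0) V W z = 0"
    "curvature (F j) (gF j) U V (\<lambda>_ _. 0) W z = 0" "curvature (F j) (gF j) U V W (\<lambda>_ _. 0) z = 0"
proof -
  have f: "ssr.flat_valued (F j) (gF j) (koszul (gF j) X Y)" if "X \<in> vector_fields (F j)" "Y \<in> vector_fields (F j)" for X Y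
    unfolding ssr.flat_valued_def[OF sF[OF assms(1)]] using represents_fibre[OF assms(1) that] by blast
  show "curvature (F j) (gF j) (\<lambda>_ _. 0) U V W z = 0" "curvature (F j) (gF j) U (\<lambda>_ _. 0) V W z = 0"
    "curvature (F j) (gF j) U V (\<lambda>_ _. 0) W z = 0" "curvature (F j) (gF j) U V W (\<lambda>_ _. 0) z = 0"
    by (rule ssr.curvature_zero[OF sF[OF assms(1)] assms(2-5) f]; assumption)+
qed

lemma curvature_base_zero:
  assumes X: "X \<in> vector_fields B" and Y: "Y \<in> vector_fields B" and Z: "Z \<in> vector_fields B" and z: "z \<in> Carrier B"
  shows "curvature B gB (\<lambda>_ _. 0) X Y Z z = 0" "curvature B gB X (\<lambda>_ _. 0) Y Z z = 0"
    "curvature B gB X Y (\<lambda>_ _. 0) Z z = 0" "curvature B gB X Y Z (\<lambda>_ _. 0) z = 0"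
proof -
  have f: "gB.flat_valued (koszul gB X Y)" if "X \<in> vector_fields B" "Y \<in> vector_fields B" for X Y
    unfolding gB.flat_valued_def using nab(2)[OF that] by blast
  show "curvature B gB (\<lambda>_ _. 0) X Y Z z = 0" "curvature B gB X (\<lambda>_ _. 0) Y Z z = 0"
    "curvature B gB X Y (\<lambda>_ _. 0) Z z = 0" "curvature B gB X Y Z (\<lambda>_ _. 0) z = 0"
    by (rule gB.curvature_zero[OF assms f]; assumption)+
qed

section \<open>Metric, Koszul form and curvature on lifts\<close>

context
  fixes x assumes x: "x \<in> Carrier M"
begin

lemma fibre_TS: "j \<in> J \<Longrightarrow> V \<in> vector_fields (F j) \<Longrightarrow> V (snd x j) \<in> tangent_space (F j) (snd x j)"
  by (rule mfd.VF_TS[OF mF _ snd_C[OF x]])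

lemma base_TS: "X \<in> vector_fields B \<Longrightarrow> X (fst x) \<in> tangent_space B (fst x)"
  by (rule base.N.VF_TS[OF _ fst_C[OF x]])

lemma gF_zero: "j \<in> J \<Longrightarrow> v \<in> tangent_space (F j) (snd x j) \<Longrightarrow> gF j (snd x j) (\<lambda>_. 0) v = 0"
  "j \<in> J \<Longrightarrow> v \<in> tangent_space (F j) (snd x j) \<Longrightarrow> gF j (snd x j) v (\<lambda>_. 0) = 0"
  using ssr.g_zero[OF sF snd_C[OF x]] ssr.g_zeroR[OF sF snd_C[OF x]] by simp_all

lemma gB_zero: "v \<in> tangent_space B (fst x) \<Longrightarrow> gB (fst x) (\<lambda>_. 0) v = 0"
  "v \<in> tangent_space B (fst x) \<Longrightarrow> gB (fst x) v (\<lambda>_. 0) = 0"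
  using gB.g_zero[OF fst_C[OF x]] gB.g_zeroR[OF fst_C[OF x]] by simp_all

lemma gj_nil: "pf X V \<Longrightarrow> j \<in> J \<Longrightarrow> gj j V nil x = 0" "pf X V \<Longrightarrow> j \<in> J \<Longrightarrow> gj j nil V x = 0"
  by (simp_all add: gF_zero fibre_TS pfD(2))

lemma gj_single:
  assumes V: "V \<in> vector_fields (F i)" and W: "W \<in> vector_fields (F k)" and j: "j \<in> J"
  shows "gj j (single i V) (single k W) x = (if j = i \<and> i = k then gF i (snd x i) (V (snd x i)) (W (snd x i)) else 0)"
proof -
  have "(\<lambda>_. 0) \<in> tangent_space (F j) (snd x j)" by (rule mfd.TS_zero[OF mF[OF j]])
  then show ?thesis using j V W by (auto simp: gF_zero fibre_TS)
qed

lemma sum_gj_single: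
  assumes V: "V \<in> vector_fields (F i)" and W: "W \<in> vector_fields (F k)" and i: "i \<in> J"
  shows "(\<Sum>j\<in>J. c j * gj j (single i V) (single k W) x) =
    (if i = k then c i * gF i (snd x i) (V (snd x i)) (W (snd x i)) else 0)"
proof -
  have "(\<Sum>j\<in>J. c j * gj j (single i V) (single k W) x) = c i * gj i (single i V) (single k W) x"
    by (rule sum_single[OF i]) (subst gj_single[OF V W], assumption, simp)
  then show ?thesis unfolding gj_single[OF V W i] by simp
qed

lemma gM_HH: "X \<in> vector_fields B \<Longrightarrow> Y \<in> vector_fields B \<Longrightarrow> gM x (H X x) (H Y x) = gB (fst x) (X (fst x)) (Y (fst x))"
  unfolding H_eq_PF gM_PF[OF pf_nil pf_nil x] using gj_nil[OF pf_nil] by simp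

lemma gM_HL: "X \<in> vector_fields B \<Longrightarrow> i \<in> J \<Longrightarrow> V \<in> vector_fields (F i) \<Longrightarrow> gM x (H X x) (L i V x) = 0"
proof -
  assume X: "X \<in> vector_fields B" and i: "i \<in> J" and V: "V \<in> vector_fields (F i)"
  show ?thesis
    unfolding H_eq_PF L_eq_PF[OF i] gM_PF[OF pf_nil[OF X] pf_single[OF V] x]
    using gj_nil(2)[OF pf_single[OF V]] gB_zero(2)[OF base_TS[OF X]] by simp
qed

lemma gM_LH: "X \<in> vector_fields B \<Longrightarrow> i \<in> J \<Longrightarrow> V \<in> vector_fields (F i) \<Longrightarrow> gM x (L i V x) (H X x) = 0"
proof -
  assume X: "X \<in> vector_fields B" and i: "i \<in> J" and V: "V \<in> vector_fields (F i)"
  show ?thesis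
    unfolding H_eq_PF L_eq_PF[OF i] gM_PF[OF pf_single[OF V] pf_nil[OF X] x]
    using gj_nil(1)[OF pf_single[OF V]] gB_zero(1)[OF base_TS[OF X]] by simp
qed

lemma gM_LL:
  assumes i: "i \<in> J" and V: "V \<in> vector_fields (F i)" and k: "k \<in> J" and W: "W \<in> vector_fields (F k)"
  shows "gM x (L i V x) (L k W x) = (if i = k then (bb i x)\<^sup>2 * gF i (snd x i) (V (snd x i)) (W (snd x i)) else 0)"
  unfolding L_eq_PF[OF i] L_eq_PF[OF k] gM_PF[OF pf_single[OF V] pf_single[OF W] x] sum_gj_single[OF V W i]
  by (simp add: gB_zero(1)[OF base.N.TS_zero])

context
  fixes l P assumes l: "l \<in> J" and P: "P \<in> vector_fields (F l)"
begin

text \<open>With the lift of \<open>P\<close> in the second slot, this and the next three lemmas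
  give its lowered covariant derivative, which is all that the semi-symmetric curvature needs of the
  Koszul form. The letters in the names record the slots: \<open>H\<close> for the base,
  \<open>L\<close> for a fibre.\<close>

lemma koszul_HH: "X \<in> vector_fields B \<Longrightarrow> Y \<in> vector_fields B \<Longrightarrow> koszul gM (H X) (L l P) (H Y) x = 0"
proof -
  assume X: "X \<in> vector_fields B" and Y: "Y \<in> vector_fields B"
  have k: "Kj j nil (single l P) nil x = 0" if "j \<in> J" for j
    using koszul_fibre_zero(1)[OF that pfD(2)[OF pf_single[OF P] that] mfd.VF_zero[OF mF[OF that]] snd_C[OF x that]] .
  show ?thesis
    unfolding H_eq_PF L_eq_PF[OF l] koszul_PF[OF pf_nil[OF X] pf_single[OF P] pf_nil[OF Y] x]
    using k gj_nil[OF pf_single[OF P]] gj_nil[OF pf_nil[OF X]] gB.koszul_zero(2)[OF X Y fst_C[OF x]] by simp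
qed

lemma koszul_HL:
  assumes X: "X \<in> vector_fields B" and j: "j \<in> J" and W: "W \<in> vector_fields (F j)"
  shows "koszul gM (H X) (L l P) (L j W) x =
    (if j = l then bb l x * X (fst x) (b l) * gF l (snd x l) (W (snd x l)) (P (snd x l)) else 0)"
proof -
  have k: "Kj i nil (single l P) (single j W) x = 0" if "i \<in> J" for i
    using koszul_fibre_zero(1)[OF that pfD(2)[OF pf_single[OF P] that] pfD(2)[OF pf_single[OF W] that] snd_C[OF x that]] .
  have "koszul gM (H X) (L l P) (L j W) x = (\<Sum>i\<in>J. bb i x * X (fst x) (b i) * gj i (single l P) (single j W) x)"
    unfolding H_eq_PF L_eq_PF[OF l] L_eq_PF[OF j] koszul_PF[OF pf_nil[OF X] pf_single[OF P] pf_single[OF W] x]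
    using k gj_nil[OF pf_single[OF P]] gj_nil[OF pf_single[OF W]] gB.koszul_zero(2)[OF X base.N.VF_zero fst_C[OF x]]
    by (simp add: mult.assoc)
  then show ?thesis
    unfolding sum_gj_single[OF P W l] using ssr.g_sym[OF sF[OF l] snd_C[OF x l] fibre_TS[OF l P] fibre_TS[OF l]] W by auto
qed

text \<open>The sign is opposite to that of the previous lemma: along a fibre field the covariant
  derivative of \<open>P\<close> has a base component against the gradient of
  \<open>b l\<close>.\<close>

lemma koszul_LH:
  assumes X: "X \<in> vector_fields B" and j: "j \<in> J" and W: "W \<in> vector_fields (F j)"
  shows "koszul gM (L j W) (L l P) (H X) x =
    (if j = l then - bb l x * X (fst x) (b l) * gF l (snd x l) (W (snd x l)) (P (snd x l)) else 0)"
proof -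
  have k: "Kj i (single j W) (single l P) nil x = 0" if "i \<in> J" for i
    using koszul_fibre_zero(3)[OF that pfD(2)[OF pf_single[OF W] that] pfD(2)[OF pf_single[OF P] that] snd_C[OF x that]] .
  have "koszul gM (L j W) (L l P) (H X) x = (\<Sum>i\<in>J. (- bb i x * X (fst x) (b i)) * gj i (single j W) (single l P) x)"
    unfolding H_eq_PF L_eq_PF[OF l] L_eq_PF[OF j] koszul_PF[OF pf_single[OF W] pf_single[OF P] pf_nil[OF X] x]
    using k gB.koszul_zero(1)[OF base.N.VF_zero X fst_C[OF x]]
    by (simp add: mult.assoc)
  then show ?thesis
    unfolding sum_gj_single[OF W P j] by auto
qed

lemma koszul_LL:
  assumes i: "i \<in> J" and V: "V \<in> vector_fields (F i)" and j: "j \<in> J" and W: "W \<in> vector_fields (F j)"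
  shows "koszul gM (L i V) (L l P) (L j W) x =
    (if i = l \<and> j = l then (bb l x)\<^sup>2 * koszul (gF l) V P W (snd x l) else 0)"
proof -
  note v = pfD(2)[OF pf_single[OF V]] and p = pfD(2)[OF pf_single[OF P]] and w = pfD(2)[OF pf_single[OF W]]
  have "koszul gM (L i V) (L l P) (L j W) x = (\<Sum>a\<in>J. (bb a x)\<^sup>2 * Kj a (single i V) (single l P) (single j W) x)"
    unfolding L_eq_PF[OF i] L_eq_PF[OF l] L_eq_PF[OF j] koszul_PF[OF pf_single[OF V] pf_single[OF P] pf_single[OF W] x]
    using gB.koszul_zero(1)[OF base.N.VF_zero base.N.VF_zero fst_C[OF x]] by simp
  also have "\<dots> = (bb l x)\<^sup>2 * Kj l (single i V) (single l P) (single j W) x"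
  proof (rule sum_single[OF l])
    fix a assume a: "a \<in> J" "a \<noteq> l"
    then show "(bb a x)\<^sup>2 * Kj a (single i V) (single l P) (single j W) x = 0"
      using koszul_fibre_zero(2)[OF a(1) v[OF a(1)] w[OF a(1)] snd_C[OF x a(1)]] by simp
  qed
  also have "\<dots> = (if i = l \<and> j = l then (bb l x)\<^sup>2 * koszul (gF l) V P W (snd x l) else 0)"
    using koszul_fibre_zero(1)[OF l p[OF l] w[OF l] snd_C[OF x l]] koszul_fibre_zero(3)[OF l v[OF l] p[OF l] snd_C[OF x l]] by auto
  finally show ?thesis .
qed

end

lemma Hess_zero: "Y \<in> vector_fields B \<Longrightarrow> j \<in> J \<Longrightarrow> Hess (\<lambda>_ _. 0) Y j x = 0"
  "Y \<in> vector_fields B \<Longrightarrow> j \<in> J \<Longrightarrow> Hess Y (\<lambda>_ _. 0) j x = 0"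
  using gB.koszul_zero(1,2)[OF _ grad(1) fst_C[OF x]] base.N.tan_const[OF base_TS] by (simp_all add: Hess_def)

lemma curvature_HHHH:
  assumes "X \<in> vector_fields B" "Y \<in> vector_fields B" "Z \<in> vector_fields B" "T \<in> vector_fields B"
  shows "curvature M gM (H X) (H Y) (H Z) (H T) x = curvature B gB X Y Z T (fst x)"
proof -
  have c: "curvature (F j) (gF j) (\<lambda>_ _. 0) (\<lambda>_ _. 0) (\<lambda>_ _. 0) (\<lambda>_ _. 0) (snd x j) = 0" if "j \<in> J" for j
    using mfd.VF_zero[OF mF[OF that]] curvature_fibre_zero(1)[OF that _ _ _ snd_C[OF x that]] by blast
  show ?thesis
    unfolding H_eq_PF curvature_PF[OF pf_nil[OF assms(1)] pf_nil[OF assms(2)] pf_nil[OF assms(3)] pf_nil[OF assms(4)] x]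
    using gj_nil[OF pf_nil[OF assms(1)]] c by simp
qed

lemma curvature_HHHL:
  assumes "X \<in> vector_fields B" "Y \<in> vector_fields B" "Z \<in> vector_fields B" and i: "i \<in> J" and V: "V \<in> vector_fields (F i)"
  shows "curvature M gM (H X) (H Y) (H Z) (L i V) x = 0" "curvature M gM (H Z) (L i V) (H X) (H Y) x = 0"
proof -
  note z = mfd.VF_zero[OF mF] and v = pfD(2)[OF pf_single[OF V]]
  have c: "curvature (F j) (gF j) (\<lambda>_ _. 0) (\<lambda>_ _. 0) (\<lambda>_ _. 0) (single i V j) (snd x j) = 0"
    "curvature (F j) (gF j) (\<lambda>_ _. 0) (single i V j) (\<lambda>_ _. 0) (\<lambda>_ _. 0) (snd x j) = 0" if "j \<in> J" for j
    by (rule curvature_fibre_zero(1)[OF that _ _ _ snd_C[OF x that]]; intro z v that)+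
  note gz = gj_nil[OF pf_nil[OF assms(1)]] gj_nil[OF pf_single[OF V]]
  show "curvature M gM (H X) (H Y) (H Z) (L i V) x = 0"
    unfolding H_eq_PF L_eq_PF[OF i] curvature_PF[OF pf_nil[OF assms(1)] pf_nil[OF assms(2)] pf_nil[OF assms(3)] pf_single[OF V] x]
    using gz c(1) curvature_base_zero(4)[OF assms(1-3) fst_C[OF x]] by simp
  show "curvature M gM (H Z) (L i V) (H X) (H Y) x = 0"
    unfolding H_eq_PF L_eq_PF[OF i] curvature_PF[OF pf_nil[OF assms(3)] pf_single[OF V] pf_nil[OF assms(1)] pf_nil[OF assms(2)] x]
    using gz c(2) curvature_base_zero(2)[OF assms(3,1,2) fst_C[OF x]] by simp
qed

lemma curvature_HHLL:
  assumes X: "X \<in> vector_fields B" and Y: "Y \<in> vector_fields B"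
    and i: "i \<in> J" and V: "V \<in> vector_fields (F i)" and j: "j \<in> J" and W: "W \<in> vector_fields (F j)"
  shows "curvature M gM (H X) (H Y) (L i V) (L j W) x = 0" "curvature M gM (L i V) (L j W) (H X) (H Y) x = 0"
proof -
  note z = mfd.VF_zero[OF mF] and v = pfD(2)[OF pf_single[OF V]] and w = pfD(2)[OF pf_single[OF W]]
  note zB = base.N.VF_zero
  have c1: "curvature (F a) (gF a) (\<lambda>_ _. 0) (\<lambda>_ _. 0) (single i V a) (single j W a) (snd x a) = 0" if "a \<in> J" for a
    by (rule curvature_fibre_zero(1)[OF that _ _ _ snd_C[OF x that]]; intro z v w that)
  have c2: "curvature (F a) (gF a) (single i V a) (single j W a) (\<lambda>_ _. 0) (\<lambda>_ _. 0) (snd x a) = 0" if "a \<in> J" for a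
    by (rule curvature_fibre_zero(3)[OF that _ _ _ snd_C[OF x that]]; intro z v w that)
  note gz = gj_nil[OF pf_nil[OF X]] gj_nil[OF pf_single[OF V]] gj_nil[OF pf_single[OF W]]
  show "curvature M gM (H X) (H Y) (L i V) (L j W) x = 0"
    unfolding H_eq_PF L_eq_PF[OF i] L_eq_PF[OF j]
      curvature_PF[OF pf_nil[OF X] pf_nil[OF Y] pf_single[OF V] pf_single[OF W] x]
    using gz c1 curvature_base_zero(3)[OF X Y zB fst_C[OF x]] by simp
  show "curvature M gM (L i V) (L j W) (H X) (H Y) x = 0"
    unfolding H_eq_PF L_eq_PF[OF i] L_eq_PF[OF j]
      curvature_PF[OF pf_single[OF V] pf_single[OF W] pf_nil[OF X] pf_nil[OF Y] x]
    using gz c2 curvature_base_zero(1)[OF zB X Y fst_C[OF x]] by simp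
qed

lemma curvature_HLLH:
  assumes X: "X \<in> vector_fields B" and Y: "Y \<in> vector_fields B"
    and i: "i \<in> J" and V: "V \<in> vector_fields (F i)" and j: "j \<in> J" and W: "W \<in> vector_fields (F j)"
  shows "curvature M gM (H X) (L i V) (L j W) (H Y) x =
    (if i = j then - (bb i x * Hess X Y i x * gF i (snd x i) (V (snd x i)) (W (snd x i))) else 0)"
proof -
  note z = mfd.VF_zero[OF mF] and v = pfD(2)[OF pf_single[OF V]] and w = pfD(2)[OF pf_single[OF W]]
  note zB = base.N.VF_zero
  have c: "curvature (F a) (gF a) (\<lambda>_ _. 0) (single i V a) (single j W a) (\<lambda>_ _. 0) (snd x a) = 0" if "a \<in> J" for a
    by (rule curvature_fibre_zero(1)[OF that _ _ _ snd_C[OF x that]]; intro z v w that)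
  note gz = gj_nil[OF pf_nil[OF X]] gj_nil[OF pf_single[OF V]] gj_nil[OF pf_single[OF W]]
  have "curvature M gM (H X) (L i V) (L j W) (H Y) x = - (\<Sum>a\<in>J. bb a x * Hess X Y a x * gj a (single i V) (single j W) x)"
    unfolding H_eq_PF L_eq_PF[OF i] L_eq_PF[OF j]
      curvature_PF[OF pf_nil[OF X] pf_single[OF V] pf_single[OF W] pf_nil[OF Y] x]
    using gz c curvature_base_zero(2)[OF X zB Y fst_C[OF x]] by simp
  then show ?thesis unfolding sum_gj_single[OF V W i] by simp
qed

text \<open>In the general formula a fibre pairing of two lifts comes with the Hessian of a zero
  field or with a pairing that contains one. The Riemann curvature thus has no such component, and
  the semi-symmetric one is due to \<open>P\<close> entirely.\<close>

lemma curvature_HLLL: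
  assumes X: "X \<in> vector_fields B" and i: "i \<in> J" and V: "V \<in> vector_fields (F i)"
    and j: "j \<in> J" and W: "W \<in> vector_fields (F j)" and k: "k \<in> J" and U: "U \<in> vector_fields (F k)"
  shows "curvature M gM (H X) (L i V) (L j W) (L k U) x = 0" "curvature M gM (L j W) (L k U) (H X) (L i V) x = 0"
proof -
  note z = mfd.VF_zero[OF mF] and v = pfD(2)[OF pf_single[OF V]] and w = pfD(2)[OF pf_single[OF W]] and u = pfD(2)[OF pf_single[OF U]]
  note zB = base.N.VF_zero
  have c1: "curvature (F a) (gF a) (\<lambda>_ _. 0) (single i V a) (single j W a) (single k U a) (snd x a) = 0" if "a \<in> J" for a
    by (rule curvature_fibre_zero(1)[OF that _ _ _ snd_C[OF x that]]; intro z v w u that)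
  have c2: "curvature (F a) (gF a) (single j W a) (single k U a) (\<lambda>_ _. 0) (single i V a) (snd x a) = 0" if "a \<in> J" for a
    by (rule curvature_fibre_zero(3)[OF that _ _ _ snd_C[OF x that]]; intro z v w u that)
  note gz = gj_nil[OF pf_nil[OF X]] gj_nil[OF pf_single[OF V]] gj_nil[OF pf_single[OF W]] gj_nil[OF pf_single[OF U]]
  show "curvature M gM (H X) (L i V) (L j W) (L k U) x = 0"
    unfolding H_eq_PF L_eq_PF[OF i] L_eq_PF[OF j] L_eq_PF[OF k]
      curvature_PF[OF pf_nil[OF X] pf_single[OF V] pf_single[OF W] pf_single[OF U] x]
    using gz c1 curvature_base_zero(4)[OF X zB zB fst_C[OF x]] Hess_zero(2)[OF X] Hess_zero(1)[OF zB] by simp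
  show "curvature M gM (L j W) (L k U) (H X) (L i V) x = 0"
    unfolding H_eq_PF L_eq_PF[OF i] L_eq_PF[OF j] L_eq_PF[OF k]
      curvature_PF[OF pf_single[OF W] pf_single[OF U] pf_nil[OF X] pf_single[OF V] x]
    using gz c2 curvature_base_zero(1)[OF zB X zB fst_C[OF x]] Hess_zero(1)[OF X] Hess_zero(1)[OF zB] by simp
qed

text \<open>Three origins: the curvature of a fibre, present only if all four fields lie in it, and
  two products of fibre pairings weighted by the inner product of gradients. The conditionals on the
  indices are the source of the case distinction in the theorem.\<close>

lemma curvature_LLLL:
  assumes k: "k \<in> J" and U: "U \<in> vector_fields (F k)" and i: "i \<in> J" and V: "V \<in> vector_fields (F i)"
    and j: "j \<in> J" and W: "W \<in> vector_fields (F j)" and s: "s \<in> J" and Q: "Q \<in> vector_fields (F s)"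
  shows "curvature M gM (L k U) (L i V) (L j W) (L s Q) x =
    (if i = k \<and> j = k \<and> s = k then (bb k x)\<^sup>2 * curvature (F k) (gF k) U V W Q (snd x k) else 0)
    + (if k = j \<and> i = s then bb k x * bb i x * gF k (snd x k) (U (snd x k)) (W (snd x k)) *
        gF i (snd x i) (V (snd x i)) (Q (snd x i)) * gB (fst x) (grad k (fst x)) (grad i (fst x)) else 0)
    - (if i = j \<and> k = s then bb i x * bb k x * gF i (snd x i) (V (snd x i)) (W (snd x i)) *
        gF k (snd x k) (U (snd x k)) (Q (snd x k)) * gB (fst x) (grad i (fst x)) (grad k (fst x)) else 0)"
proof -
  note v = pfD(2)[OF pf_single[OF V]] and w = pfD(2)[OF pf_single[OF W]] and u = pfD(2)[OF pf_single[OF U]]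
    and q = pfD(2)[OF pf_single[OF Q]]
  note zB = base.N.VF_zero
  have c: "(\<Sum>a\<in>J. (bb a x)\<^sup>2 * curvature (F a) (gF a) (single k U a) (single i V a) (single j W a) (single s Q a) (snd x a)) =
    (if i = k \<and> j = k \<and> s = k then (bb k x)\<^sup>2 * curvature (F k) (gF k) U V W Q (snd x k) else 0)"
  proof -
    have "(\<Sum>a\<in>J. (bb a x)\<^sup>2 * curvature (F a) (gF a) (single k U a) (single i V a) (single j W a) (single s Q a) (snd x a)) =
      (bb k x)\<^sup>2 * curvature (F k) (gF k) (single k U k) (single i V k) (single j W k) (single s Q k) (snd x k)"
    proof (rule sum_single[OF k])
      fix a assume a: "a \<in> J" "a \<noteq> k"
      then show "(bb a x)\<^sup>2 * curvature (F a) (gF a) (single k U a) (single i V a) (single j W a) (single s Q a) (snd x a) = 0"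
        using curvature_fibre_zero(1)[OF a(1) v[OF a(1)] w[OF a(1)] q[OF a(1)] snd_C[OF x a(1)]] by simp
    qed
    then show ?thesis
      using curvature_fibre_zero(2)[OF k u[OF k] w[OF k] q[OF k] snd_C[OF x k]]
        curvature_fibre_zero(3)[OF k u[OF k] v[OF k] q[OF k] snd_C[OF x k]]
        curvature_fibre_zero(4)[OF k u[OF k] v[OF k] w[OF k] snd_C[OF x k]] by auto
  qed
  \<comment> \<open>The double sum collapses twice: the inner sum to the fibre of the second
    pairing, the outer one to the fibre of the first.\<close>
  have d: "(\<Sum>a\<in>J. \<Sum>a'\<in>J. bb a x * bb a' x * gj a (single m E) (single m' E') x * gj a' (single n D) (single n' D') x *
        gB (fst x) (grad a (fst x)) (grad a' (fst x))) =
      (if m = m' \<and> n = n' then bb m x * bb n x * gF m (snd x m) (E (snd x m)) (E' (snd x m)) *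
        gF n (snd x n) (D (snd x n)) (D' (snd x n)) * gB (fst x) (grad m (fst x)) (grad n (fst x)) else 0)"
    if m: "m \<in> J" and E: "E \<in> vector_fields (F m)" and E': "E' \<in> vector_fields (F m')"
      and n: "n \<in> J" and D: "D \<in> vector_fields (F n)" and D': "D' \<in> vector_fields (F n')" for m m' n n' E E' D D'
  proof -
    have "(\<Sum>a\<in>J. \<Sum>a'\<in>J. bb a x * bb a' x * gj a (single m E) (single m' E') x * gj a' (single n D) (single n' D') x *
        gB (fst x) (grad a (fst x)) (grad a' (fst x))) =
      (\<Sum>a\<in>J. (\<Sum>a'\<in>J. (bb a x * bb a' x * gB (fst x) (grad a (fst x)) (grad a' (fst x))) * gj a' (single n D) (single n' D') x)
         * gj a (single m E) (single m' E') x)"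
      by (intro sum.cong refl) (subst sum_distrib_right, rule sum.cong[OF refl], simp only: mult_ac)
    also have "\<dots> = (if m = m' \<and> n = n' then bb m x * bb n x * gF m (snd x m) (E (snd x m)) (E' (snd x m)) *
        gF n (snd x n) (D (snd x n)) (D' (snd x n)) * gB (fst x) (grad m (fst x)) (grad n (fst x)) else 0)"
      unfolding sum_gj_single[OF E E' m] sum_gj_single[OF D D' n] by (simp add: mult_ac)
    finally show ?thesis .
  qed
  have h: "(\<Sum>a\<in>J. bb a x * Hess (\<lambda>_ _. 0) (\<lambda>_ _. 0) a x * f a) = 0" for f
    using Hess_zero(1)[OF zB] by (intro sum.neutral) simp
  show ?thesis
    unfolding L_eq_PF[OF i] L_eq_PF[OF j] L_eq_PF[OF k] L_eq_PF[OF s]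
      curvature_PF[OF pf_single[OF U] pf_single[OF V] pf_single[OF W] pf_single[OF Q] x]
      c h d[OF k U W i V Q] d[OF i V W k U Q] curvature_base_zero(1)[OF zB zB zB fst_C[OF x]] by simp
qed

end

section \<open>Semi-symmetric curvature on lifts\<close>

definition lifted :: "('b \<times> (nat \<Rightarrow> 'f)) vfield \<Rightarrow> bool"
  where "lifted A \<longleftrightarrow> (\<exists>X V. pf X V \<and> A = PF X V)"

lemma lifted_H: "X \<in> vector_fields B \<Longrightarrow> lifted (H X)"
  unfolding lifted_def H_eq_PF using pf_nil by blast

lemma lifted_L: "i \<in> J \<Longrightarrow> V \<in> vector_fields (F i) \<Longrightarrow> lifted (L i V)"
  unfolding lifted_def L_eq_PF using pf_single by blast

lemma lifted_VF: "lifted A \<Longrightarrow> A \<in> vector_fields M"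
  by (auto simp: lifted_def)

lemma lifted_flat: "lifted A \<Longrightarrow> lifted A' \<Longrightarrow> W.flat_valued (koszul gM A A')"
  unfolding lifted_def using koszul_PF_flat by blast

lemma lifted_contraction: "lifted A \<Longrightarrow> lifted A' \<Longrightarrow> lifted D \<Longrightarrow> lifted D' \<Longrightarrow>
    \<exists>h. is_contraction M gM (koszul gM A A') (koszul gM D D') h"
  unfolding lifted_def using contraction_PF by blast

lemma ssm_curvature_lifted:
  assumes P: "lifted P" and A: "lifted A1" "lifted A2" "lifted A3" "lifted A4" and x: "x \<in> Carrier M"
  shows "ssm_curvature M gM P A1 A2 A3 A4 x = curvature M gM A1 A2 A3 A4 x
    + gM x (A2 x) (A4 x) * koszul gM A1 P A3 x - gM x (A2 x) (A3 x) * koszul gM A1 P A4 x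
    - gM x (A1 x) (A4 x) * koszul gM A2 P A3 x + gM x (A1 x) (A3 x) * koszul gM A2 P A4 x
    + (gM x (A1 x) (A3 x) * gM x (A2 x) (A4 x) - gM x (A2 x) (A3 x) * gM x (A1 x) (A4 x)) * gM x (P x) (P x)
    - gM x (A1 x) (P x) * (gM x (A3 x) (P x) * gM x (A2 x) (A4 x) - gM x (A4 x) (P x) * gM x (A2 x) (A3 x))
    + gM x (A2 x) (P x) * (gM x (A3 x) (P x) * gM x (A1 x) (A4 x) - gM x (A1 x) (A3 x) * gM x (A4 x) (P x))"
proof -
  obtain h h' where h: "is_contraction M gM (koszul gM A1 A3) (koszul gM A2 A4) h"
    "is_contraction M gM (koszul gM A2 A3) (koszul gM A1 A4) h'"
    using lifted_contraction[OF A(1,3,2,4)] lifted_contraction[OF A(2,3,1,4)] by blast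
  show ?thesis
    by (rule W.ssm_curvature_eq[OF lifted_VF[OF P] lifted_VF[OF A(1)] lifted_VF[OF A(2)] lifted_VF[OF A(3)] lifted_VF[OF A(4)] _ h x])
      (use A lifted_flat in auto)
qed

end

theorem theorem2p12:
  fixes B :: "('b, 'c) manifold" and gB :: "'b bform"
    and F :: "nat \<Rightarrow> ('f, 'd) manifold" and gF :: "nat \<Rightarrow> 'f bform"
    and b :: "nat \<Rightarrow> 'b \<Rightarrow> real" and m l :: nat and P :: "'f vfield"
    and X Y Z T :: "'b vfield"
    and k i j s :: nat and U V W Q :: "'f vfield"
    and p :: 'b and q :: "nat \<Rightarrow> 'f"
    and Rb :: "('b \<times> (nat \<Rightarrow> 'f)) vfield \<Rightarrow> ('b \<times> (nat \<Rightarrow> 'f)) vfield \<Rightarrow>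
               ('b \<times> (nat \<Rightarrow> 'f)) vfield \<Rightarrow> ('b \<times> (nat \<Rightarrow> 'f)) vfield \<Rightarrow> real"
    and H :: "'b vfield \<Rightarrow> ('b \<times> (nat \<Rightarrow> 'f)) vfield"
    and L :: "nat \<Rightarrow> 'f vfield \<Rightarrow> ('b \<times> (nat \<Rightarrow> 'f)) vfield"
    and \<beta> :: "nat \<Rightarrow> real" and D :: "'b vfield \<Rightarrow> nat \<Rightarrow> real"
    and GB :: "'b vfield \<Rightarrow> 'b vfield \<Rightarrow> real"
    and GBs :: "'b covec \<Rightarrow> 'b covec \<Rightarrow> real" and db :: "nat \<Rightarrow> 'b covec"
    and G :: "nat \<Rightarrow> 'f vfield \<Rightarrow> 'f vfield \<Rightarrow> real"
    and K :: "nat \<Rightarrow> 'f vfield \<Rightarrow> 'f vfield \<Rightarrow> 'f vfield \<Rightarrow> real"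
    and RF :: "nat \<Rightarrow> 'f vfield \<Rightarrow> 'f vfield \<Rightarrow> 'f vfield \<Rightarrow> 'f vfield \<Rightarrow> real"
  assumes B: "singular_semi_riemannian B gB" "non_degenerate B gB"
    and F: "\<And>j. j \<in> {1..m} \<Longrightarrow> semi_regular (F j) (gF j)"
    and b: "\<And>j. j \<in> {1..m} \<Longrightarrow> b j \<in> C_inf B"
    and l: "l \<in> {1..m}" and P: "P \<in> vector_fields (F l)"
    and XYZT: "X \<in> vector_fields B" "Y \<in> vector_fields B" "Z \<in> vector_fields B" "T \<in> vector_fields B"
    and idx: "k \<in> {1..m}" "i \<in> {1..m}" "j \<in> {1..m}" "s \<in> {1..m}"
    and UVWQ: "U \<in> vector_fields (F k)" "V \<in> vector_fields (F i)"
              "W \<in> vector_fields (F j)" "Q \<in> vector_fields (F s)"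
    and pq: "p \<in> Carrier B" "q \<in> (\<Pi>\<^sub>E j\<in>{1..m}. Carrier (F j))"
  defines "H \<equiv> lift_base B F {1..m}" and "L \<equiv> lift_fibre B F {1..m}"
    and "Rb \<equiv> \<lambda>A1 A2 A3 A4. ssm_curvature (prod_manifold B F {1..m}) (warped_metric B gB F gF b {1..m})
                               (lift_fibre B F {1..m} l P) A1 A2 A3 A4 (p, q)"
    and "\<beta> \<equiv> \<lambda>j. b j p" and "D \<equiv> \<lambda>X j. X p (b j)"
    and "GB \<equiv> \<lambda>X Y. gB p (X p) (Y p)" and "GBs \<equiv> inverse_metric B gB p"
    and "db \<equiv> \<lambda>j. diff_at B (b j) p"
    and "G \<equiv> \<lambda>j V W. gF j (q j) (V (q j)) (W (q j))"
    and "K \<equiv> \<lambda>j U V W. koszul (gF j) U V W (q j)"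
    and "RF \<equiv> \<lambda>j U V W Q. curvature (F j) (gF j) U V W Q (q j)"
  shows
    "Rb (H X) (H Y) (H Z) (H T) =
       curvature B gB X Y Z T p + (\<beta> l)\<^sup>2 * GB X Z * GB Y T * G l P P - (\<beta> l)\<^sup>2 * GB X T * GB Y Z * G l P P
     \<and>
     (j = l \<longrightarrow>
       Rb (H X) (H Y) (H Z) (L j W) = - Rb (H Z) (L j W) (H X) (H Y) \<and>
       Rb (H X) (H Y) (H Z) (L j W) =
         - \<beta> j * D X j * GB Y Z * G j W P + \<beta> j * D Y j * GB X Z * G j W P)
     \<and>
     (j \<noteq> l \<longrightarrow>
       Rb (H X) (H Y) (H Z) (L j W) = 0 \<and> Rb (H Z) (L j W) (H X) (H Y) = 0)
     \<and>
     (Rb (H X) (H Y) (L i V) (L j W) = 0 \<and> Rb (L i V) (L j W) (H X) (H Y) = 0)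
     \<and>
     (i = j \<and> j = l \<longrightarrow>
       Rb (H X) (L i V) (L j W) (H Y) =
         \<beta> j * GBs (form_at B (koszul gB X Y) p) (db j) * G j V W
         - \<beta> j * X p (\<lambda>x. Y x (b j)) * G j V W
         - (\<beta> j)\<^sup>2 * GB X Y * (K j V P W + (\<beta> j)\<^sup>2 * G j V W * G j P P - (\<beta> j)\<^sup>2 * G j V P * G j W P))
     \<and>
     (i = j \<and> j \<noteq> l \<longrightarrow>
       Rb (H X) (L i V) (L j W) (H Y) =
         \<beta> j * GBs (form_at B (koszul gB X Y) p) (db j) * G j V W
         - \<beta> j * X p (\<lambda>x. Y x (b j)) * G j V W
         - (\<beta> j)\<^sup>2 * (\<beta> l)\<^sup>2 * GB X Y * G j V W * G l P P)
     \<and>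
     (\<not> (i = j \<and> j = l) \<and> \<not> (i = j \<and> j \<noteq> l) \<longrightarrow>
       Rb (H X) (L i V) (L j W) (H Y) = 0)
     \<and>
     (i = j \<and> j = k \<and> k = l \<longrightarrow>
       Rb (H X) (L i V) (L j W) (L k U) = - Rb (L j W) (L k U) (H X) (L i V) \<and>
       Rb (H X) (L i V) (L j W) (L k U) =
         (\<beta> j)^3 * D X j * (G j V U * G j W P - G j V W * G j U P))
     \<and>
     (i = j \<and> j \<noteq> k \<and> k = l \<longrightarrow>
       Rb (H X) (L i V) (L j W) (L k U) = - Rb (L j W) (L k U) (H X) (L i V) \<and>
       Rb (H X) (L i V) (L j W) (L k U) =
         - \<beta> l * (\<beta> j)\<^sup>2 * D X l * G l U P * G j V W)
     \<and>
     ((\<not> (i = j \<and> j = k \<and> k = l) \<and> \<not> (i = j \<and> j \<noteq> k \<and> k = l) \<and> \<not> (i = k \<and> k \<noteq> j \<and> j = l) \<longrightarrow>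
        Rb (H X) (L i V) (L j W) (L k U) = 0) \<and>
      (i = k \<and> k \<noteq> j \<and> j = l \<longrightarrow>
        Rb (H X) (L i V) (L j W) (L k U) = - Rb (H X) (L i V) (L k U) (L j W)))
     \<and>
     (i = j \<and> j = k \<and> k = s \<and> s = l \<longrightarrow>
       Rb (L k U) (L i V) (L j W) (L s Q) =
         (\<beta> j)\<^sup>2 * RF j U V W Q
         + ((\<beta> j)\<^sup>2 * GBs (db j) (db j) + (\<beta> j)^6 * G j P P) * (G j U W * G j V Q - G j V W * G j U Q)
         + (\<beta> j)^4 * G j V Q * K j U P W - (\<beta> j)^4 * G j U Q * K j V P W
         - (\<beta> j)^4 * G j V W * K j U P Q + (\<beta> j)^4 * G j U W * K j V P Q
         + (\<beta> j)^6 * G j U P * (G j V W * G j Q P - G j V Q * G j W P)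
         - (\<beta> j)^6 * G j V P * (G j U W * G j Q P - G j U Q * G j W P))
     \<and>
     (i = j \<and> j = k \<and> k = s \<and> s \<noteq> l \<longrightarrow>
       Rb (L k U) (L i V) (L j W) (L s Q) =
         (\<beta> j)\<^sup>2 * RF j U V W Q
         + ((\<beta> j)\<^sup>2 * GBs (db j) (db j) + (\<beta> l)\<^sup>2 * (\<beta> j)^4 * G l P P) *
           (G j U W * G j V Q - G j V W * G j U Q))
     \<and>
     (j = k \<and> k \<noteq> i \<and> i = s \<and> s = l \<longrightarrow>
       Rb (L k U) (L i V) (L j W) (L s Q) =
         \<beta> i * \<beta> j * GBs (db i) (db j) * G i V Q * G j U W
         + (\<beta> i)\<^sup>2 * (\<beta> j)\<^sup>2 * G j U W *
           (K i V P Q + (\<beta> i)\<^sup>2 * G i P P * G i V Q - (\<beta> i)\<^sup>2 * G i V P * G i Q P))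
     \<and>
     (l = j \<and> j = k \<and> k \<noteq> i \<and> i = s \<longrightarrow>
       Rb (L k U) (L i V) (L j W) (L s Q) =
         \<beta> i * \<beta> j * GBs (db i) (db j) * G i V Q * G j U W
         + (\<beta> i)\<^sup>2 * (\<beta> j)\<^sup>2 * G i V Q *
           (K j U P W + (\<beta> j)\<^sup>2 * G j P P * G j U W - (\<beta> j)\<^sup>2 * G j U P * G j W P))
     \<and>
     (k = j \<and> i = s \<and> j \<noteq> i \<and> i \<noteq> l \<and> j \<noteq> l \<longrightarrow>
       Rb (L k U) (L i V) (L j W) (L s Q) =
         \<beta> i * \<beta> j * GBs (db i) (db j) * G i V Q * G j U W
         + (\<beta> i)\<^sup>2 * (\<beta> j)\<^sup>2 * (\<beta> l)\<^sup>2 * G i V Q * G j U W * G l P P)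
     \<and>
     ((\<not> (i = j \<and> j = k \<and> k = s \<and> s = l) \<and> \<not> (i = j \<and> j = k \<and> k = s \<and> s \<noteq> l) \<and>
       \<not> (j = k \<and> k \<noteq> i \<and> i = s \<and> s = l) \<and> \<not> (l = j \<and> j = k \<and> k \<noteq> i \<and> i = s) \<and>
       \<not> (k = j \<and> i = s \<and> j \<noteq> i \<and> i \<noteq> l \<and> j \<noteq> l) \<and> \<not> (k = s \<and> s \<noteq> i \<and> i = j) \<longrightarrow>
        Rb (L k U) (L i V) (L j W) (L s Q) = 0) \<and>
      (k = s \<and> s \<noteq> i \<and> i = j \<longrightarrow>
        Rb (L k U) (L i V) (L j W) (L s Q) = - Rb (L k U) (L i V) (L s Q) (L j W)))"
proof -
  \<comment> \<open>As an opaque constant the index set matches the parameter of the locale, and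
    membership of an index is settled by the stored facts alone.\<close>
  define J where "J = {1..m}"
  have finJ: "finite J" by (simp add: J_def)
  note F = F[folded J_def] and b = b[folded J_def] and l = l[folded J_def] and idx = idx[folded J_def]
    and pq = pq[folded J_def]
  have sB: "ssr B gB" by (rule singular_semi_riemannian_imp_ssr[OF B(1)])
  have sF: "ssr (F j) (gF j)" if "j \<in> J" for j
    using F[OF that] by (intro singular_semi_riemannian_imp_ssr) (simp add: semi_regular_def)
  have pB: "mfd B" and pF: "\<And>j. j \<in> J \<Longrightarrow> mfd (F j)"
    using sB sF by (auto simp: ssr_def)
  interpret w: warped B F "J" gB gF b
    by (intro warped.intro mfd_product.intro warped_axioms.intro pB pF sB sF B(2) F b finJ)
  let ?M = "prod_manifold B F J" and ?g = "warped_metric B gB F gF b J"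
  have x: "(p, q) \<in> Carrier ?M" using pq by (simp add: w.Carrier_M)
  note X = XYZT(1) and Y = XYZT(2) and Z = XYZT(3) and T = XYZT(4)
  note U = UVWQ(1) and V = UVWQ(2) and W = UVWQ(3) and Q = UVWQ(4)
  note k = idx(1) and i = idx(2) and j = idx(3) and s = idx(4)
  note lH = w.lifted_H[OF X] w.lifted_H[OF Y] w.lifted_H[OF Z] w.lifted_H[OF T]
  note lL = w.lifted_L[OF k U] w.lifted_L[OF i V] w.lifted_L[OF j W] w.lifted_L[OF s Q]
  note ssm = w.ssm_curvature_lifted[OF w.lifted_L[OF l P] _ _ _ _ x]
  \<comment> \<open>One instance of the general formula for each pattern of base and fibre slots in
    the claims, including those with two slots exchanged for the antisymmetry statements.\<close>
  note r = ssm[OF lH(1,2,3,4)] ssm[OF lH(1,2,3) lL(3)] ssm[OF lH(3) lL(3) lH(1,2)]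
    ssm[OF lH(1,2) lL(2,3)] ssm[OF lL(2,3) lH(1,2)] ssm[OF lH(1) lL(2,3) lH(2)]
    ssm[OF lH(1) lL(2,3,1)] ssm[OF lL(3,1) lH(1) lL(2)] ssm[OF lH(1) lL(2,1,3)]
    ssm[OF lL(1,2,3,4)] ssm[OF lL(1,2,4,3)]
  note gHH = w.gM_HH[OF x X Y] w.gM_HH[OF x X Z] w.gM_HH[OF x X T] w.gM_HH[OF x Y Z] w.gM_HH[OF x Y T]
    w.gM_HH[OF x Z X] w.gM_HH[OF x Z Y]
  note gHL = w.gM_HL[OF x] w.gM_LH[OF x] and gLL = w.gM_LL[OF x]
  note kos = w.koszul_HH[OF x l P] w.koszul_HL[OF x l P] w.koszul_LH[OF x l P] w.koszul_LL[OF x l P]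
  note cur = w.curvature_HHHH[OF x X Y Z T] w.curvature_HHHL[OF x X Y Z j W] w.curvature_HHLL[OF x X Y i V j W]
    w.curvature_HLLH[OF x X Y i V j W] w.curvature_HLLL[OF x X i V j W k U] w.curvature_HLLL[OF x X i V k U j W]
    w.curvature_LLLL[OF x k U i V j W s Q] w.curvature_LLLL[OF x k U i V s Q j W]
  note inv = w.inverse_metric_nab[OF X Y _ pq(1)] w.inverse_metric_grad[OF _ _ pq(1)]
  have sym: "gF a (q a) (A (q a)) (A' (q a)) = gF a (q a) (A' (q a)) (A (q a))"
    if "a \<in> J" "A \<in> vector_fields (F a)" "A' \<in> vector_fields (F a)" for a A A'
  proof -
    have "q a \<in> Carrier (F a)" using w.snd_C[OF x that(1)] by simp
    then show ?thesis using that ssr.g_sym[OF sF[OF that(1)]] mfd.VF_TS[OF pF[OF that(1)]] by blast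
  qed
  have symB: "gB p (A p) (A' p) = gB p (A' p) (A p)" if "A \<in> vector_fields B" "A' \<in> vector_fields B" for A A'
    using ssr.g_sym[OF sB pq(1)] mfd.VF_TS[OF pB _ pq(1)] that by blast
  \<comment> \<open>The claims pair \<open>db i\<close> with \<open>db j\<close> in a fixed order,
    whereas the curvature has the gradients in the order of the slots.\<close>
  have symg: "gB p (w.grad a p) (w.grad a' p) = gB p (w.grad a' p) (w.grad a p)" if "a \<in> J" "a' \<in> J" for a a'
    by (intro symB w.grad(1) that)
  note mem = X Y Z T U V W Q k i j s l P
  note d = Rb_def H_def L_def \<beta>_def D_def GB_def GBs_def db_def G_def K_def RF_def
  \<comment> \<open>Powers are spelled out as products so that both sides are compared as sums of
    the same monomials.\<close>
  have pow: "t ^ 4 = t * t * t * t" "t ^ 6 = t * t * t * t * t * t" for t :: real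
    by (simp_all add: eval_nat_numeral)
  note alg = algebra_simps power2_eq_square power3_eq_cube pow
  note e = r gHH gHL gLL kos cur inv w.Hess_def
  show ?thesis
    unfolding d J_def[symmetric]
  proof (intro conjI impI, goal_cases)
    case 1
    \<comment> \<open>The first call replaces every component by its general expression, whose
      conditionals carry the index pattern. The second evaluates the conditionals under the
      hypotheses of the case and compares polynomials; most later cases follow this scheme.\<close>
    show ?case by (simp only: e mem fst_conv snd_conv simp_thms) (use mem in \<open>simp add: alg sym symB\<close>)
  next
    case 2
    show ?case by (simp only: e mem fst_conv snd_conv simp_thms) (use 2 mem in \<open>simp add: alg sym symB\<close>)
  next
    case 3
    show ?case by (simp only: e mem fst_conv snd_conv simp_thms) (use 3 mem in \<open>simp add: alg sym symB\<close>)
  next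
    case 4
    show ?case by (simp only: e mem fst_conv snd_conv simp_thms) (use 4 mem in \<open>simp add: alg sym symB\<close>)
  next
    case 5
    show ?case by (simp only: e mem fst_conv snd_conv simp_thms) (use 5 mem in \<open>simp add: alg sym symB\<close>)
  next
    case 6
    show ?case by (simp only: e mem fst_conv snd_conv simp_thms) (use mem in \<open>simp add: alg sym symB\<close>)
  next
    case 7
    show ?case by (simp only: e mem fst_conv snd_conv simp_thms) (use mem in \<open>simp add: alg sym symB\<close>)
  next
    case 8
    show ?case by (simp only: e mem fst_conv snd_conv simp_thms) (use 8 mem in \<open>simp add: alg sym symB\<close>)
  next
    case 9
    show ?case by (simp only: e mem fst_conv snd_conv simp_thms) (use 9 mem in \<open>simp add: alg sym symB\<close>)
  next
    case 10
    \<comment> \<open>The two excluded patterns together exhaust \<open>i = j\<close>.\<close>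
    then have "i \<noteq> j" by blast
    then show ?case by (simp only: e mem fst_conv snd_conv simp_thms) simp
  next
    case 11
    show ?case by (simp only: e mem fst_conv snd_conv simp_thms) (use 11 mem in \<open>simp add: alg sym symB\<close>)
  next
    case 12
    show ?case by (simp only: e mem fst_conv snd_conv simp_thms) (use 12 mem in \<open>simp add: alg sym symB\<close>)
  next
    case 13
    show ?case by (simp only: e mem fst_conv snd_conv simp_thms) (use 13 mem in \<open>simp add: alg sym symB\<close>)
  next
    case 14
    show ?case by (simp only: e mem fst_conv snd_conv simp_thms) (use 14 mem in \<open>simp add: alg sym symB\<close>)
  next
    case 15
    show ?case by (simp only: e mem fst_conv snd_conv simp_thms) (use 15 in \<open>auto split: if_splits\<close>)
  next
    case 16
    show ?case by (simp only: e mem fst_conv snd_conv simp_thms) (use 16 mem in \<open>simp add: alg sym symB\<close>)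
  next
    case 17
    show ?case by (simp only: e mem fst_conv snd_conv simp_thms) (use 17 mem in \<open>simp add: alg sym symB\<close>)
  next
    case 18
    show ?case by (simp only: e mem fst_conv snd_conv simp_thms) (use 18 mem in \<open>simp add: alg sym symB symg\<close>)
  next
    case 19
    show ?case by (simp only: e mem fst_conv snd_conv simp_thms) (use 19 mem in \<open>simp add: alg sym symB symg\<close>)
  next
    case 20
    show ?case by (simp only: e mem fst_conv snd_conv simp_thms) (use 20 mem in \<open>simp add: alg sym symB symg\<close>)
  next
    case 21
    \<comment> \<open>Only the one instance of symmetry that exchanges the gradients of
      \<open>i\<close> and \<open>j\<close> is used, with the equal indices eliminated beforehand,
      so that the rewriting has a fixed direction.\<close>
    then have eq: "k = j" "s = i" and ne: "j \<noteq> i" "i \<noteq> j" "i \<noteq> l" "l \<noteq> i" "j \<noteq> l" "l \<noteq> j" by auto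
    note gg = symg[OF i j]
    show ?case
      by (simp only: e mem fst_conv snd_conv simp_thms) (simp add: eq ne gg; simp add: algebra_simps power2_eq_square)
  next
    case 22
    show ?case
    proof (cases "k = j \<and> i = s")
      case True
      \<comment> \<open>The patterns already treated cover all cases with \<open>k = j\<close> and
        \<open>i = s\<close>, according to whether \<open>i = j\<close> and which of
        \<open>i\<close>, \<open>j\<close> equals \<open>l\<close>.\<close>
      with 22 have False by metis
      then show ?thesis ..
    next
      case False
      \<comment> \<open>Neither of the two ways to match the slots in pairs is left, so each
        conditional is false or multiplies a vanishing metric value.\<close>
      have "i = j \<Longrightarrow> k \<noteq> s" using 22 False by metis
      with False show ?thesis
        by (simp only: e mem fst_conv snd_conv simp_thms)
          (cases "k = j"; cases "i = s"; cases "i = j"; cases "k = s"; simp; auto)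
    qed
  next
    case 23
    \<comment> \<open>Both components are evaluated separately; the exchange of the last two slots
      swaps the two gradient products and reverses the correction terms.\<close>
    then have eq: "k = s" "j = i" and ne: "s \<noteq> i" "i \<noteq> s" by auto
    show ?case
      by (simp only: e mem fst_conv snd_conv simp_thms) (simp add: eq ne symg[OF i s])
  qed
qed

end
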